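(* There are an absolute constant $C$ and an algorithm in real arithmetic which, for all $n,d\ge 1$ and every orthogonal matrix representation $\rho:S_n\to \mathrm{O}(d)$, given as input the matrices $\rho(\tau_1),\ldots,\rho(\tau_{n-1})\in \mathrm{O}(d)$, computes an orthogonal matrix $Q\in \mathrm{O}(d)$ such that for all $g\in S_n$ $$Q^\top \rho(g) Q = \begin{pmatrix} \rho_1(g)^{\oplus a_1} & & \\ & \ddots & \\ & & \rho_r(g)^{\oplus a_r}\end{pmatrix},$$ where $\rho_1,\ldots,\rho_r$ are distinct (pairwise non-isomorphic) irreducible representations of $S_n$ and $a_1,\ldots,a_r$ are their multiplicities in $\rho$. The algorithm first uses at most $Cn^2d^3$ operations to compute the partitions $\lambda^1,\ldots,\lambda^r$ of $n$ indexing the irreducible representations that occur in $\rho$, their multiplicities, and an orthogonal matrix $\tilde Q\in \mathrm{O}(d)$ such that $\tilde Q^\top\rho(X_j)\tilde Q$ is diagonal for every $j=1,\ldots,n$; it then uses at most a further $C n d^4$ operations to compute $Q$.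
   Context: $S_n$ is the symmetric group and $\tau_\ell=(\ell\ \ell+1)$, $\ell=1,\ldots,n-1$, are the simple transpositions. $\mathrm{O}(d)$ is the group of real orthogonal $d\times d$ matrices. An orthogonal matrix representation is a group homomorphism $\rho:S_n\to \mathrm{O}(d)$. It is extended linearly to the group algebra of $S_n$. The Young--Jucys--Murphy generators are the group algebra elements $X_1=0$ and $X_j=(1\ j)+(2\ j)+\cdots+(j-1\ j)$ for $j=2,\ldots,n$. The irreducible representations of $S_n$ are indexed up to isomorphism in the usual way by the partitions of $n$. For a matrix representation $\rho_k:S_n\to \mathrm{O}(d_k)$, the notation $\rho_k(g)^{\oplus a_k}$ means $I_{a_k}\otimes\rho_k(g)$, i.e. the block-diagonal matrix with $a_k$ copies of $\rho_k(g)$ (the identical matrix in each block). Operations are exact real-number operations (arithmetic operations, square roots, comparisons), each of unit cost. *)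

theory Defs
  imports
    "HOL-Algebra.Sym_Groups"
    "Jordan_Normal_Form.VS_Connect"
begin

section \<open>Matrix representations of the symmetric group\<close>

definition orthogonal_group :: "nat \<Rightarrow> real mat monoid" where
  "orthogonal_group d =
     \<lparr>carrier = {A \<in> carrier_mat d d. transpose_mat A * A = 1\<^sub>m d}, mult = (*), one = 1\<^sub>m d\<rparr>"

definition GL :: "nat \<Rightarrow> real mat monoid" where
  "GL d = units_of (ring_mat TYPE(real) d ())"

definition rep_isomorphic ::
  "nat \<Rightarrow> nat \<Rightarrow> ((nat \<Rightarrow> nat) \<Rightarrow> real mat) \<Rightarrow> nat \<Rightarrow> ((nat \<Rightarrow> nat) \<Rightarrow> real mat) \<Rightarrow> bool" where
  "rep_isomorphic n d \<rho> e \<sigma> \<longleftrightarrow>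
     d = e \<and> (\<exists>P \<in> carrier (GL d). \<forall>g \<in> carrier (sym_group n). P * \<rho> g = \<sigma> g * P)"

definition irreducible_rep :: "nat \<Rightarrow> nat \<Rightarrow> ((nat \<Rightarrow> nat) \<Rightarrow> real mat) \<Rightarrow> bool" where
  "irreducible_rep n d \<rho> \<longleftrightarrow>
     \<rho> \<in> hom (sym_group n) (GL d) \<and> d \<ge> 1 \<and>
     (\<forall>W. VectorSpace.subspace class_ring W (module_vec TYPE(real) d) \<and>
          (\<forall>g \<in> carrier (sym_group n). \<forall>w \<in> W. \<rho> g *\<^sub>v w \<in> W)
          \<longrightarrow> W = {0\<^sub>v d} \<or> W = carrier_vec d)"


section \<open>The group algebra\<close>

text \<open>Elements of the real group algebra are their coefficient functions, vanishing off the group.\<close>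

type_synonym group_alg = "(nat \<Rightarrow> nat) \<Rightarrow> real"

definition group_algebra :: "nat \<Rightarrow> group_alg set" where
  "group_algebra n = {a. \<forall>g. g \<notin> carrier (sym_group n) \<longrightarrow> a g = 0}"

definition ga_single :: "(nat \<Rightarrow> nat) \<Rightarrow> group_alg" where
  "ga_single g = (\<lambda>h. if h = g then 1 else 0)"

definition ga_mult :: "nat \<Rightarrow> group_alg \<Rightarrow> group_alg \<Rightarrow> group_alg" where
  "ga_mult n a b =
     (\<lambda>g. \<Sum>(h, k) \<in> {(h, k) \<in> carrier (sym_group n) \<times> carrier (sym_group n). h \<circ> k = g}. a h * b k)"

definition rep_extend ::
  "nat \<Rightarrow> nat \<Rightarrow> ((nat \<Rightarrow> nat) \<Rightarrow> real mat) \<Rightarrow> group_alg \<Rightarrow> real mat" where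
  "rep_extend n d \<rho> a = mat d d (\<lambda>(i, j). \<Sum>g \<in> carrier (sym_group n). a g * \<rho> g $$ (i, j))"

definition jucys_murphy :: "nat \<Rightarrow> group_alg" where
  "jucys_murphy j = (\<lambda>g. \<Sum>i = 1..<j. ga_single (Transposition.transpose i j) g)"


section \<open>Partitions and Specht modules\<close>

definition partitions_of :: "nat \<Rightarrow> nat list set" where
  "partitions_of n = {lam. sorted_wrt (\<ge>) lam \<and> (\<forall>p \<in> set lam. p > 0) \<and> sum_list lam = n}"

definition young_diagram :: "nat list \<Rightarrow> (nat \<times> nat) set" where
  "young_diagram lam = {(i, j). i < length lam \<and> j < lam ! i}"

text \<open>The tableau whose rows, read from top to bottom, are filled with 1, 2, 3, and so on.\<close>

definition row_tableau :: "nat list \<Rightarrow> nat \<times> nat \<Rightarrow> nat" where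
  "row_tableau lam = (\<lambda>(i, j). sum_list (take i lam) + j + 1)"

definition row_stabilizer :: "nat \<Rightarrow> nat list \<Rightarrow> (nat \<Rightarrow> nat) set" where
  "row_stabilizer n lam = {p \<in> carrier (sym_group n).
     \<forall>(i, j) \<in> young_diagram lam. \<exists>j'. (i, j') \<in> young_diagram lam \<and>
       p (row_tableau lam (i, j)) = row_tableau lam (i, j')}"

definition column_stabilizer :: "nat \<Rightarrow> nat list \<Rightarrow> (nat \<Rightarrow> nat) set" where
  "column_stabilizer n lam = {p \<in> carrier (sym_group n).
     \<forall>(i, j) \<in> young_diagram lam. \<exists>i'. (i', j) \<in> young_diagram lam \<and>
       p (row_tableau lam (i, j)) = row_tableau lam (i', j)}"

definition young_symmetrizer :: "nat \<Rightarrow> nat list \<Rightarrow> group_alg" where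
  "young_symmetrizer n lam =
     ga_mult n (\<lambda>g. if g \<in> row_stabilizer n lam then 1 else 0)
               (\<lambda>g. if g \<in> column_stabilizer n lam then of_int (sign g) else 0)"

text \<open>
  The Specht module is taken as the left ideal generated by the Young symmetrizer.  In this
  convention the one-row partition indexes the trivial and the one-column partition the sign
  representation.
\<close>

definition specht_module :: "nat \<Rightarrow> nat list \<Rightarrow> group_alg set" where
  "specht_module n lam = (\<lambda>x. ga_mult n x (young_symmetrizer n lam)) ` group_algebra n"

definition indexed_by :: "nat \<Rightarrow> nat \<Rightarrow> ((nat \<Rightarrow> nat) \<Rightarrow> real mat) \<Rightarrow> nat list \<Rightarrow> bool" where
  "indexed_by n d \<sigma> lam \<longleftrightarrow>
     (\<exists>\<Phi>. bij_betw \<Phi> (carrier_vec d) (specht_module n lam) \<and>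
        (\<forall>v \<in> carrier_vec d. \<forall>w \<in> carrier_vec d. \<Phi> (v + w) = (\<lambda>g. \<Phi> v g + \<Phi> w g)) \<and>
        (\<forall>c. \<forall>v \<in> carrier_vec d. \<Phi> (c \<cdot>\<^sub>v v) = (\<lambda>g. c * \<Phi> v g)) \<and>
        (\<forall>g \<in> carrier (sym_group n). \<forall>v \<in> carrier_vec d.
           \<Phi> (\<sigma> g *\<^sub>v v) = ga_mult n (ga_single g) (\<Phi> v)))"

definition irreducible_decomposition ::
  "nat \<Rightarrow> nat \<Rightarrow> ((nat \<Rightarrow> nat) \<Rightarrow> real mat) \<Rightarrow> (nat \<times> ((nat \<Rightarrow> nat) \<Rightarrow> real mat)) list \<Rightarrow> bool" where
  "irreducible_decomposition n d \<rho> \<sigma>s \<longleftrightarrow>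
     (\<forall>(e, \<sigma>) \<in> set \<sigma>s. irreducible_rep n e \<sigma>) \<and>
     rep_isomorphic n d \<rho> (sum_list (map fst \<sigma>s)) (\<lambda>g. diag_block_mat (map (\<lambda>(e, \<sigma>). \<sigma> g) \<sigma>s))"

text \<open>The description determines a unique number, by Maschke and Krull-Schmidt.\<close>

definition irrep_multiplicity :: "nat \<Rightarrow> nat \<Rightarrow> ((nat \<Rightarrow> nat) \<Rightarrow> real mat) \<Rightarrow> nat list \<Rightarrow> nat" where
  "irrep_multiplicity n d \<rho> lam =
     (THE m. \<exists>\<sigma>s. irreducible_decomposition n d \<rho> \<sigma>s \<and>
        m = length (filter (\<lambda>(e, \<sigma>). indexed_by n e \<sigma> lam) \<sigma>s))"


section \<open>Algorithms in real arithmetic\<close>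

text \<open>
  A while language over two families of named arrays, one with entries in the natural numbers
  and one with real entries.  Programs are finite syntax, so one program serves all input sizes.
  Natural numbers are used for indexing and control; they depend on the real data only
  through comparisons.  Each real arithmetic operation, square root, comparison and
  embedding of a natural number counts as one operation; copying and bookkeeping with natural
  numbers is not counted.
\<close>

datatype nexp =
    Lit nat
  | Cell string nexp
  | NPlus nexp nexp
  | NMinus nexp nexp
  | NTimes nexp nexp
  | NDiv nexp nexp

datatype bexp =
    Less nexp nexp
  | Not bexp
  | And bexp bexp

datatype arith_op = Add | Sub | Mul | Quot

type_synonym loc = "string \<times> nexp"

datatype com =
    Skip
  | NAssign loc nexp
  | Copy loc loc
  | OfNat loc nexp
  | Arith arith_op loc loc loc
  | Sqrt loc loc
  | Compare loc loc loc
  | Seq com com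
  | If bexp com com
  | While bexp com

record state =
  nats :: "string \<Rightarrow> nat \<Rightarrow> nat"
  reals :: "string \<Rightarrow> nat \<Rightarrow> real"

fun nval :: "nexp \<Rightarrow> state \<Rightarrow> nat" where
  "nval (Lit k) s = k"
| "nval (Cell x e) s = nats s x (nval e s)"
| "nval (NPlus e f) s = nval e s + nval f s"
| "nval (NMinus e f) s = nval e s - nval f s"
| "nval (NTimes e f) s = nval e s * nval f s"
| "nval (NDiv e f) s = nval e s div nval f s"

fun bval :: "bexp \<Rightarrow> state \<Rightarrow> bool" where
  "bval (Less e f) s \<longleftrightarrow> nval e s < nval f s"
| "bval (Not b) s \<longleftrightarrow> \<not> bval b s"
| "bval (And b c) s \<longleftrightarrow> bval b s \<and> bval c s"

fun op_defined :: "arith_op \<Rightarrow> real \<Rightarrow> real \<Rightarrow> bool" where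
  "op_defined Quot a b \<longleftrightarrow> b \<noteq> 0"
| "op_defined _ a b \<longleftrightarrow> True"

fun op_val :: "arith_op \<Rightarrow> real \<Rightarrow> real \<Rightarrow> real" where
  "op_val Add a b = a + b"
| "op_val Sub a b = a - b"
| "op_val Mul a b = a * b"
| "op_val Quot a b = a / b"

definition get_real :: "state \<Rightarrow> loc \<Rightarrow> real" where
  "get_real s l = reals s (fst l) (nval (snd l) s)"

definition set_real :: "state \<Rightarrow> loc \<Rightarrow> real \<Rightarrow> state" where
  "set_real s l v = s\<lparr>reals := (reals s)(fst l := (reals s (fst l))(nval (snd l) s := v))\<rparr>"

definition set_nat :: "state \<Rightarrow> loc \<Rightarrow> nat \<Rightarrow> state" where
  "set_nat s l v = s\<lparr>nats := (nats s)(fst l := (nats s (fst l))(nval (snd l) s := v))\<rparr>"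

text \<open>
  \<open>exec c s k t\<close>: started in \<open>s\<close>, the program \<open>c\<close> terminates in \<open>t\<close> after exactly \<open>k\<close> real
  operations.  Division by zero and square roots of negative numbers have no execution.
\<close>

inductive exec :: "com \<Rightarrow> state \<Rightarrow> nat \<Rightarrow> state \<Rightarrow> bool" where
  Skip: "exec Skip s 0 s"
| NAssign: "exec (NAssign l e) s 0 (set_nat s l (nval e s))"
| Copy: "exec (Copy l l1) s 0 (set_real s l (get_real s l1))"
| OfNat: "exec (OfNat l e) s 1 (set_real s l (real (nval e s)))"
| Arith: "op_defined f (get_real s l1) (get_real s l2) \<Longrightarrow>
    exec (Arith f l l1 l2) s 1 (set_real s l (op_val f (get_real s l1) (get_real s l2)))"
| Sqrt: "get_real s l1 \<ge> 0 \<Longrightarrow> exec (Sqrt l l1) s 1 (set_real s l (sqrt (get_real s l1)))"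
| Compare: "exec (Compare l l1 l2) s 1
    (set_nat s l (if get_real s l1 < get_real s l2 then 1 else 0))"
| Seq: "exec c1 s k1 s' \<Longrightarrow> exec c2 s' k2 t \<Longrightarrow> exec (Seq c1 c2) s (k1 + k2) t"
| IfTrue: "bval b s \<Longrightarrow> exec c1 s k t \<Longrightarrow> exec (If b c1 c2) s k t"
| IfFalse: "\<not> bval b s \<Longrightarrow> exec c2 s k t \<Longrightarrow> exec (If b c1 c2) s k t"
| WhileFalse: "\<not> bval b s \<Longrightarrow> exec (While b c) s 0 s"
| WhileTrue: "bval b s \<Longrightarrow> exec c s k1 s' \<Longrightarrow> exec (While b c) s' k2 t \<Longrightarrow>
    exec (While b c) s (k1 + k2) t"

lemma exec_deterministic:
  "exec c s k t \<Longrightarrow> exec c s k' t' \<Longrightarrow> k' = k \<and> t' = t"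
proof (induction arbitrary: k' t' rule: exec.induct)
  case (Seq c1 s k1 s' c2 k2 t)
  from Seq.prems show ?case by (cases rule: exec.cases) (use Seq.IH in blast)+
next
  case (WhileTrue b s c k1 s' k2 t)
  from WhileTrue.prems WhileTrue.hyps(1) show ?case
    by (cases rule: exec.cases) (use WhileTrue.IH in blast)+
qed (erule exec.cases; auto)+


text \<open>
  The entry \<open>(i, j)\<close> (counted from 0) of the \<open>l\<close>-th input matrix, \<open>1 \<le> l \<le> n - 1\<close>, is stored at
  position \<open>((l - 1) * d + i) * d + j\<close> of the real array \<open>rho\<close>.  Everything not listed is 0.
\<close>

definition input_state :: "nat \<Rightarrow> nat \<Rightarrow> (nat \<Rightarrow> real mat) \<Rightarrow> state" where
  "input_state n d A = \<lparr>
     nats = (\<lambda>x m. if x = ''n'' \<and> m = 0 then n else if x = ''d'' \<and> m = 0 then d else 0),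
     reals = (\<lambda>x m. if x = ''rho'' \<and> m < (n - 1) * d * d
                    then A (m div (d * d) + 1) $$ (m div d mod d, m mod d) else 0)\<rparr>"

definition output_mat :: "state \<Rightarrow> string \<Rightarrow> nat \<Rightarrow> real mat" where
  "output_mat s x d = mat d d (\<lambda>(i, j). reals s x (i * d + j))"

text \<open>
  The array \<open>r\<close> holds, at 0, the number of partitions; \<open>lam\<close> holds the partitions of \<open>n\<close>, each padded
  with zeros to \<open>n\<close> entries; \<open>mult\<close> holds the multiplicities.
\<close>

definition outputs_partitions ::
  "state \<Rightarrow> nat \<Rightarrow> nat list list \<Rightarrow> (nat list \<Rightarrow> nat) \<Rightarrow> bool" where
  "outputs_partitions s n lams a \<longleftrightarrow>
     nats s ''r'' 0 = length lams \<and>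
     (\<forall>k < length lams.
        nats s ''mult'' k = a (lams ! k) \<and>
        (\<forall>i < n. nats s ''lam'' (k * n + i) =
                 (if i < length (lams ! k) then lams ! k ! i else 0)))"

end

theory Submission
  imports Defs "HOL-Library.Function_Algebras"
begin

text \<open>
  Call a vector a weight vector if it is an eigenvector of all \<open>X\<^sub>j\<close>.  The \<open>X\<^sub>j\<close> are symmetric and
  commute, and by induction on \<open>j\<close> each is annihilated by a polynomial with roots in \<open>[-n, n]\<close>; so
  multiplying any vector by the factors \<open>X\<^sub>j - c\<close>, and keeping the last nonzero value, leads to a
  weight vector, which stays orthogonal to the weight vectors found before.  Since
  \<open>X\<^bsub>j+1\<^esub> = \<tau>\<^sub>j X\<^sub>j \<tau>\<^sub>j + \<tau>\<^sub>j\<close>, the matrices of the \<open>X\<^sub>j\<close> cost two matrix products each.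

  The compression of \<open>\<tau>\<^bsub>n-1\<^esub>\<close> to an eigenspace of \<open>X\<^sub>n\<close> is a polynomial in \<open>X\<^bsub>n-1\<^esub>\<close>.  Hence the
  matrix coefficient of a unit weight vector is determined by its weight, its weight space in the
  cyclic module it generates is one-dimensional, and this module is irreducible.  The Specht module
  of \<open>\<lambda>\<close> is generated by a vector whose weight is the sequence of contents of \<open>\<lambda>\<close>, read row by row;
  therefore the multiplicity of \<open>\<lambda>\<close> is the number of basis vectors with this weight, and partitions
  and multiplicities can be read off the eigenvalues.

  To get one block, close such a basis vector under the \<open>\<tau>\<^sub>l\<close> by Gram--Schmidt.  Two runs that start in
  vectors of the same weight see the same inner products, so they apply the same group algebra
  elements and produce identical blocks.
\<close>

text \<open>No classification of the irreducible representations and no branching rule enters. Two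
  facts replace them: every nonzero invariant subspace contains a weight vector whose weight is the
  row-by-row content word of a partition, found by maximizing a potential over all weights; and
  modules generated by weight vectors can be compared across representations through their inner
  products. Multiplicities are well defined because of one group algebra element per partition, the
  projection to the row-reading weight: its trace is 1 on irreducible representations indexed by
  that partition and 0 on the others. Three kinds of spaces have to be compared: Specht modules
  inside the group algebra, the input on R^d, and the summands of a decomposition, which need not be
  orthogonal. Therefore the theory is developed on an abstract subspace of a real vector space, and
  operators are realized by group algebra elements. The costs are those of d searches, each trying 2
  n + 1 shifts of n matrices at d^2 operations, and of at most d blocks with at most d vectors, each
  multiplied by n - 1 generators and projected at d^2 operations.\<close>

instantiation "fun" :: (type, scaleR) scaleR
begin
definition scaleR_fun :: "real \<Rightarrow> ('a \<Rightarrow> 'b) \<Rightarrow> 'a \<Rightarrow> 'b" where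
  "scaleR_fun r f = (\<lambda>x. r *\<^sub>R f x)"
instance ..
end

text \<open>Group algebra elements and coordinate vectors are both plain functions, so this instance
  lets one locale over real vector spaces serve the regular representation and all matrix
  representations.\<close>

instance "fun" :: (type, real_vector) real_vector
  by standard (simp_all add: scaleR_fun_def fun_eq_iff algebra_simps)

lemma scaleR_fun_apply [simp]: "(r *\<^sub>R f) x = r *\<^sub>R f x"
  by (simp add: scaleR_fun_def)

lemma sum_fun_apply: "(\<Sum>i\<in>I. f i) x = (\<Sum>i\<in>I. f i x)"
  by (induction I rule: infinite_finite_induct) auto

section \<open>Adjacent transpositions and double cosets\<close>

abbreviation tr :: "nat \<Rightarrow> nat \<Rightarrow> nat \<Rightarrow> nat" where
  "tr i j \<equiv> Transposition.transpose i j"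

lemma tr_permutes: "i \<in> S \<Longrightarrow> j \<in> S \<Longrightarrow> tr i j permutes S"
  by (rule permutes_swap_id)

text \<open>A permutation that moves k+1 lies in the double coset of (k k+1) with respect to S_k:
  composing \<open>g\<close> with the swap of k and the preimage m of k+1, and then with (k k+1),
  gives a permutation fixing k+1. Besides the generation by adjacent transpositions, this
  factorization drives the recursion of \<open>matcoef\<close>.\<close>

lemma permutes_step_decomp:
  assumes g: "g permutes {1..Suc k}" and "g (Suc k) \<noteq> Suc k"
  obtains p q where "p permutes {1..k}" "q permutes {1..k}" "g = p \<circ> tr k (Suc k) \<circ> q" "k \<ge> 1"
proof -
  define m where "m = Hilbert_Choice.inv g (Suc k)"
  have gm: "g m = Suc k" unfolding m_def using g permutes_inverses(1) by fastforce
  have "m \<in> {1..Suc k}" using gm permutes_not_in[OF g, of m] by fastforce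
  moreover have "m \<noteq> Suc k" using gm assms(2) by auto
  ultimately have m: "m \<in> {1..k}" by auto
  then have k: "k \<ge> 1" by auto
  define q where "q = tr m k"
  have q: "q permutes {1..k}" unfolding q_def using m k by (intro tr_permutes) auto
  define p where "p = g \<circ> q \<circ> tr k (Suc k)"
  have "q permutes {1..Suc k}" using q permutes_subset by fastforce
  moreover have "tr k (Suc k) permutes {1..Suc k}" using k by (intro tr_permutes) auto
  ultimately have p: "p permutes {1..Suc k}" unfolding p_def
    using g by (intro permutes_compose)
  have "p (Suc k) = Suc k" by (simp add: p_def q_def gm)
  have "p permutes {1..k}"
    by (rule permutes_superset[OF p]) (use \<open>p (Suc k) = Suc k\<close> in \<open>auto simp: le_Suc_eq\<close>)
  moreover have "g = p \<circ> tr k (Suc k) \<circ> q"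
    by (auto simp: p_def q_def fun_eq_iff)
  ultimately show ?thesis using q k that by blast
qed

lemma permutes_below: "g permutes {1..k} \<Longrightarrow> k \<le> n \<Longrightarrow> g permutes {1..n::nat}"
  by (erule permutes_subset) auto

text \<open>Generation of the symmetric group in the form of an induction rule, for properties such
  as commuting with a fixed operator or preserving a subspace.\<close>

lemma permutes_adjacent_induct [consumes 1, case_names id comp adjacent]:
  assumes "g permutes {1..n}"
    and "P id"
    and "\<And>g h. g permutes {1..n} \<Longrightarrow> h permutes {1..n} \<Longrightarrow> P g \<Longrightarrow> P h \<Longrightarrow> P (g \<circ> h)"
    and "\<And>i. 1 \<le> i \<Longrightarrow> Suc i \<le> n \<Longrightarrow> P (tr i (Suc i))"
  shows "P g"
proof -
  have "k \<le> n \<Longrightarrow> g permutes {1..k} \<Longrightarrow> P g" for k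
  proof (induction k arbitrary: g)
    case 0
    then show ?case using assms(2) by (simp add: permutes_empty id_def)
  next
    case (Suc k)
    show ?case
    proof (cases "g (Suc k) = Suc k")
      case True
      then have "g permutes {1..k}"
        by (intro permutes_superset[OF Suc.prems(2)]) (auto simp: le_Suc_eq)
      then show ?thesis using Suc by auto
    next
      case False
      obtain p q where pq: "p permutes {1..k}" "q permutes {1..k}" "g = p \<circ> tr k (Suc k) \<circ> q" "k \<ge> 1"
        using permutes_step_decomp[OF Suc.prems(2) False] .
      have "tr k (Suc k) permutes {1..n}" using pq(4) Suc.prems by (intro tr_permutes) auto
      moreover have "p permutes {1..n}" "q permutes {1..n}"
        using pq Suc.prems permutes_below by auto
      moreover have "P p" "P q" using Suc.IH pq Suc.prems by auto
      ultimately show ?thesis unfolding pq(3) using assms(3,4) pq(4) Suc.prems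
        by (intro assms(3) permutes_compose) auto
    qed
  qed
  then show ?thesis using assms(1) by blast
qed

section \<open>Polynomials in an operator\<close>

text \<open>The vector p(B) v. Horner's scheme hands \<open>B v\<close> on to the remaining
  coefficients, so inductions over \<open>p\<close> often have to leave the vector
  arbitrary.\<close>

definition pact :: "real poly \<Rightarrow> ('v::real_vector \<Rightarrow> 'v) \<Rightarrow> 'v \<Rightarrow> 'v" where
  "pact p B = fold_coeffs (\<lambda>a f v. a *\<^sub>R v + f (B v)) p (\<lambda>v. 0)"

lemma pact_0 [simp]: "pact 0 B v = 0"
  by (simp add: pact_def)

lemma pact_pCons [simp]: "pact (pCons a p) B v = a *\<^sub>R v + pact p B (B v)"
  by (cases "p = 0 \<and> a = 0") (auto simp: pact_def)

lemma pact_1 [simp]: "pact 1 B v = v"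
  by (simp add: one_pCons)

lemma pact_add: "pact (p + q) B v = pact p B v + pact q B v"
  by (induction p q arbitrary: v rule: poly_induct2) (auto simp: algebra_simps)

lemma pact_smult: "pact (Polynomial.smult c p) B v = c *\<^sub>R pact p B v"
  by (induction p arbitrary: v) (auto simp: algebra_simps)

lemma linear_pact: "linear B \<Longrightarrow> linear (pact p B)"
proof (induction p)
  case 0
  then show ?case by (simp add: linear_iff)
next
  case (pCons a p)
  then show ?case by (simp add: linear_iff algebra_simps)
qed

lemma pact_in: "real_vector.subspace W \<Longrightarrow> (\<And>v. v \<in> W \<Longrightarrow> B v \<in> W) \<Longrightarrow> v \<in> W \<Longrightarrow> pact p B v \<in> W"
  by (induction p arbitrary: v) (simp_all add: real_vector.subspace_0 real_vector.subspace_add real_vector.subspace_scale)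

text \<open>Intertwining is demanded only on a \<open>B\<close>-stable set, because the group
  relations hold on the invariant subspace while the operators are linear on the whole type.\<close>

lemma pact_commute:
  assumes "linear C" "\<And>v. v \<in> W \<Longrightarrow> B v \<in> W" "\<And>v. v \<in> W \<Longrightarrow> C (B v) = B' (C v)" "v \<in> W"
  shows "C (pact p B v) = pact p B' (C v)"
  using assms(4)
  by (induction p arbitrary: v)
     (auto simp: linear_0[OF assms(1)] linear_add[OF assms(1)] linear_scale[OF assms(1)] assms)

lemma pact_mult: "linear B \<Longrightarrow> pact (p * q) B v = pact p B (pact q B v)"
proof (induction p arbitrary: v)
  case (pCons a p)
  have "B (pact q B v) = pact q B (B v)"
    by (rule pact_commute[where W = UNIV]) (use pCons in auto)
  then show ?case using pCons by (simp add: pact_add pact_smult)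
qed simp

lemma pact_eigen: "linear B \<Longrightarrow> B v = c *\<^sub>R v \<Longrightarrow> pact p B v = poly p c *\<^sub>R v"
proof (induction p)
  case (pCons a p)
  have "pact p B (c *\<^sub>R v) = c *\<^sub>R pact p B v" using linear_scale linear_pact pCons by blast
  then show ?case using pCons by (simp add: algebra_simps)
qed simp

abbreviation lin_factor :: "int \<Rightarrow> real poly" where
  "lin_factor c \<equiv> [:- of_int c, 1:]"

lemma pact_lin_factor: "pact (lin_factor c) B v = B v - of_int c *\<^sub>R v"
  by simp

text \<open>The witness is a polynomial in \<open>B\<close> applied to \<open>w\<close>; it
  therefore stays in every \<open>B\<close>-invariant subspace and inherits the eigenvalues of
  \<open>w\<close> under operators commuting with \<open>B\<close>. This is what
  \<open>X_minpoly\<close> and \<open>exists_weight\<close> exploit.\<close>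

lemma eigenvector_exists:
  assumes B: "linear B" and "finite S" "w \<noteq> 0" "pact (\<Prod>c\<in>S. lin_factor c) B w = 0"
  shows "\<exists>c\<in>S. \<exists>q. pact q B w \<noteq> 0 \<and> B (pact q B w) = of_int c *\<^sub>R pact q B w"
  using assms(2,4)
proof (induction S rule: finite_induct)
  case empty
  then show ?case using assms by simp
next
  case (insert c S)
  show ?case
  proof (cases "pact (\<Prod>c\<in>S. lin_factor c) B w = 0")
    case True
    then show ?thesis using insert by blast
  next
    case False
    have "pact (lin_factor c) B (pact (\<Prod>c\<in>S. lin_factor c) B w) = 0"
      using insert by (simp add: pact_mult[OF B, symmetric])
    then show ?thesis using False by (intro bexI[of _ c] exI[of _ "\<Prod>c\<in>S. lin_factor c"]) auto
  qed
qed

section \<open>Representations of the symmetric group\<close>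

text \<open>The space is a subset of a type, since its dimension depends on a variable. The group
  laws hold on \<open>V\<close> only: on functions supported below d, for instance, the unit matrix
  acts as the identity only there. The operator \<open>X j\<close> defined below does not depend on
  \<open>n\<close>, which permits restriction to smaller groups.\<close>

locale sym_rep =
  fixes n :: nat and V :: "'v::real_vector set" and U :: "(nat \<Rightarrow> nat) \<Rightarrow> 'v \<Rightarrow> 'v"
  assumes sub: "real_vector.subspace V"
    and U_lin: "g permutes {1..n} \<Longrightarrow> linear (U g)"
    and U_closed: "g permutes {1..n} \<Longrightarrow> v \<in> V \<Longrightarrow> U g v \<in> V"
    and U_id: "v \<in> V \<Longrightarrow> U id v = v"
    and U_comp: "g permutes {1..n} \<Longrightarrow> h permutes {1..n} \<Longrightarrow> v \<in> V \<Longrightarrow> U (g \<circ> h) v = U g (U h v)"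
begin

definition X :: "nat \<Rightarrow> 'v \<Rightarrow> 'v" where
  "X j v = (\<Sum>i=1..<j. U (tr i j) v)"

definition inv_sub :: "'v set \<Rightarrow> bool" where
  "inv_sub W \<longleftrightarrow> real_vector.subspace W \<and> W \<subseteq> V \<and> (\<forall>g v. g permutes {1..n} \<longrightarrow> v \<in> W \<longrightarrow> U g v \<in> W)"

lemma inv_sub_V: "inv_sub V"
  using sub U_closed by (auto simp: inv_sub_def)

lemma tr_n: "1 \<le> i \<Longrightarrow> i \<le> n \<Longrightarrow> 1 \<le> j \<Longrightarrow> j \<le> n \<Longrightarrow> tr i j permutes {1..n}"
  by (intro tr_permutes) auto

lemma X_lin: "j \<le> n \<Longrightarrow> linear (X j)"
  unfolding X_def by (intro linear_compose_sum ballI U_lin tr_n) auto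

lemma X_inv_sub: "inv_sub W \<Longrightarrow> j \<le> n \<Longrightarrow> v \<in> W \<Longrightarrow> X j v \<in> W"
  unfolding X_def inv_sub_def using tr_n by (intro real_vector.subspace_sum) auto

lemma X_closed: "j \<le> n \<Longrightarrow> v \<in> V \<Longrightarrow> X j v \<in> V"
  using X_inv_sub inv_sub_V by blast

lemma X_1 [simp]: "X (Suc 0) v = 0" "X 0 v = 0"
  by (auto simp: X_def)

lemma U_cancel: "g permutes {1..n} \<Longrightarrow> v \<in> V \<Longrightarrow> U (Hilbert_Choice.inv g) (U g v) = v"
  using U_comp[of "Hilbert_Choice.inv g" g v] by (simp add: permutes_inv permutes_inv_o U_id)

lemma U_tr_tr: "1 \<le> i \<Longrightarrow> i \<le> n \<Longrightarrow> 1 \<le> j \<Longrightarrow> j \<le> n \<Longrightarrow> v \<in> V \<Longrightarrow> U (tr i j) (U (tr i j) v) = v"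
  using U_comp[OF tr_n[of i j] tr_n[of i j], of v] U_id[of v] by simp

text \<open>As \<open>g\<close> fixes \<open>j\<close>, conjugation by it sends (i j) to (g(i) j),
  hence only permutes the summands of \<open>X j\<close>.\<close>

lemma U_X_commute:
  assumes g: "g permutes {1..<j}" and "j \<le> n" "v \<in> V"
  shows "U g (X j v) = X j (U g v)"
proof (cases "j = 0")
  case True
  then have "g = id" using g by simp
  then show ?thesis using True U_id sub by (simp add: real_vector.subspace_0)
next
  case False
  have gn: "g permutes {1..n}" using g by (rule permutes_subset) (use assms in auto)
  have *: "tr (g i) j \<circ> g = g \<circ> tr i j" for i
  proof -
    have "g j = j" using permutes_not_in[OF g, of j] by simp
    moreover have "g a = g b \<longleftrightarrow> a = b" for a b using inj_eq[OF permutes_inj[OF g]] .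
    ultimately show ?thesis
      by (auto simp: fun_eq_iff Transposition.transpose_def)
  qed
  have gi: "g i \<in> {1..<j}" if "i \<in> {1..<j}" for i using that permutes_in_image[OF g] by blast
  have "X j (U g v) = (\<Sum>i=1..<j. U (tr (g i) j) (U g v))"
    unfolding X_def using sum.permute[OF g, of "\<lambda>i. U (tr i j) (U g v)"] by (simp add: o_def)
  also have "\<dots> = (\<Sum>i=1..<j. U g (U (tr i j) v))"
  proof (rule sum.cong[OF refl])
    fix i assume i: "i \<in> {1..<j}"
    then have "U (tr (g i) j) (U g v) = U (tr (g i) j \<circ> g) v"
      using gi[OF i] assms gn by (intro U_comp[symmetric] tr_n) auto
    also have "\<dots> = U g (U (tr i j) v)"
      unfolding * using i gn assms by (intro U_comp tr_n) auto
    finally show "U (tr (g i) j) (U g v) = U g (U (tr i j) v)" .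
  qed
  also have "\<dots> = U g (X j v)" unfolding X_def by (rule linear_sum[OF U_lin[OF gn], symmetric])
  finally show ?thesis ..
qed

text \<open>Every summand of the element with the smaller index permutes the numbers below the
  larger index, so \<open>U_X_commute\<close> applies termwise.\<close>

lemma X_commute:
  assumes "i \<le> n" "j \<le> n" "v \<in> V"
  shows "X i (X j v) = X j (X i v)"
proof -
  have *: "X i (X j v) = X j (X i v)" if "i < j" "j \<le> n" for i j
  proof -
    have "U (tr l i) (X j v) = X j (U (tr l i) v)" if "l \<in> {1..<i}" for l
      using that \<open>i < j\<close> \<open>j \<le> n\<close> assms by (intro U_X_commute tr_permutes) auto
    then show ?thesis
      using linear_sum[OF X_lin[OF \<open>j \<le> n\<close>], of "\<lambda>l. U (tr l i) v" "{1..<i}"]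
      unfolding X_def[of i] by simp
  qed
  show ?thesis using * assms by (cases i j rule: linorder_cases) auto
qed

lemma s_X_far:
  assumes "1 \<le> i" "Suc i \<le> n" "1 \<le> j" "j \<le> n" "j \<noteq> i" "j \<noteq> Suc i" "v \<in> V"
  shows "U (tr i (Suc i)) (X j v) = X j (U (tr i (Suc i)) v)"
proof (cases "j < i")
  case True
  have "U (tr i (Suc i)) (U (tr l j) v) = U (tr l j) (U (tr i (Suc i)) v)" if "l \<in> {1..<j}" for l
  proof -
    have "tr i (Suc i) \<circ> tr l j = tr l j \<circ> tr i (Suc i)"
      using that True by (auto simp: fun_eq_iff Transposition.transpose_def)
    moreover have "tr i (Suc i) permutes {1..n}" "tr l j permutes {1..n}"
      using that True assms by (auto intro!: tr_permutes)
    ultimately show ?thesis using U_comp assms(7) by metis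
  qed
  then show ?thesis unfolding X_def
    using linear_sum[OF U_lin[OF tr_n[of i "Suc i"]], of "\<lambda>l. U (tr l j) v"] assms by simp
next
  case False
  then show ?thesis using assms by (intro U_X_commute tr_permutes) auto
qed

text \<open>Conjugation by (k k+1) turns (i k) into (i k+1); of the summands of X_{k+1} only (k k+1)
  itself is not reached.\<close>

lemma s_X_s:
  assumes "1 \<le> k" "Suc k \<le> n" "v \<in> V"
  shows "U (tr k (Suc k)) (X k (U (tr k (Suc k)) v)) = X (Suc k) v - U (tr k (Suc k)) v"
proof -
  let ?s = "tr k (Suc k)"
  have s: "?s permutes {1..n}" using assms by (intro tr_n) auto
  have "U ?s (U (tr i k) (U ?s v)) = U (tr i (Suc k)) v" if "i \<in> {1..<k}" for i
  proof -
    have t: "tr i k permutes {1..n}" using that assms by (intro tr_n) auto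
    have "?s \<circ> (tr i k \<circ> ?s) = tr i (Suc k)"
      using that by (auto simp: fun_eq_iff Transposition.transpose_def)
    then show ?thesis
      using U_comp[OF s permutes_compose[OF s t] assms(3)] U_comp[OF t s assms(3)] by simp
  qed
  then have "U ?s (X k (U ?s v)) = (\<Sum>i=1..<k. U (tr i (Suc k)) v)"
    unfolding X_def by (simp add: linear_sum[OF U_lin[OF s]])
  also have "\<dots> = X (Suc k) v - U ?s v" using assms by (simp add: X_def)
  finally show ?thesis .
qed

lemma X_s:
  assumes "1 \<le> k" "Suc k \<le> n" "v \<in> V"
  shows "X k (U (tr k (Suc k)) v) = U (tr k (Suc k)) (X (Suc k) v) - v"
    and "X (Suc k) (U (tr k (Suc k)) v) = U (tr k (Suc k)) (X k v) + v"
proof -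
  let ?s = "tr k (Suc k)"
  have s: "?s permutes {1..n}" using assms by (intro tr_n) auto
  have ss: "U ?s (U ?s w) = w" if "w \<in> V" for w using U_tr_tr that assms by auto
  have "X k (U ?s v) = U ?s (U ?s (X k (U ?s v)))"
    using assms s by (intro ss[symmetric] X_closed U_closed) auto
  also have "\<dots> = U ?s (X (Suc k) v) - v"
    using assms by (simp add: s_X_s linear_diff[OF U_lin[OF s]] ss)
  finally show "X k (U ?s v) = U ?s (X (Suc k) v) - v" .
  have "U ?s (X k v) = U ?s (X k (U ?s (U ?s v)))" using ss assms by simp
  also have "\<dots> = X (Suc k) (U ?s v) - v" using assms s s_X_s[of k "U ?s v"] by (simp add: ss U_closed)
  finally show "X (Suc k) (U ?s v) = U ?s (X k v) + v" by simp
qed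

text \<open>Restriction to S_k changes only the index and keeps space and operators; the induction
  in theorem \<open>matcoef\<close> runs over these restrictions.\<close>

lemma sym_rep_restrict: "k \<le> n \<Longrightarrow> sym_rep k V U"
  by (intro sym_rep.intro) (auto intro!: sub U_lin U_closed U_id U_comp permutes_below[of _ k n, simplified])

end

section \<open>Orthogonal representations and annihilating polynomials\<close>

locale orth_rep = sym_rep n V U
  for n and V :: "'v::real_vector set" and U +
  fixes ip :: "'v \<Rightarrow> 'v \<Rightarrow> real"
  assumes ip_lin: "linear (\<lambda>v. ip v w)"
    and ip_sym: "ip v w = ip w v"
    and ip_pos: "v \<in> V \<Longrightarrow> v \<noteq> 0 \<Longrightarrow> ip v v > 0"
    and ip_U: "g permutes {1..n} \<Longrightarrow> v \<in> V \<Longrightarrow> w \<in> V \<Longrightarrow> ip (U g v) (U g w) = ip v w"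
begin

lemma ip_lin2: "linear (ip w)"
  using ip_lin[of w] unfolding ip_sym[of _ w] by simp

lemma ip_simps:
  "ip (u + v) w = ip u w + ip v w" "ip (u - v) w = ip u w - ip v w" "ip (- v) w = - ip v w"
  "ip (c *\<^sub>R v) w = c * ip v w" "ip 0 w = 0"
  "ip w (u + v) = ip w u + ip w v" "ip w (u - v) = ip w u - ip w v" "ip w (- v) = - ip w v"
  "ip w (c *\<^sub>R v) = c * ip w v" "ip w 0 = 0"
  using linear_add[OF ip_lin] linear_diff[OF ip_lin] linear_neg[OF ip_lin] linear_scale[OF ip_lin] linear_0[OF ip_lin]
    linear_add[OF ip_lin2] linear_diff[OF ip_lin2] linear_neg[OF ip_lin2] linear_scale[OF ip_lin2] linear_0[OF ip_lin2]
  by auto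

lemma ip_sum: "ip (sum f S) w = (\<Sum>i\<in>S. ip (f i) w)" "ip w (sum f S) = (\<Sum>i\<in>S. ip w (f i))"
  using linear_sum[OF ip_lin] linear_sum[OF ip_lin2] by auto

lemma ip_eq_0: "v \<in> V \<Longrightarrow> ip v v = 0 \<Longrightarrow> v = 0"
  using ip_pos by fastforce

lemma ip_nonneg: "v \<in> V \<Longrightarrow> ip v v \<ge> 0"
  using ip_pos[of v] by (cases "v = 0") (auto simp: ip_simps)

lemma orth_rep_restrict: "k \<le> n \<Longrightarrow> orth_rep k V U ip"
  by (intro orth_rep.intro sym_rep_restrict orth_rep_axioms.intro)
     (auto simp only: ip_lin intro: ip_pos ip_U[OF permutes_below] ip_sym)

lemma ip_U_adj:
  "g permutes {1..n} \<Longrightarrow> v \<in> V \<Longrightarrow> w \<in> V \<Longrightarrow> ip (U g v) w = ip v (U (Hilbert_Choice.inv g) w)"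
  using ip_U[of "Hilbert_Choice.inv g" "U g v" w] by (simp add: permutes_inv U_closed U_cancel)

definition symm :: "('v \<Rightarrow> 'v) \<Rightarrow> bool" where
  "symm B \<longleftrightarrow> linear B \<and> (\<forall>v\<in>V. B v \<in> V) \<and> (\<forall>v\<in>V. \<forall>w\<in>V. ip (B v) w = ip v (B w))"

lemma symm_tr: "1 \<le> i \<Longrightarrow> i \<le> n \<Longrightarrow> 1 \<le> j \<Longrightarrow> j \<le> n \<Longrightarrow> symm (U (tr i j))"
  using ip_U_adj[OF tr_n] U_lin[OF tr_n] U_closed[OF tr_n]
  by (simp add: symm_def)

lemma symm_X:
  assumes "j \<le> n" shows "symm (X j)"
proof -
  have "ip (X j v) w = ip v (X j w)" if "v \<in> V" "w \<in> V" for v w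
    unfolding X_def ip_sum using that assms symm_tr by (intro sum.cong) (auto simp: symm_def)
  then show ?thesis using X_lin X_closed assms by (auto simp: symm_def)
qed

lemma symm_pact:
  assumes "symm B" shows "symm (pact p B)"
proof -
  have "ip (pact p B v) w = ip v (pact p B w)" if "v \<in> V" "w \<in> V" for v w
    using that
  proof (induction p arbitrary: v w)
    case (pCons a p)
    have "pact p B (B w) = B (pact p B w)"
      using assms by (intro pact_commute[symmetric, where W = UNIV]) (auto simp: symm_def)
    moreover have "pact p B w \<in> V" using pact_in[OF sub] assms pCons by (auto simp: symm_def)
    moreover have "B v \<in> V" using assms pCons.prems by (auto simp: symm_def)
    ultimately show ?case using pCons assms by (simp add: ip_simps symm_def)
  qed (simp add: ip_simps)
  moreover have "pact p B v \<in> V" if "v \<in> V" for v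
    using pact_in[OF sub _ that, of B p] assms by (auto simp: symm_def)
  ultimately show ?thesis using assms linear_pact by (auto simp: symm_def)
qed

lemma symm_square_zero:
  assumes "symm B" "v \<in> V" "B (B v) = 0" shows "B v = 0"
proof -
  have "ip (B v) (B v) = ip v (B (B v))" using assms by (auto simp: symm_def)
  then have "ip (B v) (B v) = 0" using assms by (simp add: ip_simps)
  then show ?thesis using ip_eq_0 assms by (auto simp: symm_def)
qed

lemma symm_eigen_orth:
  assumes "symm B" "v \<in> V" "w \<in> V" "B v = a *\<^sub>R v" "B w = b *\<^sub>R w" "a \<noteq> b"
  shows "ip v w = 0"
proof -
  have "a * ip v w = b * ip v w" using assms by (metis symm_def ip_simps(4,9))
  then show ?thesis using assms by simp
qed

text \<open>For a symmetric operator, B^2 v = 0 forces B v = 0, so one copy of a repeated factor can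
  be cancelled; every factor in \<open>cs\<close> already divides \<open>q\<close>.\<close>

lemma pact_squarefree:
  assumes B: "symm B" and v: "v \<in> V" and "\<forall>c\<in>set cs. lin_factor c dvd q"
    and "pact ((\<Prod>c\<leftarrow>cs. lin_factor c) * q) B v = 0"
  shows "pact q B v = 0"
  using assms(3,4)
proof (induction cs)
  case (Cons c cs)
  define r where "r = (\<Prod>c\<leftarrow>cs. lin_factor c)"
  obtain q' where q': "q = lin_factor c * q'" using Cons by (auto simp: dvd_def)
  have lB: "linear B" using B by (simp add: symm_def)
  define y where "y = pact (r * q') B v"
  have "y \<in> V" unfolding y_def using symm_pact[OF B] v by (auto simp: symm_def)
  moreover have "pact (lin_factor c) B (pact (lin_factor c) B y) = pact ((\<Prod>c\<leftarrow>c # cs. lin_factor c) * q) B v"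
    unfolding y_def pact_mult[OF lB, symmetric] q' by (simp add: r_def mult.commute mult.left_commute mult.assoc del: pact_pCons mult_pCons_left mult_pCons_right)
  ultimately have "pact (lin_factor c) B y = 0"
    using symm_square_zero[OF symm_pact[OF B]] Cons.prems by metis
  then have "pact (r * q) B v = 0"
    unfolding y_def pact_mult[OF lB, symmetric] q' by (simp add: mult.commute mult.left_commute mult.assoc del: pact_pCons mult_pCons_left mult_pCons_right)
  then show ?case using Cons r_def by simp
qed simp

definition content_poly :: "nat \<Rightarrow> real poly" where
  "content_poly m = (\<Prod>c\<in>{- int m..int m}. lin_factor c)"

text \<open>
  With \<open>A = X k\<close>, \<open>B = X (k + 1)\<close> and \<open>s = (k k+1)\<close>, the operator \<open>\<phi> = s (A - B) + 1\<close> satisfies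
  \<open>\<phi> B = A \<phi>\<close> and \<open>\<phi>\<^sup>2 = 1 - (A - B)\<^sup>2\<close>, so an annihilating polynomial of \<open>A\<close> yields a relation for \<open>B\<close>.
\<close>

lemma X_minpoly:
  assumes "Suc m \<le> n" "v \<in> V"
  shows "pact (content_poly m) (X (Suc m)) v = 0"
  using assms
proof (induction m arbitrary: v)
  case 0
  then show ?case by (simp add: content_poly_def)
next
  case (Suc m)
  define k where "k = Suc m"
  let ?s = "U (tr k (Suc k))" and ?A = "X k" and ?B = "X (Suc k)"
  let ?p = "content_poly m" and ?q = "content_poly (Suc m)"
  have k: "1 \<le> k" "Suc k \<le> n" using Suc.prems by (auto simp: k_def)
  have s: "tr k (Suc k) permutes {1..n}" using k by (intro tr_n) auto
  note cl = X_closed U_closed[OF s] real_vector.subspace_add[OF sub] real_vector.subspace_diff[OF sub]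
    real_vector.subspace_scale[OF sub]
  have lA: "linear ?A" and lB: "linear ?B" using X_lin k by auto
  note lin = linear_add[OF lA] linear_add[OF lB] linear_diff[OF lA] linear_diff[OF lB]
    linear_scale[OF lA] linear_scale[OF lB]
    linear_add[OF U_lin[OF s]] linear_diff[OF U_lin[OF s]] linear_scale[OF U_lin[OF s]]
  have AB: "?A (?B w) = ?B (?A w)" if "w \<in> V" for w using X_commute that k by auto
  define phi where "phi = (\<lambda>w. ?s (?A w - ?B w) + w)"
  have phi_lin: "linear phi"
    unfolding phi_def by (intro linear_compose_add linear_compose[OF _ U_lin[OF s], unfolded o_def] linear_compose_sub lA lB linear_id[unfolded id_def])
  have phiB: "phi (?B w) = ?A (phi w)" if "w \<in> V" for w
    using that k by (simp add: phi_def lin X_s cl AB algebra_simps)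
  have phi2: "phi (phi w) = w - (?B (?B w) - 2 *\<^sub>R ?A (?B w) + ?A (?A w))" if "w \<in> V" for w
  proof -
    have "?s (?s y) = y" if "y \<in> V" for y using U_tr_tr k that by auto
    then show ?thesis using that k
      by (simp add: phi_def lin X_s cl AB algebra_simps scaleR_2)
  qed
  \<comment> \<open>p(B) \<phi>^2 w = \<phi> p(A) \<phi> w, and the induction hypothesis kills p(A)
    on \<open>phi w\<close>.\<close>
  have rel: "pact ?p ?B (w - (?B (?B w) - 2 *\<^sub>R ?A (?B w) + ?A (?A w))) = 0" if w: "w \<in> V" for w
  proof -
    have pw: "phi w \<in> V" using w k by (auto simp: phi_def intro!: cl)
    have "pact ?p ?B (w - (?B (?B w) - 2 *\<^sub>R ?A (?B w) + ?A (?A w))) = pact ?p ?B (phi (phi w))"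
      using phi2 w by simp
    also have "\<dots> = phi (pact ?p ?A (phi w))"
    proof (rule pact_commute[OF phi_lin, symmetric, where W = V])
      show "phi (?A y) = ?B (phi y)" if "y \<in> V" for y
        using that k by (simp add: phi_def lin X_s cl AB algebra_simps)
    qed (use pw cl k in auto)
    also have "pact ?p ?A (phi w) = 0" using Suc.IH pw k by (simp add: k_def)
    finally show ?thesis using linear_0[OF phi_lin] by simp
  qed
  show ?case
  proof (rule ccontr)
    assume "pact (content_poly (Suc m)) (X (Suc (Suc m))) v \<noteq> 0"
    then have ne: "pact ?q ?B v \<noteq> 0" by (simp add: k_def)
    have inV: "pact ?q ?B v \<in> V" using pact_in[OF sub] Suc.prems k cl by auto
    then have "pact ?p ?A (pact ?q ?B v) = 0" using Suc.IH Suc.prems k_def by simp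
    then obtain a r where a: "a \<in> {- int m..int m}" and u: "pact r ?A (pact ?q ?B v) \<noteq> 0"
      "?A (pact r ?A (pact ?q ?B v)) = of_int a *\<^sub>R pact r ?A (pact ?q ?B v)"
      using eigenvector_exists[OF lA _ ne, of "{- int m..int m}"] unfolding content_poly_def by auto
    define v' where "v' = pact r ?A v"
    have v'V: "v' \<in> V" using pact_in[OF sub] Suc.prems k cl by (auto simp: v'_def)
    have comm: "pact r ?A (pact ?q ?B v) = pact ?q ?B v'"
      unfolding v'_def
    proof (rule pact_commute[where W = V])
      show "linear (pact r ?A)" using linear_pact lA by auto
      show "pact r ?A (?B y) = ?B (pact r ?A y)" if "y \<in> V" for y
        by (rule pact_commute[where W = V, symmetric]) (use lB AB cl k that in auto)
    qed (use cl k Suc.prems in auto)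
    define u where "u = pact ?q ?B v'"
    have uV: "u \<in> V" using pact_in[OF sub] v'V k cl by (auto simp: u_def)
    have Au: "?A u = of_int a *\<^sub>R u" and "u \<noteq> 0" using u comm by (auto simp: u_def)
    \<comment> \<open>On the eigenspace A = a the quadratic expression 1 - (A - B)^2 splits, up to
      sign, into linear factors with roots a - 1 and a + 1.\<close>
    have "pact (lin_factor (a+1)) ?B (pact (lin_factor (a-1)) ?B u) = - (u - (?B (?B u) - 2 *\<^sub>R ?A (?B u) + ?A (?A u)))"
    proof -
      have "2 *\<^sub>R ?A (?B u) = of_int a *\<^sub>R ?B u + of_int a *\<^sub>R ?B u"
        unfolding scaleR_2 using AB[OF uV] by (simp add: lin Au)
      moreover have "?A (?A u) = (of_int a * of_int a) *\<^sub>R u" by (simp add: lin Au)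
      ultimately show ?thesis by (simp add: lin algebra_simps)
    qed
    then have "pact ?p ?B (pact (lin_factor (a+1)) ?B (pact (lin_factor (a-1)) ?B u)) = 0"
      using rel[OF uV] by (simp only: linear_neg[OF linear_pact[OF lB]] minus_zero)
    then have "pact ((?p * (lin_factor (a+1) * lin_factor (a-1))) * ?q) ?B v' = 0"
      unfolding u_def pact_mult[OF lB, symmetric] by (simp add: mult.assoc del: pact_pCons mult_pCons_left mult_pCons_right)
    moreover have "?p * (lin_factor (a+1) * lin_factor (a-1)) = (\<Prod>c\<leftarrow>[a+1,a-1] @ sorted_list_of_set {- int m..int m}. lin_factor c)"
      unfolding content_poly_def
      by (simp add: prod.distinct_set_conv_list[symmetric] mult.commute mult.left_commute del: mult_pCons_left mult_pCons_right)
    ultimately have "pact ((\<Prod>c\<leftarrow>[a+1,a-1] @ sorted_list_of_set {- int m..int m}. lin_factor c) * ?q) ?B v' = 0"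
      by simp
    \<comment> \<open>The roots a - 1, a + 1 and those of p all lie in [-(m+1), m+1], hence are
      roots of q, and the extra factors cancel; this contradicts u being nonzero.\<close>
    then have "pact ?q ?B v' = 0"
    proof (rule pact_squarefree[rotated 3])
      show "symm ?B" using symm_X k by auto
      have "lin_factor c dvd ?q" if "c \<in> {- int (Suc m)..int (Suc m)}" for c
        unfolding content_poly_def using that by (intro dvd_prodI) auto
      moreover have "set ([a+1,a-1] @ sorted_list_of_set {- int m..int m}) \<subseteq> {- int (Suc m)..int (Suc m)}"
        using a by auto
      ultimately show "\<forall>c\<in>set ([a+1,a-1] @ sorted_list_of_set {- int m..int m}). lin_factor c dvd ?q"
        by blast
    qed (rule v'V)
    then show False using \<open>u \<noteq> 0\<close> by (simp add: u_def)
  qed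
qed

text \<open>A single polynomial for all j lets the program try the same candidates for every
  operator.\<close>

lemma X_minpoly_n:
  assumes "1 \<le> j" "j \<le> n" "v \<in> V"
  shows "pact (content_poly n) (X j) v = 0"
proof -
  obtain m where m: "j = Suc m" using assms by (cases j) auto
  have "content_poly m dvd content_poly n" unfolding content_poly_def
    using assms m by (intro prod_dvd_prod_subset) auto
  then obtain r where "content_poly n = r * content_poly m" by (auto simp: dvd_def mult.commute)
  then show ?thesis using X_minpoly[of m v] assms m
    by (simp add: pact_mult X_lin linear_0[OF linear_pact[OF X_lin]])
qed

end

section \<open>The regular representation\<close>

text \<open>Left multiplication by \<open>g\<close>, written on coefficient functions; the case
  distinction restores the convention that coefficients vanish off the group.\<close>

definition ltrans :: "nat \<Rightarrow> (nat \<Rightarrow> nat) \<Rightarrow> group_alg \<Rightarrow> group_alg" where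
  "ltrans n g x = (\<lambda>h. if h permutes {1..n} then x (Hilbert_Choice.inv g \<circ> h) else 0)"

definition ga_ip :: "nat \<Rightarrow> group_alg \<Rightarrow> group_alg \<Rightarrow> real" where
  "ga_ip n x y = (\<Sum>g | g permutes {1..n}. x g * y g)"

lemma group_algebra_iff: "x \<in> group_algebra n \<longleftrightarrow> (\<forall>g. \<not> g permutes {1..n} \<longrightarrow> x g = 0)"
  by (auto simp: group_algebra_def sym_group_carrier)

declare finite_permutations [simp]

lemma sym_rep_regular: "sym_rep n (group_algebra n) (ltrans n)"
proof (rule sym_rep.intro)
  show "real_vector.subspace (group_algebra n)"
    by (auto simp: real_vector.subspace_def group_algebra_iff)
  show "linear (ltrans n g)" for g
    by (rule linearI) (auto simp: ltrans_def fun_eq_iff)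
  show "ltrans n g x \<in> group_algebra n" for g x
    by (auto simp: ltrans_def group_algebra_iff)
  show "ltrans n id x = x" if "x \<in> group_algebra n" for x
    using that by (auto simp: ltrans_def group_algebra_iff fun_eq_iff)
  show "ltrans n (g \<circ> h) x = ltrans n g (ltrans n h x)"
    if gh: "g permutes {1..n}" "h permutes {1..n}" for g h x
  proof
    fix k
    show "ltrans n (g \<circ> h) x k = ltrans n g (ltrans n h x) k"
      using permutes_compose[OF _ permutes_inv[OF gh(1)], of k]
      by (auto simp: ltrans_def o_inv_distrib[OF permutes_bij[OF gh(1)] permutes_bij[OF gh(2)]] comp_assoc)
  qed
qed

lemma orth_rep_regular: "orth_rep n (group_algebra n) (ltrans n) (ga_ip n)"
proof (intro orth_rep.intro sym_rep_regular orth_rep_axioms.intro)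
  show "linear (\<lambda>v. ga_ip n v w)" for w
    by (rule linearI) (auto simp: ga_ip_def algebra_simps sum.distrib sum_distrib_left)
  show "ga_ip n v w = ga_ip n w v" for v w
    by (simp add: ga_ip_def mult.commute)
  show "0 < ga_ip n v v" if "v \<in> group_algebra n" "v \<noteq> 0" for v
  proof -
    obtain g where "v g \<noteq> 0" using \<open>v \<noteq> 0\<close> by (auto simp: fun_eq_iff)
    then have "g permutes {1..n}" using that by (auto simp: group_algebra_iff)
    then have "0 < v g * v g" "v g * v g \<le> ga_ip n v v"
      unfolding ga_ip_def using \<open>v g \<noteq> 0\<close>
      by (auto intro!: member_le_sum zero_less_mult_iff[THEN iffD2])
    then show ?thesis by linarith
  qed
  show "ga_ip n (ltrans n g v) (ltrans n g w) = ga_ip n v w" if "g permutes {1..n}" for g v w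
  proof -
    have "ga_ip n v w = (\<Sum>k | k permutes {1..n}. v (Hilbert_Choice.inv g \<circ> k) * w (Hilbert_Choice.inv g \<circ> k))"
      unfolding ga_ip_def by (rule setum_permutations_compose_left[OF permutes_inv[OF that]])
    then show ?thesis by (simp add: ga_ip_def ltrans_def)
  qed
qed

context sym_rep
begin

definition ext :: "group_alg \<Rightarrow> 'v \<Rightarrow> 'v" where
  "ext x v = (\<Sum>g | g permutes {1..n}. x g *\<^sub>R U g v)"

lemma ext_linear: "linear (ext x)"
  unfolding ext_def by (intro linear_compose_sum ballI linear_compose_scale_right U_lin) simp

lemma ext_inv_sub: "inv_sub W \<Longrightarrow> v \<in> W \<Longrightarrow> ext x v \<in> W"
  unfolding ext_def inv_sub_def by (intro real_vector.subspace_sum real_vector.subspace_scale) auto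

lemma ext_closed: "v \<in> V \<Longrightarrow> ext x v \<in> V"
  using ext_inv_sub inv_sub_V by blast

lemma ext_add: "ext (x + y) v = ext x v + ext y v"
  and ext_diff: "ext (x - y) v = ext x v - ext y v"
  and ext_scale: "ext (c *\<^sub>R x) v = c *\<^sub>R ext x v"
  and ext_zero: "ext 0 v = 0"
  by (simp_all add: ext_def scaleR_left_distrib scaleR_left_diff_distrib sum.distrib sum_subtractf scaleR_sum_right)

lemma ext_sum: "ext (sum f S) v = (\<Sum>i\<in>S. ext (f i) v)"
  by (induction S rule: infinite_finite_induct) (simp_all only: sum.infinite sum.empty sum.insert ext_add ext_zero not_False_eq_True)

lemma ext_delta: "v \<in> V \<Longrightarrow> ext (ga_single id) v = v"
proof -
  assume "v \<in> V"
  have "ext (ga_single id) v = (\<Sum>g | g permutes {1..n}. if g = id then U g v else 0)"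
    unfolding ext_def by (rule sum.cong) (auto simp: ga_single_def)
  also have "\<dots> = v" using \<open>v \<in> V\<close> U_id[of v] permutes_id[of "{1..n}"] by (subst sum.delta) auto
  finally show ?thesis .
qed

text \<open>For fixed \<open>v\<close>, evaluation x \<mapsto> x v is a module map from the regular
  representation. Operators built from the group action can thus be formed once in the group algebra
  and transferred, as the lemmas that follow do for \<open>X j\<close> and its polynomials.\<close>

lemma ext_ltrans: "g permutes {1..n} \<Longrightarrow> v \<in> V \<Longrightarrow> ext (ltrans n g x) v = U g (ext x v)"
proof -
  assume g: "g permutes {1..n}" and v: "v \<in> V"
  have "ext (ltrans n g x) v = (\<Sum>h | h permutes {1..n}. x (Hilbert_Choice.inv g \<circ> h) *\<^sub>R U h v)"
    unfolding ext_def by (rule sum.cong) (auto simp: ltrans_def)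
  also have "\<dots> = (\<Sum>h | h permutes {1..n}. x (Hilbert_Choice.inv g \<circ> (g \<circ> h)) *\<^sub>R U (g \<circ> h) v)"
    by (rule setum_permutations_compose_left[OF g])
  also have "\<dots> = (\<Sum>h | h permutes {1..n}. x h *\<^sub>R U g (U h v))"
    using g v by (intro sum.cong) (auto simp: U_comp comp_assoc[symmetric] permutes_inv_o)
  also have "\<dots> = U g (ext x v)"
    unfolding ext_def by (simp add: linear_sum[OF U_lin[OF g]] linear_scale[OF U_lin[OF g]])
  finally show ?thesis .
qed

lemma ext_X: "j \<le> n \<Longrightarrow> v \<in> V \<Longrightarrow> ext (sym_rep.X (ltrans n) j x) v = X j (ext x v)"
  unfolding sym_rep.X_def[OF sym_rep_regular] X_def ext_sum
  by (intro sum.cong ext_ltrans tr_n) auto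

lemma ext_pact:
  assumes "j \<le> n" "v \<in> V"
  shows "ext (pact p (sym_rep.X (ltrans n) j) x) v = pact p (X j) (ext x v)"
  using assms by (induction p arbitrary: x) (auto simp: ext_zero ext_add ext_scale ext_X)

lemma U_ext: "g permutes {1..n} \<Longrightarrow> v \<in> V \<Longrightarrow> U g (ext x v) = ext (ltrans n g x) v"
  using ext_ltrans by simp

lemma ext_ga_mult:
  assumes "v \<in> V" "y \<in> group_algebra n"
  shows "ext (sym_rep.ext n (ltrans n) x y) v = ext x (ext y v)"
  unfolding sym_rep.ext_def[OF sym_rep_regular]
  using assms by (simp add: ext_sum ext_scale ext_ltrans ext_def[of x])

definition weight :: "(nat \<Rightarrow> int) \<Rightarrow> 'v \<Rightarrow> bool" where
  "weight \<alpha> v \<longleftrightarrow> v \<in> V \<and> (\<forall>j\<in>{1..n}. X j v = of_int (\<alpha> j) *\<^sub>R v)"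

lemma weightD: "weight \<alpha> v \<Longrightarrow> v \<in> V" "weight \<alpha> v \<Longrightarrow> 1 \<le> j \<Longrightarrow> j \<le> n \<Longrightarrow> X j v = of_int (\<alpha> j) *\<^sub>R v"
  by (auto simp: weight_def)

end

text \<open>With the product read as the action of the left factor on the regular representation,
  left ideals become cyclic modules and the locale results apply to Specht modules.\<close>

lemma ga_mult_eq_ext:
  "ga_mult n a b = sym_rep.ext n (ltrans n) a b"
proof
  fix g
  show "ga_mult n a b g = sym_rep.ext n (ltrans n) a b g"
  proof (cases "g permutes {1..n}")
    case True
    have "ga_mult n a b g = (\<Sum>h | h permutes {1..n}. a h * b (Hilbert_Choice.inv h \<circ> g))"
      unfolding ga_mult_def
    proof (rule sum.reindex_bij_witness[where j = fst and i = "\<lambda>h. (h, Hilbert_Choice.inv h \<circ> g)"])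
      fix h assume h: "h \<in> {h. h permutes {1..n}}"
      then show "(h, Hilbert_Choice.inv h \<circ> g) \<in> {(h, k). (h, k) \<in> carrier (sym_group n) \<times> carrier (sym_group n) \<and> h \<circ> k = g}"
        using True by (auto simp: sym_group_carrier permutes_inv permutes_compose comp_assoc[symmetric] permutes_inv_o)
    qed (auto simp: sym_group_carrier comp_assoc[symmetric] permutes_inv_o)
    also have "\<dots> = sym_rep.ext n (ltrans n) a b g"
      using True by (simp add: sym_rep.ext_def[OF sym_rep_regular] sum_fun_apply ltrans_def)
    finally show ?thesis .
  next
    case False
    then have "{(h, k). (h, k) \<in> carrier (sym_group n) \<times> carrier (sym_group n) \<and> h \<circ> k = g} = {}"
      using permutes_compose by (auto simp: sym_group_carrier)
    then have "ga_mult n a b g = 0" unfolding ga_mult_def by (simp only: sum.empty)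
    then show ?thesis using False
      by (simp add: sym_rep.ext_def[OF sym_rep_regular] sum_fun_apply ltrans_def)
  qed
qed

section \<open>Matrix coefficients of weight vectors\<close>

text \<open>For \<open>a\<close> in the range, multiplication by t - a completes this to
  \<open>content_poly\<close>, so at X_j it maps into the eigenspace of \<open>a\<close>; for
  \<open>a\<close> out of range it already is \<open>content_poly\<close> and gives 0.\<close>

definition punctured_poly :: "nat \<Rightarrow> int \<Rightarrow> real poly" where
  "punctured_poly m a = (\<Prod>c\<in>{- int m..int m} - {a}. lin_factor c)"

text \<open>Write q for the punctured polynomial. From q(t) = q(a) + (t - a) s(t) one gets (a - t)
  s(t) / q(a) = 1 - q(t) / q(a): the polynomial s / q(a) inverts a - t modulo q.\<close>

definition inverse_poly :: "nat \<Rightarrow> int \<Rightarrow> real poly" where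
  "inverse_poly m a = Polynomial.smult (1 / poly (punctured_poly m a) (of_int a))
     (synthetic_div (punctured_poly m a) (of_int a))"

lemma punctured_poly_nonzero: "poly (punctured_poly m a) (of_int a) \<noteq> 0"
  by (auto simp: punctured_poly_def poly_prod)

context orth_rep
begin

lemma punctured_poly_X:
  assumes "1 \<le> j" "j \<le> n" "v \<in> V"
  shows "X j (pact (punctured_poly n a) (X j) v) = of_int a *\<^sub>R pact (punctured_poly n a) (X j) v"
proof (cases "a \<in> {- int n..int n}")
  case True
  then have "content_poly n = lin_factor a * punctured_poly n a"
    by (simp add: content_poly_def punctured_poly_def prod.remove)
  then have "pact (lin_factor a) (X j) (pact (punctured_poly n a) (X j) v) = 0"
    using X_minpoly_n[OF assms] X_lin assms by (simp only: pact_mult)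
  then show ?thesis by simp
next
  case False
  then have "content_poly n = punctured_poly n a"
    by (simp add: content_poly_def punctured_poly_def)
  then show ?thesis using X_minpoly_n[OF assms] X_lin assms by (simp add: linear_0)
qed

text \<open>
  The compression of the last adjacent transposition to an eigenspace of \<open>X n\<close> is a polynomial in
  \<open>X (n - 1)\<close>; this is what makes all weight spaces of a cyclic module one-dimensional.
\<close>

lemma compression:
  assumes "n = Suc k" "1 \<le> k" "v \<in> V" "w \<in> V"
    and Xv: "X n v = of_int a *\<^sub>R v" and Xw: "X n w = of_int a *\<^sub>R w"
  shows "ip (U (tr k (Suc k)) v) w = ip (pact (inverse_poly n a) (X k) v) w"
proof -
  let ?s = "U (tr k (Suc k))"
  \<comment> \<open>On the eigenspace X_n = a, the relation X_k s = s X_n - 1 becomes (a - X_k) s =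
    1; X_k is moved to the other argument by symmetry.\<close>
  have key: "ip (?s u) (of_int a *\<^sub>R y - X k y) = ip u y"
    if "u \<in> V" "X n u = of_int a *\<^sub>R u" "y \<in> V" for u y
  proof -
    have "ip (?s u) (X k y) = ip (X k (?s u)) y"
      using symm_X[of k] that assms symm_tr[of k "Suc k"] by (auto simp: symm_def)
    also have "\<dots> = of_int a * ip (?s u) y - ip u y"
      using X_s(1)[of k u] that assms linear_scale[OF U_lin[OF tr_n[of k "Suc k"]]] by (simp add: ip_simps)
    finally show ?thesis by (simp add: ip_simps)
  qed
  let ?q = "punctured_poly n a"
  have lX: "linear (X k)" using X_lin assms by auto
  have pV: "pact p (X k) y \<in> V" if "y \<in> V" for p y
    using pact_in[OF sub _ that] X_closed assms by auto
  have pn: "X n (pact p (X k) y) = pact p (X k) (X n y)" if "y \<in> V" for p y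
    by (rule pact_commute[where W = V]) (use that X_lin X_closed X_commute[of n k] assms in auto)
  define h where "h = inverse_poly n a"
  have "?q = [:poly ?q a:] + lin_factor a * synthetic_div ?q a"
    using synthetic_div_correct'[of "of_int a" ?q] by (simp add: add.commute)
  \<comment> \<open>This vector y satisfies X_k y = a y and X_n y = a y, so \<open>key\<close> gives
    <y, y> = <s y, (a - X_k) y> = 0.\<close>
  moreover have "pact ?q (X k) v = 0"
  proof -
    let ?y = "pact ?q (X k) v"
    have "X n ?y = of_int a *\<^sub>R ?y"
      using pn[OF assms(3)] Xv linear_scale[OF linear_pact[OF lX]] by simp
    moreover have "X k ?y = of_int a *\<^sub>R ?y" using punctured_poly_X assms by simp
    ultimately have "ip ?y ?y = 0"
      using key[of ?y ?y] pV assms by (simp add: ip_simps)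
    then show ?thesis using ip_eq_0 pV assms by blast
  qed
  ultimately have "poly ?q a *\<^sub>R v + pact (lin_factor a * synthetic_div ?q a) (X k) v = 0"
    by (metis pact_add pact_0 pact_pCons add_0_right)
  then have "poly ?q a *\<^sub>R v = of_int a *\<^sub>R pact (synthetic_div ?q a) (X k) v - X k (pact (synthetic_div ?q a) (X k) v)"
    unfolding pact_mult[OF lX] by (simp add: algebra_simps eq_neg_iff_add_eq_0)
  then have "(1 / poly ?q a) *\<^sub>R (poly ?q a *\<^sub>R v) = of_int a *\<^sub>R pact h (X k) v - X k (pact h (X k) v)"
    unfolding h_def inverse_poly_def
    by (simp add: pact_smult linear_scale[OF lX] scaleR_diff_right mult.commute)
  then have hv: "of_int a *\<^sub>R pact h (X k) v - X k (pact h (X k) v) = v"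
    using punctured_poly_nonzero[of n a] by simp
  \<comment> \<open>The transposition is moved to \<open>w\<close>, and \<open>v\<close> is written
    as (a - X_k) h(X_k) v, so that \<open>key\<close> removes s together with a - X_k.\<close>
  have "ip (?s v) w = ip v (?s w)" using symm_tr[of k "Suc k"] assms by (auto simp: symm_def)
  also have "\<dots> = ip (?s w) (of_int a *\<^sub>R pact h (X k) v - X k (pact h (X k) v))"
    unfolding hv by (rule ip_sym)
  also have "\<dots> = ip w (pact h (X k) v)" using key[of w] pV assms by auto
  finally show ?thesis unfolding h_def using ip_sym by simp
qed

end

text \<open>The quotient <g v, w> / <v, w> for vectors of weight \<alpha>, defined without reference
  to any representation. A permutation outside S_k is split as p (k k+1) q, and the compression of
  (k k+1) to an eigenspace of X_{k+1} is expanded in the group algebra of S_k. Theorem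
  \<open>matcoef\<close> holds for whichever factorization is picked.\<close>

fun matcoef :: "nat \<Rightarrow> (nat \<Rightarrow> int) \<Rightarrow> (nat \<Rightarrow> nat) \<Rightarrow> real" where
  "matcoef 0 \<alpha> g = 1"
| "matcoef (Suc k) \<alpha> g = (if g permutes {1..k} then matcoef k \<alpha> g else
     (let (p, q) = (SOME (p, q). p permutes {1..k} \<and> q permutes {1..k} \<and> g = p \<circ> tr k (Suc k) \<circ> q) in
      \<Sum>h | h permutes {1..k}.
        pact (inverse_poly (Suc k) (\<alpha> (Suc k))) (sym_rep.X (ltrans k) k) (ga_single id) h * matcoef k \<alpha> (p \<circ> h \<circ> q)))"

theorem matcoef:
  assumes "orth_rep n V U ip" "sym_rep.weight n V U \<alpha> v" "sym_rep.weight n V U \<alpha> w" "g permutes {1..n}"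
  shows "ip (U g v) w = matcoef n \<alpha> g * ip v w"
  using assms
proof (induction n arbitrary: g)
  case 0
  interpret orth_rep 0 V U ip by fact
  have "g = id" using 0 by simp
  then show ?case using 0 U_id by (simp add: weight_def)
next
  case (Suc k)
  interpret orth_rep "Suc k" V U ip by fact
  interpret k: orth_rep k V U ip using orth_rep_restrict by simp
  have kw: "k.weight \<alpha> v" "k.weight \<alpha> w"
    using Suc.prems(2,3) by (auto simp: weight_def k.weight_def)
  have IH: "ip (U g v) w = matcoef k \<alpha> g * ip v w" if "g permutes {1..k}" for g
    using Suc.IH[OF k.orth_rep_axioms kw that] .
  have V: "v \<in> V" "w \<in> V" using Suc.prems by (auto simp: weight_def)
  show ?case
  proof (cases "g permutes {1..k}")
    case True
    then show ?thesis using IH by simp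
  next
    case False
    then have "g (Suc k) \<noteq> Suc k"
      using permutes_superset[OF Suc.prems(4), of "{1..k}"] by (auto simp: le_Suc_eq)
    then obtain p0 q0 where pq0: "p0 permutes {1..k}" "q0 permutes {1..k}" "g = p0 \<circ> tr k (Suc k) \<circ> q0" "k \<ge> 1"
      using permutes_step_decomp[OF Suc.prems(4)] by metis
    define pq where "pq = (SOME (p, q). p permutes {1..k} \<and> q permutes {1..k} \<and> g = p \<circ> tr k (Suc k) \<circ> q)"
    obtain p q where pq_eq: "pq = (p, q)" by (cases pq)
    have "case pq of (p, q) \<Rightarrow> p permutes {1..k} \<and> q permutes {1..k} \<and> g = p \<circ> tr k (Suc k) \<circ> q"
      unfolding pq_def by (rule someI[of _ "(p0, q0)"]) (use pq0 in auto)
    then have p: "p permutes {1..k}" and q: "q permutes {1..k}" and g: "g = p \<circ> tr k (Suc k) \<circ> q"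
      by (auto simp: pq_eq)
    have pn: "p permutes {1..Suc k}" and qn: "q permutes {1..Suc k}" using permutes_below[OF p] permutes_below[OF q] by simp_all
    have sn: "tr k (Suc k) permutes {1..Suc k}" using pq0(4) by (intro tr_permutes) auto
    define a where "a = \<alpha> (Suc k)"
    define h where "h = inverse_poly (Suc k) a"
    define y where "y = pact h (sym_rep.X (ltrans k) k) (ga_single id)"
    \<comment> \<open>S_k commutes with X_{k+1}, so q v and p^{-1} w remain in the eigenspace on
      which \<open>compression\<close> applies.\<close>
    have Xq: "X (Suc k) (U r u) = of_int a *\<^sub>R U r u" if "r permutes {1..k}" "weight \<alpha> u" for r u
    proof -
      have "r permutes {1..<Suc k}" using that by (simp add: atLeastLessThanSuc_atLeastAtMost)
      then have "X (Suc k) (U r u) = U r (X (Suc k) u)" using U_X_commute[of r "Suc k" u] weightD(1)[OF that(2)] by simp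
      then show ?thesis
        using weightD(2)[OF that(2), of "Suc k"] linear_scale[OF k.U_lin[OF that(1)]] by (simp add: a_def)
    qed
    have "ip (U g v) w = ip (U p (U (tr k (Suc k)) (U q v))) w"
      unfolding g using U_comp[OF pn permutes_compose[OF qn sn] V(1)] U_comp[OF sn qn V(1)]
      by (simp add: comp_assoc)
    also have "\<dots> = ip (U (tr k (Suc k)) (U q v)) (U (Hilbert_Choice.inv p) w)"
      using V by (intro ip_U_adj pn U_closed sn qn)
    also have "\<dots> = ip (pact h (X k) (U q v)) (U (Hilbert_Choice.inv p) w)"
      unfolding h_def using Suc.prems pq0(4)
      by (intro compression Xq p q permutes_inv U_closed V sn qn pn) auto
    also have "\<dots> = ip (U p (pact h (X k) (U q v))) w"
      using V by (intro ip_U_adj[symmetric] pn pact_in[OF sub] U_closed sn qn X_closed) auto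
    finally have g1: "ip (U g v) w = ip (U p (pact h (X k) (U q v))) w" .
    \<comment> \<open>Here h(X_k) is rewritten as the action of an element \<open>y\<close> of the
      group algebra of S_k, so that the induction hypothesis applies to each of its terms.\<close>
    have g2: "pact h (X k) (U q v) = k.ext y (U q v)"
      unfolding y_def using k.ext_pact[of k "U q v" h "ga_single id"] k.ext_delta[of "U q v"] V k.U_closed q by simp
    have g3: "U p (k.ext y (U q v)) = (\<Sum>r | r permutes {1..k}. y r *\<^sub>R U (p \<circ> r \<circ> q) v)"
      unfolding k.ext_def linear_sum[OF U_lin[OF pn]] linear_scale[OF U_lin[OF pn]]
      using k.U_comp[OF _ q V(1)] k.U_comp[OF p permutes_compose[OF q] V(1)] by (intro sum.cong) (auto simp: comp_assoc)
    have "ip (\<Sum>r | r permutes {1..k}. y r *\<^sub>R U (p \<circ> r \<circ> q) v) w =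
      (\<Sum>r | r permutes {1..k}. y r * (matcoef k \<alpha> (p \<circ> r \<circ> q) * ip v w))"
      unfolding ip_sum
    proof (rule sum.cong[OF refl])
      fix r assume "r \<in> {r. r permutes {1..k}}"
      then have "p \<circ> r \<circ> q permutes {1..k}" using permutes_compose[OF q permutes_compose[OF _ p]] by simp
      from IH[OF this] show "ip (y r *\<^sub>R U (p \<circ> r \<circ> q) v) w = y r * (matcoef k \<alpha> (p \<circ> r \<circ> q) * ip v w)"
        unfolding ip_simps(4) by (rule arg_cong)
    qed
    also have "\<dots> = matcoef (Suc k) \<alpha> g * ip v w"
    proof -
      have "matcoef (Suc k) \<alpha> g = (\<Sum>r | r permutes {1..k}. y r * matcoef k \<alpha> (p \<circ> r \<circ> q))"
        by (simp only: matcoef.simps False if_False pq_def[symmetric] pq_eq Let_def prod.case y_def h_def a_def)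
      then show ?thesis by (simp only: sum_distrib_right mult.assoc)
    qed
    finally show ?thesis unfolding g1 g2 g3 .
  qed
qed

definition matcoef2 :: "nat \<Rightarrow> (nat \<Rightarrow> int) \<Rightarrow> group_alg \<Rightarrow> group_alg \<Rightarrow> real" where
  "matcoef2 n \<alpha> x y = (\<Sum>g | g permutes {1..n}. \<Sum>h | h permutes {1..n}.
     x g * y h * matcoef n \<alpha> (Hilbert_Choice.inv h \<circ> g))"

text \<open>The central rigidity statement: the factor \<open>matcoef2\<close> knows only the
  weight. With <v, v> = <w, w> it makes two Gram--Schmidt runs agree; with <v, w> = 0 it makes
  cyclic modules orthogonal; with v = w it shows that annihilators depend on the weight
  alone.\<close>

lemma (in orth_rep) ip_ext:
  assumes v: "weight \<alpha> v" and w: "weight \<alpha> w"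
  shows "ip (ext x v) (ext y w) = matcoef2 n \<alpha> x y * ip v w"
proof -
  have "ip (U g v) (U h w) = matcoef n \<alpha> (Hilbert_Choice.inv h \<circ> g) * ip v w"
    if g: "g permutes {1..n}" and h: "h permutes {1..n}" for g h
  proof -
    have V: "v \<in> V" "w \<in> V" using v w by (auto simp: weight_def)
    have "ip (U g v) (U h w) = ip (U (Hilbert_Choice.inv h) (U g v)) w"
      using ip_U[OF permutes_inv[OF h] U_closed[OF g V(1)] U_closed[OF h V(2)]] U_cancel[OF h V(2)] by simp
    also have "\<dots> = ip (U (Hilbert_Choice.inv h \<circ> g) v) w"
      using U_comp[OF permutes_inv[OF h] g V(1)] by simp
    also have "\<dots> = matcoef n \<alpha> (Hilbert_Choice.inv h \<circ> g) * ip v w"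
      by (rule matcoef[OF orth_rep_axioms v w permutes_compose[OF g permutes_inv[OF h]]])
    finally show ?thesis .
  qed
  then show ?thesis
    unfolding ext_def matcoef2_def ip_sum ip_simps sum_distrib_right sum_distrib_left
    by (subst sum.swap, intro sum.cong refl) (simp add: mult_ac)
qed

section \<open>Weight projections and cyclic modules\<close>

text \<open>Lagrange interpolation: the value is 1 at \<open>a\<close> and 0 at the other integers
  of the range, so at X_j this is the spectral projection belonging to \<open>a\<close>.\<close>

definition punctured_idem :: "nat \<Rightarrow> int \<Rightarrow> real poly" where
  "punctured_idem m a = Polynomial.smult (1 / poly (punctured_poly m a) (of_int a)) (punctured_poly m a)"

lemma poly_punctured_idem [simp]: "poly (punctured_idem m a) (of_int a) = 1"
  using punctured_poly_nonzero by (simp add: punctured_idem_def)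

context sym_rep
begin

text \<open>The product of the spectral projections of X_1, ..., X_k; for k = n, the projection to
  the weight space of \<alpha>.\<close>

primrec Eop :: "(nat \<Rightarrow> int) \<Rightarrow> nat \<Rightarrow> 'v \<Rightarrow> 'v" where
  "Eop \<alpha> 0 v = v"
| "Eop \<alpha> (Suc k) v = pact (punctured_idem n (\<alpha> (Suc k))) (X (Suc k)) (Eop \<alpha> k v)"

text \<open>The product (t - X_1) ... (t - X_k). For k = n it commutes with the whole group, being
  symmetric in the X_j, and its scalars for varying t recover the multiset of contents.\<close>

primrec Zop :: "real \<Rightarrow> nat \<Rightarrow> 'v \<Rightarrow> 'v" where
  "Zop t 0 v = v"
| "Zop t (Suc k) v = t *\<^sub>R Zop t k v - X (Suc k) (Zop t k v)"

lemma Eop_linear: "k \<le> n \<Longrightarrow> linear (Eop \<alpha> k)"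
proof (induction k)
  case 0
  then show ?case by (simp add: linear_iff)
next
  case (Suc k)
  then have "linear (pact (punctured_idem n (\<alpha> (Suc k))) (X (Suc k)) \<circ> Eop \<alpha> k)"
    by (intro linear_compose linear_pact X_lin) auto
  then show ?case by (simp add: o_def cong: arg_cong[of _ _ linear])
qed

lemma Eop_inv_sub: "inv_sub W \<Longrightarrow> k \<le> n \<Longrightarrow> v \<in> W \<Longrightarrow> Eop \<alpha> k v \<in> W"
  by (induction k) (auto intro!: pact_in X_inv_sub simp: inv_sub_def[of W])

lemma Eop_closed: "k \<le> n \<Longrightarrow> v \<in> V \<Longrightarrow> Eop \<alpha> k v \<in> V"
  using Eop_inv_sub inv_sub_V by blast

lemma Eop_weight: "weight \<alpha> v \<Longrightarrow> k \<le> n \<Longrightarrow> Eop \<alpha> k v = v"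
  by (induction k) (auto simp: pact_eigen[OF X_lin weightD(2)])

lemma X_pact_commute:
  "i \<le> n \<Longrightarrow> j \<le> n \<Longrightarrow> v \<in> V \<Longrightarrow> X i (pact p (X j) v) = pact p (X j) (X i v)"
  by (rule pact_commute[where W = V]) (auto simp: X_lin X_closed X_commute)

lemma X_Eop_commute: "j \<le> n \<Longrightarrow> k \<le> n \<Longrightarrow> v \<in> V \<Longrightarrow> X j (Eop \<alpha> k v) = Eop \<alpha> k (X j v)"
  by (induction k) (auto simp: X_pact_commute Eop_closed)

lemma pact_Eop_commute:
  "j \<le> n \<Longrightarrow> k \<le> n \<Longrightarrow> v \<in> V \<Longrightarrow> pact p (X j) (Eop \<alpha> k v) = Eop \<alpha> k (pact p (X j) v)"
  by (rule pact_commute[where W = V, symmetric]) (auto simp: Eop_linear X_closed X_Eop_commute)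

lemma ext_Eop:
  "k \<le> n \<Longrightarrow> v \<in> V \<Longrightarrow> ext (sym_rep.Eop n (ltrans n) \<alpha> k x) v = Eop \<alpha> k (ext x v)"
  by (induction k) (auto simp: sym_rep.Eop.simps[OF sym_rep_regular] ext_pact)

lemma Zop_linear: "k \<le> n \<Longrightarrow> linear (Zop t k)"
  by (induction k) (auto simp: linear_iff linear_add[OF X_lin] linear_scale[OF X_lin] algebra_simps)

lemma Zop_closed: "k \<le> n \<Longrightarrow> v \<in> V \<Longrightarrow> Zop t k v \<in> V"
  by (induction k) (auto intro!: real_vector.subspace_diff[OF sub] real_vector.subspace_scale[OF sub] X_closed)

lemma Zop_weight: "weight \<alpha> v \<Longrightarrow> k \<le> n \<Longrightarrow> Zop t k v = (\<Prod>j=1..k. t - of_int (\<alpha> j)) *\<^sub>R v"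
  by (induction k) (auto simp: linear_scale[OF X_lin] weightD algebra_simps)

lemma X_Zop_commute: "j \<le> n \<Longrightarrow> k \<le> n \<Longrightarrow> v \<in> V \<Longrightarrow> X j (Zop t k v) = Zop t k (X j v)"
proof (induction k)
  case (Suc k)
  then have "X j (X (Suc k) (Zop t k v)) = X (Suc k) (X j (Zop t k v))"
    by (intro X_commute) (auto intro: Zop_closed)
  then show ?case using Suc by (simp add: linear_diff[OF X_lin] linear_scale[OF X_lin])
qed simp

text \<open>Factors other than t - X_i and t - X_{i+1} commute with (i i+1), and so does the product
  of these two. The value k = i is excluded because it would contain just one of the pair.\<close>

lemma Zop_adjacent_commute:
  assumes "1 \<le> i" "Suc i \<le> n" "k \<le> n" "k \<noteq> i" "v \<in> V"
  shows "U (tr i (Suc i)) (Zop t k v) = Zop t k (U (tr i (Suc i)) v)"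
  using assms(3,4)
proof (induction k rule: less_induct)
  case (less k)
  let ?s = "U (tr i (Suc i))"
  have s: "tr i (Suc i) permutes {1..n}" using assms by (intro tr_n) auto
  note lin = linear_diff[OF U_lin[OF s]] linear_scale[OF U_lin[OF s]]
  show ?case
  proof (cases k)
    case (Suc m)
    show ?thesis
    proof (cases "m = i")
      case True
      then obtain l where l: "i = Suc l" using assms by (cases i) auto
      let ?z = "Zop t l v"
      have z: "?z \<in> V" using Zop_closed assms l by auto
      have sz: "?s ?z = Zop t l (?s v)" using less.IH[of l] Suc True l assms less.prems by auto
      note xs = X_s[of i, OF assms(1,2)]
      have Xl: "linear (X i)" "linear (X (Suc i))" using X_lin assms by auto
      have com: "X i (X (Suc i) ?z) = X (Suc i) (X i ?z)" using X_commute z assms by auto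
      have Zk: "Zop t k w = (t*t) *\<^sub>R Zop t l w - t *\<^sub>R X i (Zop t l w) - t *\<^sub>R X (Suc i) (Zop t l w)
          + X (Suc i) (X i (Zop t l w))" for w
      proof -
        have "Zop t k w = t *\<^sub>R (t *\<^sub>R Zop t l w - X i (Zop t l w)) - X (Suc i) (t *\<^sub>R Zop t l w - X i (Zop t l w))"
          using Suc True l by simp
        then show ?thesis unfolding linear_diff[OF Xl(2)] linear_scale[OF Xl(2)] by (simp add: algebra_simps)
      qed
      \<comment> \<open>Exchanging X_i and X_{i+1} across the transposition costs -z and +z; these
        errors cancel in the sum, and likewise in the product of the two operators.\<close>
      have e1: "?s (X i ?z) = X (Suc i) (?s ?z) - ?z" and e2: "?s (X (Suc i) ?z) = X i (?s ?z) + ?z"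
        using xs[OF z] by (simp_all add: algebra_simps)
      have e3: "?s (X (Suc i) (X i ?z)) = X (Suc i) (X i (?s ?z))"
      proof -
        have "?s (X (Suc i) (X i ?z)) = X i (?s (X i ?z)) + X i ?z"
          using xs[OF X_closed[of i ?z]] z assms by (simp add: algebra_simps)
        also have "\<dots> = X i (X (Suc i) (?s ?z))"
          using xs[OF z] linear_diff[OF Xl(1)] linear_add[OF Xl(1)] by simp
        also have "\<dots> = X (Suc i) (X i (?s ?z))" using U_closed[OF s z] X_commute assms by auto
        finally show ?thesis .
      qed
      have "?s (Zop t k v) = (t*t) *\<^sub>R ?s ?z - t *\<^sub>R X i (?s ?z) - t *\<^sub>R X (Suc i) (?s ?z) + X (Suc i) (X i (?s ?z))"
        unfolding Zk linear_add[OF U_lin[OF s]] lin e1 e2 e3 by (simp add: algebra_simps)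
      also have "\<dots> = Zop t k (?s v)" unfolding Zk sz ..
      finally show ?thesis .
    next
      case False
      then show ?thesis
        using Suc less s_X_far[of i "Suc m" "Zop t m v"] assms Zop_closed
        by (simp add: lin)
    qed
  qed simp
qed

lemma Zop_commute:
  assumes "g permutes {1..n}"
  shows "\<forall>v\<in>V. U g (Zop t n v) = Zop t n (U g v)"
  using assms
proof (induction rule: permutes_adjacent_induct)
  case id
  show ?case using U_id Zop_closed[OF order_refl] by metis
next
  case (comp g h)
  then show ?case using U_comp[OF comp(1,2)] Zop_closed[OF order_refl] U_closed by metis
next
  case (adjacent i)
  then show ?case using Zop_adjacent_commute[of i n] by auto
qed

definition cyc :: "'v \<Rightarrow> 'v set" where
  "cyc v = range (\<lambda>x. ext x v)"

lemma cyc_inv_sub: "v \<in> V \<Longrightarrow> inv_sub (cyc v)"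
  unfolding inv_sub_def
proof (intro conjI allI impI)
  assume v: "v \<in> V"
  show "real_vector.subspace (cyc v)"
    unfolding real_vector.subspace_def cyc_def
    by (auto simp: image_iff) (metis ext_zero, metis ext_add, metis ext_scale)
  show "cyc v \<subseteq> V" using ext_closed v by (auto simp: cyc_def)
  show "U g w \<in> cyc v" if "g permutes {1..n}" "w \<in> cyc v" for g w
    using that v by (auto simp: cyc_def U_ext)
qed

lemma cyc_self: "v \<in> V \<Longrightarrow> v \<in> cyc v"
  unfolding cyc_def using ext_delta by (metis rangeI)

lemma cyc_minimal: "inv_sub W \<Longrightarrow> v \<in> W \<Longrightarrow> cyc v \<subseteq> W"
  using ext_inv_sub by (auto simp: cyc_def)

text \<open>A central operator acts on a cyclic module by the scalar by which it acts on the
  generator.\<close>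

lemma cyc_Zop:
  assumes "weight \<alpha> v" "u \<in> cyc v"
  shows "Zop t n u = (\<Prod>j=1..n. t - of_int (\<alpha> j)) *\<^sub>R u"
proof -
  obtain x where u: "u = ext x v" using assms by (auto simp: cyc_def)
  have v: "v \<in> V" using assms weightD by auto
  have "Zop t n u = (\<Sum>g | g permutes {1..n}. x g *\<^sub>R U g (Zop t n v))"
    unfolding u ext_def linear_sum[OF Zop_linear[OF order_refl]] linear_scale[OF Zop_linear[OF order_refl]]
    using Zop_commute v by (intro sum.cong) auto
  also have "\<dots> = (\<Prod>j=1..n. t - of_int (\<alpha> j)) *\<^sub>R u"
    unfolding u ext_def Zop_weight[OF assms(1) order_refl]
    by (simp add: linear_scale[OF U_lin] scaleR_sum_right mult.commute)
  finally show ?thesis .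
qed

end

text \<open>The weight projection as one group algebra element: it has a meaning in every
  representation, also in matrix representations that are not orthogonal.\<close>

definition idem :: "nat \<Rightarrow> (nat \<Rightarrow> int) \<Rightarrow> group_alg" where
  "idem n \<alpha> = sym_rep.Eop n (ltrans n) \<alpha> n (ga_single id)"

lemma (in sym_rep) ext_idem: "v \<in> V \<Longrightarrow> ext (idem n \<alpha>) v = Eop \<alpha> n v"
  by (simp add: idem_def ext_Eop ext_delta)

context orth_rep
begin

lemma X_punctured_idem:
  assumes "1 \<le> j" "j \<le> n" "v \<in> V"
  shows "X j (pact (punctured_idem n a) (X j) v) = of_int a *\<^sub>R pact (punctured_idem n a) (X j) v"
  unfolding punctured_idem_def pact_smult
  using punctured_poly_X[OF assms, of a] linear_scale[OF X_lin[OF assms(2)]] by simp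

lemma weight_Eop:
  assumes "v \<in> V" shows "weight \<alpha> (Eop \<alpha> n v)"
proof -
  have "k \<le> n \<Longrightarrow> \<forall>j\<in>{1..k}. X j (Eop \<alpha> k v) = of_int (\<alpha> j) *\<^sub>R Eop \<alpha> k v" for k
  proof (induction k)
    case (Suc k)
    show ?case
    proof
      fix j assume j: "j \<in> {1..Suc k}"
      show "X j (Eop \<alpha> (Suc k) v) = of_int (\<alpha> j) *\<^sub>R Eop \<alpha> (Suc k) v"
      proof (cases "j = Suc k")
        case True
        then show ?thesis using X_punctured_idem[of "Suc k" "Eop \<alpha> k v"] Suc.prems assms Eop_closed by simp
      next
        case False
        then show ?thesis using Suc j assms
          by (simp add: X_pact_commute Eop_closed linear_scale[OF linear_pact[OF X_lin]])
      qed
    qed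
  qed simp
  then show ?thesis using Eop_closed assms by (auto simp: weight_def)
qed

lemma ip_Eop: "k \<le> n \<Longrightarrow> v \<in> V \<Longrightarrow> w \<in> V \<Longrightarrow> ip (Eop \<alpha> k v) w = ip v (Eop \<alpha> k w)"
proof (induction k arbitrary: w)
  case (Suc k)
  let ?P = "pact (punctured_idem n (\<alpha> (Suc k))) (X (Suc k))"
  have "symm ?P" using symm_pact symm_X Suc by auto
  then have "?P w \<in> V" "ip (?P (Eop \<alpha> k v)) w = ip (Eop \<alpha> k v) (?P w)"
    using Suc.prems Eop_closed by (auto simp: symm_def)
  then show ?case using Suc pact_Eop_commute by simp
qed simp

lemma ip_Zop: "k \<le> n \<Longrightarrow> v \<in> V \<Longrightarrow> w \<in> V \<Longrightarrow> ip (Zop t k v) w = ip v (Zop t k w)"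
proof (induction k arbitrary: w)
  case (Suc k)
  have "ip (X (Suc k) (Zop t k v)) w = ip (Zop t k v) (X (Suc k) w)"
    using symm_X[of "Suc k"] Suc.prems Zop_closed by (auto simp: symm_def)
  also have "\<dots> = ip v (X (Suc k) (Zop t k w))"
    using Suc X_closed X_Zop_commute by simp
  finally show ?case using Suc by (simp add: ip_simps)
qed simp

text \<open>\<open>Zop t n\<close> is symmetric and scalar on both modules, so vectors that are not
  orthogonal force equal scalars for every t. As functions of t these are polynomials whose roots,
  with multiplicity, are the entries of the weights.\<close>

lemma cyc_not_orth_contents:
  assumes "weight \<alpha> v" "weight \<beta> w" "u \<in> cyc v" "u' \<in> cyc w" "ip u u' \<noteq> 0"
  shows "mset (map \<alpha> [1..<Suc n]) = mset (map \<beta> [1..<Suc n])"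
proof -
  have V: "u \<in> V" "u' \<in> V" using assms cyc_inv_sub weightD by (auto simp: inv_sub_def)
  let ?p = "\<lambda>\<alpha>. \<Prod>j\<in>{1..n}. lin_factor (\<alpha> j)"
  have "poly (?p \<alpha>) t = poly (?p \<beta>) t" for t
  proof -
    have "(\<Prod>j=1..n. t - of_int (\<alpha> j)) * ip u u' = (\<Prod>j=1..n. t - of_int (\<beta> j)) * ip u u'"
      using ip_Zop[OF order_refl V, of t] cyc_Zop[OF assms(1,3), of t] cyc_Zop[OF assms(2,4), of t]
      by (simp add: ip_simps)
    then show ?thesis using assms(5) by (simp add: poly_prod)
  qed
  then have "?p \<alpha> = ?p \<beta>" using poly_eq_poly_eq_iff by blast
  moreover have "proots (?p \<alpha>) = image_mset (\<lambda>j. of_int (\<alpha> j)) (mset_set {1..n})" for \<alpha> :: "nat \<Rightarrow> int"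
  proof -
    have "proots (?p \<alpha>) = (\<Sum>j\<in>{1..n}. proots (lin_factor (\<alpha> j)))" by (rule proots_prod) auto
    also have "\<dots> = (\<Sum>j\<in>{1..n}. {# of_int (\<alpha> j) #})"
      by (intro sum.cong refl) (use proots_linear_factor[of "- of_int (_ :: int)"] in simp)
    also have "\<dots> = image_mset (\<lambda>j. of_int (\<alpha> j)) (mset_set {1..n})"
      by (simp add: sum_unfold_sum_mset)
    finally show ?thesis .
  qed
  ultimately have "image_mset (real_of_int \<circ> \<alpha>) (mset_set {1..n}) = image_mset (real_of_int \<circ> \<beta>) (mset_set {1..n})"
    unfolding o_def by metis
  then have "image_mset real_of_int (image_mset \<alpha> (mset_set {1..n})) = image_mset real_of_int (image_mset \<beta> (mset_set {1..n}))"
    by (simp add: multiset.map_comp)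
  then have "image_mset \<alpha> (mset_set {1..n}) = image_mset \<beta> (mset_set {1..n})"
    by (drule_tac arg_cong[where f = "image_mset floor"]) (simp add: multiset.map_comp o_def)
  moreover have "mset (map \<alpha> [1..<Suc n]) = image_mset \<alpha> (mset_set {1..n})" for \<alpha> :: "nat \<Rightarrow> int"
    by (metis mset_map mset_upt atLeastLessThanSuc_atLeastAtMost)
  ultimately show ?thesis by simp
qed

text \<open>The remainder \<open>u0\<close> after splitting off the component along v again has
  weight \<alpha> and equals x v for some x. By \<open>ip_ext\<close>, <x v, u0> is a multiple of
  <v, u0> = 0; as x v = u0, the remainder vanishes.\<close>

lemma weight_in_cyc:
  assumes v: "weight \<alpha> v" "v \<noteq> 0" and u: "weight \<alpha> u" "u \<in> cyc v"
  shows "u = (ip u v / ip v v) *\<^sub>R v"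
proof -
  define u0 where "u0 = u - (ip u v / ip v v) *\<^sub>R v"
  have pos: "ip v v > 0" using v ip_pos weightD by auto
  have "u0 \<in> cyc v"
    using cyc_inv_sub[of v] cyc_self[of v] u v weightD(1)[OF v(1)]
    unfolding u0_def inv_sub_def by (auto intro!: real_vector.subspace_diff real_vector.subspace_scale)
  then obtain x where x: "u0 = ext x v" by (auto simp: cyc_def)
  have w0: "weight \<alpha> u0"
    using v u sub unfolding u0_def weight_def
    by (auto intro!: real_vector.subspace_diff real_vector.subspace_scale simp: linear_diff[OF X_lin] linear_scale[OF X_lin] algebra_simps)
  have "ip u0 v = 0" using pos by (simp add: u0_def ip_simps)
  moreover have "ip (ext x v) (ext (ga_single id) u0) = matcoef2 n \<alpha> x (ga_single id) * ip v u0"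
    using ip_ext v(1) w0 by blast
  ultimately have "ip u0 u0 = 0" using ext_delta weightD(1)[OF w0] x ip_sym by simp
  then have "u0 = 0" using ip_eq_0 w0 weightD by blast
  then show ?thesis by (simp add: u0_def)
qed

text \<open>If the weight projection does not vanish on W, its image yields a nonzero multiple of v,
  hence the whole module. If it vanishes, adjointness makes W orthogonal to every g v, hence to
  itself.\<close>

lemma cyc_irreducible:
  assumes v: "weight \<alpha> v" "v \<noteq> 0" and W: "inv_sub W" "W \<subseteq> cyc v"
  shows "W = {0} \<or> W = cyc v"
proof (cases "\<exists>w\<in>W. Eop \<alpha> n w \<noteq> 0")
  case True
  then obtain w where w: "w \<in> W" "Eop \<alpha> n w \<noteq> 0" by auto
  then have "Eop \<alpha> n w \<in> W" using Eop_inv_sub W by auto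
  moreover have "weight \<alpha> (Eop \<alpha> n w)" using w W weight_Eop by (auto simp: inv_sub_def)
  ultimately obtain c where c: "Eop \<alpha> n w = c *\<^sub>R v" using weight_in_cyc[OF v] W by blast
  then have "(1 / c) *\<^sub>R Eop \<alpha> n w = v" using w by auto
  then have "v \<in> W" using \<open>Eop \<alpha> n w \<in> W\<close> W(1) real_vector.subspace_scale unfolding inv_sub_def by metis
  then show ?thesis using cyc_minimal W by auto
next
  case False
  have vV: "v \<in> V" using v weightD by auto
  have "w = 0" if w: "w \<in> W" for w
  proof -
    obtain x where x: "w = ext x v" using w W by (auto simp: cyc_def)
    have "ip w (U g v) = 0" if g: "g permutes {1..n}" for g
    proof -
      have "U (Hilbert_Choice.inv g) w \<in> W" using w W permutes_inv[OF g] unfolding inv_sub_def by blast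
      then have E: "Eop \<alpha> n (U (Hilbert_Choice.inv g) w) = 0" "U (Hilbert_Choice.inv g) w \<in> V"
        using False W by (auto simp: inv_sub_def)
      have "ip w (U g v) = ip v (U (Hilbert_Choice.inv g) w)"
        using ip_U_adj[OF g vV] ip_sym W w by (metis inv_sub_def subsetD)
      also have "\<dots> = ip (Eop \<alpha> n v) (U (Hilbert_Choice.inv g) w)" using Eop_weight v by simp
      also have "\<dots> = 0" using ip_Eop[OF order_refl vV E(2)] E(1) by (simp add: ip_simps)
      finally show ?thesis .
    qed
    then have "ip w (ext x v) = 0" unfolding ext_def by (simp add: ip_sum ip_simps)
    then show ?thesis using x ip_eq_0 w W by (auto simp: inv_sub_def)
  qed
  moreover have "0 \<in> W" using W real_vector.subspace_0 by (auto simp: inv_sub_def)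
  ultimately show ?thesis by auto
qed

end

text \<open><x v, x v> is the number \<open>matcoef2 n \<alpha> x x\<close> times <v, v>, so whether
  x kills a nonzero weight vector is decided by the weight. This makes maps between cyclic modules
  of different representations well defined.\<close>

lemma ext_eq_0_transfer:
  assumes V: "orth_rep n V U ip" "sym_rep.weight n V U \<alpha> v" "v \<noteq> 0"
    and V': "orth_rep n V' U' ip'" "sym_rep.weight n V' U' \<alpha> v'"
    and "sym_rep.ext n U x v = 0"
  shows "sym_rep.ext n U' x v' = 0"
proof -
  interpret A: orth_rep n V U ip by fact
  interpret B: orth_rep n V' U' ip' by fact
  have "matcoef2 n \<alpha> x x * ip v v = 0" using A.ip_ext[OF V(2,2), of x x] assms by (simp add: A.ip_simps)
  then have "matcoef2 n \<alpha> x x = 0" using A.ip_pos V A.weightD(1) by (metis less_irrefl mult_eq_0_iff)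
  then have "ip' (B.ext x v') (B.ext x v') = 0" using B.ip_ext[OF V'(2,2), of x x] by simp
  then show ?thesis using B.ip_eq_0 B.ext_closed V' B.weightD by auto
qed

section \<open>Contents of partitions and weights\<close>

text \<open>Contents (column minus row) in row order, for arbitrary lists: while a maximal word is
  analysed or a weight is parsed, it is not yet known that the rows decrease.\<close>

definition cont :: "nat list \<Rightarrow> int list" where
  "cont mu = concat (map (\<lambda>i. map (\<lambda>q. int q - int i) [0..<mu ! i]) [0..<length mu])"

definition composition :: "nat list \<Rightarrow> bool" where
  "composition mu \<longleftrightarrow> (\<forall>p\<in>set mu. p > 0)"

lemma cont_Nil [simp]: "cont [] = []"
  by (simp add: cont_def)

lemma cont_snoc: "cont (mu @ [m]) = cont mu @ map (\<lambda>q. int q - int (length mu)) [0..<m]"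
proof -
  have "map (\<lambda>i. map (\<lambda>q. int q - int i) [0..<(mu @ [m]) ! i]) [0..<length mu] =
    map (\<lambda>i. map (\<lambda>q. int q - int i) [0..<mu ! i]) [0..<length mu]"
    by (rule map_cong) (auto simp: nth_append)
  then show ?thesis by (simp add: cont_def del: map_eq_conv)
qed

lemma cont_snoc_Suc: "cont (mu @ [Suc m]) = cont (mu @ [m]) @ [int m - int (length mu)]"
  by (simp add: cont_snoc)

lemma cont_Cons: "cont (m # mu) = map int [0..<m] @ map (\<lambda>c. c - 1) (cont mu)"
proof (induction mu rule: rev_induct)
  case Nil
  then show ?case using cont_snoc[of "[]" m] by simp
next
  case (snoc x mu)
  have "cont (m # mu @ [x]) = cont ((m # mu) @ [x])" by simp
  then show ?case unfolding cont_snoc using snoc by (simp add: cont_snoc)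
qed

lemma length_cont [simp]: "length (cont mu) = sum_list mu"
  by (induction mu) (auto simp: cont_Cons)

lemma cont_append_prefix: "\<exists>zs. cont (mu @ nu) = cont mu @ zs"
proof (induction nu rule: rev_induct)
  case (snoc x nu)
  then show ?case using cont_snoc[of "mu @ nu" x] by auto
qed simp

lemma cont_bound: "c \<in> set (cont mu) \<Longrightarrow> c > - int (length mu)"
  by (auto simp: cont_def)

lemma cont_upper: "c \<in> set (cont mu) \<Longrightarrow> \<forall>p\<in>set mu. p \<le> m \<Longrightarrow> c < int m"
proof -
  assume c: "c \<in> set (cont mu)" and m: "\<forall>p\<in>set mu. p \<le> m"
  obtain i q where i: "i < length mu" "q < mu ! i" "c = int q - int i" using c by (auto simp: cont_def)
  then have "mu ! i \<le> m" using m by simp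
  then show ?thesis using i by linarith
qed

lemma cont_eq_Nil: "composition mu \<Longrightarrow> cont mu = [] \<longleftrightarrow> mu = []"
  by (cases mu) (auto simp: cont_Cons composition_def)

lemma upt_split: "j + 2 \<le> k \<Longrightarrow> [0..<k] = [0..<j] @ [j, Suc j] @ [Suc (Suc j)..<k]"
proof -
  assume "j + 2 \<le> k"
  then obtain e where "k = j + (2 + e)" by (metis le_Suc_ex add.assoc)
  then show ?thesis using upt_add_eq_append[of 0 j "2 + e"] by (simp add: upt_conv_Cons)
qed

text \<open>The last cell either prolongs the last row or opens a new one at minus the number of
  rows. Prefixes of content words are thus content words, which makes incremental parsing
  possible.\<close>

lemma cont_prefix:
  assumes "composition mu" "cont mu = ys @ [x]"
  obtains nu where "composition nu" "ys = cont nu"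
    "(nu \<noteq> [] \<and> x = last ys + 1) \<or> x = - int (length nu)"
proof -
  obtain la m where mu: "mu = la @ [m]" using assms by (cases mu rule: rev_cases) auto
  then obtain m' where m': "m = Suc m'" using assms by (cases m) (auto simp: composition_def)
  have eq: "ys @ [x] = cont (la @ [m']) @ [int m' - int (length la)]"
    using assms mu m' cont_snoc_Suc by simp
  show ?thesis
  proof (cases m')
    case 0
    then have "ys = cont la" "x = - int (length la)" using eq by (auto simp: cont_snoc)
    then show ?thesis using that[of la] assms mu by (auto simp: composition_def)
  next
    case (Suc m'')
    then have "ys = cont (la @ [m'])" "x = last ys + 1" using eq by (auto simp: cont_snoc)
    then show ?thesis using that[of "la @ [m']"] assms mu Suc by (auto simp: composition_def)
  qed
qed

text \<open>The second row starts at -1, so the first row is the longest nonnegative initial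
  segment; it is stripped and the rest shifted by one.\<close>

lemma cont_inj:
  assumes "composition mu" "composition nu" "cont mu = cont nu"
  shows "mu = nu"
  using assms
proof (induction mu arbitrary: nu)
  case Nil
  then show ?case by (cases nu) (auto simp: cont_Cons composition_def)
next
  case (Cons m mu)
  have m: "m > 0" "composition mu" using Cons.prems by (auto simp: composition_def)
  obtain k nu' where nu: "nu = k # nu'" using Cons.prems m by (cases nu) (auto simp: cont_Cons)
  have k: "k > 0" "composition nu'" using Cons.prems nu by (auto simp: composition_def)
  have pre: "takeWhile (\<lambda>c. c \<ge> 0) (map int [0..<m] @ map (\<lambda>c. c - 1) (cont mu)) = map int [0..<m]"
    if "composition mu" for m mu
  proof -
    have "takeWhile (\<lambda>c. c \<ge> 0) (map (\<lambda>c. c - 1) (cont mu)) = []"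
      using that by (cases mu) (auto simp: cont_Cons composition_def upt_conv_Cons)
    then show ?thesis by (subst takeWhile_append2) auto
  qed
  have "map int [0..<m] @ map (\<lambda>c. c - 1) (cont mu) = map int [0..<k] @ map (\<lambda>c. c - 1) (cont nu')"
    using Cons.prems nu by (simp add: cont_Cons)
  then have "map int [0..<m] = map int [0..<k]" using pre[OF m(2)] pre[OF k(2)] by metis
  then have "m = k" by (metis length_map length_upt diff_zero)
  moreover have "inj (\<lambda>c::int. c - 1)" by (simp add: inj_def)
  ultimately have "cont mu = cont nu'"
    using Cons.prems nu by (simp add: cont_Cons inj_map_eq_map)
  then show ?case using Cons.IH m k nu \<open>m = k\<close> by simp
qed

text \<open>For a partition the largest content is the first part minus one. Hence the multiset
  determines the first row, and the rest follows by induction.\<close>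

lemma cont_mset_inj:
  assumes "composition mu" "composition nu" "sorted_wrt (\<ge>) mu" "sorted_wrt (\<ge>) nu"
    "mset (cont mu) = mset (cont nu)"
  shows "mu = nu"
  using assms
proof (induction mu arbitrary: nu)
  case Nil
  then show ?case using cont_eq_Nil by auto
next
  case (Cons m mu)
  have m: "m > 0" "composition mu" using Cons.prems by (auto simp: composition_def)
  have "cont nu \<noteq> []" using Cons.prems cont_eq_Nil by (metis list.distinct(1) mset_zero_iff)
  then obtain k nu' where nu: "nu = k # nu'" by (cases nu) auto
  have k: "k > 0" "composition nu'" using Cons.prems nu by (auto simp: composition_def)
  have bound: "c < int m" if "\<forall>p\<in>set mu. p \<le> m" "c \<in> set (cont (m # mu))" for c m mu
    using that cont_upper by fastforce
  have "int (m - 1) \<in> set (cont (m # mu))" "int (k - 1) \<in> set (cont (k # nu'))"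
    using m k imageI[of "m - 1" "{0..<m}" int] imageI[of "k - 1" "{0..<k}" int] by (simp_all add: cont_Cons)
  moreover have "set (cont (m # mu)) = set (cont (k # nu'))" using Cons.prems nu by (metis mset_eq_setD)
  moreover have "\<forall>p\<in>set mu. p \<le> m" "\<forall>p\<in>set nu'. p \<le> k" using Cons.prems nu by auto
  ultimately have "int (m - 1) < int k" "int (k - 1) < int m" using bound by blast+
  then have "m = k" using m k by linarith
  then have "mset (map (\<lambda>c. c - 1) (cont mu)) = mset (map (\<lambda>c. c - 1) (cont nu'))"
    using Cons.prems nu by (simp add: cont_Cons)
  then have "image_mset (\<lambda>c. c + 1) (mset (map (\<lambda>c. c - 1) (cont mu))) = image_mset (\<lambda>c. c + 1) (mset (map (\<lambda>c. c - 1) (cont nu')))"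
    by simp
  then have "mset (cont mu) = mset (cont nu')" by (simp add: multiset.map_comp o_def)
  then show ?case using Cons.IH m k nu \<open>m = k\<close> Cons.prems by simp
qed

text \<open>Each entry is weighted by the number of its successors, so moving a larger entry to the
  left past a smaller neighbour raises the potential by their difference.\<close>

fun potential :: "int list \<Rightarrow> int" where
  "potential [] = 0"
| "potential (x # xs) = int (length xs) * x + potential xs"

lemma potential_swap: "potential (xs @ [b, a] @ ys) = potential (xs @ [a, b] @ ys) + (b - a)"
  by (induction xs) (auto simp: algebra_simps)

text \<open>Properties of the set of weights of an invariant subspace: the patterns a a, and a b a
  with |a - b| = 1, are forbidden, and neighbours at distance at least 2 may be exchanged. They
  separate the combinatorics from the representations.\<close>

locale weight_words =
  fixes n :: nat and P :: "int list \<Rightarrow> bool"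
  assumes len: "P xs \<Longrightarrow> length xs = n"
    and fst0: "P (x # xs) \<Longrightarrow> x = 0"
    and neq: "\<not> P (xs @ [a, a] @ ys)"
    and swap: "P (xs @ [a, b] @ ys) \<Longrightarrow> \<bar>a - b\<bar> \<ge> 2 \<Longrightarrow> P (xs @ [b, a] @ ys)"
    and nobraid: "\<bar>a - b\<bar> = 1 \<Longrightarrow> \<not> P (xs @ [a, b, a] @ ys)"
    and bnd: "P xs \<Longrightarrow> x \<in> set xs \<Longrightarrow> \<bar>x\<bar> \<le> int n"
begin

lemma move_right: "P (xs @ [a] @ zs @ ys) \<Longrightarrow> \<forall>z\<in>set zs. \<bar>a - z\<bar> \<ge> 2 \<Longrightarrow> P (xs @ zs @ [a] @ ys)"
proof (induction zs arbitrary: xs)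
  case (Cons z zs)
  then have "P ((xs @ [z]) @ [a] @ zs @ ys)" using swap[of xs a z "zs @ ys"] by simp
  then show ?case using Cons.IH[of "xs @ [z]"] Cons.prems by simp
qed simp

lemma move_left: "P (xs @ zs @ [a] @ ys) \<Longrightarrow> \<forall>z\<in>set zs. \<bar>a - z\<bar> \<ge> 2 \<Longrightarrow> P (xs @ [a] @ zs @ ys)"
proof (induction zs arbitrary: ys rule: rev_induct)
  case (snoc z zs)
  then have "P (xs @ zs @ [a] @ ([z] @ ys))" using swap[of "xs @ zs" z a ys] by (simp add: abs_minus_commute)
  then show ?case using snoc.IH[of "[z] @ ys"] snoc.prems by simp
qed simp

text \<open>Suppose a row is longer than the one above it, which ends in a. This a can be moved to
  the right past the entries of the longer row that precede a - 1. There a - 1 is followed by a once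
  more, and the forbidden pattern a, a - 1, a appears.\<close>

lemma sorted_rows:
  assumes "composition mu" "P (cont mu)"
  shows "sorted_wrt (\<ge>) mu"
proof (rule ccontr)
  assume "\<not> ?thesis"
  then obtain i where i: "Suc i < length mu" "mu ! i < mu ! Suc i"
    using sorted_wrt_iff_nth_Suc_transp[of "(\<ge>)" mu] by (auto simp: transp_def not_le)
  define la where "la = take i mu"
  define m where "m = mu ! i"
  define k where "k = mu ! Suc i"
  have mu: "mu = la @ [m, k] @ drop (Suc (Suc i)) mu"
    using i by (simp add: la_def m_def k_def Cons_nth_drop_Suc id_take_nth_drop[symmetric])
  have lla: "length la = i" using i by (simp add: la_def)
  obtain zs where "cont mu = cont (la @ [m, k]) @ zs" using cont_append_prefix[of "la @ [m,k]"] mu by (metis append.assoc)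
  have "m \<in> set mu" using i by (simp add: m_def)
  then have "m > 0" using assms by (auto simp: composition_def)
  then obtain m' where m': "m = Suc m'" by (cases m) auto
  have km: "k \<ge> Suc (Suc m')" using i m' by (simp add: m_def k_def)
  let ?f = "\<lambda>q. int q - int i" and ?g = "\<lambda>q. int q - int (Suc i)"
  have "[0..<k] = [0..<m'] @ [m', Suc m'] @ [Suc (Suc m')..<k]"
    using km upt_split[of m' k] by simp
  then have "cont mu = (cont la @ map ?f [0..<m']) @ [?f m'] @ map ?g [0..<m'] @ ([?g m', ?g (Suc m')] @ map ?g [Suc (Suc m')..<k] @ zs)"
    using \<open>cont mu = _\<close> cont_snoc[of "la @ [m]" k] cont_snoc[of la m] lla m' by simp
  moreover have "\<forall>z\<in>set (map ?g [0..<m']). \<bar>?f m' - z\<bar> \<ge> 2" by auto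
  ultimately have "P ((cont la @ map ?f [0..<m']) @ map ?g [0..<m'] @ [?f m'] @ ([?g m', ?g (Suc m')] @ map ?g [Suc (Suc m')..<k] @ zs))"
    using move_right assms by metis
  then have "P (((cont la @ map ?f [0..<m']) @ map ?g [0..<m']) @ [?f m', ?g m', ?f m'] @ (map ?g [Suc (Suc m')..<k] @ zs))"
    by simp
  moreover have "\<bar>?f m' - ?g m'\<bar> = 1" by simp
  ultimately show False using nobraid by blast
qed

text \<open>Growing prefixes are recognized as content words: every value of the next entry, except
  for the two that prolong the last row or open a new one, contradicts maximality or one of the
  axioms.\<close>

lemma maximal_rows:
  assumes P: "P ws" and max: "\<And>us. P us \<Longrightarrow> potential us \<le> potential ws"
  shows "\<exists>mu. composition mu \<and> ws = cont mu"
proof -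
  have "k \<le> length ws \<Longrightarrow> \<exists>mu. composition mu \<and> take k ws = cont mu" for k
  proof (induction k)
    case 0
    then show ?case by (intro exI[of _ "[]"]) (simp add: composition_def)
  next
    case (Suc k)
    then obtain mu where mu: "composition mu" "take k ws = cont mu" by auto
    define x where "x = ws ! k"
    define ys where "ys = drop (Suc k) ws"
    have "ws = take k ws @ ws ! k # drop (Suc k) ws" using Suc.prems by (intro id_take_nth_drop) auto
    then have ws: "ws = cont mu @ [x] @ ys" by (metis mu(2) x_def ys_def append_Cons append_Nil)
    have tk: "take (Suc k) ws = cont mu @ [x]" using Suc.prems mu(2) by (simp add: x_def take_Suc_conv_app_nth)
    have newrow: ?case if "x = - int (length mu)"
    proof -
      have "cont (mu @ [1]) = cont mu @ [x]" using that by (simp add: cont_snoc)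
      then show ?thesis using mu tk by (intro exI[of _ "mu @ [1]"]) (auto simp: composition_def)
    qed
    show ?case
    proof (cases mu rule: rev_cases)
      case Nil
      then show ?thesis using newrow P ws fst0[of x ys] by simp
    next
      case (snoc la m)
      define r where "r = length la"
      obtain m' where m': "m = Suc m'" using mu snoc by (cases m) (auto simp: composition_def)
      let ?f = "\<lambda>q. int q - int r"
      have cm: "cont mu = cont la @ map ?f [0..<m'] @ [?f m']" using snoc m' by (simp add: cont_snoc r_def)
      consider "x > ?f m' + 1" | "x = ?f m' + 1" | "x = ?f m'" | "x < ?f m'" "x \<ge> - int r"
        | "x = - int (Suc r)" | "x < - int (Suc r)" by linarith
      then show ?thesis
      proof cases
        case 1
        \<comment> \<open>Too large: the exchange with the predecessor raises the potential.\<close>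
        have "P ((cont la @ map ?f [0..<m']) @ [x, ?f m'] @ ys)"
          using swap[of "cont la @ map ?f [0..<m']" "?f m'" x ys] P 1 ws cm by simp
        then have "potential ((cont la @ map ?f [0..<m']) @ [x, ?f m'] @ ys) \<le> potential ws" by (rule max)
        then show ?thesis using 1 ws cm potential_swap[of "cont la @ map ?f [0..<m']" x "?f m'" ys] by simp
      next
        case 2
        have "cont (la @ [Suc m]) = cont mu @ [x]" using 2 snoc m' cont_snoc_Suc[of la m] by (simp add: r_def)
        then show ?thesis using mu snoc tk by (intro exI[of _ "la @ [Suc m]"]) (auto simp: composition_def)
      next
        case 3
        then show ?thesis using P ws cm neq[of "cont la @ map ?f [0..<m']" x ys] by simp
      next
        case 4
        \<comment> \<open>A value already present in the last row moves left until it stands behind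
          its successor there, producing x, x + 1, x.\<close>
        define q where "q = nat (x + int r)"
        have q: "x = ?f q" "q < m'" using 4 by (auto simp: q_def)
        have "[0..<m'] @ [m'] = [0..<q] @ [q, Suc q] @ [Suc (Suc q)..<Suc m']"
          using q upt_split[of q "Suc m'"] by simp
        then have "map ?f ([0..<m'] @ [m']) = map ?f ([0..<q] @ [q, Suc q] @ [Suc (Suc q)..<Suc m'])" by simp
        then have "ws = (cont la @ map ?f [0..<q] @ [?f q, ?f (Suc q)]) @ map ?f [Suc (Suc q)..<Suc m'] @ [x] @ ys"
          using ws cm by (simp del: upt_Suc)
        moreover have "\<forall>z\<in>set (map ?f [Suc (Suc q)..<Suc m']). \<bar>x - z\<bar> \<ge> 2" using q by auto
        ultimately have "P ((cont la @ map ?f [0..<q] @ [?f q, ?f (Suc q)]) @ [x] @ map ?f [Suc (Suc q)..<Suc m'] @ ys)"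
          using P move_left by metis
        then show ?thesis using nobraid[of "?f q" "?f (Suc q)" "cont la @ map ?f [0..<q]"] q by simp
      next
        case 5
        then show ?thesis using newrow snoc by (simp add: r_def)
      next
        case 6
        \<comment> \<open>The entry is smaller by at least 2 than everything before it, so it can be
          moved to the front, where only 0 is allowed.\<close>
        have "\<forall>z\<in>set (cont mu). \<bar>x - z\<bar> \<ge> 2"
          using cont_bound[of _ mu] 6 snoc by (fastforce simp: r_def)
        then have "P ([] @ [x] @ cont mu @ ys)" using move_left[of "[]" "cont mu" x ys] P ws by simp
        then show ?thesis using fst0[of x "cont mu @ ys"] 6 by simp
      qed
    qed
  qed
  then show ?thesis by (metis order_refl take_all)
qed

text \<open>Words of length n with entries bounded by n are finite in number, so a maximum of the
  potential exists.\<close>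

lemma exists_rows:
  assumes "P xs"
  shows "\<exists>mu. composition mu \<and> sorted_wrt (\<ge>) mu \<and> P (cont mu)"
proof -
  have "Collect P \<subseteq> {xs. set xs \<subseteq> {- int n..int n} \<and> length xs = n}"
    using bnd len by (fastforce simp: abs_le_iff)
  then have "finite (Collect P)" by (rule finite_subset) (simp add: finite_lists_length_eq)
  then have fin: "finite (potential ` Collect P)" by simp
  then have "Max (potential ` Collect P) \<in> potential ` Collect P" using assms by (intro Max_in) auto
  then obtain ws where ws: "P ws" "potential ws = Max (potential ` Collect P)" by auto
  then have "potential us \<le> potential ws" if "P us" for us using that fin by auto
  then show ?thesis using ws(1) maximal_rows sorted_rows by metis
qed

end

lemma partition_iff: "mu \<in> partitions_of n \<longleftrightarrow> composition mu \<and> sorted_wrt (\<ge>) mu \<and> sum_list mu = n"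
  by (auto simp: partitions_of_def composition_def)

text \<open>Weights are indexed from 1, as the X_j are, lists from 0.\<close>

definition wt_of :: "int list \<Rightarrow> nat \<Rightarrow> int" where
  "wt_of xs j = xs ! (j - 1)"

context orth_rep
begin

lemma weight_bound:
  assumes "weight \<alpha> v" "v \<noteq> 0" "1 \<le> j" "j \<le> n"
  shows "\<bar>\<alpha> j\<bar> \<le> int n"
proof -
  have "poly (content_poly n) (of_int (\<alpha> j)) *\<^sub>R v = 0"
    using X_minpoly_n[of j v] pact_eigen[OF X_lin weightD(2)] assms weightD(1) by metis
  then have "poly (content_poly n) (of_int (\<alpha> j)) = 0" using assms by simp
  then obtain c where "c \<in> {- int n..int n}" "poly (lin_factor c) (of_int (\<alpha> j)) = 0"
    by (auto simp: content_poly_def poly_prod)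
  then show ?thesis by auto
qed

section \<open>Adjacent transpositions acting on a weight vector\<close>

context
  fixes \<alpha> :: "nat \<Rightarrow> int" and v i
  assumes wt: "weight \<alpha> v" and i: "1 \<le> i" "Suc i \<le> n"
begin

lemma adjacent_X:
  "X i (U (tr i (Suc i)) v) = of_int (\<alpha> (Suc i)) *\<^sub>R U (tr i (Suc i)) v - v"
  "X (Suc i) (U (tr i (Suc i)) v) = of_int (\<alpha> i) *\<^sub>R U (tr i (Suc i)) v + v"
  using X_s[of i v] wt i weightD linear_scale[OF U_lin[OF tr_n[of i "Suc i"]]] by simp_all

text \<open>With equal entries, X_i - \<alpha>_i would send s v to -v and v to 0; but a symmetric
  operator whose square kills s v kills s v itself.\<close>

lemma adjacent_neq:
  assumes "v \<noteq> 0" shows "\<alpha> i \<noteq> \<alpha> (Suc i)"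
proof
  assume eq: "\<alpha> i = \<alpha> (Suc i)"
  let ?sv = "U (tr i (Suc i)) v" and ?p = "pact (lin_factor (\<alpha> i)) (X i)"
  have vV: "v \<in> V" using wt weightD by auto
  have sV: "?sv \<in> V" using vV i by (intro U_closed tr_n) auto
  have iX: "i \<le> n" using i by simp
  have psv: "?p ?sv = - v" using adjacent_X eq by simp
  have "?p v = 0" using wt i weightD by simp
  then have "?p (?p ?sv) = 0" unfolding psv linear_neg[OF linear_pact[OF X_lin[OF iX]]] by simp
  then have "?p ?sv = 0"
    by (rule symm_square_zero[OF symm_pact[OF symm_X[OF iX]] sV])
  then show False using psv assms by simp
qed

text \<open>The intertwiner behind Young's seminormal form: subtracting 1 / (\<alpha>_{i+1} -
  \<alpha>_i) from s removes the error terms in the commutation relations with X_i and X_{i+1} and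
  leaves a plain exchange.\<close>

lemma adjacent_swap_weight:
  assumes neq: "\<alpha> i \<noteq> \<alpha> (Suc i)"
  shows "weight (\<alpha> \<circ> tr i (Suc i)) (U (tr i (Suc i)) v - (1 / of_int (\<alpha> (Suc i) - \<alpha> i)) *\<^sub>R v)"
proof -
  let ?sv = "U (tr i (Suc i)) v"
  define r where "r = real_of_int (\<alpha> (Suc i) - \<alpha> i)"
  have r: "r \<noteq> 0" using neq by (simp add: r_def)
  have vV: "v \<in> V" using wt weightD by auto
  have sV: "?sv \<in> V" using vV i by (intro U_closed tr_n) auto
  let ?w = "?sv - (1 / r) *\<^sub>R v"
  have wV: "?w \<in> V" using sV vV sub by (auto intro!: real_vector.subspace_diff real_vector.subspace_scale)
  have lin: "X j ?w = X j ?sv - (1 / r) *\<^sub>R X j v" if "j \<le> n" for j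
    using that by (simp add: linear_diff[OF X_lin] linear_scale[OF X_lin])
  have c1: "real_of_int (\<alpha> (Suc i)) = of_int (\<alpha> i) + r" by (simp add: r_def)
  have "X j ?w = of_int ((\<alpha> \<circ> tr i (Suc i)) j) *\<^sub>R ?w" if j: "j \<in> {1..n}" for j
  proof -
    consider "j = i" | "j = Suc i" | "j \<noteq> i" "j \<noteq> Suc i" by blast
    then show ?thesis
    proof cases
      case 1
      have "X i ?w = of_int (\<alpha> (Suc i)) *\<^sub>R ?sv - (1 + of_int (\<alpha> i) / r) *\<^sub>R v"
        using i wt by (simp add: lin weightD adjacent_X algebra_simps)
      also have "1 + of_int (\<alpha> i) / r = of_int (\<alpha> (Suc i)) / r" using r by (simp add: c1 field_simps)
      finally show ?thesis using 1 by (simp add: algebra_simps)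
    next
      case 2
      have "X (Suc i) ?w = of_int (\<alpha> i) *\<^sub>R ?sv - (of_int (\<alpha> (Suc i)) / r - 1) *\<^sub>R v"
        using i wt by (simp add: lin weightD adjacent_X algebra_simps)
      also have "of_int (\<alpha> (Suc i)) / r - 1 = of_int (\<alpha> i) / r" using r by (simp add: c1 field_simps)
      finally show ?thesis using 2 by (simp add: algebra_simps)
    next
      case 3
      have "X j ?sv = U (tr i (Suc i)) (X j v)" using s_X_far[of i j v] i j 3 vV by auto
      then have "X j ?sv = of_int (\<alpha> j) *\<^sub>R ?sv"
        using weightD(2)[OF wt] j linear_scale[OF U_lin[OF tr_n[of i "Suc i"]]] i by simp
      then show ?thesis using 3 j by (simp add: lin weightD(2)[OF wt] algebra_simps)
    qed
  qed
  then show ?thesis using wV by (simp add: weight_def r_def)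
qed

text \<open>Otherwise v would be an eigenvector of an involution with an eigenvalue of absolute
  value at most 1/2.\<close>

lemma adjacent_swap_nonzero:
  assumes "v \<noteq> 0" "\<bar>\<alpha> i - \<alpha> (Suc i)\<bar> \<ge> 2"
  shows "U (tr i (Suc i)) v - (1 / of_int (\<alpha> (Suc i) - \<alpha> i)) *\<^sub>R v \<noteq> 0"
proof
  define c where "c = 1 / real_of_int (\<alpha> (Suc i) - \<alpha> i)"
  assume "U (tr i (Suc i)) v - (1 / of_int (\<alpha> (Suc i) - \<alpha> i)) *\<^sub>R v = 0"
  then have eq: "U (tr i (Suc i)) v = c *\<^sub>R v" by (simp add: c_def)
  have "v = U (tr i (Suc i)) (U (tr i (Suc i)) v)" using U_tr_tr i wt weightD by auto
  also have "\<dots> = (c * c) *\<^sub>R v" using eq linear_scale[OF U_lin[OF tr_n[of i "Suc i"]]] i by simp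
  finally have "(1 - c * c) *\<^sub>R v = 0" by (simp add: scaleR_left_diff_distrib)
  then have "c * c = 1" using assms by simp
  then have "\<bar>c\<bar> = 1" by (metis abs_mult_self_eq abs_square_eq_1 power2_eq_square)
  moreover have "\<bar>real_of_int (\<alpha> (Suc i) - \<alpha> i)\<bar> \<ge> 2" using assms(2) by linarith
  ultimately show False by (simp add: c_def abs_divide field_simps)
qed

text \<open>Write r = \<alpha>_{i+1} - \<alpha>_i, so r^2 = 1. The vector w = s v - r v has another
  X_i-eigenvalue than v, so <s v, v> = r <v, v>; then |w|^2 = (1 - r^2) |v|^2 = 0.\<close>

lemma adjacent_sign:
  assumes "\<bar>\<alpha> i - \<alpha> (Suc i)\<bar> = 1"
  shows "U (tr i (Suc i)) v = of_int (\<alpha> (Suc i) - \<alpha> i) *\<^sub>R v"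
proof -
  let ?sv = "U (tr i (Suc i)) v"
  define r where "r = real_of_int (\<alpha> (Suc i) - \<alpha> i)"
  have "\<alpha> (Suc i) - \<alpha> i = 1 \<or> \<alpha> (Suc i) - \<alpha> i = -1" using assms by linarith
  then have "r = 1 \<or> r = -1" unfolding r_def by (metis of_int_1 of_int_minus)
  then have r: "r * r = 1" "1 / r = r" by auto
  have vV: "v \<in> V" using wt weightD by auto
  have sV: "?sv \<in> V" using vV i by (intro U_closed tr_n) auto
  let ?w = "?sv - r *\<^sub>R v"
  have neq: "\<alpha> i \<noteq> \<alpha> (Suc i)" using assms by auto
  have w: "weight (\<alpha> \<circ> tr i (Suc i)) ?w" using adjacent_swap_weight[OF neq] r by (simp add: r_def)
  have "X i ?w = of_int (\<alpha> (Suc i)) *\<^sub>R ?w" using weightD(2)[OF w, of i] i by simp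
  then have "ip ?w v = 0"
    using symm_eigen_orth[OF symm_X[of i] weightD(1)[OF w] vV, of "of_int (\<alpha> (Suc i))" "of_int (\<alpha> i)"]
      weightD(2)[OF wt, of i] i neq by simp
  then have sv: "ip ?sv v = r * ip v v" by (simp add: ip_simps)
  have "ip ?w ?w = ip ?sv ?sv - 2 * r * ip ?sv v + r * r * ip v v"
    using ip_sym[of v ?sv] by (simp add: ip_simps algebra_simps)
  also have "ip ?sv ?sv = ip v v" using ip_U[of "tr i (Suc i)" v v] tr_n[of i "Suc i"] vV i by simp
  also have "ip v v - 2 * r * ip ?sv v + r * r * ip v v = 0" unfolding sv using r(1) by (simp add: algebra_simps)
  finally have "?w = 0" using ip_eq_0 weightD(1)[OF w] by blast
  then show ?thesis by (simp add: r_def)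
qed

end

definition occurs :: "'v set \<Rightarrow> int list \<Rightarrow> bool" where
  "occurs W xs \<longleftrightarrow> length xs = n \<and> (\<exists>v\<in>W. v \<noteq> 0 \<and> weight (wt_of xs) v)"

lemma weight_cong: "(\<And>j. 1 \<le> j \<Longrightarrow> j \<le> n \<Longrightarrow> \<alpha> j = \<beta> j) \<Longrightarrow> weight \<alpha> v \<longleftrightarrow> weight \<beta> v"
  by (auto simp: weight_def)

lemma weight_words_occurs:
  assumes W: "inv_sub W"
  shows "weight_words n (occurs W)"
proof
  show "length xs = n" if "occurs W xs" for xs using that by (simp add: occurs_def)
  show "x = 0" if occ: "occurs W (x # xs)" for x xs
  proof -
    obtain v where v: "v \<noteq> 0" "weight (wt_of (x # xs)) v" "1 \<le> n" using occ by (auto simp: occurs_def)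
    then have "X 1 v = of_int x *\<^sub>R v" using weightD(2)[OF v(2), of 1] by (simp add: wt_of_def)
    then show ?thesis using v by simp
  qed
  show "\<bar>x\<bar> \<le> int n" if occ: "occurs W xs" and x: "x \<in> set xs" for x xs
  proof -
    obtain v where v: "v \<noteq> 0" "weight (wt_of xs) v" "length xs = n" using occ by (auto simp: occurs_def)
    obtain k where "k < n" "x = xs ! k" using x v by (auto simp: in_set_conv_nth)
    then show ?thesis using weight_bound[OF v(2,1), of "Suc k"] by (simp add: wt_of_def)
  qed
  have pos: "\<exists>v\<in>W. v \<noteq> 0 \<and> weight (wt_of (xs @ [a, b] @ ys)) v \<and> Suc (length xs) < n
      \<and> wt_of (xs @ [a, b] @ ys) (Suc (length xs)) = a \<and> wt_of (xs @ [a, b] @ ys) (Suc (Suc (length xs))) = b"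
    if "occurs W (xs @ [a, b] @ ys)" for xs ys a b
    using that by (auto simp: occurs_def wt_of_def nth_append)
  show "\<not> occurs W (xs @ [a, a] @ ys)" for xs ys a
  proof
    assume "occurs W (xs @ [a, a] @ ys)"
    from pos[OF this] show False
      using adjacent_neq[of "wt_of (xs @ [a, a] @ ys)" _ "Suc (length xs)"] by force
  qed
  show "occurs W (xs @ [b, a] @ ys)" if occ: "occurs W (xs @ [a, b] @ ys)" and ab: "\<bar>a - b\<bar> \<ge> 2" for xs ys a b
  proof -
    let ?i = "Suc (length xs)" and ?\<alpha> = "wt_of (xs @ [a, b] @ ys)"
    obtain v where v: "v \<in> W" "v \<noteq> 0" "weight ?\<alpha> v" "?i < n" "?\<alpha> ?i = a" "?\<alpha> (Suc ?i) = b"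
      using pos[OF occ] by blast
    let ?w = "U (tr ?i (Suc ?i)) v - (1 / of_int (?\<alpha> (Suc ?i) - ?\<alpha> ?i)) *\<^sub>R v"
    have "?w \<noteq> 0" using adjacent_swap_nonzero[OF v(3), of ?i] v ab by simp
    moreover have "weight (?\<alpha> \<circ> tr ?i (Suc ?i)) ?w" using adjacent_swap_weight[OF v(3), of ?i] v ab by auto
    moreover have "(?\<alpha> \<circ> tr ?i (Suc ?i)) j = wt_of (xs @ [b, a] @ ys) j" if "1 \<le> j" for j
    proof -
      consider (lt) "j \<le> length xs" | (fst) "j = ?i" | (snd) "j = Suc ?i" | (gt) "Suc (Suc (Suc (length xs))) \<le> j"
        by linarith
      then show ?thesis
      proof cases
        case lt
        then have "j - 1 < length xs" "j \<noteq> ?i" "j \<noteq> Suc ?i" using that by auto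
        then show ?thesis by (simp add: wt_of_def nth_append)
      next
        case gt
        then obtain d where "j = Suc (Suc (Suc (length xs))) + d" using le_Suc_ex by blast
        then show ?thesis by (simp add: wt_of_def nth_append)
      qed (simp_all add: wt_of_def nth_append)
    qed
    then have "weight (?\<alpha> \<circ> tr ?i (Suc ?i)) ?w \<longleftrightarrow> weight (wt_of (xs @ [b, a] @ ys)) ?w"
      by (rule weight_cong)
    ultimately have "weight (wt_of (xs @ [b, a] @ ys)) ?w" by blast
    moreover have "U (tr ?i (Suc ?i)) v \<in> W" using W v tr_n[of ?i "Suc ?i"] unfolding inv_sub_def by simp
    then have "?w \<in> W" using W v unfolding inv_sub_def
      by (intro real_vector.subspace_diff real_vector.subspace_scale) auto
    moreover have "length (xs @ [b, a] @ ys) = n" using occ by (simp add: occurs_def)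
    ultimately show ?thesis using \<open>?w \<noteq> 0\<close> unfolding occurs_def by blast
  qed
  show "\<not> occurs W (xs @ [a, b, a] @ ys)" if ab: "\<bar>a - b\<bar> = 1" for xs ys a b
  proof
    let ?i = "Suc (length xs)" and ?\<alpha> = "wt_of (xs @ [a, b, a] @ ys)"
    assume "occurs W (xs @ [a, b, a] @ ys)"
    then obtain v where v: "v \<noteq> 0" "weight ?\<alpha> v" "Suc (Suc ?i) \<le> n" by (auto simp: occurs_def)
    have \<alpha>: "?\<alpha> ?i = a" "?\<alpha> (Suc ?i) = b" "?\<alpha> (Suc (Suc ?i)) = a" by (auto simp: wt_of_def nth_append)
    let ?s = "tr ?i (Suc ?i)" and ?t = "tr (Suc ?i) (Suc (Suc ?i))"
    define r where "r = real_of_int (b - a)"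
    have "b - a = 1 \<or> b - a = -1" using ab by linarith
    then have "r = 1 \<or> r = -1" unfolding r_def by (metis of_int_1 of_int_minus)
    then have rr: "r * r = 1" by auto
    have s: "U ?s v = r *\<^sub>R v" using adjacent_sign[OF v(2), of ?i] v \<alpha> ab by (simp add: r_def)
    have t: "U ?t v = (- r) *\<^sub>R v"
      using adjacent_sign[OF v(2), of "Suc ?i"] v \<alpha> ab by (simp add: r_def abs_minus_commute)
    have p: "?s permutes {1..n}" "?t permutes {1..n}" using v by (auto intro!: tr_permutes)
    have vV: "v \<in> V" using v weightD by auto
    \<comment> \<open>The entries a, b, a make v an eigenvector of both transpositions with opposite
      signs; the braid relation then gives -r^3 v = r^3 v.\<close>
    have "?s \<circ> (?t \<circ> ?s) = ?t \<circ> (?s \<circ> ?t)"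
      by (auto simp: fun_eq_iff Transposition.transpose_def)
    then have "U ?s (U ?t (U ?s v)) = U ?t (U ?s (U ?t v))"
      using U_comp[OF p(1) permutes_compose[OF p] vV] U_comp[OF p(2,1) vV]
        U_comp[OF p(2) permutes_compose[OF p(2,1)] vV] U_comp[OF p vV] by simp
    moreover have "U ?s (U ?t (U ?s v)) = (- (r * r * r)) *\<^sub>R v" "U ?t (U ?s (U ?t v)) = (r * r * r) *\<^sub>R v"
      unfolding s t linear_scale[OF U_lin[OF p(1)]] linear_scale[OF U_lin[OF p(2)]] by (simp_all add: mult.assoc)
    ultimately have "(r * r * r) *\<^sub>R v + (r * r * r) *\<^sub>R v = 0" by (simp add: neg_eq_iff_add_eq_0)
    then have "(2 * r) *\<^sub>R v = 0" using rr by (simp add: scaleR_left_distrib[symmetric])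
    then show False using v rr by auto
  qed
qed

text \<open>Eigenvectors are refined one operator at a time: a polynomial in X_{k+1} keeps the
  eigenvalues under X_1, ..., X_k by commutation.\<close>

lemma exists_weight:
  assumes W: "inv_sub W" and "W \<noteq> {0}"
  shows "\<exists>xs. occurs W xs"
proof -
  have "0 \<in> W" using W real_vector.subspace_0 by (auto simp: inv_sub_def)
  then obtain v0 where v0: "v0 \<in> W" "v0 \<noteq> 0" using assms by auto
  have "k \<le> n \<Longrightarrow> \<exists>v\<in>W. v \<noteq> 0 \<and> (\<exists>\<alpha>. \<forall>j\<in>{1..k}. X j v = of_int (\<alpha> j) *\<^sub>R v)" for k
  proof (induction k)
    case 0
    then show ?case using v0 by auto
  next
    case (Suc k)
    then obtain v and \<alpha> :: "nat \<Rightarrow> int" where v: "v \<in> W" "v \<noteq> 0" "\<forall>j\<in>{1..k}. X j v = of_int (\<alpha> j) *\<^sub>R v" by auto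
    have vV: "v \<in> V" using v W by (auto simp: inv_sub_def)
    have lX: "linear (X (Suc k))" using X_lin Suc.prems by auto
    have "pact (\<Prod>c\<in>{- int n..int n}. lin_factor c) (X (Suc k)) v = 0"
      using X_minpoly_n[of "Suc k" v] vV Suc.prems by (simp add: content_poly_def)
    then obtain c q where cq: "pact q (X (Suc k)) v \<noteq> 0"
      "X (Suc k) (pact q (X (Suc k)) v) = of_int c *\<^sub>R pact q (X (Suc k)) v"
      using eigenvector_exists[OF lX _ v(2), of "{- int n..int n}"] by auto
    let ?u = "pact q (X (Suc k)) v"
    have "X j ?u = of_int ((\<alpha>(Suc k := c)) j) *\<^sub>R ?u" if "j \<in> {1..Suc k}" for j
    proof (cases "j = Suc k")
      case False
      then have "X j ?u = pact q (X (Suc k)) (X j v)" using X_pact_commute that Suc.prems vV by auto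
      then show ?thesis using v(3) False that linear_scale[OF linear_pact[OF lX]] by auto
    qed (use cq in simp)
    moreover have "?u \<in> W" using W v X_inv_sub Suc.prems by (intro pact_in) (auto simp: inv_sub_def[of W])
    ultimately show ?case using cq by blast
  qed
  then obtain v and \<alpha> :: "nat \<Rightarrow> int" where v: "v \<in> W" "v \<noteq> 0" "\<forall>j\<in>{1..n}. X j v = of_int (\<alpha> j) *\<^sub>R v" by blast
  then have "weight \<alpha> v" using W by (auto simp: weight_def inv_sub_def)
  moreover have "wt_of (map \<alpha> [1..<Suc n]) j = \<alpha> j" if "1 \<le> j" "j \<le> n" for j
    using that by (simp add: wt_of_def del: upt_Suc)
  then have "weight (wt_of (map \<alpha> [1..<Suc n])) v \<longleftrightarrow> weight \<alpha> v" by (rule weight_cong)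
  ultimately have "weight (wt_of (map \<alpha> [1..<Suc n])) v" by blast
  then show ?thesis using v by (intro exI[of _ "map \<alpha> [1..<Suc n]"]) (auto simp: occurs_def)
qed

text \<open>Takes the place of a classification: applied to the complement of all blocks, it shows
  that nothing is left over.\<close>

theorem exists_partition_weight:
  assumes "inv_sub W" "W \<noteq> {0}"
  shows "\<exists>mu\<in>partitions_of n. \<exists>v\<in>W. v \<noteq> 0 \<and> weight (wt_of (cont mu)) v"
proof -
  interpret weight_words n "occurs W" using weight_words_occurs assms by blast
  obtain mu where mu: "composition mu" "sorted_wrt (\<ge>) mu" "occurs W (cont mu)"
    using exists_weight[OF assms] exists_rows by blast
  then have "mu \<in> partitions_of n" by (simp add: partition_iff occurs_def)
  then show ?thesis using mu by (auto simp: occurs_def)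
qed

text \<open>Decreasing rows come for free from \<open>sorted_rows\<close>, so the program may accept
  any composition while parsing.\<close>

lemma weight_partition:
  assumes "composition mu" "sum_list mu = n" "weight (wt_of (cont mu)) v" "v \<noteq> 0"
  shows "mu \<in> partitions_of n"
proof -
  interpret weight_words n "occurs V" using weight_words_occurs inv_sub_V by blast
  have "occurs V (cont mu)" using assms weightD by (auto simp: occurs_def)
  then show ?thesis using sorted_rows assms by (simp add: partition_iff)
qed

lemma cyc_orth:
  assumes "mu \<in> partitions_of n" "nu \<in> partitions_of n" "mu \<noteq> nu"
    "weight (wt_of (cont mu)) v" "weight (wt_of (cont nu)) w" "u \<in> cyc v" "u' \<in> cyc w"
  shows "ip u u' = 0"
proof (rule ccontr)
  assume "ip u u' \<noteq> 0"
  then have "mset (map (wt_of (cont mu)) [1..<Suc n]) = mset (map (wt_of (cont nu)) [1..<Suc n])"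
    using cyc_not_orth_contents assms by blast
  moreover have "map (wt_of (cont mu)) [1..<Suc n] = cont mu" if "mu \<in> partitions_of n" for mu
    using that by (intro nth_equalityI) (auto simp: partition_iff wt_of_def simp del: upt_Suc)
  ultimately show False using assms cont_mset_inj by (metis partition_iff)
qed

end

section \<open>Specht modules are generated by weight vectors\<close>

lemma row_tableau_Cons:
  "row_tableau (m # mu) (0, j) = j + 1" "row_tableau (m # mu) (Suc i, j) = m + row_tableau mu (i, j)"
  by (simp_all add: row_tableau_def)

lemma young_diagram_Cons:
  "(0, j) \<in> young_diagram (m # mu) \<longleftrightarrow> j < m" "(Suc i, j) \<in> young_diagram (m # mu) \<longleftrightarrow> (i, j) \<in> young_diagram mu"
  by (simp_all add: young_diagram_def)

lemma row_tableau_surj: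
  "1 \<le> k \<Longrightarrow> k \<le> sum_list lam \<Longrightarrow> \<exists>i j. (i, j) \<in> young_diagram lam \<and> row_tableau lam (i, j) = k"
proof (induction lam arbitrary: k)
  case (Cons m mu)
  show ?case
  proof (cases "k \<le> m")
    case True
    then show ?thesis using Cons.prems by (intro exI[of _ 0] exI[of _ "k - 1"]) (auto simp: young_diagram_Cons row_tableau_Cons)
  next
    case False
    then have "1 \<le> k - m" "k - m \<le> sum_list mu" using Cons.prems by auto
    then obtain i j where "(i, j) \<in> young_diagram mu" "row_tableau mu (i, j) = k - m"
      using Cons.IH by blast
    then show ?thesis using False
      by (intro exI[of _ "Suc i"] exI[of _ j]) (auto simp: young_diagram_Cons row_tableau_Cons)
  qed
qed simp

lemma row_tableau_range:
  "(i, j) \<in> young_diagram lam \<Longrightarrow> row_tableau lam (i, j) \<in> {1..sum_list lam}"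
proof (induction lam arbitrary: i)
  case (Cons m mu)
  then show ?case by (cases i) (fastforce simp: young_diagram_Cons row_tableau_Cons)+
qed (simp add: young_diagram_def)

lemma row_tableau_inj:
  "(i, j) \<in> young_diagram lam \<Longrightarrow> (i', j') \<in> young_diagram lam \<Longrightarrow>
   row_tableau lam (i, j) = row_tableau lam (i', j') \<Longrightarrow> i = i' \<and> j = j'"
proof (induction lam arbitrary: i i')
  case (Cons m mu)
  note r = row_tableau_range[of _ _ mu]
  show ?case
    using Cons r by (cases i; cases i') (fastforce simp: young_diagram_Cons row_tableau_Cons)+
qed (simp add: young_diagram_def)

text \<open>Rows are filled consecutively, so the tableau entry of a cell is the position of that
  cell in the content word.\<close>

lemma cont_row_tableau:
  "(i, j) \<in> young_diagram lam \<Longrightarrow> wt_of (cont lam) (row_tableau lam (i, j)) = int j - int i"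
proof (induction lam arbitrary: i)
  case (Cons m mu)
  show ?case
  proof (cases i)
    case 0
    then show ?thesis using Cons.prems by (simp add: young_diagram_Cons row_tableau_Cons wt_of_def cont_Cons nth_append)
  next
    case (Suc i')
    then have *: "(i', j) \<in> young_diagram mu" using Cons.prems by (simp add: young_diagram_Cons)
    obtain y where y: "row_tableau mu (i', j) = Suc y" "y < sum_list mu"
      using row_tableau_range[OF *] by (cases "row_tableau mu (i', j)") auto
    then show ?thesis using Cons.IH[OF *] Suc
      by (simp add: row_tableau_Cons wt_of_def cont_Cons nth_append)
  qed
qed (simp add: young_diagram_def)

lemma eq_minus_self: "x = - x \<Longrightarrow> x = (0 :: 'a :: real_vector)"
proof -
  assume "x = - x"
  then have "2 *\<^sub>R x = 0" by (simp add: scaleR_2 eq_neg_iff_add_eq_0)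
  then show ?thesis by simp
qed

locale specht =
  fixes n :: nat and lam :: "nat list"
  assumes lam: "lam \<in> partitions_of n"
begin

abbreviation "T \<equiv> row_tableau lam"
abbreviation "Y \<equiv> young_diagram lam"
abbreviation "R \<equiv> row_stabilizer n lam"
abbreviation "C \<equiv> column_stabilizer n lam"
abbreviation "L \<equiv> ltrans n"

text \<open>The signed column sum. The Young symmetrizer \<open>c\<close> is the row sum times
  \<open>b\<close>, and it will be the weight vector that generates the Specht module.\<close>

definition b :: group_alg where "b = (\<lambda>g. if g \<in> C then of_int (sign g) else 0)"
definition c :: group_alg where "c = young_symmetrizer n lam"

sublocale reg: orth_rep n "group_algebra n" L "ga_ip n"
  by (rule orth_rep_regular)

lemma lam_facts: "sum_list lam = n" "sorted_wrt (\<ge>) lam"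
  using lam by (auto simp: partitions_of_def)

lemma T_range: "(i, j) \<in> Y \<Longrightarrow> T (i, j) \<in> {1..n}"
  using row_tableau_range[of i j lam] lam_facts by simp

lemma T_surj: "k \<in> {1..n} \<Longrightarrow> \<exists>i j. (i, j) \<in> Y \<and> T (i, j) = k"
  using row_tableau_surj[of k lam] lam_facts by simp

lemma R_perm: "p \<in> R \<Longrightarrow> p permutes {1..n}" and C_perm: "p \<in> C \<Longrightarrow> p permutes {1..n}"
  by (auto simp: row_stabilizer_def column_stabilizer_def sym_group_carrier)

lemma R_row: "p \<in> R \<Longrightarrow> (i, j) \<in> Y \<Longrightarrow> \<exists>j'. (i, j') \<in> Y \<and> p (T (i, j)) = T (i, j')"
  by (fastforce simp: row_stabilizer_def)

lemma C_col: "p \<in> C \<Longrightarrow> (i, j) \<in> Y \<Longrightarrow> \<exists>i'. (i', j) \<in> Y \<and> p (T (i, j)) = T (i', j)"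
  by (fastforce simp: column_stabilizer_def)

lemma R_I: "p permutes {1..n} \<Longrightarrow> (\<And>i j. (i, j) \<in> Y \<Longrightarrow> \<exists>j'. (i, j') \<in> Y \<and> p (T (i, j)) = T (i, j')) \<Longrightarrow> p \<in> R"
  by (auto simp: row_stabilizer_def sym_group_carrier)

lemma C_I: "p permutes {1..n} \<Longrightarrow> (\<And>i j. (i, j) \<in> Y \<Longrightarrow> \<exists>i'. (i', j) \<in> Y \<and> p (T (i, j)) = T (i', j)) \<Longrightarrow> p \<in> C"
  by (auto simp: column_stabilizer_def sym_group_carrier)

lemma R_comp: "p \<in> R \<Longrightarrow> q \<in> R \<Longrightarrow> p \<circ> q \<in> R"
proof (rule R_I)
  assume pq: "p \<in> R" "q \<in> R"
  show "p \<circ> q permutes {1..n}" using permutes_compose[OF R_perm[OF pq(2)] R_perm[OF pq(1)]] .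
  fix i j assume "(i, j) \<in> Y"
  then obtain j' where "(i, j') \<in> Y" "q (T (i, j)) = T (i, j')" using R_row pq by blast
  then show "\<exists>j'. (i, j') \<in> Y \<and> (p \<circ> q) (T (i, j)) = T (i, j')" using R_row[OF pq(1)] by simp
qed

lemma C_comp: "p \<in> C \<Longrightarrow> q \<in> C \<Longrightarrow> p \<circ> q \<in> C"
proof (rule C_I)
  assume pq: "p \<in> C" "q \<in> C"
  show "p \<circ> q permutes {1..n}" using permutes_compose[OF C_perm[OF pq(2)] C_perm[OF pq(1)]] .
  fix i j assume "(i, j) \<in> Y"
  then obtain i' where "(i', j) \<in> Y" "q (T (i, j)) = T (i', j)" using C_col pq by blast
  then show "\<exists>i'. (i', j) \<in> Y \<and> (p \<circ> q) (T (i, j)) = T (i', j)" using C_col[OF pq(1)] by simp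
qed

lemma finite_R [simp]: "finite R"
  by (rule finite_subset[of _ "{p. p permutes {1..n}}"]) (use R_perm in auto)

text \<open>Left multiplication by \<open>p\<close> is an injective self-map of the finite set
  \<open>R\<close>, hence it hits the identity.\<close>

lemma inv_R:
  assumes "p \<in> R" shows "Hilbert_Choice.inv p \<in> R"
proof -
  have inj: "inj_on (\<lambda>q. p \<circ> q) R"
    by (rule inj_on_inverseI[where g = "\<lambda>q. Hilbert_Choice.inv p \<circ> q"])
       (simp add: comp_assoc[symmetric] permutes_inv_o[OF R_perm[OF assms]])
  have "(\<lambda>q. p \<circ> q) ` R = R"
    using assms R_comp by (intro endo_inj_surj inj) auto
  moreover have "id \<in> R" by (rule R_I) (auto simp: permutes_id)
  ultimately obtain q where q: "q \<in> R" "p \<circ> q = id" by (metis imageE)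
  then have "Hilbert_Choice.inv p = q"
    by (metis R_perm assms comp_id comp_assoc id_comp permutes_inv_o(2))
  then show ?thesis using q by simp
qed

lemma tr_row: "(i, j) \<in> Y \<Longrightarrow> (i, j') \<in> Y \<Longrightarrow> tr (T (i, j)) (T (i, j')) \<in> R"
  by (rule R_I) (auto intro!: tr_permutes T_range[simplified] simp: Transposition.transpose_def dest: row_tableau_inj)

lemma tr_col: "(i, j) \<in> Y \<Longrightarrow> (i', j) \<in> Y \<Longrightarrow> tr (T (i, j)) (T (i', j)) \<in> C"
  by (rule C_I) (auto intro!: tr_permutes T_range[simplified] simp: Transposition.transpose_def dest: row_tableau_inj)

definition row :: "nat \<Rightarrow> nat set" where
  "row i = {T (i, j) | j. (i, j) \<in> Y}"

lemma row_eq: "i < length lam \<Longrightarrow> row i = {sum_list (take i lam) + 1..sum_list (take i lam) + lam ! i}"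
proof -
  assume i: "i < length lam"
  have "k \<in> row i" if "sum_list (take i lam) + 1 \<le> k" "k \<le> sum_list (take i lam) + lam ! i" for k
    unfolding row_def using that i
    by (auto simp: row_tableau_def young_diagram_def intro!: exI[of _ "k - sum_list (take i lam) - 1"])
  then show ?thesis using i by (auto simp: row_def row_tableau_def young_diagram_def)
qed

lemma row_subset: "row i \<subseteq> {1..n}"
  using T_range by (auto simp: row_def)

lemma finite_row [simp]: "finite (row i)"
  using row_subset finite_subset by blast

lemma row_perm_R:
  assumes "p permutes (row i)" shows "p \<in> R"
proof (rule R_I)
  show "p permutes {1..n}" using permutes_subset[OF assms row_subset] .
  fix k j assume kj: "(k, j) \<in> Y"
  show "\<exists>j'. (k, j') \<in> Y \<and> p (T (k, j)) = T (k, j')"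
  proof (cases "T (k, j) \<in> row i")
    case True
    then have "k = i" using row_tableau_inj kj by (auto simp: row_def)
    moreover have "p (T (k, j)) \<in> row i" using True permutes_in_image[OF assms] by simp
    ultimately show ?thesis by (auto simp: row_def)
  next
    case False
    then show ?thesis using kj permutes_not_in[OF assms] by auto
  qed
qed

lemma b_in: "b \<in> group_algebra n"
  using C_perm by (auto simp: b_def group_algebra_iff)

lemma L_closed: "g permutes {1..n} \<Longrightarrow> x \<in> group_algebra n \<Longrightarrow> L g x \<in> group_algebra n"
  by (rule reg.U_closed)

lemma c_eq: "c = (\<Sum>h\<in>R. L h b)"
proof -
  have "c = (\<Sum>g | g permutes {1..n}. (if g \<in> R then 1 else 0) *\<^sub>R L g b)"
    unfolding c_def young_symmetrizer_def ga_mult_eq_ext reg.ext_def b_def ..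
  also have "\<dots> = (\<Sum>g\<in>R. (if g \<in> R then 1 else 0) *\<^sub>R L g b)"
    using R_perm by (intro sum.mono_neutral_right) auto
  finally show ?thesis by simp
qed

lemma c_in: "c \<in> group_algebra n"
  unfolding c_eq using R_perm b_in by (intro real_vector.subspace_sum reg.sub L_closed) auto

lemma L_R_c:
  assumes p: "p \<in> R" shows "L p c = c"
proof -
  have pn: "p permutes {1..n}" using R_perm p by auto
  have "L p c = (\<Sum>h\<in>R. L (p \<circ> h) b)"
    unfolding c_eq linear_sum[OF reg.U_lin[OF pn]]
    using reg.U_comp[OF pn R_perm b_in] by (intro sum.cong) auto
  also have "\<dots> = (\<Sum>h\<in>R. L h b)"
    by (rule sum.reindex_bij_witness[where i = "\<lambda>h. Hilbert_Choice.inv p \<circ> h" and j = "\<lambda>h. p \<circ> h"])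
       (auto simp: comp_assoc[symmetric] permutes_inv_o[OF pn] R_comp p inv_R)
  finally show ?thesis by (simp add: c_eq)
qed

lemma L_tr_b:
  assumes t: "tr x y \<in> C" "x \<noteq> y" shows "L (tr x y) b = - b"
proof
  fix g
  let ?t = "tr x y"
  have iff: "?t \<circ> g \<in> C \<longleftrightarrow> g \<in> C"
  proof
    assume "?t \<circ> g \<in> C"
    then have "?t \<circ> (?t \<circ> g) \<in> C" using C_comp t by blast
    then show "g \<in> C" by (simp add: comp_assoc[symmetric])
  qed (use C_comp t in auto)
  show "L ?t b g = (- b) g"
  proof (cases "g \<in> C")
    case True
    then have "permutation g" "permutation ?t" using C_perm permutation_permutes by (blast intro: permutation_swap_id)+
    then have "sign (?t \<circ> g) = - sign g" using t by (simp add: sign_compose sign_swap_id)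
    then show ?thesis using True iff C_perm[OF True] by (simp add: b_def ltrans_def)
  next
    case False
    then show ?thesis using iff by (simp add: b_def ltrans_def)
  qed
qed

text \<open>
  The sum over the permutations of a row enlarged by one entry further down annihilates \<open>b\<close>: each
  of its terms is paired with its product with a transposition in a column.
\<close>

lemma garnir:
  assumes rq: "(r, q) \<in> Y" and r': "r' < r"
  shows "c + (\<Sum>i\<in>row r'. L (tr i (T (r, q))) c) = 0"
proof -
  let ?j = "T (r, q)"
  let ?S = "{p. p permutes (insert ?j (row r'))}"
  have jn: "?j \<notin> row r'"
  proof
    assume "?j \<in> row r'"
    then obtain j where "(r', j) \<in> Y" "?j = T (r', j)" by (auto simp: row_def)
    then show False using row_tableau_inj[OF rq] r' by auto
  qed
  have sub: "insert ?j (row r') \<subseteq> {1..n}" using row_subset T_range rq by auto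
  have Sn: "p permutes {1..n}" if "p \<in> ?S" for p using that permutes_subset[OF _ sub] by auto
  have zero: "(\<Sum>p\<in>?S. L (p \<circ> h) b) = 0" if h: "h \<in> R" for h
  proof -
    have hn: "h permutes {1..n}" using R_perm h by auto
    \<comment> \<open>The cell holding h^{-1} j lies in row r; above it, in row r', there is a cell
      of the same column because rows decrease. The transposition t of these two entries lies in C,
      and h t = u h with u permuting the enlarged row, so right multiplication by u pairs the terms
      with opposite signs.\<close>
    obtain q' where q': "(r, q') \<in> Y" "Hilbert_Choice.inv h ?j = T (r, q')" using R_row[OF inv_R[OF h] rq] by auto
    have "lam ! r \<le> lam ! r'" using lam_facts(2) r' q'(1) by (auto simp: sorted_wrt_iff_nth_less young_diagram_def)
    then have rr: "(r', q') \<in> Y" using q'(1) r' by (auto simp: young_diagram_def)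
    obtain q'' where q'': "(r', q'') \<in> Y" "h (T (r', q')) = T (r', q'')" using R_row[OF h rr] by auto
    let ?t = "tr (T (r', q')) (T (r, q'))" and ?u = "tr (T (r', q'')) ?j"
    have tC: "?t \<in> C" using tr_col rr q' by auto
    have ne: "T (r', q') \<noteq> T (r, q')" using row_tableau_inj rr q' r' by blast
    have hj: "h (T (r, q')) = ?j" using q'(2) permutes_inverses(1)[OF hn] by metis
    have uh: "?u \<circ> h = h \<circ> ?t"
    proof -
      have "h x = h y \<longleftrightarrow> x = y" for x y using inj_eq[OF permutes_inj[OF hn]] .
      then show ?thesis unfolding hj[symmetric] q''(2)[symmetric] by (auto simp: fun_eq_iff Transposition.transpose_def)
    qed
    have uS: "?u permutes (insert ?j (row r'))" using q'' by (intro tr_permutes) (auto simp: row_def)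
    have "(\<Sum>p\<in>?S. L (p \<circ> h) b) = (\<Sum>p\<in>?S. L (p \<circ> ?u \<circ> h) b)"
      using sum_permutations_compose_right[OF uS, of "\<lambda>p. L (p \<circ> h) b"] .
    also have "\<dots> = (\<Sum>p\<in>?S. - L (p \<circ> h) b)"
    proof (rule sum.cong[OF refl])
      fix p assume p: "p \<in> ?S"
      have "L (p \<circ> ?u \<circ> h) b = L ((p \<circ> h) \<circ> ?t) b" using uh by (metis comp_assoc)
      also have "\<dots> = L (p \<circ> h) (L ?t b)"
        using reg.U_comp[OF permutes_compose[OF hn Sn[OF p]] C_perm[OF tC] b_in] .
      also have "\<dots> = - L (p \<circ> h) b"
        unfolding L_tr_b[OF tC ne] by (rule linear_neg[OF reg.U_lin[OF permutes_compose[OF hn Sn[OF p]]]])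
      finally show "L (p \<circ> ?u \<circ> h) b = - L (p \<circ> h) b" .
    qed
    also have "\<dots> = - (\<Sum>p\<in>?S. L (p \<circ> h) b)" by (rule sum_negf)
    finally show ?thesis by (rule eq_minus_self)
  qed
  have "(\<Sum>p\<in>?S. L p c) = (\<Sum>p\<in>?S. \<Sum>h\<in>R. L (p \<circ> h) b)"
    unfolding c_eq using linear_sum[OF reg.U_lin[OF Sn]] reg.U_comp[OF Sn R_perm b_in]
    by (intro sum.cong) auto
  also have "\<dots> = 0" by (subst sum.swap) (simp add: zero)
  finally have "(\<Sum>p\<in>?S. L p c) = 0" .
  \<comment> \<open>Each permutation of the enlarged row is (j i) times a permutation of the row
    itself, and the latter fixes \<open>c\<close>; dividing by the factorial leaves one
    transposition for each i, with i = j giving the identity.\<close>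
  moreover have "(\<Sum>p\<in>?S. L p c) = (\<Sum>i\<in>insert ?j (row r'). \<Sum>q | q permutes (row r'). L (tr ?j i \<circ> q) c)"
    by (rule sum_over_permutations_insert) (use jn in auto)
  moreover have "(\<Sum>q | q permutes (row r'). L (tr ?j i \<circ> q) c) = real (fact (card (row r'))) *\<^sub>R L (tr i ?j) c"
    if i: "i \<in> insert ?j (row r')" for i
  proof -
    have t: "tr ?j i permutes {1..n}" using i sub by (intro tr_permutes) auto
    have "(\<Sum>q | q permutes (row r'). L (tr ?j i \<circ> q) c) = (\<Sum>q | q permutes (row r'). L (tr ?j i) c)"
      using reg.U_comp[OF t R_perm c_in] L_R_c row_perm_R by (intro sum.cong) auto
    also have "\<dots> = real (card {q. q permutes (row r')}) *\<^sub>R L (tr ?j i) c" by (simp add: sum_constant_scaleR del: sum_constant)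
    finally show ?thesis by (simp add: card_permutations Transposition.transpose_commute)
  qed
  ultimately have "(\<Sum>i\<in>insert ?j (row r'). real (fact (card (row r'))) *\<^sub>R L (tr i ?j) c) = 0" by simp
  then have "real (fact (card (row r'))) *\<^sub>R (\<Sum>i\<in>insert ?j (row r'). L (tr i ?j) c) = 0"
    by (simp add: scaleR_sum_right)
  then have "(\<Sum>i\<in>insert ?j (row r'). L (tr i ?j) c) = 0" by simp
  then show ?thesis using jn reg.U_id[OF c_in] by (simp add: id_def)
qed

text \<open>The smaller entries are split by rows: every row above contributes -1 by
  \<open>garnir\<close>, and each of the q entries to the left in the same row contributes +1
  because row permutations fix \<open>c\<close>.\<close>

lemma X_c:
  assumes "(r, q) \<in> Y"
  shows "reg.X (T (r, q)) c = (real q - real r) *\<^sub>R c"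
proof -
  let ?j = "T (r, q)" and ?s = "\<lambda>i. sum_list (take i lam)"
  have rl: "r < length lam" "q < lam ! r" using assms by (auto simp: young_diagram_def)
  have rows: "(\<Sum>i=1..?s r'. L (tr i ?j) c) = (- real r') *\<^sub>R c" if "r' \<le> r" for r'
    using that
  proof (induction r')
    case (Suc r')
    have l: "r' < length lam" using Suc.prems rl by auto
    have "?s (Suc r') = ?s r' + lam ! r'" using l by (simp add: take_Suc_conv_app_nth)
    then have "{1..?s (Suc r')} = {1..?s r'} \<union> row r'" "{1..?s r'} \<inter> row r' = {}"
      using l by (auto simp: row_eq)
    then have "(\<Sum>i=1..?s (Suc r'). L (tr i ?j) c) = (\<Sum>i=1..?s r'. L (tr i ?j) c) + (\<Sum>i\<in>row r'. L (tr i ?j) c)"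
      by (simp add: sum.union_disjoint)
    also have "(\<Sum>i\<in>row r'. L (tr i ?j) c) = - c"
      using garnir[OF assms, of r'] Suc.prems by (simp add: eq_neg_iff_add_eq_0 add.commute)
    also have "(\<Sum>i=1..?s r'. L (tr i ?j) c) = (- real r') *\<^sub>R c" by (rule Suc.IH) (use Suc.prems in simp)
    also have "(- real r') *\<^sub>R c + - c = (- real (Suc r')) *\<^sub>R c" by (simp add: fun_eq_iff algebra_simps)
    finally show ?case .
  qed simp
  have j: "?j = ?s r + q + 1" by (simp add: row_tableau_def)
  have "L (tr i ?j) c = c" if i: "i \<in> {?s r + 1..<?j}" for i
  proof -
    have "(r, i - ?s r - 1) \<in> Y" "i = T (r, i - ?s r - 1)"
      using i j rl by (auto simp: young_diagram_def row_tableau_def)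
    then show ?thesis using tr_row assms L_R_c by metis
  qed
  then have "(\<Sum>i\<in>{?s r + 1..<?j}. L (tr i ?j) c) = real q *\<^sub>R c"
    using j by (simp add: sum_constant_scaleR del: sum_constant)
  moreover have "{1..<?j} = {1..?s r} \<union> {?s r + 1..<?j}" "{1..?s r} \<inter> {?s r + 1..<?j} = {}" using j by auto
  ultimately have "reg.X ?j c = (- real r) *\<^sub>R c + real q *\<^sub>R c"
    unfolding reg.X_def using rows[OF order_refl] by (simp add: sum.union_disjoint)
  then show ?thesis by (simp add: algebra_simps)
qed

lemma c_weight: "reg.weight (wt_of (cont lam)) c"
  unfolding reg.weight_def
proof (intro conjI ballI c_in)
  fix j assume "j \<in> {1..n}"
  then obtain r q where rq: "(r, q) \<in> Y" "T (r, q) = j" using T_surj by blast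
  show "reg.X j c = of_int (wt_of (cont lam) j) *\<^sub>R c"
    using X_c[OF rq(1)] cont_row_tableau[OF rq(1)] rq(2) by simp
qed

text \<open>Row and column stabilizer meet in the identity only, so the coefficient of
  \<open>c\<close> at the identity is 1.\<close>

lemma c_nonzero: "c \<noteq> 0"
proof -
  have RC: "h = id" if "h \<in> R" "Hilbert_Choice.inv h \<in> C" for h
  proof -
    have "Hilbert_Choice.inv h x = x" for x
    proof (cases "x \<in> {1..n}")
      case True
      then obtain i j where ij: "(i, j) \<in> Y" "T (i, j) = x" using T_surj by blast
      then show ?thesis using R_row[OF inv_R[OF that(1)] ij(1)] C_col[OF that(2) ij(1)] row_tableau_inj by metis
    next
      case False
      then show ?thesis using permutes_not_in[OF permutes_inv[OF R_perm[OF that(1)]]] by auto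
    qed
    then have "Hilbert_Choice.inv h = id" by auto
    then show ?thesis using permutes_inv_inv[OF R_perm[OF that(1)]] by (metis inv_id)
  qed
  have "id \<in> R" by (rule R_I) (auto simp: permutes_id)
  have "id \<in> C" by (rule C_I) (auto simp: permutes_id)
  have "c id = (\<Sum>h\<in>R. L h b id)" unfolding c_eq by (rule sum_fun_apply)
  also have "\<dots> = (\<Sum>h\<in>R. if h = id then 1 else 0)"
    using RC \<open>id \<in> C\<close> by (intro sum.cong) (auto simp: ltrans_def b_def permutes_id)
  also have "\<dots> = 1" using \<open>id \<in> R\<close> by simp
  finally show ?thesis by auto
qed

text \<open>The left ideal ranges over group algebra elements, the cyclic module over all functions;
  the action sees values on the group only, so cutting a function off outside changes
  nothing.\<close>

lemma specht_module_eq: "specht_module n lam = reg.cyc c"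
proof -
  have "reg.ext x c \<in> (\<lambda>x. reg.ext x c) ` group_algebra n" for x
  proof -
    have "reg.ext x c = reg.ext (\<lambda>g. if g permutes {1..n} then x g else 0) c"
      unfolding reg.ext_def by (intro sum.cong) auto
    then show ?thesis by (rule image_eqI[of _ _ "\<lambda>g. if g permutes {1..n} then x g else 0"]) (simp add: group_algebra_iff)
  qed
  then show ?thesis unfolding specht_module_def ga_mult_eq_ext c_def[symmetric] reg.cyc_def by auto
qed

end

section \<open>Matrix representations as representations on functions\<close>

text \<open>Vectors of length d as functions vanishing from d on: one type for all dimensions, with
  the vector space structure of the type class.\<close>

definition fvecs :: "nat \<Rightarrow> (nat \<Rightarrow> real) set" where
  "fvecs d = {v. \<forall>i\<ge>d. v i = 0}"

definition mact :: "nat \<Rightarrow> real mat \<Rightarrow> (nat \<Rightarrow> real) \<Rightarrow> nat \<Rightarrow> real" where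
  "mact d M v = (\<lambda>i. if i < d then \<Sum>j<d. M $$ (i, j) * v j else 0)"

definition vip :: "nat \<Rightarrow> (nat \<Rightarrow> real) \<Rightarrow> (nat \<Rightarrow> real) \<Rightarrow> real" where
  "vip d v w = (\<Sum>i<d. v i * w i)"

definition fn :: "real vec \<Rightarrow> nat \<Rightarrow> real" where
  "fn v = (\<lambda>i. if i < dim_vec v then v $ i else 0)"

lemma fn_in [simp]: "v \<in> carrier_vec d \<Longrightarrow> fn v \<in> fvecs d"
  by (auto simp: fn_def fvecs_def)

lemma fn_vec [simp]: "f \<in> fvecs d \<Longrightarrow> fn (vec d f) = f"
  by (auto simp: fn_def fvecs_def fun_eq_iff)

lemma vec_fn [simp]: "v \<in> carrier_vec d \<Longrightarrow> vec d (fn v) = v"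
  by (auto simp: fn_def)

lemma fn_inj: "v \<in> carrier_vec d \<Longrightarrow> w \<in> carrier_vec d \<Longrightarrow> fn v = fn w \<Longrightarrow> v = w"
  by (metis vec_fn)

lemma fn_add: "v \<in> carrier_vec d \<Longrightarrow> w \<in> carrier_vec d \<Longrightarrow> fn (v + w) = fn v + fn w"
  by (auto simp: fn_def fun_eq_iff)

lemma fn_smult: "fn (c \<cdot>\<^sub>v v) = c *\<^sub>R fn v"
  by (auto simp: fn_def fun_eq_iff)

lemma fn_zero: "fn (0\<^sub>v d) = 0"
  by (auto simp: fn_def fun_eq_iff)

lemma fn_mult: "M \<in> carrier_mat d d \<Longrightarrow> v \<in> carrier_vec d \<Longrightarrow> fn (M *\<^sub>v v) = mact d M (fn v)"
  by (auto simp: fn_def mact_def fun_eq_iff scalar_prod_def atLeast0LessThan intro!: sum.cong)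

lemma subspace_fvecs: "real_vector.subspace (fvecs d)"
  by (auto simp: real_vector.subspace_def fvecs_def)

lemma mact_in [simp]: "mact d M v \<in> fvecs d"
  by (auto simp: mact_def fvecs_def)

lemma mact_linear: "linear (mact d M)"
  by (rule linearI) (auto simp: mact_def fun_eq_iff algebra_simps sum.distrib sum_distrib_left)

lemma mact_one: "v \<in> fvecs d \<Longrightarrow> mact d (1\<^sub>m d) v = v"
  by (auto simp: mact_def fvecs_def fun_eq_iff one_mat_def if_distrib[of "\<lambda>x. x * _"] cong: if_cong)

lemma mact_mult:
  assumes "A \<in> carrier_mat d d" "B \<in> carrier_mat d d"
  shows "mact d (A * B) v = mact d A (mact d B v)"
proof
  fix i
  have "(\<Sum>j<d. (\<Sum>k<d. A $$ (i, k) * B $$ (k, j)) * v j) = (\<Sum>k<d. A $$ (i, k) * (\<Sum>j<d. B $$ (k, j) * v j))" if "i < d"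
    unfolding sum_distrib_left sum_distrib_right by (subst sum.swap) (simp add: mult.assoc)
  then show "mact d (A * B) v i = mact d A (mact d B v) i"
    using assms by (simp add: mact_def scalar_prod_def atLeast0LessThan)
qed

lemma mact_unit: "j < d \<Longrightarrow> mact d M (\<lambda>i. if i = j then 1 else 0) = (\<lambda>i. if i < d then M $$ (i, j) else 0)"
  by (auto simp: mact_def fun_eq_iff if_distrib[of "\<lambda>x. _ * x"] cong: if_cong)

lemma vip_linear: "linear (\<lambda>v. vip d v w)"
  by (rule linearI) (auto simp: vip_def algebra_simps sum.distrib sum_distrib_left)

lemma vip_sym: "vip d v w = vip d w v"
  by (simp add: vip_def mult.commute)

lemma vip_pos: "v \<in> fvecs d \<Longrightarrow> v \<noteq> 0 \<Longrightarrow> vip d v v > 0"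
proof -
  assume v: "v \<in> fvecs d" "v \<noteq> 0"
  then obtain i where i: "v i \<noteq> 0" by (auto simp: fun_eq_iff)
  then have "i < d" using v by (auto simp: fvecs_def not_le[symmetric])
  then have "v i * v i \<le> vip d v v" unfolding vip_def by (intro member_le_sum) auto
  moreover have "v i * v i > 0" using i by (metis mult_eq_0_iff zero_le_square order_le_less)
  ultimately show ?thesis by linarith
qed

lemma vip_adjoint:
  assumes "A \<in> carrier_mat d d" shows "vip d (mact d A v) w = vip d v (mact d (transpose_mat A) w)"
proof -
  have "vip d (mact d A v) w = (\<Sum>i<d. \<Sum>j<d. A $$ (i, j) * v j * w i)"
    by (simp add: vip_def mact_def sum_distrib_right)
  also have "\<dots> = (\<Sum>j<d. \<Sum>i<d. A $$ (i, j) * v j * w i)" by (rule sum.swap)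
  also have "\<dots> = vip d v (mact d (transpose_mat A) w)"
    using assms by (simp add: vip_def mact_def sum_distrib_left mult_ac)
  finally show ?thesis .
qed

section \<open>Matrix representations as instances of the abstract locales\<close>

locale mat_rep =
  fixes n d :: nat and \<rho> :: "(nat \<Rightarrow> nat) \<Rightarrow> real mat"
  assumes carr: "g permutes {1..n} \<Longrightarrow> \<rho> g \<in> carrier_mat d d"
    and comp: "g permutes {1..n} \<Longrightarrow> h permutes {1..n} \<Longrightarrow> \<rho> (g \<circ> h) = \<rho> g * \<rho> h"
    and one: "\<rho> id = 1\<^sub>m d"
begin

sublocale sym_rep n "fvecs d" "\<lambda>g. mact d (\<rho> g)"
  by (rule sym_rep.intro) (auto simp: subspace_fvecs mact_linear one mact_one comp mact_mult carr)

end

locale orth_mat_rep = mat_rep +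
  assumes orth: "g permutes {1..n} \<Longrightarrow> transpose_mat (\<rho> g) * \<rho> g = 1\<^sub>m d"
begin

sublocale orth_rep n "fvecs d" "\<lambda>g. mact d (\<rho> g)" "vip d"
proof (intro orth_rep.intro sym_rep_axioms orth_rep_axioms.intro)
  show "vip d (mact d (\<rho> g) v) (mact d (\<rho> g) w) = vip d v w"
    if "g permutes {1..n}" "v \<in> fvecs d" "w \<in> fvecs d" for g v w
    using that carr[OF that(1)]
    by (simp add: vip_adjoint mact_mult[symmetric] orth mact_one)
qed (auto simp: vip_linear vip_pos intro: vip_sym)

end

lemma orth_mat_rep_hom:
  "orth_mat_rep n d \<rho> \<longleftrightarrow> \<rho> \<in> hom (sym_group n) (orthogonal_group d)"
proof
  assume "orth_mat_rep n d \<rho>"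
  then interpret orth_mat_rep n d \<rho> .
  show "\<rho> \<in> hom (sym_group n) (orthogonal_group d)"
    by (auto simp: hom_def sym_group_def orthogonal_group_def carr orth comp)
next
  assume hom: "\<rho> \<in> hom (sym_group n) (orthogonal_group d)"
  then have c: "\<rho> g \<in> carrier_mat d d" "transpose_mat (\<rho> g) * \<rho> g = 1\<^sub>m d" if "g permutes {1..n}" for g
    using that by (auto simp: hom_def sym_group_def orthogonal_group_def)
  have m: "\<rho> (g \<circ> h) = \<rho> g * \<rho> h" if "g permutes {1..n}" "h permutes {1..n}" for g h
    using hom that by (auto simp: hom_def sym_group_def orthogonal_group_def)
  \<comment> \<open>A homomorphism is only known to be multiplicative, so the image of the identity
    is an idempotent orthogonal matrix; cancelling one factor gives the unit matrix.\<close>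
  let ?A = "\<rho> id"
  have A: "?A \<in> carrier_mat d d" "transpose_mat ?A * ?A = 1\<^sub>m d" "?A * ?A = ?A"
    using c[of id] m[of id id] by (auto simp: permutes_id)
  have "1\<^sub>m d = transpose_mat ?A * (?A * ?A)" using A by simp
  also have "\<dots> = ?A" using A by (subst assoc_mult_mat[symmetric, of _ d d _ d _ d]) auto
  finally show "orth_mat_rep n d \<rho>"
    using c m by unfold_locales auto
qed

lemma carrier_GL:
  "P \<in> carrier (GL d) \<longleftrightarrow> P \<in> carrier_mat d d \<and> (\<exists>Q\<in>carrier_mat d d. Q * P = 1\<^sub>m d \<and> P * Q = 1\<^sub>m d)"
  by (auto simp: GL_def units_of_carrier Units_def ring_mat_simps)

lemma mat_rep_GL:
  assumes hom: "\<rho> \<in> hom (sym_group n) (GL d)"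
  shows "mat_rep n d \<rho>"
proof -
  have c: "\<rho> g \<in> carrier (GL d)" if "g permutes {1..n}" for g
    using hom that by (auto simp: hom_def sym_group_def)
  have m: "\<rho> (g \<circ> h) = \<rho> g * \<rho> h" if "g permutes {1..n}" "h permutes {1..n}" for g h
    using hom that by (auto simp: hom_def sym_group_def GL_def units_of_mult ring_mat_simps)
  let ?A = "\<rho> id"
  obtain B where A: "?A \<in> carrier_mat d d" "B \<in> carrier_mat d d" "B * ?A = 1\<^sub>m d" "?A * ?A = ?A"
    using c[of id] m[of id id] by (auto simp: permutes_id carrier_GL)
  have "1\<^sub>m d = B * (?A * ?A)" using A by simp
  also have "\<dots> = ?A" using A by (subst assoc_mult_mat[symmetric, of _ d d _ d _ d]) auto
  finally show ?thesis using c m by unfold_locales (auto simp: carrier_GL)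
qed

lemma orthogonal_mult_transpose:
  assumes "Q \<in> carrier_mat d d" "transpose_mat Q * Q = 1\<^sub>m d"
  shows "Q * transpose_mat Q = 1\<^sub>m (d::nat) \<and> (Q :: real mat) \<in> carrier (GL d)"
proof -
  have "Q * transpose_mat Q = 1\<^sub>m d" using mat_mult_left_right_inverse[of "transpose_mat Q" d Q] assms by auto
  then show ?thesis using assms by (auto simp: carrier_GL intro!: bexI[of _ "transpose_mat Q"])
qed

lemma hom_orthogonal_GL:
  "\<rho> \<in> hom (sym_group n) (orthogonal_group d) \<Longrightarrow> \<rho> \<in> hom (sym_group n) (GL d)"
  using orthogonal_mult_transpose
  by (auto simp: hom_def orthogonal_group_def GL_def units_of_mult ring_mat_simps Pi_iff)

section \<open>Irreducibility and Specht modules for matrix representations\<close>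

lemma subspace_class_ring_iff:
  "VectorSpace.subspace class_ring W (module_vec TYPE(real) d) \<longleftrightarrow>
   W \<subseteq> carrier_vec d \<and> 0\<^sub>v d \<in> W \<and> (\<forall>v\<in>W. \<forall>w\<in>W. v + w \<in> W) \<and> (\<forall>c. \<forall>v\<in>W. c \<cdot>\<^sub>v v \<in> W)"
  using vec_vs[where ?'a = real and n = d] vec_module[where ?'a = real and n = d]
  unfolding VectorSpace.subspace_def submodule_def
  by (auto simp: module_vec_simps)

context mat_rep
begin

lemma irreducible_inv_sub:
  assumes irr: "irreducible_rep n d \<rho>" and W: "inv_sub W"
  shows "W = {0} \<or> W = fvecs d"
proof -
  define W' where "W' = {v \<in> carrier_vec d. fn v \<in> W}"
  have s: "real_vector.subspace W" "W \<subseteq> fvecs d" "\<And>g v. g permutes {1..n} \<Longrightarrow> v \<in> W \<Longrightarrow> mact d (\<rho> g) v \<in> W"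
    using W by (auto simp: inv_sub_def)
  have "VectorSpace.subspace class_ring W' (module_vec TYPE(real) d)"
    unfolding subspace_class_ring_iff W'_def
    using s(1) by (auto simp: fn_add fn_smult fn_zero real_vector.subspace_0 real_vector.subspace_add real_vector.subspace_scale)
  moreover have "\<forall>g\<in>carrier (sym_group n). \<forall>w\<in>W'. \<rho> g *\<^sub>v w \<in> W'"
  proof (intro ballI)
    fix g w assume "g \<in> carrier (sym_group n)" "w \<in> W'"
    then have g: "g permutes {1..n}" and w: "w \<in> carrier_vec d" "fn w \<in> W" by (auto simp: W'_def sym_group_carrier)
    show "\<rho> g *\<^sub>v w \<in> W'"
      unfolding W'_def using s(3)[OF g w(2)] fn_mult[OF carr[OF g] w(1)] mult_mat_vec_carrier[OF carr[OF g] w(1)] by simp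
  qed
  ultimately have "W' = {0\<^sub>v d} \<or> W' = carrier_vec d" using irr by (auto simp: irreducible_rep_def)
  moreover have WW: "W = fn ` W'"
  proof -
    have "w \<in> fn ` W'" if "w \<in> W" for w
      using that s(2) by (intro image_eqI[of _ _ "vec d w"]) (auto simp: W'_def)
    then show ?thesis by (auto simp: W'_def)
  qed
  moreover have "fn ` carrier_vec d = fvecs d"
  proof -
    have "w \<in> fn ` carrier_vec d" if "w \<in> fvecs d" for w
      using that by (intro image_eqI[of _ _ "vec d w"]) auto
    then show ?thesis by auto
  qed
  ultimately show ?thesis by (auto simp: fn_zero)
qed

lemma irreducibleI:
  assumes "\<rho> \<in> hom (sym_group n) (GL d)" "d \<ge> 1" and irr: "\<And>W. inv_sub W \<Longrightarrow> W = {0} \<or> W = fvecs d"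
  shows "irreducible_rep n d \<rho>"
  unfolding irreducible_rep_def
proof (intro conjI allI impI assms(1,2), elim conjE)
  fix W
  assume sub: "VectorSpace.subspace class_ring W (module_vec TYPE(real) d)"
    and inv: "\<forall>g\<in>carrier (sym_group n). \<forall>w\<in>W. \<rho> g *\<^sub>v w \<in> W"
  note W = sub[unfolded subspace_class_ring_iff]
  have Wc: "w \<in> carrier_vec d" if "w \<in> W" for w using W that by auto
  have WW: "W = vec d ` (fn ` W)" using Wc by (force simp: image_image)
  have "inv_sub (fn ` W)" unfolding inv_sub_def
  proof (intro conjI allI impI)
    show "real_vector.subspace (fn ` W)" unfolding real_vector.subspace_def
    proof (intro conjI ballI allI)
      show "0 \<in> fn ` W" using W fn_zero by (metis imageI)
      show "x + y \<in> fn ` W" if "x \<in> fn ` W" "y \<in> fn ` W" for x y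
        using that W Wc fn_add by (smt (verit) imageE imageI)
      show "c *\<^sub>R x \<in> fn ` W" if "x \<in> fn ` W" for c x
        using that W fn_smult by (metis imageE imageI)
    qed
    show "fn ` W \<subseteq> fvecs d" using Wc by auto
    show "mact d (\<rho> g) v \<in> fn ` W" if "g permutes {1..n}" "v \<in> fn ` W" for g v
      using that inv Wc fn_mult[OF carr[OF that(1)]] by (force simp: sym_group_carrier)
  qed
  then consider "fn ` W = {0}" | "fn ` W = fvecs d" using irr by blast
  then show "W = {0\<^sub>v d} \<or> W = carrier_vec d"
  proof cases
    case 1
    have "vec d 0 = (0\<^sub>v d :: real vec)" by auto
    then show ?thesis using WW 1 by auto
  next
    case 2
    have "v \<in> W" if "v \<in> carrier_vec d" for v
    proof -
      have "fn v \<in> fn ` W" using 2 that by auto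
      then show ?thesis using fn_inj that Wc by blast
    qed
    then show ?thesis using Wc by blast
  qed
qed

end

text \<open>The character, extended linearly, at x. It is additive over blocks and invariant under
  isomorphism, so a suitable x counts constituents.\<close>

definition tr_coef :: "nat \<Rightarrow> nat \<Rightarrow> ((nat \<Rightarrow> nat) \<Rightarrow> real mat) \<Rightarrow> group_alg \<Rightarrow> real" where
  "tr_coef n d \<rho> x = (\<Sum>g | g permutes {1..n}. x g * (\<Sum>i<d. \<rho> g $$ (i, i)))"

definition lam_idem :: "nat \<Rightarrow> nat list \<Rightarrow> group_alg" where
  "lam_idem n lam = idem n (wt_of (cont lam))"

lemma (in mat_rep) tr_coef_ext:
  "tr_coef n d \<rho> x = (\<Sum>i<d. ext x (\<lambda>j. if j = i then 1 else 0) i)"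
proof -
  have "ext x (\<lambda>j. if j = i then 1 else 0) i = (\<Sum>g | g permutes {1..n}. x g * \<rho> g $$ (i, i))" if "i < d" for i
    using that unfolding ext_def by (simp add: sum_fun_apply mact_unit)
  then have "(\<Sum>i<d. ext x (\<lambda>j. if j = i then 1 else 0) i) = (\<Sum>i<d. \<Sum>g | g permutes {1..n}. x g * \<rho> g $$ (i, i))"
    by simp
  also have "\<dots> = tr_coef n d \<rho> x"
    unfolding tr_coef_def by (subst sum.swap) (simp add: sum_distrib_left)
  finally show ?thesis ..
qed

lemma fvecs_expand: "v \<in> fvecs d \<Longrightarrow> v = (\<Sum>i<d. v i *\<^sub>R (\<lambda>j. if j = i then 1 else 0))"
  by (auto simp: fun_eq_iff sum_fun_apply fvecs_def if_distrib[of "\<lambda>x. _ * x"] cong: if_cong)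

text \<open>On the Specht module the element acts as the projection to the weight space of the
  generator \<open>c\<close>, which is one-dimensional. The isomorphism \<Phi> transports this to
  \<rho>, where no invariant inner product is given; a projection of rank one has trace 1.\<close>

theorem (in mat_rep) tr_coef_indexed:
  assumes lam: "lam \<in> partitions_of n" and idx: "indexed_by n d \<rho> lam"
  shows "tr_coef n d \<rho> (lam_idem n lam) = 1"
proof -
  interpret S: specht n lam by unfold_locales fact
  let ?\<alpha> = "wt_of (cont lam)" and ?e = "lam_idem n lam"
  obtain \<Phi> where bij: "bij_betw \<Phi> (carrier_vec d) (specht_module n lam)"
    and add': "\<forall>v\<in>carrier_vec d. \<forall>w\<in>carrier_vec d. \<Phi> (v + w) = (\<lambda>g. \<Phi> v g + \<Phi> w g)"
    and scl': "\<forall>c. \<forall>v\<in>carrier_vec d. \<Phi> (c \<cdot>\<^sub>v v) = (\<lambda>g. c * \<Phi> v g)"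
    and act': "\<forall>g\<in>carrier (sym_group n). \<forall>v\<in>carrier_vec d. \<Phi> (\<rho> g *\<^sub>v v) = ga_mult n (ga_single g) (\<Phi> v)"
    using idx unfolding indexed_by_def by (elim exE conjE) (rule that)
  note add = add'[rule_format] and scl = scl'[rule_format] and act = act'[unfolded sym_group_carrier, rule_format]
  define F where "F = (\<lambda>v. \<Phi> (vec d v))"
  have Fin: "F v \<in> S.reg.cyc S.c" for v
    using bij S.specht_module_eq by (auto simp: F_def bij_betw_def)
  have cycin: "S.reg.cyc S.c \<subseteq> group_algebra n" using S.reg.cyc_inv_sub[OF S.c_in] by (auto simp: S.reg.inv_sub_def)
  have Fadd: "F (v + w) = F v + F w" if "v \<in> fvecs d" "w \<in> fvecs d" for v w
  proof -
    have "vec d (v + w) = vec d v + vec d w" by auto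
    then show ?thesis using add by (simp add: F_def fun_eq_iff)
  qed
  have Fscl: "F (a *\<^sub>R v) = a *\<^sub>R F v" if "v \<in> fvecs d" for v a
  proof -
    have "vec d (a *\<^sub>R v) = a \<cdot>\<^sub>v vec d v" by auto
    then show ?thesis using scl by (simp add: F_def fun_eq_iff)
  qed
  have F0: "F 0 = 0" using Fscl[of 0 0] by (simp add: fvecs_def)
  have Fsum: "F (sum f I) = (\<Sum>i\<in>I. F (f i))" if "finite I" "\<And>i. i \<in> I \<Longrightarrow> f i \<in> fvecs d" for f and I :: "'z set"
    using that
  proof (induction I rule: finite_induct)
    case (insert i I)
    then have "sum f I \<in> fvecs d" using real_vector.subspace_sum[OF subspace_fvecs] by blast
    moreover have "f i \<in> fvecs d" using insert by blast
    ultimately have "F (f i + sum f I) = F (f i) + F (sum f I)" using Fadd by blast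
    moreover have "F (sum f I) = (\<Sum>i\<in>I. F (f i))" using insert by blast
    ultimately show ?case by (simp only: sum.insert[OF insert(1,2)])
  qed (simp add: F0)
  have single: "ga_mult n (ga_single g) y = ltrans n g y" if g: "g permutes {1..n}" for g y
  proof -
    have "ga_mult n (ga_single g) y = (\<Sum>h | h permutes {1..n}. if h = g then ltrans n g y else 0)"
      unfolding ga_mult_eq_ext S.reg.ext_def by (intro sum.cong) (auto simp: ga_single_def)
    then show ?thesis using g by (simp add: sum.delta)
  qed
  have Fact: "F (mact d (\<rho> g) v) = ltrans n g (F v)" if "g permutes {1..n}" "v \<in> fvecs d" for g v
  proof -
    have "vec d (mact d (\<rho> g) v) = \<rho> g *\<^sub>v vec d v"
      using that carr[OF that(1)] fn_mult[of "\<rho> g" d "vec d v"] by (metis fn_vec mult_mat_vec_carrier vec_carrier vec_fn)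
    then show ?thesis using act[of g "vec d v"] single that by (simp add: F_def sym_group_carrier)
  qed
  have Fext: "F (ext x v) = S.reg.ext x (F v)" if "v \<in> fvecs d" for x v
    unfolding ext_def S.reg.ext_def
    using that real_vector.subspace_scale[OF subspace_fvecs] by (subst Fsum) (auto simp: Fscl Fact)
  have inj: "v = w" if "v \<in> fvecs d" "w \<in> fvecs d" "F v = F w" for v w
  proof -
    have "vec d v = vec d w" using bij that unfolding F_def bij_betw_def by (auto dest: inj_onD)
    then show ?thesis using that by (metis fn_vec)
  qed
  have "S.c \<in> \<Phi> ` carrier_vec d" using bij S.reg.cyc_self[OF S.c_in] S.specht_module_eq by (auto simp: bij_betw_def)
  then obtain v0 where v0: "v0 \<in> carrier_vec d" "S.c = \<Phi> v0" by blast
  define u where "u = fn v0"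
  have u: "u \<in> fvecs d" "F u = S.c" using v0 by (simp_all add: u_def F_def)
  have rank1: "\<exists>f. ext ?e v = f *\<^sub>R u" if v: "v \<in> fvecs d" for v
  proof -
    have "F (ext ?e v) = S.reg.Eop ?\<alpha> n (F v)"
      using Fext[OF v] S.reg.ext_idem Fin cycin by (metis lam_idem_def subsetD)
    moreover have "S.reg.weight ?\<alpha> (S.reg.Eop ?\<alpha> n (F v))" using S.reg.weight_Eop Fin cycin by blast
    moreover have "S.reg.Eop ?\<alpha> n (F v) \<in> S.reg.cyc S.c"
      using S.reg.Eop_inv_sub[OF S.reg.cyc_inv_sub[OF S.c_in] order_refl] Fin by blast
    ultimately obtain f where "F (ext ?e v) = f *\<^sub>R S.c" using S.reg.weight_in_cyc[OF S.c_weight S.c_nonzero] by metis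
    then have "F (ext ?e v) = F (f *\<^sub>R u)" using Fscl u by simp
    then show ?thesis using inj ext_closed[OF v] u real_vector.subspace_scale[OF subspace_fvecs] by blast
  qed
  let ?E = "\<lambda>i. (\<lambda>j. if j = i then 1 else 0 :: real)"
  have unit: "?E i \<in> fvecs d" if "i < d" for i using that by (auto simp: fvecs_def)
  have "\<exists>a. ext ?e (?E i) = a *\<^sub>R u" if "i < d" for i using rank1[OF unit[OF that]] .
  \<comment> \<open>The operator has the form v \<mapsto> f(v) u with a linear form f whose
    coefficients are \<open>f i\<close>. Its trace is f(u), and f(u) = 1 because u is fixed.\<close>
  then obtain f where f: "\<And>i. i < d \<Longrightarrow> ext ?e (?E i) = f i *\<^sub>R u" by (metis (mono_tags))
  have "F (ext ?e u) = S.c"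
    using Fext[OF u(1)] u(2) S.reg.ext_idem[OF S.c_in] S.reg.Eop_weight[OF S.c_weight order_refl] by (simp add: lam_idem_def)
  then have "ext ?e u = u" using inj ext_closed u by metis
  moreover have "ext ?e u = (\<Sum>i<d. u i * f i) *\<^sub>R u"
  proof -
    have "ext ?e u = ext ?e (\<Sum>i<d. u i *\<^sub>R ?E i)" using fvecs_expand[OF u(1)] by simp
    also have "\<dots> = (\<Sum>i<d. u i *\<^sub>R ext ?e (?E i))"
      by (simp only: linear_sum[OF ext_linear] linear_scale[OF ext_linear])
    also have "\<dots> = (\<Sum>i<d. u i * f i) *\<^sub>R u" using f by (simp add: scaleR_sum_left)
    finally show ?thesis .
  qed
  moreover have "u \<noteq> 0" using u F0 S.c_nonzero by auto
  ultimately have "((\<Sum>i<d. u i * f i) - 1) *\<^sub>R u = 0" "u \<noteq> 0" by (simp_all add: scaleR_left_diff_distrib)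
  then have "(\<Sum>i<d. u i * f i) = 1" by simp
  then show ?thesis unfolding tr_coef_ext using f by (simp add: mult.commute)
qed

text \<open>The vectors u = e w and c have the same annihilator in the group algebra, so x u
  \<mapsto> x c is a well-defined isomorphism of the modules they generate; by irreducibility u
  generates everything.\<close>

theorem (in mat_rep) indexed_by_if_nonzero:
  assumes lam: "lam \<in> partitions_of n" and irr: "irreducible_rep n d \<rho>"
    and w: "w \<in> fvecs d" "ext (lam_idem n lam) w \<noteq> 0"
  shows "indexed_by n d \<rho> lam"
proof -
  interpret S: specht n lam by unfold_locales fact
  let ?\<alpha> = "wt_of (cont lam)" and ?e = "lam_idem n lam"
  define u where "u = ext ?e w"
  have uV: "u \<in> fvecs d" and u0: "u \<noteq> 0" using w ext_closed by (auto simp: u_def)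
  have delta: "ga_single id \<in> group_algebra n" by (auto simp: group_algebra_iff ga_single_def permutes_id)
  have ew: "S.reg.weight ?\<alpha> ?e" unfolding lam_idem_def idem_def by (rule S.reg.weight_Eop[OF delta])
  \<comment> \<open>The element e is itself a vector of the same weight in the regular
    representation, so what kills c kills e, and then e w.\<close>
  have zero1: "ext x u = 0" if "S.reg.ext x S.c = 0" for x
  proof -
    have "S.reg.ext x ?e = 0"
      by (rule ext_eq_0_transfer[OF orth_rep_regular S.c_weight S.c_nonzero orth_rep_regular ew that])
    then have "ext x (ext ?e w) = ext 0 w" using ext_ga_mult[OF w(1) S.reg.weightD(1)[OF ew]] by metis
    then show ?thesis by (simp add: u_def ext_zero)
  qed
  \<comment> \<open>If x c were nonzero, it would generate the irreducible Specht module, so c = z x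
    c for some z. Then z x - 1 kills c, hence u, and u = z x u = 0.\<close>
  have zero2: "S.reg.ext x S.c = 0" if x: "ext x u = 0" for x
  proof (rule ccontr)
    assume ne: "S.reg.ext x S.c \<noteq> 0"
    let ?y = "S.reg.ext x S.c"
    have yV: "?y \<in> group_algebra n" using S.reg.ext_closed S.c_in by auto
    have "?y \<in> S.reg.cyc S.c" by (auto simp: S.reg.cyc_def)
    then have "S.reg.cyc ?y \<subseteq> S.reg.cyc S.c" using S.reg.cyc_minimal S.reg.cyc_inv_sub S.c_in by blast
    then have "S.reg.cyc ?y = S.reg.cyc S.c"
      using S.reg.cyc_irreducible[OF S.c_weight S.c_nonzero S.reg.cyc_inv_sub[OF yV]] S.reg.cyc_self[OF yV] ne by auto
    then obtain z where z: "S.c = S.reg.ext z ?y" using S.reg.cyc_self[OF S.c_in] by (auto simp: S.reg.cyc_def)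
    define y where "y = (\<lambda>g. if g permutes {1..n} then x g else 0)"
    have x': "y \<in> group_algebra n" by (simp add: group_algebra_iff y_def)
    have xx: "S.reg.ext y v = S.reg.ext x v" "ext y v' = ext x v'" for v v'
      unfolding S.reg.ext_def ext_def y_def by (auto intro!: sum.cong)
    have "S.reg.ext (S.reg.ext z y - ga_single id) S.c = 0"
      using z S.reg.ext_ga_mult[OF S.c_in x'] S.reg.ext_delta[OF S.c_in] by (simp add: S.reg.ext_diff xx)
    then have "ext (S.reg.ext z y - ga_single id) u = 0" by (rule zero1)
    then have "u = ext z (ext x u)" using ext_ga_mult[OF uV x'] ext_delta[OF uV] by (simp add: ext_diff xx)
    then show False using x u0 linear_0[OF ext_linear] by simp
  qed
  have cycu: "cyc u = fvecs d"
    using irreducible_inv_sub[OF irr cyc_inv_sub[OF uV]] cyc_self[OF uV] u0 by auto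
  \<comment> \<open>The choice of x is harmless: two candidates differ by an annihilator of u, which
    by \<open>zero1\<close> and \<open>zero2\<close> is the same as an annihilator of c.\<close>
  define \<Phi> where "\<Phi> v = S.reg.ext (SOME x. ext x u = fn v) S.c" for v
  have \<Phi>: "\<Phi> v = S.reg.ext x S.c" if "ext x u = fn v" for x v
  proof -
    have "ext (SOME x. ext x u = fn v) u = fn v" using someI[of "\<lambda>x. ext x u = fn v", OF that] .
    then have "ext ((SOME x. ext x u = fn v) - x) u = 0" using that by (simp add: ext_diff)
    then have "S.reg.ext ((SOME x. ext x u = fn v) - x) S.c = 0" by (rule zero2)
    then show ?thesis by (simp add: \<Phi>_def S.reg.ext_diff)
  qed
  have ex: "\<exists>x. ext x u = fn v" if "v \<in> carrier_vec d" for v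
  proof -
    have "fn v \<in> range (\<lambda>x. ext x u)" using fn_in[OF that] cycu by (simp only: cyc_def)
    then show ?thesis by (metis rangeE)
  qed
  show ?thesis unfolding indexed_by_def
  proof (intro exI[of _ \<Phi>] conjI ballI allI)
    show "bij_betw \<Phi> (carrier_vec d) (specht_module n lam)"
      unfolding bij_betw_def S.specht_module_eq
    proof (intro conjI inj_onI subset_antisym subsetI)
      fix v v' assume v: "v \<in> carrier_vec d" "v' \<in> carrier_vec d" and eq: "\<Phi> v = \<Phi> v'"
      obtain x x' where x: "ext x u = fn v" "ext x' u = fn v'" using ex v by metis
      then have "S.reg.ext (x - x') S.c = 0" using \<Phi> eq by (metis S.reg.ext_diff right_minus_eq)
      then have "ext (x - x') u = 0" by (rule zero1)
      then have "fn v = fn v'" using x by (simp add: ext_diff)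
      then show "v = v'" using fn_inj v by blast
    next
      fix y assume "y \<in> \<Phi> ` carrier_vec d"
      then show "y \<in> S.reg.cyc S.c" by (auto simp: \<Phi>_def S.reg.cyc_def)
    next
      fix y assume "y \<in> S.reg.cyc S.c"
      then obtain x where x: "y = S.reg.ext x S.c" by (auto simp: S.reg.cyc_def)
      have "ext x u \<in> fvecs d" using ext_closed[OF uV] .
      then have "\<Phi> (vec d (ext x u)) = y" unfolding x by (intro \<Phi>) simp
      then show "y \<in> \<Phi> ` carrier_vec d" by (metis imageI vec_carrier)
    qed
    show "\<Phi> (v + v') = (\<lambda>g. \<Phi> v g + \<Phi> v' g)" if v: "v \<in> carrier_vec d" "v' \<in> carrier_vec d" for v v'
    proof -
      obtain x x' where x: "ext x u = fn v" "ext x' u = fn v'" using ex v by metis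
      then have "\<Phi> (v + v') = S.reg.ext (x + x') S.c" using v by (intro \<Phi>) (simp add: ext_add fn_add)
      then show ?thesis using \<Phi>[OF x(1)] \<Phi>[OF x(2)] by (simp add: S.reg.ext_add fun_eq_iff)
    qed
    show "\<Phi> (a \<cdot>\<^sub>v v) = (\<lambda>g. a * \<Phi> v g)" if v: "v \<in> carrier_vec d" for a v
    proof -
      obtain x where x: "ext x u = fn v" using ex v by metis
      then have "\<Phi> (a \<cdot>\<^sub>v v) = S.reg.ext (a *\<^sub>R x) S.c" using v by (intro \<Phi>) (simp add: ext_scale fn_smult)
      then show ?thesis using \<Phi>[OF x] by (simp add: S.reg.ext_scale fun_eq_iff)
    qed
    show "\<Phi> (\<rho> g *\<^sub>v v) = ga_mult n (ga_single g) (\<Phi> v)" if g: "g \<in> carrier (sym_group n)" and v: "v \<in> carrier_vec d" for g v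
    proof -
      have g': "g permutes {1..n}" using g by (simp add: sym_group_carrier)
      obtain x where x: "ext x u = fn v" using ex v by metis
      have "\<Phi> (\<rho> g *\<^sub>v v) = S.reg.ext (ltrans n g x) S.c"
        using v x g' uV carr[OF g'] by (intro \<Phi>) (simp add: ext_ltrans fn_mult)
      also have "\<dots> = ltrans n g (\<Phi> v)" using \<Phi>[OF x] S.reg.ext_ltrans[OF g' S.c_in] by simp
      also have "\<dots> = (\<Sum>h | h permutes {1..n}. if h = g then ltrans n g (\<Phi> v) else 0)"
        using g' by (simp add: sum.delta)
      also have "\<dots> = ga_mult n (ga_single g) (\<Phi> v)"
        unfolding ga_mult_eq_ext S.reg.ext_def by (intro sum.cong) (auto simp: ga_single_def)
      finally show ?thesis .
    qed
  qed
qed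

corollary (in mat_rep) tr_coef_irreducible:
  assumes "lam \<in> partitions_of n" "irreducible_rep n d \<rho>"
  shows "tr_coef n d \<rho> (lam_idem n lam) = (if indexed_by n d \<rho> lam then 1 else 0)"
proof (cases "indexed_by n d \<rho> lam")
  case False
  have "ext (lam_idem n lam) (\<lambda>j. if j = i then 1 else 0) = 0" if "i < d" for i
    using indexed_by_if_nonzero[OF assms, of "\<lambda>j. if j = i then 1 else 0"] False that by (auto simp: fvecs_def)
  then show ?thesis using False by (simp add: tr_coef_ext)
qed (use tr_coef_indexed assms in auto)

section \<open>Gram--Schmidt bases of cyclic modules\<close>

definition gs_proj :: "('v \<Rightarrow> 'v \<Rightarrow> real) \<Rightarrow> 'v::real_vector list \<Rightarrow> 'v \<Rightarrow> 'v" where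
  "gs_proj ip bs u = u - (\<Sum>i<length bs. ip u (bs ! i) *\<^sub>R bs ! i)"

text \<open>By definiteness, the comparison 0 < <w, w>, which a program can evaluate, decides
  whether w is nonzero.\<close>

definition gs_ext :: "('v \<Rightarrow> 'v \<Rightarrow> real) \<Rightarrow> 'v::real_vector list \<Rightarrow> 'v \<Rightarrow> 'v list" where
  "gs_ext ip bs u = (let w = gs_proj ip bs u in
     if 0 < ip w w then bs @ [(1 / sqrt (ip w w)) *\<^sub>R w] else bs)"

primrec gs_row :: "('v \<Rightarrow> 'v \<Rightarrow> real) \<Rightarrow> (nat \<Rightarrow> 'v \<Rightarrow> 'v) \<Rightarrow> 'v \<Rightarrow> nat \<Rightarrow> 'v::real_vector list \<Rightarrow> 'v list" where
  "gs_row ip T b 0 bs = bs"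
| "gs_row ip T b (Suc l) bs = gs_ext ip (gs_row ip T b l bs) (T l b)"

text \<open>The list is basis and worklist at once: round m applies all generators to the m-th
  vector and appends what is new. Once m has passed the end of the list, nothing changes any
  more.\<close>

primrec gs :: "('v \<Rightarrow> 'v \<Rightarrow> real) \<Rightarrow> (nat \<Rightarrow> 'v \<Rightarrow> 'v) \<Rightarrow> nat \<Rightarrow> 'v::real_vector \<Rightarrow> nat \<Rightarrow> 'v list" where
  "gs ip T N v 0 = [v]"
| "gs ip T N v (Suc m) = (let bs = gs ip T N v m in if m < length bs then gs_row ip T (bs ! m) N bs else bs)"

definition orthonormal :: "('v \<Rightarrow> 'v \<Rightarrow> real) \<Rightarrow> 'v list \<Rightarrow> bool" where
  "orthonormal ip bs \<longleftrightarrow> (\<forall>i<length bs. \<forall>j<length bs. ip (bs ! i) (bs ! j) = (if i = j then 1 else 0))"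

lemma gs_ext_prefix: "\<exists>zs. gs_ext ip bs u = bs @ zs"
  by (auto simp: gs_ext_def Let_def)

lemma gs_row_prefix: "\<exists>zs. gs_row ip T b l bs = bs @ zs"
proof (induction l)
  case (Suc l)
  then show ?case using gs_ext_prefix by (metis append_assoc gs_row.simps(2))
qed simp

lemma gs_prefix: "\<exists>zs. gs ip T N v m = v # zs"
proof (induction m)
  case (Suc m)
  then show ?case using gs_row_prefix[of ip T _ N "gs ip T N v m"] by (auto simp: Let_def) (metis append_Cons)
qed simp

context orth_rep
begin

lemma gs_proj_in: "u \<in> V \<Longrightarrow> set bs \<subseteq> V \<Longrightarrow> gs_proj ip bs u \<in> V"
  unfolding gs_proj_def using sub
  by (auto intro!: real_vector.subspace_diff real_vector.subspace_sum real_vector.subspace_scale)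

lemma gs_proj_inv_sub: "inv_sub W \<Longrightarrow> u \<in> W \<Longrightarrow> set bs \<subseteq> W \<Longrightarrow> gs_proj ip bs u \<in> W"
  unfolding gs_proj_def inv_sub_def
  by (auto intro!: real_vector.subspace_diff real_vector.subspace_sum real_vector.subspace_scale)

lemma gs_proj_orth:
  assumes "orthonormal ip bs" "j < length bs" shows "ip (gs_proj ip bs u) (bs ! j) = 0"
proof -
  have "(\<Sum>i<length bs. ip u (bs ! i) * ip (bs ! i) (bs ! j)) = (\<Sum>i<length bs. if i = j then ip u (bs ! i) else 0)"
    using assms by (intro sum.cong) (auto simp: orthonormal_def)
  then show ?thesis using assms by (simp add: gs_proj_def ip_simps ip_sum)
qed

lemma gs_proj_snoc: "gs_proj ip (bs @ [b]) u = gs_proj ip bs u - ip u b *\<^sub>R b"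
  by (simp add: gs_proj_def nth_append)

lemma orthonormal_snoc:
  assumes "orthonormal ip bs" "ip b b = 1" "\<And>j. j < length bs \<Longrightarrow> ip b (bs ! j) = 0"
  shows "orthonormal ip (bs @ [b])"
  unfolding orthonormal_def
proof (intro allI impI)
  fix i j assume ij: "i < length (bs @ [b])" "j < length (bs @ [b])"
  have sym: "ip (bs ! k) b = 0" if "k < length bs" for k using assms(3)[OF that] by (subst ip_sym)
  show "ip ((bs @ [b]) ! i) ((bs @ [b]) ! j) = (if i = j then 1 else 0)"
    using ij assms sym unfolding orthonormal_def by (cases "i < length bs"; cases "j < length bs") (simp_all add: nth_append)
qed

lemma orthonormal_prefix: "orthonormal ip (bs @ cs) \<Longrightarrow> orthonormal ip bs"
  unfolding orthonormal_def
proof (intro allI impI)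
  fix i j assume h: "\<forall>i<length (bs @ cs). \<forall>j<length (bs @ cs). ip ((bs @ cs) ! i) ((bs @ cs) ! j) = (if i = j then 1 else 0)"
    and "i < length bs" "j < length bs"
  then show "ip (bs ! i) (bs ! j) = (if i = j then 1 else 0)" using h[rule_format, of i j] by (simp add: nth_append)
qed

text \<open>A zero residue means that u lies in the span of \<open>bs\<close>; later members are
  orthogonal to this span and subtract nothing.\<close>

lemma gs_proj_zero_append:
  assumes "orthonormal ip (bs @ cs)" "gs_proj ip bs u = 0"
  shows "gs_proj ip (bs @ cs) u = 0"
  using assms
proof (induction cs rule: rev_induct)
  case (snoc c cs)
  have on: "orthonormal ip (bs @ cs)" using snoc.prems orthonormal_prefix[of "bs @ cs" "[c]"] by simp
  then have z: "gs_proj ip (bs @ cs) u = 0" using snoc by blast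
  let ?ds = "bs @ cs"
  have u: "u = (\<Sum>i<length ?ds. ip u (?ds ! i) *\<^sub>R ?ds ! i)" using z unfolding gs_proj_def by simp
  have "ip (?ds ! i) c = 0" if "i < length ?ds" for i
    using snoc.prems(1) that unfolding orthonormal_def
    by (elim allE[of _ i] allE[of _ "length ?ds"] impE) (auto simp: nth_append split: if_splits)
  then have "ip u c = 0" by (subst u) (simp add: ip_sum ip_simps)
  then show ?case using z gs_proj_snoc[of ?ds c u] by simp
qed simp

lemma gs_ext_props:
  assumes on: "orthonormal ip bs" and W: "inv_sub W" "set bs \<subseteq> W" "u \<in> W"
  shows "orthonormal ip (gs_ext ip bs u)" "set (gs_ext ip bs u) \<subseteq> W" "gs_proj ip (gs_ext ip bs u) u = 0"
proof -
  let ?w = "gs_proj ip bs u"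
  have wW: "?w \<in> W" using gs_proj_inv_sub assms by blast
  then have wV: "?w \<in> V" using W by (auto simp: inv_sub_def)
  have "orthonormal ip (gs_ext ip bs u) \<and> set (gs_ext ip bs u) \<subseteq> W \<and> gs_proj ip (gs_ext ip bs u) u = 0"
  proof (cases "0 < ip ?w ?w")
    case True
    let ?r = "sqrt (ip ?w ?w)" and ?b = "(1 / sqrt (ip ?w ?w)) *\<^sub>R ?w"
    have r: "?r > 0" "?r * ?r = ip ?w ?w" using True by auto
    have e: "gs_ext ip bs u = bs @ [?b]" using True by (simp add: gs_ext_def Let_def)
    have "ip ?b ?b = 1" using r by (simp add: ip_simps field_simps)
    then have "orthonormal ip (bs @ [?b])"
      using on gs_proj_orth[OF on] by (intro orthonormal_snoc) (simp_all add: ip_simps)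
    moreover have "?b \<in> W" using wW W by (auto simp: inv_sub_def intro: real_vector.subspace_scale)
    moreover have "ip u ?w = ip ?w ?w"
    proof -
      have "ip (\<Sum>i<length bs. ip u (bs ! i) *\<^sub>R bs ! i) ?w = 0"
      proof -
        have "ip (bs ! i) ?w = 0" if "i < length bs" for i using gs_proj_orth[OF on that, of u] by (subst ip_sym)
        then show ?thesis by (simp add: ip_sum ip_simps)
      qed
      moreover have eq: "?w + (\<Sum>i<length bs. ip u (bs ! i) *\<^sub>R bs ! i) = u" by (simp add: gs_proj_def)
      ultimately show ?thesis using ip_simps(1)[of ?w "\<Sum>i<length bs. ip u (bs ! i) *\<^sub>R bs ! i" ?w] unfolding eq by linarith
    qed
    then have "ip u ?b *\<^sub>R ?b = ?w" using r by (simp add: ip_simps field_simps)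
    ultimately show ?thesis using e W by (simp add: gs_proj_snoc)
  next
    case False
    then have "?w = 0" using ip_pos[OF wV] by blast
    then show ?thesis using False on W by (simp add: gs_ext_def Let_def)
  qed
  then show "orthonormal ip (gs_ext ip bs u)" "set (gs_ext ip bs u) \<subseteq> W" "gs_proj ip (gs_ext ip bs u) u = 0" by auto
qed

abbreviation "tau \<equiv> \<lambda>l. U (tr (Suc l) (Suc (Suc l)))"

lemma tau_in: "inv_sub W \<Longrightarrow> Suc l < n \<Longrightarrow> v \<in> W \<Longrightarrow> tau l v \<in> W"
  using tr_n[of "Suc l" "Suc (Suc l)"] by (auto simp: inv_sub_def)

lemma gs_row_props:
  assumes "orthonormal ip bs" "inv_sub W" "set bs \<subseteq> W" "b \<in> W" "l \<le> n - 1"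
  shows "orthonormal ip (gs_row ip tau b l bs) \<and> set (gs_row ip tau b l bs) \<subseteq> W \<and>
    (\<forall>k<l. gs_proj ip (gs_row ip tau b l bs) (tau k b) = 0)"
  using assms(5)
proof (induction l)
  case 0
  then show ?case using assms by simp
next
  case (Suc l)
  let ?bs = "gs_row ip tau b l bs"
  have t: "tau l b \<in> W" using tau_in assms Suc.prems by auto
  have IH: "orthonormal ip ?bs" "set ?bs \<subseteq> W" "\<And>k. k < l \<Longrightarrow> gs_proj ip ?bs (tau k b) = 0" using Suc by auto
  note p = gs_ext_props[OF IH(1) assms(2) IH(2) t]
  obtain zs where zs: "gs_ext ip ?bs (tau l b) = ?bs @ zs" using gs_ext_prefix by blast
  have "gs_proj ip (gs_ext ip ?bs (tau l b)) (tau k b) = 0" if "k < Suc l" for k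
    using that p(3) IH(3) gs_proj_zero_append[of ?bs zs] p(1) zs by (cases "k = l") auto
  then show ?case using p by simp
qed

lemma gs_props:
  assumes v: "v \<in> V" "ip v v = 1"
  shows "orthonormal ip (gs ip tau (n - 1) v m) \<and> set (gs ip tau (n - 1) v m) \<subseteq> cyc v \<and>
    (\<forall>i<length (gs ip tau (n - 1) v m). i < m \<longrightarrow> (\<forall>l<n - 1. gs_proj ip (gs ip tau (n - 1) v m) (tau l (gs ip tau (n - 1) v m ! i)) = 0))"
proof (induction m)
  case 0
  then show ?case using v cyc_self by (simp add: orthonormal_def)
next
  case (Suc m)
  let ?bs = "gs ip tau (n - 1) v m"
  show ?case
  proof (cases "m < length ?bs")
    case False
    then show ?thesis using Suc by (auto simp: Let_def less_Suc_eq)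
  next
    case True
    let ?cs = "gs_row ip tau (?bs ! m) (n - 1) ?bs"
    have p: "orthonormal ip ?cs" "set ?cs \<subseteq> cyc v" "\<forall>k<n - 1. gs_proj ip ?cs (tau k (?bs ! m)) = 0"
      using gs_row_props[of ?bs "cyc v" "?bs ! m" "n - 1"] Suc cyc_inv_sub v True by (auto simp: subset_iff)
    obtain zs where zs: "?cs = ?bs @ zs" using gs_row_prefix by blast
    have "gs_proj ip ?cs (tau l (?cs ! i)) = 0" if "i < Suc m" "l < n - 1" for i l
    proof (cases "i = m")
      case False
      then have "gs_proj ip ?bs (tau l (?bs ! i)) = 0" "?cs ! i = ?bs ! i" using Suc that True zs by (auto simp: nth_append)
      then show ?thesis using gs_proj_zero_append[of ?bs zs] p(1) zs by simp
    qed (use p zs True that in \<open>auto simp: nth_append\<close>)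
    then show ?thesis using p True by (simp add: Let_def)
  qed
qed

text \<open>The bound on the length says that every member of the list has been processed. The span
  is then stable under the adjacent transpositions and contains v, while all members lie in the
  cyclic module.\<close>

lemma cyc_eq_gs_span:
  assumes v: "v \<in> V" "ip v v = 1" and len: "length (gs ip tau (n - 1) v m) \<le> m"
  shows "cyc v = {u \<in> V. gs_proj ip (gs ip tau (n - 1) v m) u = 0}"
proof -
  let ?bs = "gs ip tau (n - 1) v m"
  let ?W = "{u \<in> V. gs_proj ip ?bs u = 0}"
  note p = gs_props[OF v, of m]
  have cV: "cyc v \<subseteq> V" using cyc_inv_sub v by (auto simp: inv_sub_def)
  have exp: "u = (\<Sum>i<length ?bs. ip u (?bs ! i) *\<^sub>R ?bs ! i)" if "u \<in> ?W" for u
    using that unfolding gs_proj_def by simp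
  have sW: "real_vector.subspace ?W"
    unfolding real_vector.subspace_def using sub
    by (auto simp: gs_proj_def ip_simps real_vector.subspace_0 real_vector.subspace_add real_vector.subspace_scale
        scaleR_left_distrib sum.distrib scaleR_sum_right[symmetric] scaleR_scaleR[symmetric] simp del: scaleR_scaleR)
  have tW: "tau l u \<in> ?W" if u: "u \<in> ?W" and l: "Suc l < n" for u l
  proof -
    have t: "linear (tau l)" using l by (intro U_lin tr_n) auto
    have "tau l (?bs ! i) \<in> ?W" if "i < length ?bs" for i
    proof -
      have "?bs ! i \<in> V" using p that cV nth_mem by blast
      then show ?thesis using p that len l tau_in[OF inv_sub_V l] by auto
    qed
    then have "(\<Sum>i<length ?bs. ip u (?bs ! i) *\<^sub>R tau l (?bs ! i)) \<in> ?W"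
      by (intro real_vector.subspace_sum[OF sW] real_vector.subspace_scale[OF sW]) auto
    also have "(\<Sum>i<length ?bs. ip u (?bs ! i) *\<^sub>R tau l (?bs ! i)) = tau l u"
      by (subst (2) exp[OF u]) (simp only: linear_sum[OF t] linear_scale[OF t])
    finally show ?thesis .
  qed
  have "\<forall>u\<in>?W. U g u \<in> ?W" if "g permutes {1..n}" for g
    using that
  proof (induction rule: permutes_adjacent_induct)
    case id
    show ?case
    proof
      fix u assume "u \<in> ?W"
      then show "U id u \<in> ?W" using U_id[of u] by (simp only: mem_Collect_eq)
    qed
  next
    case (comp g h)
    show ?case
    proof
      fix u assume u: "u \<in> ?W"
      then have "u \<in> V" by (simp only: mem_Collect_eq)
      then have "U (g \<circ> h) u = U g (U h u)" by (rule U_comp[OF comp(1,2)])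
      then show "U (g \<circ> h) u \<in> ?W" using comp(3,4) u by (simp only:)
    qed
  next
    case (adjacent i)
    then show ?case using tW[of _ "i - 1"] by auto
  qed
  then have iW: "inv_sub ?W" using sW by (auto simp: inv_sub_def)
  obtain zs where zs: "?bs = v # zs" using gs_prefix by blast
  have "gs_proj ip [v] v = 0" using v by (simp add: gs_proj_def)
  then have "v \<in> ?W" using gs_proj_zero_append[of "[v]" zs v] p zs v by simp
  then have "cyc v \<subseteq> ?W" using cyc_minimal iW by blast
  moreover have "u \<in> cyc v" if "u \<in> ?W" for u
  proof (subst exp[OF that], intro real_vector.subspace_sum real_vector.subspace_scale)
    show "real_vector.subspace (cyc v)" using cyc_inv_sub v by (auto simp: inv_sub_def)
    then show "real_vector.subspace (cyc v)" .
  qed (use p nth_mem in blast)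
  ultimately show ?thesis by blast
qed

text \<open>
  Two runs started in unit vectors of the same weight make the same decisions, because all inner
  products in the cyclic modules agree; they apply the same group algebra elements.
\<close>

lemma gs_parallel:
  assumes w: "weight \<alpha> v" "weight \<alpha> w" and one: "ip v v = 1" "ip w w = 1"
  shows "\<exists>xs. gs ip tau (n - 1) v m = map (\<lambda>x. ext x v) xs \<and> gs ip tau (n - 1) w m = map (\<lambda>x. ext x w) xs"
proof -
  have V: "v \<in> V" "w \<in> V" using w weightD by auto
  have ip_eq: "ip (ext x v) (ext y v) = ip (ext x w) (ext y w)" for x y
    using ip_ext[OF w(1,1)] ip_ext[OF w(2,2)] one by simp
  define prl where "prl bs cs \<longleftrightarrow> (\<exists>xs. bs = map (\<lambda>x. ext x v) xs \<and> cs = map (\<lambda>x. ext x w) xs)" for bs cs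
  have ext_step: "prl (gs_ext ip bs (ext y v)) (gs_ext ip cs (ext y w))" if prl: "prl bs cs" for bs cs y
  proof -
    obtain xs where xs: "bs = map (\<lambda>x. ext x v) xs" "cs = map (\<lambda>x. ext x w) xs" using prl unfolding prl_def by blast
    \<comment> \<open>The coefficients are inner products in the run from v; by \<open>ip_eq\<close>
      they are also those of the run from w, so one element z describes both residues.\<close>
    define z where "z = y - (\<Sum>i<length xs. ip (ext y v) (ext (xs ! i) v) *\<^sub>R xs ! i)"
    have p: "gs_proj ip bs (ext y v) = ext z v" "gs_proj ip cs (ext y w) = ext z w"
      unfolding gs_proj_def z_def xs by (simp_all add: ext_diff ext_sum ext_scale ip_eq)
    show ?thesis
    proof (cases "0 < ip (ext z v) (ext z v)")
      case True
      then show ?thesis unfolding prl_def gs_ext_def Let_def p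
        by (intro exI[of _ "xs @ [(1 / sqrt (ip (ext z w) (ext z w))) *\<^sub>R z]"]) (simp add: xs ext_scale ip_eq)
    next
      case False
      then show ?thesis using prl by (simp add: gs_ext_def Let_def p ip_eq)
    qed
  qed
  have row_step: "prl (gs_row ip tau (ext y v) l bs) (gs_row ip tau (ext y w) l cs)" if "prl bs cs" "l \<le> n - 1" for bs cs y l
    using that(2)
  proof (induction l)
    case (Suc l)
    then have s: "tr (Suc l) (Suc (Suc l)) permutes {1..n}" by (intro tr_n) auto
    show ?case using Suc ext_step[of _ _ "ltrans n (tr (Suc l) (Suc (Suc l))) y"] by (simp add: U_ext[OF s] V)
  qed (simp add: that)
  have "prl (gs ip tau (n - 1) v m) (gs ip tau (n - 1) w m)"
  proof (induction m)
    case 0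
    show ?case unfolding prl_def by (intro exI[of _ "[ga_single id]"]) (simp add: ext_delta V)
  next
    case (Suc m)
    then obtain xs where xs: "gs ip tau (n - 1) v m = map (\<lambda>x. ext x v) xs" "gs ip tau (n - 1) w m = map (\<lambda>x. ext x w) xs"
      by (auto simp: prl_def)
    show ?case using Suc row_step[OF Suc order_refl, of "xs ! m"] by (simp add: Let_def xs del: One_nat_def)
  qed
  then show ?thesis by (simp add: prl_def)
qed

text \<open>The blocks of two runs are thereby equal and not merely isomorphic, as the form with
  identical copies demands.\<close>

lemma gs_coefficients:
  assumes w: "weight \<alpha> v" "weight \<alpha> w" and one: "ip v v = 1" "ip w w = 1" and g: "g permutes {1..n}"
  shows "length (gs ip tau (n - 1) v m) = length (gs ip tau (n - 1) w m)"
    and "i < length (gs ip tau (n - 1) v m) \<Longrightarrow> j < length (gs ip tau (n - 1) v m) \<Longrightarrow>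
      ip (gs ip tau (n - 1) v m ! i) (U g (gs ip tau (n - 1) v m ! j)) =
      ip (gs ip tau (n - 1) w m ! i) (U g (gs ip tau (n - 1) w m ! j))"
proof -
  obtain xs where xs: "gs ip tau (n - 1) v m = map (\<lambda>x. ext x v) xs" "gs ip tau (n - 1) w m = map (\<lambda>x. ext x w) xs"
    using gs_parallel[OF w one] by blast
  show "length (gs ip tau (n - 1) v m) = length (gs ip tau (n - 1) w m)" by (simp add: xs del: One_nat_def)
  show "ip (gs ip tau (n - 1) v m ! i) (U g (gs ip tau (n - 1) v m ! j)) =
      ip (gs ip tau (n - 1) w m ! i) (U g (gs ip tau (n - 1) w m ! j))"
    if "i < length (gs ip tau (n - 1) v m)" "j < length (gs ip tau (n - 1) v m)"
    using that ip_ext[OF w(1,1)] ip_ext[OF w(2,2)] one weightD(1)[OF w(1)] weightD(1)[OF w(2)]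
    by (simp add: xs U_ext[OF g] del: One_nat_def)
qed

lemma weights_orth:
  assumes "weight \<alpha> v" "weight \<beta> w" "1 \<le> j" "j \<le> n" "\<alpha> j \<noteq> \<beta> j"
  shows "ip v w = 0"
  by (rule symm_eigen_orth[OF symm_X[OF assms(4)] weightD(1)[OF assms(1)] weightD(1)[OF assms(2)]
    weightD(2)[OF assms(1,3,4)] weightD(2)[OF assms(2,3,4)]]) (use assms(5) in simp)

lemma cyc_orth_same_weight:
  assumes "weight \<alpha> v" "weight \<alpha> w" "ip v w = 0" "u \<in> cyc v" "u' \<in> cyc w"
  shows "ip u u' = 0"
  using assms ip_ext[OF assms(1,2)] by (auto simp: cyc_def)

end

text \<open>All squared coordinates are summed in two ways: by vectors the total is the length of
  the list; by coordinates, each unit vector contributes 1 minus the squared norm of its residue.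
  This double count replaces dimension theory.\<close>

lemma orthonormal_bessel:
  assumes "orthonormal (vip d) bs" "set bs \<subseteq> fvecs d"
  shows "length bs \<le> d" and "(\<And>u. u \<in> fvecs d \<Longrightarrow> gs_proj (vip d) bs u = 0) \<Longrightarrow> length bs = d"
proof -
  \<comment> \<open>The trivial action with n = 0 gives access to the lemmas on inner
    products.\<close>
  interpret orth_rep 0 "fvecs d" "\<lambda>g. id" "vip d"
    by (intro orth_rep.intro sym_rep.intro orth_rep_axioms.intro)
       (auto simp: subspace_fvecs vip_linear vip_pos linear_iff intro: vip_sym)
  let ?e = "\<lambda>i. (\<lambda>j. if j = i then 1 else 0 :: real)"
  have e: "?e i \<in> fvecs d" if "i < d" for i using that by (auto simp: fvecs_def)
  have eu: "vip d (?e i) u = u i" if "i < d" for i u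
    using that by (simp add: vip_def if_distrib[of "\<lambda>x. x * _"] cong: if_cong)
  have sq: "vip d (gs_proj (vip d) bs (?e i)) (gs_proj (vip d) bs (?e i)) = 1 - (\<Sum>k<length bs. (bs ! k) i * (bs ! k) i)" if "i < d" for i
  proof -
    let ?w = "gs_proj (vip d) bs (?e i)"
    have "vip d ?w (\<Sum>k<length bs. vip d (?e i) (bs ! k) *\<^sub>R bs ! k) = 0"
      using gs_proj_orth[OF assms(1)] by (simp add: ip_sum ip_simps)
    then have "vip d ?w ?w = vip d ?w (?e i)" by (subst (2) gs_proj_def) (simp add: ip_simps)
    also have "\<dots> = ?w i" using eu[OF that] vip_sym by metis
    also have "\<dots> = 1 - (\<Sum>k<length bs. (bs ! k) i * (bs ! k) i)"
      unfolding gs_proj_def by (simp add: sum_fun_apply eu[OF that])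
    finally show ?thesis .
  qed
  have tot: "(\<Sum>i<d. \<Sum>k<length bs. (bs ! k) i * (bs ! k) i) = length bs"
  proof -
    have "(\<Sum>i<d. \<Sum>k<length bs. (bs ! k) i * (bs ! k) i) = (\<Sum>k<length bs. vip d (bs ! k) (bs ! k))"
      unfolding vip_def by (rule sum.swap)
    also have "\<dots> = (\<Sum>k<length bs. 1)" using assms(1) by (intro sum.cong) (auto simp: orthonormal_def)
    finally show ?thesis by simp
  qed
  have "(\<Sum>k<length bs. (bs ! k) i * (bs ! k) i) \<le> 1" if "i < d" for i
    using sq[OF that] ip_nonneg[OF gs_proj_in[OF e[OF that] assms(2)]] by linarith
  then have "(\<Sum>i<d. \<Sum>k<length bs. (bs ! k) i * (bs ! k) i) \<le> (\<Sum>i<d. 1)" by (intro sum_mono) auto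
  then show "length bs \<le> d" using tot by simp
  show "length bs = d" if "\<And>u. u \<in> fvecs d \<Longrightarrow> gs_proj (vip d) bs u = 0"
  proof -
    have "(\<Sum>k<length bs. (bs ! k) i * (bs ! k) i) = 1" if "i < d" for i
      using sq[OF that] \<open>\<And>u. u \<in> fvecs d \<Longrightarrow> gs_proj (vip d) bs u = 0\<close>[OF e[OF that]] by (simp add: ip_simps)
    then have "(\<Sum>i<d. \<Sum>k<length bs. (bs ! k) i * (bs ! k) i) = (\<Sum>i<d. 1)" by (intro sum.cong) auto
    then show ?thesis using tot by simp
  qed
qed

section \<open>Traces and multiplicities\<close>

definition mtr :: "real mat \<Rightarrow> real" where
  "mtr M = (\<Sum>i<dim_row M. M $$ (i, i))"

lemma mtr_comm:
  assumes "A \<in> carrier_mat d d" "B \<in> carrier_mat d d" shows "mtr (A * B) = mtr (B * A)"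
proof -
  have "mtr (A * B) = (\<Sum>i<d. \<Sum>j<d. A $$ (i, j) * B $$ (j, i))"
    using assms by (simp add: mtr_def scalar_prod_def atLeast0LessThan)
  also have "\<dots> = (\<Sum>j<d. \<Sum>i<d. A $$ (i, j) * B $$ (j, i))" by (rule sum.swap)
  also have "\<dots> = mtr (B * A)"
    using assms by (simp add: mtr_def scalar_prod_def atLeast0LessThan mult.commute)
  finally show ?thesis .
qed

lemma sum_lessThan_add: "(\<Sum>i<a + b. f i) = (\<Sum>i<a. f i) + (\<Sum>i<b. f (a + i :: nat) :: real)"
  by (induction b) (auto simp: add.assoc)

lemma mtr_four_block:
  assumes "A \<in> carrier_mat a a" "D \<in> carrier_mat b b"
  shows "mtr (four_block_mat A (0\<^sub>m a b) (0\<^sub>m b a) D) = mtr A + mtr D"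
proof -
  let ?M = "four_block_mat A (0\<^sub>m a b) (0\<^sub>m b a) D"
  have "mtr ?M = (\<Sum>i<a. ?M $$ (i, i)) + (\<Sum>i<b. ?M $$ (a + i, a + i))"
    using assms sum_lessThan_add[of "\<lambda>i. ?M $$ (i, i)" a b] by (simp add: mtr_def)
  then show ?thesis using assms by (simp add: mtr_def)
qed

lemma diag_block_mat_square_carrier:
  "\<forall>A\<in>set As. square_mat A \<Longrightarrow> diag_block_mat As \<in> carrier_mat (sum_list (map dim_row As)) (sum_list (map dim_row As))"
proof -
  assume "\<forall>A\<in>set As. square_mat A"
  then have "map dim_col As = map dim_row As" by simp
  then show ?thesis by (intro carrier_matI) (simp_all only: dim_diag_block_mat)
qed

lemma mtr_diag_block_mat:
  "\<forall>A\<in>set As. square_mat A \<Longrightarrow> mtr (diag_block_mat As) = sum_list (map mtr As)"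
proof (induction As)
  case (Cons A As)
  have sq: "A \<in> carrier_mat (dim_row A) (dim_row A)" using Cons.prems by auto
  have "\<forall>A\<in>set As. square_mat A" using Cons.prems by simp
  from diag_block_mat_square_carrier[OF this]
  have D: "diag_block_mat As \<in> carrier_mat (dim_row (diag_block_mat As)) (dim_row (diag_block_mat As))"
    by (simp only: carrier_mat_def mem_Collect_eq)
  have e: "dim_col A = dim_row A" "dim_col (diag_block_mat As) = dim_row (diag_block_mat As)"
    using carrier_matD(2)[OF sq] carrier_matD(2)[OF D] by blast+
  have "diag_block_mat (A # As) = four_block_mat A (0\<^sub>m (dim_row A) (dim_row (diag_block_mat As)))
      (0\<^sub>m (dim_row (diag_block_mat As)) (dim_row A)) (diag_block_mat As)"
    by (simp add: Let_def e)
  then show ?case using mtr_four_block[OF sq D] Cons by simp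
qed (simp add: mtr_def)

lemma tr_coef_mtr:
  "(\<And>g. g permutes {1..n} \<Longrightarrow> \<rho> g \<in> carrier_mat d d) \<Longrightarrow>
   tr_coef n d \<rho> x = (\<Sum>g | g permutes {1..n}. x g * mtr (\<rho> g))"
  unfolding tr_coef_def mtr_def by (intro sum.cong) auto

lemma tr_coef_isomorphic:
  assumes "mat_rep n d \<rho>" "\<And>g. g permutes {1..n} \<Longrightarrow> \<sigma> g \<in> carrier_mat e e" "rep_isomorphic n d \<rho> e \<sigma>"
  shows "tr_coef n d \<rho> x = tr_coef n e \<sigma> x"
proof -
  interpret mat_rep n d \<rho> by fact
  obtain P where de: "d = e" and P: "P \<in> carrier (GL d)" "\<And>g. g permutes {1..n} \<Longrightarrow> P * \<rho> g = \<sigma> g * P"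
    using assms(3) by (auto simp: rep_isomorphic_def sym_group_carrier)
  obtain R where R: "P \<in> carrier_mat d d" "R \<in> carrier_mat d d" "R * P = 1\<^sub>m d" "P * R = 1\<^sub>m d" using P(1) by (auto simp: carrier_GL)
  have "mtr (\<rho> g) = mtr (\<sigma> g)" if g: "g permutes {1..n}" for g
  proof -
    have s: "\<sigma> g \<in> carrier_mat d d" using assms(2)[OF g] de by simp
    have "\<rho> g = R * (P * \<rho> g)" using R carr[OF g] by (subst assoc_mult_mat[symmetric, of _ d d _ d _ d]) auto
    also have "mtr \<dots> = mtr ((P * \<rho> g) * R)" using R carr[OF g] by (intro mtr_comm) auto
    also have "(P * \<rho> g) * R = \<sigma> g" unfolding P(2)[OF g] using R s by (subst assoc_mult_mat[of _ d d _ d _ d]) auto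
    finally show ?thesis .
  qed
  then show ?thesis using tr_coef_mtr[of n \<rho> d x] tr_coef_mtr[of n \<sigma> e x] carr assms(2) by simp
qed

lemma sum_sum_list_swap: "(\<Sum>g\<in>S. \<Sum>p\<leftarrow>ps. f g p) = (\<Sum>p\<leftarrow>ps. \<Sum>g\<in>S. f g p :: real)"
  by (induction ps) (simp_all add: sum.distrib)

text \<open>The character at \<open>lam_idem\<close> is 1 on irreducible summands indexed by
  \<open>lam\<close> and 0 on the rest, and it does not depend on the decomposition; so all
  decompositions give the same count.\<close>

lemma decomposition_multiplicity:
  assumes "mat_rep n d \<rho>" "irreducible_decomposition n d \<rho> \<sigma>s" "lam \<in> partitions_of n"
  shows "real (length (filter (\<lambda>(e, \<sigma>). indexed_by n e \<sigma> lam) \<sigma>s)) = tr_coef n d \<rho> (lam_idem n lam)"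
proof -
  let ?x = "lam_idem n lam"
  let ?D = "\<lambda>g. diag_block_mat (map (\<lambda>(e, \<sigma>). \<sigma> g) \<sigma>s)"
  have irr: "irreducible_rep n e \<sigma>" if "(e, \<sigma>) \<in> set \<sigma>s" for e \<sigma> using assms(2) that by (auto simp: irreducible_decomposition_def)
  have rep: "mat_rep n e \<sigma>" if "(e, \<sigma>) \<in> set \<sigma>s" for e \<sigma>
    using irr[OF that] mat_rep_GL by (auto simp: irreducible_rep_def)
  have c: "\<sigma> g \<in> carrier_mat e e" if "(e, \<sigma>) \<in> set \<sigma>s" "g permutes {1..n}" for e \<sigma> g
    using mat_rep.carr[OF rep[OF that(1)] that(2)] .
  have sq: "\<forall>A\<in>set (map (\<lambda>(e, \<sigma>). \<sigma> g) \<sigma>s). square_mat A" if "g permutes {1..n}" for g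
    using c that by fastforce
  have dims: "map dim_row (map (\<lambda>(e, \<sigma>). \<sigma> g) \<sigma>s) = map fst \<sigma>s" if "g permutes {1..n}" for g
    unfolding map_map
  proof (rule map_cong[OF refl])
    fix p assume "p \<in> set \<sigma>s"
    then have "snd p g \<in> carrier_mat (fst p) (fst p)" using c[of "fst p" "snd p" g] that by simp
    then show "(dim_row \<circ> (\<lambda>(e, \<sigma>). \<sigma> g)) p = fst p" by (simp add: case_prod_beta)
  qed
  have Dc: "?D g \<in> carrier_mat (sum_list (map fst \<sigma>s)) (sum_list (map fst \<sigma>s))" if "g permutes {1..n}" for g
    using diag_block_mat_square_carrier[OF sq[OF that]] unfolding dims[OF that] .
  have "tr_coef n d \<rho> ?x = tr_coef n (sum_list (map fst \<sigma>s)) ?D ?x"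
    by (rule tr_coef_isomorphic[OF assms(1) Dc]) (use assms(2) in \<open>auto simp: irreducible_decomposition_def\<close>)
  also have "\<dots> = (\<Sum>g | g permutes {1..n}. ?x g * mtr (?D g))" by (rule tr_coef_mtr[OF Dc])
  also have "\<dots> = (\<Sum>g | g permutes {1..n}. \<Sum>p\<leftarrow>\<sigma>s. ?x g * mtr (snd p g))"
  proof (rule sum.cong[OF refl])
    fix g assume "g \<in> {g. g permutes {1..n}}"
    then have "mtr (?D g) = sum_list (map mtr (map (\<lambda>(e, \<sigma>). \<sigma> g) \<sigma>s))" by (intro mtr_diag_block_mat sq) simp
    also have "\<dots> = (\<Sum>p\<leftarrow>\<sigma>s. mtr (snd p g))" by (simp add: o_def case_prod_beta)
    finally show "?x g * mtr (?D g) = (\<Sum>p\<leftarrow>\<sigma>s. ?x g * mtr (snd p g))" by (simp only: sum_list_const_mult)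
  qed
  also have "\<dots> = (\<Sum>p\<leftarrow>\<sigma>s. \<Sum>g | g permutes {1..n}. ?x g * mtr (snd p g))"
    by (rule sum_sum_list_swap)
  also have "\<dots> = (\<Sum>p\<leftarrow>\<sigma>s. tr_coef n (fst p) (snd p) ?x)"
  proof (intro arg_cong[of _ _ sum_list] map_cong refl)
    fix p assume "p \<in> set \<sigma>s"
    then have "(fst p, snd p) \<in> set \<sigma>s" by simp
    from tr_coef_mtr[OF c[OF this], where x = ?x]
    show "(\<Sum>g | g permutes {1..n}. ?x g * mtr (snd p g)) = tr_coef n (fst p) (snd p) ?x" by simp
  qed
  also have "\<dots> = (\<Sum>p\<leftarrow>\<sigma>s. if indexed_by n (fst p) (snd p) lam then 1 else 0)"
  proof (intro arg_cong[of _ _ sum_list] map_cong refl)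
    fix p assume p: "p \<in> set \<sigma>s"
    then have "(fst p, snd p) \<in> set \<sigma>s" by simp
    then show "tr_coef n (fst p) (snd p) ?x = (if indexed_by n (fst p) (snd p) lam then 1 else 0)"
      using mat_rep.tr_coef_irreducible[OF rep assms(3) irr] by blast
  qed
  also have "\<dots> = real (length (filter (\<lambda>(e, \<sigma>). indexed_by n e \<sigma> lam) \<sigma>s))"
    by (induction \<sigma>s) (auto simp: case_prod_beta)
  finally show ?thesis ..
qed

section \<open>The block decomposition\<close>

text \<open>A vector with nonzero residue would let Gram--Schmidt produce d + 1 orthonormal
  vectors.\<close>

lemma (in orth_mat_rep) orthonormal_complete:
  assumes "orthonormal (vip d) bs" "set bs \<subseteq> fvecs d" "length bs = d" "u \<in> fvecs d"
  shows "gs_proj (vip d) bs u = 0"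
proof (rule ccontr)
  assume ne: "gs_proj (vip d) bs u \<noteq> 0"
  have "gs_proj (vip d) bs u \<in> fvecs d" using gs_proj_in assms by blast
  then have "length (gs_ext (vip d) bs u) = Suc d" using ne vip_pos assms(3) by (simp add: gs_ext_def Let_def)
  moreover have "length (gs_ext (vip d) bs u) \<le> d"
    using orthonormal_bessel(1) gs_ext_props[OF assms(1) inv_sub_V assms(2,4)] by blast
  ultimately show False by simp
qed

lemma orthonormal_append:
  assumes "orthonormal ip as" "orthonormal ip bs" "\<And>a b. a \<in> set as \<Longrightarrow> b \<in> set bs \<Longrightarrow> ip a b = 0 \<and> ip b a = 0"
  shows "orthonormal ip (as @ bs)"
  unfolding orthonormal_def
proof (intro allI impI)
  fix i j assume ij: "i < length (as @ bs)" "j < length (as @ bs)"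
  show "ip ((as @ bs) ! i) ((as @ bs) ! j) = (if i = j then 1 else 0)"
    using ij assms nth_mem[of i as] nth_mem[of j as] nth_mem[of "i - length as" bs] nth_mem[of "j - length as" bs]
    unfolding orthonormal_def
    by (cases "i < length as"; cases "j < length as") (auto simp: nth_append)
qed

definition gmat :: "nat \<Rightarrow> real mat \<Rightarrow> (nat \<Rightarrow> real) list \<Rightarrow> real mat" where
  "gmat d M bs = mat (length bs) (length bs) (\<lambda>(i, j). vip d (bs ! i) (mact d M (bs ! j)))"

lemma gmat_carrier [simp]: "gmat d M bs \<in> carrier_mat (length bs) (length bs)"
  by (simp add: gmat_def)

lemma gmat_dim [simp]: "dim_row (gmat d M bs) = length bs" "dim_col (gmat d M bs) = length bs"
  by (simp_all add: gmat_def)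

lemma gmat_append:
  assumes "\<And>a b. a \<in> set as \<Longrightarrow> b \<in> set bs \<Longrightarrow> vip d a (mact d M b) = 0 \<and> vip d b (mact d M a) = 0"
  shows "gmat d M (as @ bs) = four_block_mat (gmat d M as) (0\<^sub>m (length as) (length bs)) (0\<^sub>m (length bs) (length as)) (gmat d M bs)"
  by (rule eq_matI) (use assms in \<open>auto simp: gmat_def nth_append\<close>)

text \<open>Orthogonality of each family to the image of every other one under M kills the
  off-diagonal blocks.\<close>

lemma gmat_concat:
  assumes "sorted_wrt (\<lambda>as bs. \<forall>a\<in>set as. \<forall>b\<in>set bs. vip d a (mact d M b) = 0 \<and> vip d b (mact d M a) = 0) bss"
  shows "gmat d M (concat bss) = diag_block_mat (map (gmat d M) bss)"
  using assms
proof (induction bss)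
  case Nil
  show ?case by (rule eq_matI) (auto simp: gmat_def)
next
  case (Cons bs bss)
  then have IH: "diag_block_mat (map (gmat d M) bss) = gmat d M (concat bss)" by simp
  have "gmat d M (concat (bs # bss)) = four_block_mat (gmat d M bs) (0\<^sub>m (length bs) (length (concat bss)))
      (0\<^sub>m (length (concat bss)) (length bs)) (gmat d M (concat bss))"
    using Cons.prems by (simp only: concat.simps, intro gmat_append) auto
  then show ?case by (simp only: list.map diag_block_mat.simps Let_def IH gmat_dim)
qed

section \<open>One block: the module of a unit weight vector in coordinates\<close>

context orth_mat_rep
begin

text \<open>d rounds process the whole list, since an orthonormal list in dimension d has at most d
  members.\<close>

definition G :: "(nat \<Rightarrow> real) \<Rightarrow> (nat \<Rightarrow> real) list" where
  "G v = gs (vip d) tau (n - 1) v d"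

lemma G_Cons: "\<exists>zs. G v = v # zs"
  unfolding G_def by (rule gs_prefix)

context
  fixes \<alpha> and v :: "nat \<Rightarrow> real"
  assumes wv: "weight \<alpha> v" and v1: "vip d v v = 1"
begin

lemma vV: "v \<in> fvecs d"
  using wv weightD by auto

lemma G_props: "orthonormal (vip d) (G v)" "set (G v) \<subseteq> cyc v"
  using gs_props[OF vV v1, of d] unfolding G_def by blast+

lemma G_in: "set (G v) \<subseteq> fvecs d"
  using G_props(2) cyc_inv_sub[OF vV] by (auto simp: inv_sub_def)

lemma G_span: "u \<in> cyc v \<Longrightarrow> u = (\<Sum>i<length (G v). vip d u (G v ! i) *\<^sub>R G v ! i)"
proof -
  assume "u \<in> cyc v"
  moreover have "cyc v = {u \<in> fvecs d. gs_proj (vip d) (G v) u = 0}"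
    unfolding G_def by (rule cyc_eq_gs_span[OF vV v1 orthonormal_bessel(1)[OF G_props(1)[unfolded G_def] G_in[unfolded G_def]]])
  ultimately have "gs_proj (vip d) (G v) u = 0" by simp
  then show ?thesis by (simp add: gs_proj_def)
qed

lemma G_nth_cyc: "i < length (G v) \<Longrightarrow> G v ! i \<in> cyc v"
  using G_props(2) nth_mem by blast

lemma cyc_closed: "u \<in> cyc v \<Longrightarrow> g permutes {1..n} \<Longrightarrow> mact d (\<rho> g) u \<in> cyc v"
  using cyc_inv_sub[OF vV] by (auto simp: inv_sub_def)

text \<open>\<open>G v\<close> is an orthonormal basis of an invariant subspace; multiplicativity
  and orthogonality of the block are instances of Parseval's identity there.\<close>

lemma block_orth_rep: "orth_mat_rep n (length (G v)) (\<lambda>g. gmat d (\<rho> g) (G v))"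
proof
  let ?e = "length (G v)"
  have perp: "vip d (G v ! i) (G v ! j) = (if i = j then 1 else 0)" if "i < ?e" "j < ?e" for i j
    using G_props(1) that by (auto simp: orthonormal_def)
  have pars: "vip d u w = (\<Sum>l<?e. vip d u (G v ! l) * vip d (G v ! l) w)" if "u \<in> cyc v" for u w
    by (subst G_span[OF that]) (simp add: ip_sum ip_simps)
  show "gmat d (\<rho> g) (G v) \<in> carrier_mat ?e ?e" for g by simp
  show "gmat d (\<rho> id) (G v) = 1\<^sub>m ?e"
  proof (rule eq_matI)
    fix i j assume "i < dim_row (1\<^sub>m ?e :: real mat)" "j < dim_col (1\<^sub>m ?e :: real mat)"
    then have ij: "i < ?e" "j < ?e" by auto
    have "mact d (\<rho> id) (G v ! j) = G v ! j" using U_id G_in nth_mem[OF ij(2)] by blast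
    then show "gmat d (\<rho> id) (G v) $$ (i, j) = 1\<^sub>m ?e $$ (i, j)" using ij perp by (simp add: gmat_def one_mat_def)
  qed (auto simp: gmat_def)
  fix g assume g: "g permutes {1..n}"
  show "gmat d (\<rho> (g \<circ> h)) (G v) = gmat d (\<rho> g) (G v) * gmat d (\<rho> h) (G v)" if h: "h permutes {1..n}" for h
  proof (rule eq_matI)
    fix i j assume "i < dim_row (gmat d (\<rho> g) (G v) * gmat d (\<rho> h) (G v))" "j < dim_col (gmat d (\<rho> g) (G v) * gmat d (\<rho> h) (G v))"
    then have ij: "i < ?e" "j < ?e" by (auto simp: gmat_def)
    let ?u = "mact d (\<rho> h) (G v ! j)"
    have u: "?u \<in> cyc v" using cyc_closed[OF G_nth_cyc[OF ij(2)] h] .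
    have "vip d (G v ! i) (mact d (\<rho> (g \<circ> h)) (G v ! j)) = vip d (G v ! i) (mact d (\<rho> g) ?u)"
    proof -
      have "G v ! j \<in> fvecs d" using G_in nth_mem[OF ij(2)] by blast
      then show ?thesis by (simp only: U_comp[OF g h])
    qed
    also have "\<dots> = (\<Sum>l<?e. vip d ?u (G v ! l) * vip d (G v ! i) (mact d (\<rho> g) (G v ! l)))"
      by (subst G_span[OF u]) (simp only: linear_sum[OF mact_linear] linear_scale[OF mact_linear] ip_sum ip_simps)
    also have "\<dots> = (\<Sum>l<?e. vip d (G v ! i) (mact d (\<rho> g) (G v ! l)) * vip d (G v ! l) ?u)"
      by (intro sum.cong refl) (subst mult.commute, rule arg_cong2[where f = "(*)", OF refl vip_sym])
    finally show "gmat d (\<rho> (g \<circ> h)) (G v) $$ (i, j) = (gmat d (\<rho> g) (G v) * gmat d (\<rho> h) (G v)) $$ (i, j)"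
      using ij by (simp add: gmat_def scalar_prod_def atLeast0LessThan)
  qed (auto simp: gmat_def)
  show "transpose_mat (gmat d (\<rho> g) (G v)) * gmat d (\<rho> g) (G v) = 1\<^sub>m ?e"
  proof (rule eq_matI)
    fix i j assume "i < dim_row (1\<^sub>m ?e :: real mat)" "j < dim_col (1\<^sub>m ?e :: real mat)"
    then have ij: "i < ?e" "j < ?e" by auto
    let ?u = "\<lambda>i. mact d (\<rho> g) (G v ! i)"
    have "(\<Sum>l<?e. vip d (G v ! l) (?u i) * vip d (G v ! l) (?u j)) = vip d (?u i) (?u j)"
      unfolding pars[OF cyc_closed[OF G_nth_cyc[OF ij(1)] g], of "?u j"] by (intro sum.cong refl) (rule arg_cong2[where f = "(*)", OF vip_sym refl])
    also have "\<dots> = (if i = j then 1 else 0)" 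
    proof -
      have "G v ! i \<in> fvecs d" "G v ! j \<in> fvecs d" using G_in nth_mem[OF ij(1)] nth_mem[OF ij(2)] by blast+
      then show ?thesis using ip_U[OF g] perp[OF ij] by simp
    qed
    finally show "(transpose_mat (gmat d (\<rho> g) (G v)) * gmat d (\<rho> g) (G v)) $$ (i, j) = 1\<^sub>m ?e $$ (i, j)"
      using ij by (simp add: gmat_def scalar_prod_def atLeast0LessThan one_mat_def)
  qed (auto simp: gmat_def)
qed

text \<open>The isomorphism from the cyclic module to the block. It carries v to a weight vector
  that generates the block, which makes irreducibility and labelling instances of the abstract
  results.\<close>

definition coord :: "(nat \<Rightarrow> real) \<Rightarrow> nat \<Rightarrow> real" where
  "coord u = (\<lambda>l. if l < length (G v) then vip d u (G v ! l) else 0)"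

interpretation S: orth_mat_rep n "length (G v)" "\<lambda>g. gmat d (\<rho> g) (G v)"
  by (rule block_orth_rep)

lemma coord_linear: "linear coord"
  by (rule linearI) (auto simp: coord_def ip_simps fun_eq_iff)

lemma coord_in: "coord u \<in> fvecs (length (G v))"
  by (auto simp: coord_def fvecs_def)

lemma coord_act:
  assumes "u \<in> cyc v" "g permutes {1..n}"
  shows "mact (length (G v)) (gmat d (\<rho> g) (G v)) (coord u) = coord (mact d (\<rho> g) u)"
proof
  fix i
  show "mact (length (G v)) (gmat d (\<rho> g) (G v)) (coord u) i = coord (mact d (\<rho> g) u) i"
  proof (cases "i < length (G v)")
    case True
    have "vip d (mact d (\<rho> g) u) (G v ! i) = (\<Sum>l<length (G v). vip d u (G v ! l) * vip d (mact d (\<rho> g) (G v ! l)) (G v ! i))"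
      by (subst G_span[OF assms(1)]) (simp only: linear_sum[OF mact_linear] linear_scale[OF mact_linear] ip_sum ip_simps)
    also have "\<dots> = (\<Sum>l<length (G v). vip d (G v ! i) (mact d (\<rho> g) (G v ! l)) * vip d u (G v ! l))"
      by (intro sum.cong refl) (subst mult.commute, rule arg_cong2[where f = "(*)", OF vip_sym refl])
    finally have "vip d (mact d (\<rho> g) u) (G v ! i) = (\<Sum>l<length (G v). vip d (G v ! i) (mact d (\<rho> g) (G v ! l)) * vip d u (G v ! l))" .
    then show ?thesis using True by (simp add: mact_def coord_def gmat_def)
  qed (simp add: mact_def coord_def)
qed

lemma coord_ext: "u \<in> cyc v \<Longrightarrow> S.ext x (coord u) = coord (ext x u)"
  unfolding S.ext_def ext_def linear_sum[OF coord_linear] linear_scale[OF coord_linear]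
  by (intro sum.cong) (auto simp: coord_act)

lemma coord_weight: "S.weight \<alpha> (coord v)"
  unfolding S.weight_def
proof (intro conjI ballI coord_in)
  fix j assume j: "j \<in> {1..n}"
  have vc: "v \<in> cyc v" using cyc_self[OF vV] .
  have "S.X j (coord v) = coord (X j v)"
    unfolding S.X_def X_def linear_sum[OF coord_linear]
    using j by (intro sum.cong) (auto intro!: coord_act vc tr_permutes)
  then show "S.X j (coord v) = of_int (\<alpha> j) *\<^sub>R coord v"
    using weightD(2)[OF wv] j linear_scale[OF coord_linear] by simp
qed

lemma coord_nonzero: "coord v \<noteq> 0"
proof -
  obtain zs where "G v = v # zs" using G_Cons by blast
  then have "coord v 0 = 1" using v1 by (simp add: coord_def)
  then show ?thesis by auto
qed

lemma coord_cyc: "S.cyc (coord v) = fvecs (length (G v))"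
proof
  show "S.cyc (coord v) \<subseteq> fvecs (length (G v))" using S.cyc_inv_sub[OF coord_in] by (simp add: S.inv_sub_def)
  show "fvecs (length (G v)) \<subseteq> S.cyc (coord v)"
  proof
    fix f :: "nat \<Rightarrow> real" assume f: "f \<in> fvecs (length (G v))"
    let ?u = "\<Sum>i<length (G v). f i *\<^sub>R G v ! i"
    have sc: "real_vector.subspace (cyc v)" using cyc_inv_sub[OF vV] by (simp add: inv_sub_def)
    have "?u \<in> cyc v" by (intro real_vector.subspace_sum[OF sc] real_vector.subspace_scale[OF sc]) (auto intro: G_nth_cyc)
    then obtain x where x: "?u = ext x v" by (auto simp: cyc_def)
    have "coord ?u = f"
    proof
      fix l
      show "coord ?u l = f l"
      proof (cases "l < length (G v)")
        case True
        have "vip d ?u (G v ! l) = (\<Sum>i<length (G v). if i = l then f i else 0)"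
          unfolding ip_sum ip_simps using G_props(1) True by (intro sum.cong) (auto simp: orthonormal_def)
        then show ?thesis using True by (simp add: coord_def)
      next
        case False
        then show ?thesis using f by (simp add: coord_def fvecs_def)
      qed
    qed
    then have "f = S.ext x (coord v)" using coord_ext[OF cyc_self[OF vV]] x by simp
    then show "f \<in> S.cyc (coord v)" by (auto simp: S.cyc_def)
  qed
qed

lemma block_irreducible: "irreducible_rep n (length (G v)) (\<lambda>g. gmat d (\<rho> g) (G v))"
proof (rule S.irreducibleI)
  show "(\<lambda>g. gmat d (\<rho> g) (G v)) \<in> hom (sym_group n) (GL (length (G v)))"
    using hom_orthogonal_GL orth_mat_rep_hom block_orth_rep by blast
  show "1 \<le> length (G v)" using G_Cons[of v] by auto
  show "W = {0} \<or> W = fvecs (length (G v))" if "S.inv_sub W" for W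
    using S.cyc_irreducible[OF coord_weight coord_nonzero that] that unfolding coord_cyc by (simp add: S.inv_sub_def)
qed

lemma block_indexed:
  assumes "lam \<in> partitions_of n" "\<alpha> = wt_of (cont lam)"
  shows "indexed_by n (length (G v)) (\<lambda>g. gmat d (\<rho> g) (G v)) lam"
proof (rule S.indexed_by_if_nonzero[OF assms(1) block_irreducible coord_in])
  have "S.ext (lam_idem n lam) (coord v) = coord v"
    unfolding lam_idem_def S.ext_idem[OF coord_in] using S.Eop_weight[OF coord_weight] assms(2) by simp
  then show "S.ext (lam_idem n lam) (coord v) \<noteq> 0" using coord_nonzero by simp
qed

text \<open>A vector of weight mu in the block generates a module orthogonal to the block itself,
  since the contents differ as multisets; so the projection to this weight is zero.\<close>

lemma block_trace_other:
  assumes "lam \<in> partitions_of n" "\<alpha> = wt_of (cont lam)" "mu \<in> partitions_of n" "mu \<noteq> lam"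
  shows "tr_coef n (length (G v)) (\<lambda>g. gmat d (\<rho> g) (G v)) (lam_idem n mu) = 0"
proof -
  have "S.ext (lam_idem n mu) u = 0" if u: "u \<in> fvecs (length (G v))" for u
  proof -
    let ?w = "S.ext (lam_idem n mu) u"
    have wt: "S.weight (wt_of (cont mu)) ?w"
      unfolding lam_idem_def S.ext_idem[OF u] by (rule S.weight_Eop[OF u])
    have wV: "?w \<in> fvecs (length (G v))" using S.weightD(1)[OF wt] .
    have "vip (length (G v)) ?w ?w = 0"
      using S.cyc_orth[OF assms(3,1,4) wt coord_weight[unfolded assms(2)] S.cyc_self[OF wV]] wV coord_cyc by blast
    then show ?thesis using S.ip_eq_0 wV by blast
  qed
  then have "S.ext (lam_idem n mu) (\<lambda>j. if j = i then 1 else 0) = 0" if "i < length (G v)" for i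
    using that by (auto simp: fvecs_def)
  then show ?thesis by (simp add: S.tr_coef_ext)
qed

end

end

definition col_mat :: "nat \<Rightarrow> (nat \<Rightarrow> real) list \<Rightarrow> real mat" where
  "col_mat d bs = mat d d (\<lambda>(i, j). (bs ! j) i)"

lemma conj_col_mat:
  assumes l: "length bs = d" and M: "M \<in> carrier_mat d d"
  shows "transpose_mat (col_mat d bs) * M * col_mat d bs = gmat d M bs"
proof (rule eq_matI)
  fix i j assume "i < dim_row (gmat d M bs)" "j < dim_col (gmat d M bs)"
  then have ij: "i < d" "j < d" by (auto simp: l)
  have c: "col_mat d bs \<in> carrier_mat d d" by (simp add: col_mat_def)
  have "(transpose_mat (col_mat d bs) * M * col_mat d bs) $$ (i, j) = (transpose_mat (col_mat d bs) * (M * col_mat d bs)) $$ (i, j)"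
    using c M by (subst assoc_mult_mat[of _ d d _ d _ d]) auto
  also have "\<dots> = (\<Sum>k<d. (bs ! i) k * (\<Sum>l<d. M $$ (k, l) * (bs ! j) l))"
    using c M ij by (simp add: scalar_prod_def atLeast0LessThan col_mat_def)
  finally show "(transpose_mat (col_mat d bs) * M * col_mat d bs) $$ (i, j) = gmat d M bs $$ (i, j)"
    using ij by (simp add: gmat_def l vip_def mact_def)
qed (auto simp: col_mat_def l)

lemma col_mat_orthogonal:
  assumes l: "length bs = d" and bs: "set bs \<subseteq> fvecs d" and on: "orthonormal (vip d) bs"
  shows "col_mat d bs \<in> carrier (orthogonal_group d)"
proof -
  have "transpose_mat (col_mat d bs) * col_mat d bs = gmat d (1\<^sub>m d) bs"
  proof -
    have c: "transpose_mat (col_mat d bs) \<in> carrier_mat d d" by (simp add: col_mat_def)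
    show ?thesis using conj_col_mat[OF l one_carrier_mat] right_mult_one_mat[OF c] by metis
  qed
  also have "\<dots> = 1\<^sub>m d"
  proof (rule eq_matI)
    fix i j assume "i < dim_row (1\<^sub>m d :: real mat)" "j < dim_col (1\<^sub>m d :: real mat)"
    then have ij: "i < d" "j < d" by auto
    then have "bs ! j \<in> set bs" by (simp add: l)
    then have "bs ! j \<in> fvecs d" using bs by blast
    then show "gmat d (1\<^sub>m d) bs $$ (i, j) = 1\<^sub>m d $$ (i, j)"
      using ij on by (simp add: gmat_def l mact_one orthonormal_def)
  qed (auto simp: l)
  finally show ?thesis by (simp add: orthogonal_group_def col_mat_def)
qed

text \<open>The interface between algorithm and algebra: an orthonormal weight basis together with
  its weights. Words \<open>ws k\<close> that are no content words of compositions are allowed;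
  \<open>lams\<close> records the others.\<close>

locale weight_basis = orth_mat_rep n d \<rho> for n d \<rho> +
  fixes qs :: "(nat \<Rightarrow> real) list" and ws :: "nat \<Rightarrow> int list" and lams :: "nat list list"
  assumes qs_len: "length qs = d"
    and qs_on: "orthonormal (vip d) qs"
    and ws_len: "k < d \<Longrightarrow> length (ws k) = n"
    and qs_wt: "k < d \<Longrightarrow> weight (wt_of (ws k)) (qs ! k)"
    and lams_dist: "distinct lams"
    and lams_set: "set lams = {mu. composition mu \<and> (\<exists>k<d. ws k = cont mu)}"
begin

definition cls :: "nat \<Rightarrow> nat list" where
  "cls p = filter (\<lambda>k. ws k = cont (lams ! p)) [0..<d]"

definition ord :: "nat list" where
  "ord = concat (map cls [0..<length lams])"

text \<open>Each copy of an irreducible constituent has a one-dimensional row-reading weight space,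
  so starting only from basis vectors of such weights yields one block per copy; grouping by
  partition puts equal blocks side by side.\<close>

definition Qs :: "(nat \<Rightarrow> real) list" where
  "Qs = concat (map (\<lambda>k. G (qs ! k)) ord)"

lemma qs_one: "k < d \<Longrightarrow> vip d (qs ! k) (qs ! k) = 1"
  using qs_on qs_len by (simp add: orthonormal_def)

lemma qs_orth: "k < d \<Longrightarrow> l < d \<Longrightarrow> k \<noteq> l \<Longrightarrow> vip d (qs ! k) (qs ! l) = 0"
  using qs_on qs_len by (simp add: orthonormal_def)

lemma qs_in: "set qs \<subseteq> fvecs d"
  using qs_wt qs_len weightD(1) by (fastforce simp: in_set_conv_nth)

lemma lams_partition:
  assumes "mu \<in> set lams" shows "mu \<in> partitions_of n"
proof -
  obtain k where k: "k < d" "composition mu" "ws k = cont mu" using assms lams_set by auto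
  have "qs ! k \<noteq> 0" using qs_one[OF k(1)] by (auto simp: vip_def)
  then show ?thesis using weight_partition[of mu "qs ! k"] k qs_wt[OF k(1)] ws_len[OF k(1)] length_cont by metis
qed

lemma cls_D: "k \<in> set (cls p) \<Longrightarrow> k < d \<and> ws k = cont (lams ! p)"
  by (auto simp: cls_def)

lemma cls_weight: "k \<in> set (cls p) \<Longrightarrow> weight (wt_of (cont (lams ! p))) (qs ! k)"
  using cls_D qs_wt by metis

lemma ord_D: "k \<in> set ord \<Longrightarrow> \<exists>p<length lams. k \<in> set (cls p)"
  by (auto simp: ord_def)

lemma cont_lams_inj: "p < length lams \<Longrightarrow> q < length lams \<Longrightarrow> cont (lams ! p) = cont (lams ! q) \<Longrightarrow> p = q"
proof -
  assume pq: "p < length lams" "q < length lams" "cont (lams ! p) = cont (lams ! q)"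
  then have "composition (lams ! p)" "composition (lams ! q)" using lams_set nth_mem by blast+
  then show ?thesis using cont_inj pq lams_dist nth_eq_iff_index_eq by metis
qed

lemma ord_distinct: "distinct ord"
proof -
  have "distinct (concat (map cls [0..<m]))" if "m \<le> length lams" for m
    using that
  proof (induction m)
    case (Suc m)
    have "k \<notin> set (cls m)" if "p < m" "k \<in> set (cls p)" for p k
      using cont_lams_inj[of p m] that Suc.prems cls_D[of k p] cls_D[of k m] by auto
    then have "set (concat (map cls [0..<m])) \<inter> set (cls m) = {}" by auto
    moreover have "distinct (cls m)" by (simp add: cls_def)
    ultimately show ?case using Suc by simp
  qed simp
  then show ?thesis by (simp add: ord_def)
qed

text \<open>Start vectors of the same weight are orthogonal as members of the basis, hence so are
  their modules; for different partitions the multisets of contents differ.\<close>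

lemma cross:
  assumes "k \<in> set ord" "l \<in> set ord" "k \<noteq> l" "u \<in> cyc (qs ! k)" "u' \<in> cyc (qs ! l)"
  shows "vip d u u' = 0"
proof -
  obtain p q where p: "p < length lams" "k \<in> set (cls p)" and q: "q < length lams" "l \<in> set (cls q)"
    using ord_D assms by metis
  show ?thesis
  proof (cases "p = q")
    case True
    then show ?thesis using cyc_orth_same_weight[OF cls_weight[OF p(2)] _ _ assms(4,5)] cls_weight[OF q(2)]
        qs_orth cls_D p q assms(3) by blast
  next
    case False
    then have "lams ! p \<noteq> lams ! q" using p q lams_dist by (simp add: nth_eq_iff_index_eq)
    then show ?thesis
      using cyc_orth[OF lams_partition lams_partition _ cls_weight[OF p(2)] cls_weight[OF q(2)] assms(4,5)] p q by simp
  qed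
qed

lemma ord_weight: "k \<in> set ord \<Longrightarrow> k < d \<and> (\<exists>\<alpha>. weight \<alpha> (qs ! k))"
  using ord_D cls_D cls_weight by blast

lemma G_cyc: "k \<in> set ord \<Longrightarrow> u \<in> set (G (qs ! k)) \<Longrightarrow> u \<in> cyc (qs ! k)"
  using ord_weight G_props(2) qs_one by blast

lemma Qs_in: "set Qs \<subseteq> fvecs d"
proof
  fix u assume "u \<in> set Qs"
  then obtain k where k: "k \<in> set ord" "u \<in> set (G (qs ! k))" by (auto simp: Qs_def)
  then obtain \<alpha> where "weight \<alpha> (qs ! k)" "k < d" using ord_weight by blast
  then show "u \<in> fvecs d" using G_in[OF _ qs_one] k(2) by blast
qed

lemma Qs_orthonormal: "orthonormal (vip d) Qs"
proof -
  have "distinct ks \<Longrightarrow> set ks \<subseteq> set ord \<Longrightarrow> orthonormal (vip d) (concat (map (\<lambda>k. G (qs ! k)) ks))" for ks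
  proof (induction ks)
    case Nil
    then show ?case by (simp add: orthonormal_def)
  next
    case (Cons k ks)
    have k: "k \<in> set ord" "k \<notin> set ks" "set ks \<subseteq> set ord" using Cons.prems by auto
    have "orthonormal (vip d) (G (qs ! k) @ concat (map (\<lambda>k. G (qs ! k)) ks))"
    proof (rule orthonormal_append)
      show "orthonormal (vip d) (G (qs ! k))" using ord_weight[OF k(1)] G_props(1) qs_one by blast
      show "orthonormal (vip d) (concat (map (\<lambda>k. G (qs ! k)) ks))" using Cons by auto
      fix a b assume a: "a \<in> set (G (qs ! k))" and "b \<in> set (concat (map (\<lambda>k. G (qs ! k)) ks))"
      then obtain l where l: "l \<in> set ks" "b \<in> set (G (qs ! l))" by auto
      then have "l \<in> set ord" "k \<noteq> l" using k by auto
      then show "vip d a b = 0 \<and> vip d b a = 0"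
        using cross[OF k(1) _ _ G_cyc[OF k(1) a] G_cyc[OF _ l(2)]] cross[OF _ k(1) _ G_cyc[OF _ l(2)] G_cyc[OF k(1) a]] by blast
    qed
    then show ?case by simp
  qed
  then show ?thesis using ord_distinct by (simp add: Qs_def)
qed

text \<open>The orthogonal complement of all blocks is invariant, so if nonzero it contains a vector
  y of row-reading weight. Basis vectors of another weight are orthogonal to y, those of the same
  weight belong to blocks; y is thus orthogonal to a complete orthonormal list.\<close>

lemma Qs_perp_zero:
  assumes x: "x \<in> fvecs d" "\<And>b. b \<in> set Qs \<Longrightarrow> vip d x b = 0"
  shows "x = 0"
proof (rule ccontr)
  assume ne: "x \<noteq> 0"
  define W where "W = {u \<in> fvecs d. \<forall>b\<in>set Qs. vip d u b = 0}"
  have sW: "real_vector.subspace W"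
    using sub unfolding W_def real_vector.subspace_def by (simp add: ip_simps)
  have "mact d (\<rho> g) u \<in> W" if g: "g permutes {1..n}" and u: "u \<in> W" for g u
  proof -
    have uV: "u \<in> fvecs d" "\<And>b. b \<in> set Qs \<Longrightarrow> vip d u b = 0" using u by (auto simp: W_def)
    have "vip d (mact d (\<rho> g) u) b = 0" if b: "b \<in> set Qs" for b
    proof -
      obtain k where k: "k \<in> set ord" "b \<in> set (G (qs ! k))" using b by (auto simp: Qs_def)
      obtain \<alpha> where w: "weight \<alpha> (qs ! k)" "k < d" using ord_weight[OF k(1)] by blast
      have bV: "b \<in> fvecs d" using b Qs_in by auto
      let ?c = "mact d (\<rho> (Hilbert_Choice.inv g)) b"
      have "?c \<in> cyc (qs ! k)" using cyc_closed[OF w(1) qs_one[OF w(2)] G_cyc[OF k] permutes_inv[OF g]] .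
      then have c: "?c = (\<Sum>i<length (G (qs ! k)). vip d ?c (G (qs ! k) ! i) *\<^sub>R G (qs ! k) ! i)"
        by (rule G_span[OF w(1) qs_one[OF w(2)]])
      have "vip d u (G (qs ! k) ! i) = 0" if "i < length (G (qs ! k))" for i
        using nth_mem[OF that] k(1) by (intro uV(2)) (auto simp: Qs_def)
      then have "vip d u ?c = 0" by (subst c) (simp add: ip_sum ip_simps)
      then show ?thesis using ip_U_adj[OF g uV(1) bV] by simp
    qed
    then show ?thesis by (simp add: W_def)
  qed
  then have iW: "inv_sub W" using sW by (auto simp: inv_sub_def W_def)
  have "x \<in> W" using x by (simp add: W_def)
  then have "W \<noteq> {0}" using ne by auto
  then obtain mu y where mu: "mu \<in> partitions_of n" and y: "y \<in> W" "y \<noteq> 0" "weight (wt_of (cont mu)) y"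
    using exists_partition_weight[OF iW] by blast
  have yV: "y \<in> fvecs d" using y by (simp add: W_def)
  have lmu: "length (cont mu) = n" "composition mu" using mu by (auto simp: partition_iff)
  have "vip d y (qs ! k) = 0" if k: "k < d" for k
  proof (cases "ws k = cont mu")
    case True
    then have "mu \<in> set lams" using lams_set lmu k by auto
    then obtain p where "p < length lams" "lams ! p = mu" by (auto simp: in_set_conv_nth)
    then have ko: "k \<in> set ord" using True k by (auto simp: ord_def cls_def)
    obtain zs where "G (qs ! k) = qs ! k # zs" using G_Cons by blast
    then have "qs ! k \<in> set (G (qs ! k))" by simp
    then have "qs ! k \<in> set Qs" using ko by (auto simp: Qs_def)
    then show ?thesis using y by (simp add: W_def)
  next
    case False
    then obtain i where i: "i < n" "ws k ! i \<noteq> cont mu ! i"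
      using lmu ws_len[OF k] by (metis nth_equalityI)
    then show ?thesis
      by (intro weights_orth[OF y(3) qs_wt[OF k], of "Suc i"]) (auto simp: wt_of_def)
  qed
  then have "gs_proj (vip d) qs y = y" by (simp add: gs_proj_def qs_len)
  then show False using orthonormal_complete[OF qs_on qs_in qs_len yV] y by simp
qed

text \<open>Completeness turns Bessel's inequality into an equality, so the blocks fill the space
  and \<open>Qmat\<close> has exactly the right columns.\<close>

lemma Qs_length: "length Qs = d"
proof (rule orthonormal_bessel(2)[OF Qs_orthonormal Qs_in])
  fix u :: "nat \<Rightarrow> real" assume u: "u \<in> fvecs d"
  show "gs_proj (vip d) Qs u = 0"
  proof (rule Qs_perp_zero)
    show "gs_proj (vip d) Qs u \<in> fvecs d" using gs_proj_in u Qs_in by blast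
    show "vip d (gs_proj (vip d) Qs u) b = 0" if "b \<in> set Qs" for b
      using gs_proj_orth[OF Qs_orthonormal] that by (auto simp: in_set_conv_nth)
  qed
qed

abbreviation Qmat :: "real mat" where
  "Qmat \<equiv> col_mat d Qs"

lemmas conj_gmat = conj_col_mat[OF Qs_length]
lemmas Qmat_orthogonal = col_mat_orthogonal[OF Qs_length Qs_in Qs_orthonormal]

definition edim :: "nat \<Rightarrow> nat" where
  "edim p = length (G (qs ! (cls p ! 0)))"

definition sig :: "nat \<Rightarrow> (nat \<Rightarrow> nat) \<Rightarrow> real mat" where
  "sig p g = gmat d (\<rho> g) (G (qs ! (cls p ! 0)))"

lemma cls_nonempty: "p < length lams \<Longrightarrow> cls p \<noteq> []"
proof -
  assume p: "p < length lams"
  then have "lams ! p \<in> set lams" by simp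
  then obtain k where "k < d" "ws k = cont (lams ! p)" using lams_set by auto
  then have "k \<in> set (cls p)" by (simp add: cls_def)
  then show ?thesis by auto
qed

lemma rep_cls: "p < length lams \<Longrightarrow> cls p ! 0 \<in> set (cls p)"
  using cls_nonempty by simp

lemma block_eq_sig:
  assumes p: "p < length lams" "k \<in> set (cls p)" and g: "g permutes {1..n}"
  shows "gmat d (\<rho> g) (G (qs ! k)) = sig p g"
proof -
  have k: "k < d" "weight (wt_of (cont (lams ! p))) (qs ! k)" using cls_D[OF p(2)] cls_weight[OF p(2)] by auto
  have k0: "cls p ! 0 < d" "weight (wt_of (cont (lams ! p))) (qs ! (cls p ! 0))"
    using cls_D[OF rep_cls[OF p(1)]] cls_weight[OF rep_cls[OF p(1)]] by auto
  note co = gs_coefficients[OF k(2) k0(2) qs_one[OF k(1)] qs_one[OF k0(1)] g, where m = d, folded G_def]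
  show ?thesis unfolding sig_def
  proof (rule eq_matI)
    fix i j assume "i < dim_row (gmat d (\<rho> g) (G (qs ! (cls p ! 0))))" "j < dim_col (gmat d (\<rho> g) (G (qs ! (cls p ! 0))))"
    then have "i < length (G (qs ! k))" "j < length (G (qs ! k))" using co(1) by auto
    then show "gmat d (\<rho> g) (G (qs ! k)) $$ (i, j) = gmat d (\<rho> g) (G (qs ! (cls p ! 0))) $$ (i, j)"
      using co(1) co(2)[of i j] by (simp add: gmat_def)
  qed (use co(1) in auto)
qed

lemma conj_blocks:
  assumes g: "g permutes {1..n}"
  shows "transpose_mat Qmat * \<rho> g * Qmat =
    diag_block_mat (concat (map (\<lambda>p. replicate (length (cls p)) (sig p g)) [0..<length lams]))"
proof -
  let ?M = "\<rho> g"
  have "gmat d ?M Qs = diag_block_mat (map (gmat d ?M) (map (\<lambda>k. G (qs ! k)) ord))"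
    unfolding Qs_def
  proof (rule gmat_concat)
    have sym: "vip d a (mact d ?M b) = 0" if kl: "k \<in> set ord" "l \<in> set ord" "k \<noteq> l" "a \<in> set (G (qs ! k))" "b \<in> set (G (qs ! l))" for k l a b
    proof -
      obtain \<alpha> where w: "weight \<alpha> (qs ! l)" "l < d" using ord_weight[OF kl(2)] by blast
      show ?thesis by (rule cross[OF kl(1-3) G_cyc[OF kl(1,4)] cyc_closed[OF w(1) qs_one[OF w(2)] G_cyc[OF kl(2,5)] g]])
    qed
    show "sorted_wrt (\<lambda>as bs. \<forall>a\<in>set as. \<forall>b\<in>set bs. vip d a (mact d ?M b) = 0 \<and> vip d b (mact d ?M a) = 0)
       (map (\<lambda>k. G (qs ! k)) ord)"
      unfolding sorted_wrt_iff_nth_less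
    proof (intro allI impI ballI)
      fix i j a b assume ij: "i < j" "j < length (map (\<lambda>k. G (qs ! k)) ord)"
        and a: "a \<in> set (map (\<lambda>k. G (qs ! k)) ord ! i)" and b: "b \<in> set (map (\<lambda>k. G (qs ! k)) ord ! j)"
      have o: "ord ! i \<in> set ord" "ord ! j \<in> set ord" "ord ! i \<noteq> ord ! j"
        using ij ord_distinct by (auto simp: nth_eq_iff_index_eq)
      have ab: "a \<in> set (G (qs ! (ord ! i)))" "b \<in> set (G (qs ! (ord ! j)))" using a b ij by auto
      show "vip d a (mact d ?M b) = 0 \<and> vip d b (mact d ?M a) = 0"
        using sym[OF o ab] sym[OF o(2,1) o(3)[symmetric] ab(2,1)] by blast
    qed
  qed
  also have "map (gmat d ?M) (map (\<lambda>k. G (qs ! k)) ord) = concat (map (\<lambda>p. replicate (length (cls p)) (sig p g)) [0..<length lams])"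
  proof -
    have "map (\<lambda>k. gmat d ?M (G (qs ! k))) (cls p) = replicate (length (cls p)) (sig p g)" if "p < length lams" for p
      using block_eq_sig[OF that _ g] by (simp add: map_replicate_const[symmetric])
    then have "map (\<lambda>p. map (\<lambda>k. gmat d ?M (G (qs ! k))) (cls p)) [0..<length lams] =
        map (\<lambda>p. replicate (length (cls p)) (sig p g)) [0..<length lams]"
      by (intro map_cong) auto
    moreover have "map (gmat d ?M) (map (\<lambda>k. G (qs ! k)) ord) =
        concat (map (\<lambda>p. map (\<lambda>k. gmat d ?M (G (qs ! k))) (cls p)) [0..<length lams])"
      by (simp add: ord_def map_concat o_def)
    ultimately show ?thesis by (simp only:)
  qed
  finally show ?thesis using conj_gmat[OF carr[OF g]] by simp
qed

lemma sig_facts: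
  assumes p: "p < length lams"
  shows "orth_mat_rep n (edim p) (sig p)" "irreducible_rep n (edim p) (sig p)" "indexed_by n (edim p) (sig p) (lams ! p)"
    "mu \<in> partitions_of n \<Longrightarrow> mu \<noteq> lams ! p \<Longrightarrow> tr_coef n (edim p) (sig p) (lam_idem n mu) = 0"
proof -
  have k0: "cls p ! 0 < d" "weight (wt_of (cont (lams ! p))) (qs ! (cls p ! 0))"
    using cls_D[OF rep_cls[OF p(1)]] cls_weight[OF rep_cls[OF p(1)]] by auto
  have lp: "lams ! p \<in> partitions_of n" using lams_partition p by simp
  note w = k0(2) qs_one[OF k0(1)]
  have s: "sig p = (\<lambda>g. gmat d (\<rho> g) (G (qs ! (cls p ! 0))))" by (simp add: sig_def fun_eq_iff)
  show "orth_mat_rep n (edim p) (sig p)" unfolding edim_def s by (rule block_orth_rep[OF w])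
  show "irreducible_rep n (edim p) (sig p)" unfolding edim_def s by (rule block_irreducible[OF w])
  show "indexed_by n (edim p) (sig p) (lams ! p)" unfolding edim_def s by (rule block_indexed[OF w lp refl])
  show "tr_coef n (edim p) (sig p) (lam_idem n mu) = 0" if "mu \<in> partitions_of n" "mu \<noteq> lams ! p"
    unfolding edim_def s by (rule block_trace_other[OF w lp refl that])
qed

text \<open>Isomorphic representations have equal characters, but at \<open>lam_idem\<close> the
  values here are 1 and 0.\<close>

lemma sig_not_isomorphic:
  assumes "p < length lams" "q < length lams" "p \<noteq> q"
  shows "\<not> rep_isomorphic n (edim p) (sig p) (edim q) (sig q)"
proof
  assume iso: "rep_isomorphic n (edim p) (sig p) (edim q) (sig q)"
  interpret P: orth_mat_rep n "edim p" "sig p" using sig_facts(1) assms by blast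
  interpret Q: orth_mat_rep n "edim q" "sig q" using sig_facts(1) assms by blast
  have lp: "lams ! p \<in> partitions_of n" using lams_partition assms by simp
  have "tr_coef n (edim p) (sig p) (lam_idem n (lams ! p)) = 1"
    using P.tr_coef_indexed[OF lp] sig_facts(3) assms by blast
  moreover have "tr_coef n (edim q) (sig q) (lam_idem n (lams ! p)) = 0"
    using sig_facts(4)[OF assms(2) lp] assms lams_dist by (simp add: nth_eq_iff_index_eq)
  ultimately show False using tr_coef_isomorphic[OF P.mat_rep_axioms Q.carr iso] by simp
qed

text \<open>The existence half of the multiplicity, which is defined by a unique description;
  uniqueness is \<open>decomposition_multiplicity\<close>.\<close>

lemma decomposition_exists:
  "irreducible_decomposition n d \<rho> (concat (map (\<lambda>p. replicate (length (cls p)) (edim p, sig p)) [0..<length lams]))"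
  (is "irreducible_decomposition n d \<rho> ?\<sigma>s")
  unfolding irreducible_decomposition_def rep_isomorphic_def
proof (intro conjI)
  show "\<forall>(e, \<sigma>)\<in>set ?\<sigma>s. irreducible_rep n e \<sigma>" using sig_facts(2) by auto
  have blocks: "map (\<lambda>(e, \<sigma>). \<sigma> g) ?\<sigma>s = concat (map (\<lambda>p. replicate (length (cls p)) (sig p g)) [0..<length lams])" for g
    by (simp add: map_concat o_def)
  have c: "Qmat \<in> carrier_mat d d" by (simp add: col_mat_def)
  show "d = sum_list (map fst ?\<sigma>s)"
  proof -
    have id: "id permutes {1..n}" by (rule permutes_id)
    have "d = dim_row (transpose_mat Qmat * \<rho> id * Qmat)" by (simp add: col_mat_def)
    also have "\<dots> = sum_list (map dim_row (map (\<lambda>(e, \<sigma>). \<sigma> id) ?\<sigma>s))"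
      unfolding conj_blocks[OF id] blocks[symmetric] by (rule dim_diag_block_mat(1))
    also have "map dim_row (map (\<lambda>(e, \<sigma>). \<sigma> id) ?\<sigma>s) = map fst ?\<sigma>s"
      unfolding map_map by (rule map_cong[OF refl]) (auto simp: sig_def edim_def)
    finally show ?thesis .
  qed
  show "\<exists>P\<in>carrier (GL d). \<forall>g\<in>carrier (sym_group n). P * \<rho> g = diag_block_mat (map (\<lambda>(e, \<sigma>). \<sigma> g) ?\<sigma>s) * P"
  proof (intro bexI[of _ "transpose_mat Qmat"] ballI)
    have QQ: "transpose_mat Qmat * Qmat = 1\<^sub>m d" using Qmat_orthogonal by (simp add: orthogonal_group_def)
    have QQ': "Qmat * transpose_mat Qmat = 1\<^sub>m d" using orthogonal_mult_transpose[OF c QQ] by simp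
    show "transpose_mat Qmat \<in> carrier (GL d)" unfolding carrier_GL using c QQ QQ' by auto
    fix g assume "g \<in> carrier (sym_group n)"
    then have g: "g permutes {1..n}" by (simp add: sym_group_carrier)
    have r: "\<rho> g \<in> carrier_mat d d" using carr[OF g] .
    have "(transpose_mat Qmat * \<rho> g * Qmat) * transpose_mat Qmat = transpose_mat Qmat * \<rho> g * (Qmat * transpose_mat Qmat)"
      using c r by (subst assoc_mult_mat[of _ d d _ d _ d]) auto
    also have "\<dots> = transpose_mat Qmat * \<rho> g" using QQ' c r by simp
    finally show "transpose_mat Qmat * \<rho> g = diag_block_mat (map (\<lambda>(e, \<sigma>). \<sigma> g) ?\<sigma>s) * transpose_mat Qmat"
      unfolding conj_blocks[OF g] blocks by simp
  qed
qed

text \<open>The element acts as the orthogonal projection to the weight space of \<open>lam\<close>,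
  whose trace in an orthonormal weight basis is the number of basis vectors with that
  weight.\<close>

lemma tr_coef_weight_count:
  assumes lam: "lam \<in> partitions_of n"
  shows "tr_coef n d \<rho> (lam_idem n lam) = real (length (filter (\<lambda>k. ws k = cont lam) [0..<d]))"
proof -
  let ?\<alpha> = "wt_of (cont lam)"
  let ?E = "\<lambda>i. (\<lambda>j. if j = i then 1 else 0 :: real)"
  let ?M = "Eop ?\<alpha> n"
  have e: "?E i \<in> fvecs d" if "i < d" for i using that by (auto simp: fvecs_def)
  have eu: "vip d u (?E i) = u i" if "i < d" for i u
    using that by (simp add: vip_def if_distrib[of "\<lambda>x. _ * x"] cong: if_cong)
  have qV: "qs ! k \<in> fvecs d" if "k < d" for k using qs_in qs_len that nth_mem by blast
  \<comment> \<open>Change of basis for the trace: each unit vector is expanded in the complete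
    orthonormal list \<open>qs\<close>.\<close>
  have "?M (?E i) i = (\<Sum>k<d. (qs ! k) i * ?M (qs ! k) i)" if i: "i < d" for i
  proof -
    have "gs_proj (vip d) qs (?E i) = 0" using orthonormal_complete[OF qs_on qs_in qs_len e[OF i]] .
    then have "?E i = (\<Sum>k<d. vip d (?E i) (qs ! k) *\<^sub>R qs ! k)" by (simp add: gs_proj_def qs_len)
    also have "\<dots> = (\<Sum>k<d. (qs ! k) i *\<^sub>R qs ! k)" by (intro sum.cong refl) (metis eu[OF i] vip_sym)
    finally have "?M (?E i) = ?M (\<Sum>k<d. (qs ! k) i *\<^sub>R qs ! k)" by (rule arg_cong)
    then show ?thesis
      by (simp add: linear_sum[OF Eop_linear[OF order_refl]] linear_scale[OF Eop_linear[OF order_refl]] sum_fun_apply)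
  qed
  then have "tr_coef n d \<rho> (lam_idem n lam) = (\<Sum>i<d. \<Sum>k<d. (qs ! k) i * ?M (qs ! k) i)"
    unfolding tr_coef_ext lam_idem_def by (intro sum.cong) (auto simp: ext_idem e)
  also have "\<dots> = (\<Sum>k<d. vip d (qs ! k) (?M (qs ! k)))" unfolding vip_def by (rule sum.swap)
  also have "\<dots> = (\<Sum>k<d. if ws k = cont lam then 1 else 0)"
  proof (rule sum.cong[OF refl])
    fix k assume "k \<in> {..<d}"
    then have k: "k < d" by simp
    show "vip d (qs ! k) (?M (qs ! k)) = (if ws k = cont lam then 1 else 0)"
    proof (cases "ws k = cont lam")
      case True
      then have "?M (qs ! k) = qs ! k" using Eop_weight[OF _ order_refl] qs_wt[OF k] by metis
      then show ?thesis using True qs_one[OF k] by simp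
    next
      case False
      have "length (cont lam) = n" using lam by (simp add: partition_iff)
      then obtain i where i: "i < n" "ws k ! i \<noteq> cont lam ! i"
        using False ws_len[OF k] by (metis nth_equalityI)
      then have "vip d (qs ! k) (?M (qs ! k)) = 0"
        by (intro weights_orth[OF qs_wt[OF k] weight_Eop[OF qV[OF k]], of "Suc i"]) (auto simp: wt_of_def)
      then show ?thesis using False by simp
    qed
  qed
  also have "\<dots> = real (length (filter (\<lambda>k. ws k = cont lam) [0..<d]))"
    by (induction d) simp_all
  finally show ?thesis .
qed

theorem multiplicity:
  assumes lam: "lam \<in> partitions_of n"
  shows "irrep_multiplicity n d \<rho> lam = length (filter (\<lambda>k. ws k = cont lam) [0..<d])"
  unfolding irrep_multiplicity_def
proof (rule the_equality)
  let ?m = "length (filter (\<lambda>k. ws k = cont lam) [0..<d])"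
  have uniq: "length (filter (\<lambda>(e, \<sigma>). indexed_by n e \<sigma> lam) \<sigma>s) = ?m" if "irreducible_decomposition n d \<rho> \<sigma>s" for \<sigma>s
    using decomposition_multiplicity[OF mat_rep_axioms that lam] tr_coef_weight_count[OF lam] by simp
  show "\<exists>\<sigma>s. irreducible_decomposition n d \<rho> \<sigma>s \<and> ?m = length (filter (\<lambda>(e, \<sigma>). indexed_by n e \<sigma> lam) \<sigma>s)"
    by (rule exI, rule conjI[OF decomposition_exists uniq[OF decomposition_exists, symmetric]])
  show "m = ?m" if "\<exists>\<sigma>s. irreducible_decomposition n d \<rho> \<sigma>s \<and> m = length (filter (\<lambda>(e, \<sigma>). indexed_by n e \<sigma> lam) \<sigma>s)" for m
    using that uniq by blast
qed

lemma multiplicity_cls: "p < length lams \<Longrightarrow> irrep_multiplicity n d \<rho> (lams ! p) = length (cls p)"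
  using multiplicity lams_partition by (simp add: cls_def)

lemma lams_eq: "set lams = {lam \<in> partitions_of n. irrep_multiplicity n d \<rho> lam > 0}"
proof -
  have "irrep_multiplicity n d \<rho> lam > 0 \<longleftrightarrow> (\<exists>k<d. ws k = cont lam)" if "lam \<in> partitions_of n" for lam
    unfolding multiplicity[OF that] by (auto simp: filter_empty_conv)
  moreover have "mu \<in> set lams \<longleftrightarrow> mu \<in> partitions_of n \<and> (\<exists>k<d. ws k = cont mu)" for mu
    using lams_partition[of mu] lams_set by (auto simp: partition_iff)
  ultimately show ?thesis by auto
qed

theorem block_form:
  "\<exists>(e :: nat \<Rightarrow> nat) (\<sigma> :: nat \<Rightarrow> (nat \<Rightarrow> nat) \<Rightarrow> real mat).
     (\<forall>k < length lams. \<sigma> k \<in> hom (sym_group n) (orthogonal_group (e k)) \<and>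
        irreducible_rep n (e k) (\<sigma> k) \<and> indexed_by n (e k) (\<sigma> k) (lams ! k)) \<and>
     (\<forall>k < length lams. \<forall>l < length lams. k \<noteq> l \<longrightarrow> \<not> rep_isomorphic n (e k) (\<sigma> k) (e l) (\<sigma> l)) \<and>
     (\<forall>g \<in> carrier (sym_group n). transpose_mat Qmat * \<rho> g * Qmat =
        diag_block_mat (concat (map (\<lambda>k. replicate (irrep_multiplicity n d \<rho> (lams ! k)) (\<sigma> k g)) [0..<length lams])))"
proof (intro exI[of _ edim] exI[of _ sig] conjI allI impI ballI)
  fix g assume "g \<in> carrier (sym_group n)"
  then have g: "g permutes {1..n}" by (simp add: sym_group_carrier)
  have "map (\<lambda>k. replicate (irrep_multiplicity n d \<rho> (lams ! k)) (sig k g)) [0..<length lams] =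
      map (\<lambda>p. replicate (length (cls p)) (sig p g)) [0..<length lams]"
    by (simp add: multiplicity_cls)
  then show "transpose_mat Qmat * \<rho> g * Qmat =
        diag_block_mat (concat (map (\<lambda>k. replicate (irrep_multiplicity n d \<rho> (lams ! k)) (sig k g)) [0..<length lams]))"
    unfolding conj_blocks[OF g] by (simp only:)
qed (use sig_facts sig_not_isomorphic orth_mat_rep_hom in blast)+

end

section \<open>Reasoning about programs\<close>

text \<open>Total correctness with a cost budget. An execution exists only if the program terminates
  and all divisions and square roots on its way are defined, so \<open>wp\<close> includes these
  obligations.\<close>

definition wp :: "com \<Rightarrow> nat \<Rightarrow> (state \<Rightarrow> bool) \<Rightarrow> state \<Rightarrow> bool" where
  "wp c K Q s \<longleftrightarrow> (\<exists>k t. exec c s k t \<and> k \<le> K \<and> Q t)"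

lemma wp_conseq: "wp c K Q s \<Longrightarrow> K \<le> K' \<Longrightarrow> (\<And>t. Q t \<Longrightarrow> Q' t) \<Longrightarrow> wp c K' Q' s"
  unfolding wp_def by (meson order_trans)

lemma wp_post: "wp c K Q s \<Longrightarrow> (\<And>t. Q t \<Longrightarrow> Q' t) \<Longrightarrow> wp c K Q' s"
  by (rule wp_conseq[OF _ order_refl])

lemma wp_le: "wp c K Q s \<Longrightarrow> K \<le> K' \<Longrightarrow> wp c K' Q s"
  by (rule wp_conseq) auto

lemma wp_Seq: "wp c1 K1 (wp c2 K2 Q) s \<Longrightarrow> wp (Seq c1 c2) (K1 + K2) Q s"
  unfolding wp_def by (meson exec.Seq add_mono)

lemma wp_Skip: "Q s \<Longrightarrow> wp Skip 0 Q s"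
  unfolding wp_def using exec.Skip by blast

lemma wp_NAssign: "Q (set_nat s l (nval e s)) \<Longrightarrow> wp (NAssign l e) 0 Q s"
  unfolding wp_def using exec.NAssign by blast

lemma wp_Copy: "Q (set_real s l (get_real s l1)) \<Longrightarrow> wp (Copy l l1) 0 Q s"
  unfolding wp_def using exec.Copy by blast

lemma wp_OfNat: "Q (set_real s l (real (nval e s))) \<Longrightarrow> wp (OfNat l e) 1 Q s"
  unfolding wp_def using exec.OfNat by blast

lemma wp_Arith: "op_defined f (get_real s l1) (get_real s l2) \<Longrightarrow>
    Q (set_real s l (op_val f (get_real s l1) (get_real s l2))) \<Longrightarrow> wp (Arith f l l1 l2) 1 Q s"
  unfolding wp_def using exec.Arith by blast

lemma wp_Sqrt: "get_real s l1 \<ge> 0 \<Longrightarrow> Q (set_real s l (sqrt (get_real s l1))) \<Longrightarrow> wp (Sqrt l l1) 1 Q s"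
  unfolding wp_def using exec.Sqrt by blast

lemma wp_Compare: "Q (set_nat s l (if get_real s l1 < get_real s l2 then 1 else 0)) \<Longrightarrow> wp (Compare l l1 l2) 1 Q s"
  unfolding wp_def using exec.Compare by blast

lemma wp_If: "(bval b s \<Longrightarrow> wp c1 K Q s) \<Longrightarrow> (\<not> bval b s \<Longrightarrow> wp c2 K Q s) \<Longrightarrow> wp (If b c1 c2) K Q s"
  unfolding wp_def by (meson exec.IfTrue exec.IfFalse)

abbreviation Nv :: "string \<Rightarrow> nexp" where
  "Nv x \<equiv> Cell x (Lit 0)"

abbreviation Neq :: "nexp \<Rightarrow> nexp \<Rightarrow> bexp" where
  "Neq e f \<equiv> And (Not (Less e f)) (Not (Less f e))"

definition For :: "string \<Rightarrow> nexp \<Rightarrow> com \<Rightarrow> com" where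
  "For i N c = Seq (NAssign (i, Lit 0) (Lit 0))
     (While (Less (Nv i) N) (Seq c (NAssign (i, Lit 0) (NPlus (Nv i) (Lit 1)))))"

text \<open>The bound is evaluated afresh in every round, hence must stay N under the invariant. The
  body must restore the counter, and the invariant is asked for after the counter has been
  advanced.\<close>

lemma wp_For:
  assumes init: "I 0 (set_nat s (i, Lit 0) 0)"
    and bound: "\<And>m t. I m t \<Longrightarrow> m \<le> N \<Longrightarrow> nval e t = N"
    and step: "\<And>m t. m < N \<Longrightarrow> I m t \<Longrightarrow> nats t i 0 = m \<Longrightarrow>
      wp c K (\<lambda>t. nats t i 0 = m \<and> I (Suc m) (set_nat t (i, Lit 0) (Suc m))) t"
  shows "wp (For i e c) (N * K) (\<lambda>t. I N t \<and> nats t i 0 = N) s"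
proof -
  let ?w = "While (Less (Nv i) e) (Seq c (NAssign (i, Lit 0) (NPlus (Nv i) (Lit 1))))"
  \<comment> \<open>Induction on the number j of remaining rounds.\<close>
  have loop: "wp ?w (j * K) (\<lambda>t. I N t \<and> nats t i 0 = N) t"
    if "j \<le> N" "I (N - j) t" "nats t i 0 = N - j" for j t
    using that
  proof (induction j arbitrary: t)
    case 0
    then have "\<not> bval (Less (Nv i) e) t" using bound[of N t] by simp
    then show ?case unfolding wp_def using exec.WhileFalse 0 by fastforce
  next
    case (Suc j)
    let ?m = "N - Suc j"
    have m: "?m < N" "Suc ?m = N - j" using Suc.prems by auto
    have b: "bval (Less (Nv i) e) t" using bound[of ?m t] Suc.prems by simp
    obtain k1 t1 where t1: "exec c t k1 t1" "k1 \<le> K" "nats t1 i 0 = ?m" "I (Suc ?m) (set_nat t1 (i, Lit 0) (Suc ?m))"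
      using step[OF m(1) Suc.prems(2,3)] by (auto simp: wp_def)
    let ?t2 = "set_nat t1 (i, Lit 0) (Suc ?m)"
    have e2: "exec (NAssign (i, Lit 0) (NPlus (Nv i) (Lit 1))) t1 0 ?t2"
      using exec.NAssign[of "(i, Lit 0)" "NPlus (Nv i) (Lit 1)" t1] t1(3) by simp
    have "wp ?w (j * K) (\<lambda>t. I N t \<and> nats t i 0 = N) ?t2"
      using Suc.prems t1(4) m(2) by (intro Suc.IH) (auto simp: set_nat_def)
    then obtain k2 t3 where "exec ?w ?t2 k2 t3" "k2 \<le> j * K" "I N t3 \<and> nats t3 i 0 = N" by (auto simp: wp_def)
    then show ?case unfolding wp_def
      using exec.WhileTrue[OF b exec.Seq[OF t1(1) e2]] t1(2) by (intro exI[of _ "k1 + 0 + k2"] exI[of _ t3]) auto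
  qed
  have "wp ?w (N * K) (\<lambda>t. I N t \<and> nats t i 0 = N) (set_nat s (i, Lit 0) 0)"
    using init by (intro loop) (auto simp: set_nat_def)
  then have "wp (For i e c) (0 + N * K) (\<lambda>t. I N t \<and> nats t i 0 = N) s"
    unfolding For_def by (intro wp_Seq wp_NAssign) simp
  then show ?thesis by simp
qed

lemma nats_set [simp]:
  "nats (set_real s l v) = nats s"
  "nats (set_nat s l w) x = (if x = fst l then (nats s x)(nval (snd l) s := w) else nats s x)"
  by (auto simp: set_real_def set_nat_def)

lemma reals_set [simp]:
  "reals (set_nat s l w) = reals s"
  "reals (set_real s l v) x = (if x = fst l then (reals s x)(nval (snd l) s := v) else reals s x)"
  by (auto simp: set_real_def set_nat_def)

lemma nval_set_real [simp]: "nval e (set_real s l v) = nval e s"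
  by (induction e) auto

text \<open>The frame condition: only arrays named in \<open>NX\<close> and \<open>RX\<close> may
  have changed. With whole arrays as the unit, side conditions reduce to comparing names.\<close>

definition eqx :: "string set \<Rightarrow> string set \<Rightarrow> state \<Rightarrow> state \<Rightarrow> bool" where
  "eqx NX RX s t \<longleftrightarrow> (\<forall>x. x \<notin> NX \<longrightarrow> nats t x = nats s x) \<and> (\<forall>x. x \<notin> RX \<longrightarrow> reals t x = reals s x)"

lemma eqx_refl [simp]: "eqx NX RX s s"
  by (simp add: eqx_def)

lemma eqx_trans: "eqx NX RX s t \<Longrightarrow> eqx NX' RX' t u \<Longrightarrow> NX \<subseteq> M \<Longrightarrow> NX' \<subseteq> M \<Longrightarrow> RX \<subseteq> R \<Longrightarrow> RX' \<subseteq> R \<Longrightarrow> eqx M R s u"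
  unfolding eqx_def by (metis subsetD)

lemma eqx_mono: "eqx NX RX s t \<Longrightarrow> NX \<subseteq> M \<Longrightarrow> RX \<subseteq> R \<Longrightarrow> eqx M R s t"
  unfolding eqx_def by blast

lemma eqx_set_nat [simp]: "fst l \<in> NX \<Longrightarrow> eqx NX RX s (set_nat t l v) \<longleftrightarrow> eqx NX RX s t"
  by (auto simp: eqx_def) metis

lemma eqx_set_real [simp]: "fst l \<in> RX \<Longrightarrow> eqx NX RX s (set_real t l v) \<longleftrightarrow> eqx NX RX s t"
  by (auto simp: eqx_def) metis

lemma eqxN: "eqx NX RX s t \<Longrightarrow> x \<notin> NX \<Longrightarrow> nats t x = nats s x"
  and eqxR: "eqx NX RX s t \<Longrightarrow> x \<notin> RX \<Longrightarrow> reals t x = reals s x"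
  by (auto simp: eqx_def)

abbreviation "acc \<equiv> (''acc'', Lit 0)"
abbreviation "tmp \<equiv> (''tmp'', Lit 0)"

text \<open>Overwrites the counter \<open>i\<close> and the cells \<open>acc\<close> and
  \<open>tmp\<close>; the result stays in \<open>acc\<close>, where \<open>Fill\<close> picks it up.
  One operation clears \<open>acc\<close>, and every term costs two.\<close>

definition Dot :: "nexp \<Rightarrow> loc \<Rightarrow> loc \<Rightarrow> com" where
  "Dot e la lb = Seq (OfNat acc (Lit 0)) (For ''i'' e (Seq (Arith Mul tmp la lb) (Arith Add acc acc tmp)))"

lemma wp_Dot:
  assumes "\<And>t. eqx {''i''} {''acc'', ''tmp''} s t \<Longrightarrow> nval e t = N"
    and "\<And>t m. m < N \<Longrightarrow> eqx {''i''} {''acc'', ''tmp''} s t \<Longrightarrow> nats t ''i'' 0 = m \<Longrightarrow> get_real t la = A m \<and> get_real t lb = B m"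
  shows "wp (Dot e la lb) (1 + 2 * N) (\<lambda>t. eqx {''i''} {''acc'', ''tmp''} s t \<and> reals t ''acc'' 0 = (\<Sum>m<N. A m * B m)) s"
proof -
  define I where "I m t \<longleftrightarrow> eqx {''i''} {''acc'', ''tmp''} s t \<and> reals t ''acc'' 0 = (\<Sum>m<m. A m * B m)" for m t
  have "wp (For ''i'' e (Seq (Arith Mul tmp la lb) (Arith Add acc acc tmp))) (N * (1 + 1))
    (\<lambda>t. I N t \<and> nats t ''i'' 0 = N) (set_real s acc (real (nval (Lit 0) s)))"
  proof (rule wp_For)
    show "I 0 (set_nat (set_real s acc (real (nval (Lit 0) s))) (''i'', Lit 0) 0)"
      by (simp add: I_def)
    show "nval e t = N" if "I m t" for m t using assms(1) that by (simp add: I_def)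
    show "wp (Seq (Arith Mul tmp la lb) (Arith Add acc acc tmp)) (1 + 1)
        (\<lambda>t. nats t ''i'' 0 = m \<and> I (Suc m) (set_nat t (''i'', Lit 0) (Suc m))) t"
      if "m < N" "I m t" "nats t ''i'' 0 = m" for m t
      using assms(2)[of m t] that
      by (intro wp_Seq wp_Arith) (auto simp: I_def get_real_def[of _ acc] get_real_def[of _ tmp])
  qed
  then have "wp (Dot e la lb) (1 + N * (1 + 1)) (\<lambda>t. I N t \<and> nats t ''i'' 0 = N) s"
    unfolding Dot_def by (intro wp_Seq wp_OfNat)
  then show ?thesis by (rule wp_conseq) (auto simp: I_def)
qed

definition Fill :: "string \<Rightarrow> nexp \<Rightarrow> string \<Rightarrow> nexp \<Rightarrow> com \<Rightarrow> com" where
  "Fill i e dst off c = For i e (Seq c (Copy (dst, NPlus off (Nv i)) acc))"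

text \<open>The body may assume which part of the target has been written: several programs update
  an array in place and read entries of it that are still old.\<close>

lemma wp_Fill:
  assumes fr: "\<And>t. eqx (insert i NX) (insert dst RX) s t \<Longrightarrow> nval e t = N \<and> nval off t = b"
    and disj: "i \<notin> NX" "dst \<notin> RX"
    and body: "\<And>k t. k < N \<Longrightarrow> nats t i 0 = k \<Longrightarrow> eqx (insert i NX) (insert dst RX) s t \<Longrightarrow>
      (\<And>m. reals t dst m = (if b \<le> m \<and> m < b + k then F (m - b) else reals s dst m)) \<Longrightarrow>
      wp c K (\<lambda>u. eqx NX RX t u \<and> reals u ''acc'' 0 = F k) t"
  shows "wp (Fill i e dst off c) (N * K) (\<lambda>t. eqx (insert i NX) (insert dst RX) s t \<and>
    (\<forall>m. reals t dst m = (if b \<le> m \<and> m < b + N then F (m - b) else reals s dst m))) s"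
proof -
  define I where "I k t \<longleftrightarrow> eqx (insert i NX) (insert dst RX) s t \<and>
    (\<forall>m. reals t dst m = (if b \<le> m \<and> m < b + k then F (m - b) else reals s dst m))" for k t
  have "wp (Fill i e dst off c) (N * (K + 0)) (\<lambda>t. I N t \<and> nats t i 0 = N) s"
    unfolding Fill_def
  proof (rule wp_For)
    show "I 0 (set_nat s (i, Lit 0) 0)" by (simp add: I_def)
    show "nval e t = N" if "I m t" for m t using fr that by (simp add: I_def)
    show "wp (Seq c (Copy (dst, NPlus off (Nv i)) acc)) (K + 0)
        (\<lambda>t. nats t i 0 = k \<and> I (Suc k) (set_nat t (i, Lit 0) (Suc k))) t"
      if k: "k < N" "I k t" "nats t i 0 = k" for k t
    proof (intro wp_Seq, rule wp_post[OF body])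
      show "k < N" "nats t i 0 = k" "eqx (insert i NX) (insert dst RX) s t" using k by (auto simp: I_def)
      show "reals t dst m = (if b \<le> m \<and> m < b + k then F (m - b) else reals s dst m)" for m
        using k(2) by (simp add: I_def)
      fix u assume u: "eqx NX RX t u \<and> reals u ''acc'' 0 = F k"
      have su: "eqx (insert i NX) (insert dst RX) s u"
        by (rule eqx_trans[of "insert i NX" "insert dst RX" s t NX RX]) (use k u in \<open>auto simp: I_def\<close>)
      have ui: "nats u i 0 = k" using u k(3) disj eqxN[of NX RX t u i] by simp
      have ud: "reals u dst = reals t dst" using u disj eqxR[of NX RX t u dst] by simp
      have ob: "nval off u = b" using fr[OF su] by simp
      have td: "reals t dst m = (if b \<le> m \<and> m < b + k then F (m - b) else reals s dst m)" for m
        using k(2) by (simp add: I_def)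
      show "wp (Copy (dst, NPlus off (Nv i)) acc) 0 (\<lambda>t. nats t i 0 = k \<and> I (Suc k) (set_nat t (i, Lit 0) (Suc k))) u"
        using u su ui ob by (intro wp_Copy) (auto simp: I_def get_real_def ud td)
    qed
  qed
  then show ?thesis by (rule wp_conseq) (auto simp: I_def)
qed

section \<open>Phase one: the Young--Jucys--Murphy eigenbasis\<close>

abbreviation "dN \<equiv> Nv ''d''"
abbreviation "nN \<equiv> Nv ''n''"
abbreviation "ddN \<equiv> NTimes dN dN"
text \<open>A running index k below d^2 encodes a matrix position; the column is k - (k div d) d, as
  the expressions offer division but no remainder.\<close>

abbreviation "rowN \<equiv> NDiv (Nv ''k'') dN"
abbreviation "colN \<equiv> NMinus (Nv ''k'') (NTimes rowN dN)"
abbreviation idx2 :: "nexp \<Rightarrow> nexp \<Rightarrow> nexp" where "idx2 r c \<equiv> NPlus (NTimes r dN) c"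
abbreviation idx3 :: "nexp \<Rightarrow> nexp \<Rightarrow> nexp \<Rightarrow> nexp" where "idx3 b r c \<equiv> idx2 (idx2 b r) c"
abbreviation "zr \<equiv> (''zero'', Lit 0)"
abbreviation "sc \<equiv> (''sc'', Lit 0)"
abbreviation "t2 \<equiv> (''t2'', Lit 0)"
abbreviation "sq \<equiv> (''sq'', Lit 0)"
abbreviation "fl \<equiv> (''f'', Lit 0)"
abbreviation "pos \<equiv> Less (Lit 0) (Nv ''f'')"

text \<open>Slot l of the array \<open>X\<close> holds the matrix of X_{l+1}, and slot 0 is the zero
  matrix of the initial state. The intermediate product of X_{l+1} and the transposition matrix goes
  to \<open>Y\<close>.\<close>

definition jm_step :: com where
  "jm_step = Seq
     (Fill ''k'' ddN ''Y'' (Lit 0) (Dot dN (''X'', idx3 (Nv ''l'') rowN (Nv ''i'')) (''rho'', idx3 (Nv ''l'') (Nv ''i'') colN)))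
     (Fill ''k'' ddN ''X'' (NTimes (NPlus (Nv ''l'') (Lit 1)) ddN)
        (Seq (Dot dN (''rho'', idx3 (Nv ''l'') rowN (Nv ''i'')) (''Y'', idx2 (Nv ''i'') colN))
             (Arith Add acc acc (''rho'', NPlus (NTimes (Nv ''l'') ddN) (Nv ''k'')))))"

definition jm_prog :: com where
  "jm_prog = For ''l'' (NMinus nN (Lit 1)) jm_step"

text \<open>The candidate eigenvalue is c - n, formed in the reals because subtraction of naturals
  would truncate. The loop variable c therefore runs from 0 to 2 n.\<close>

definition eig_step :: com where
  "eig_step = Seq (OfNat sc (Nv ''c'')) (Seq (OfNat t2 nN) (Seq (Arith Sub sc sc t2)
     (Seq (Fill ''k'' dN ''w'' (Lit 0) (Seq (Dot dN (''X'', idx3 (Nv ''j'') (Nv ''k'') (Nv ''i'')) (''v'', Nv ''i''))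
          (Seq (Arith Mul t2 sc (''v'', Nv ''k'')) (Arith Sub acc acc t2))))
     (Seq (Dot dN (''w'', Nv ''i'') (''w'', Nv ''i'')) (Seq (Compare fl zr acc)
     (If pos (Fill ''k'' dN ''v'' (Lit 0) (Copy acc (''w'', Nv ''k'')))
             (NAssign (''wt'', NPlus (NTimes (Nv ''m'') nN) (Nv ''j'')) (Nv ''c''))))))))"

definition find_prog :: com where
  "find_prog = For ''a'' dN (Seq (Compare fl zr (''P'', idx2 (Nv ''a'') (Nv ''a'')))
     (If pos (NAssign (''p'', Lit 0) (Nv ''a'')) Skip))"

definition norm_prog :: com where
  "norm_prog = Seq (Dot dN (''v'', Nv ''i'') (''v'', Nv ''i''))
    (Seq (Sqrt sq acc) (Fill ''k'' dN ''q'' (NTimes (Nv ''m'') dN) (Arith Quot acc (''v'', Nv ''k'') sq)))"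

text \<open>Subtracting the outer square of the new vector keeps \<open>P\<close> a projection at a
  cost of order d^2 per vector, so that start vectors can be read off as rows and need no
  orthogonalization.\<close>

definition upd_prog :: com where
  "upd_prog = Fill ''k'' ddN ''P'' (Lit 0) (Seq (Arith Mul t2 (''q'', idx2 (Nv ''m'') rowN) (''q'', idx2 (Nv ''m'') colN))
     (Arith Sub acc (''P'', Nv ''k'') t2))"

definition vec_step :: com where
  "vec_step = Seq find_prog
    (Seq (Fill ''k'' dN ''v'' (Lit 0) (Copy acc (''P'', idx2 (Nv ''p'') (Nv ''k''))))
    (Seq (For ''j'' nN (For ''c'' (NPlus (NPlus nN nN) (Lit 1)) eig_step))
    (Seq norm_prog upd_prog)))"

definition basis_prog :: com where
  "basis_prog = Seq (Fill ''k'' ddN ''P'' (Lit 0) (If (Neq rowN colN) (OfNat acc (Lit 1)) (OfNat acc (Lit 0))))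
     (For ''m'' dN vec_step)"

definition row_of :: "nat \<Rightarrow> (nat \<Rightarrow> real) \<Rightarrow> nat \<Rightarrow> nat \<Rightarrow> real" where
  "row_of d a m = (\<lambda>i. if i < d then a (m * d + i) else 0)"

lemma row_of_in [simp]: "row_of d a m \<in> fvecs d"
  by (auto simp: row_of_def fvecs_def)

lemma div_idx: "k < d * d \<Longrightarrow> k div d < (d::nat)"
  by (simp add: less_mult_imp_div_less)

lemma mod_idx: "k < d * d \<Longrightarrow> k mod d < (d::nat)"
  by (cases d) auto

lemma idx_lt: "r < d \<Longrightarrow> c < d \<Longrightarrow> r * d + c < d * (d::nat)"
proof -
  assume "r < d" "c < d"
  then have "r * d + c < Suc r * d" "Suc r * d \<le> d * d" using mult_le_mono1[of "Suc r" d d] by simp_all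
  then show ?thesis by linarith
qed

lemma div_mod_idx: "c < d \<Longrightarrow> (r * d + c) div d = (r::nat)" "c < d \<Longrightarrow> (r * d + c) mod d = (c::nat)"
  by auto

lemma sum_mult_swap:
  "(\<Sum>i<d. \<Sum>c<d. a i * (b i c * v c)) = (\<Sum>c<d. (\<Sum>i<d. a i * b i c) * (v c :: real))" for d :: nat
  by (subst sum.swap) (simp add: sum_distrib_right mult.assoc)

section \<open>Correctness of the eigenbasis computation\<close>

locale jm_program = orth_mat_rep +
  assumes n1: "n \<ge> 1" and d1: "d \<ge> 1"
begin

abbreviation "tm l \<equiv> \<rho> (tr (Suc l) (Suc (Suc l)))"

primrec XM :: "nat \<Rightarrow> nat \<Rightarrow> nat \<Rightarrow> real" where
  "XM 0 = (\<lambda>r c. 0)"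
| "XM (Suc l) = (\<lambda>r c. (\<Sum>i<d. tm l $$ (r, i) * (\<Sum>k<d. XM l i k * tm l $$ (k, c))) + tm l $$ (r, c))"

lemma XM_X:
  assumes "j < n" "v \<in> fvecs d" "r < d"
  shows "X (Suc j) v r = (\<Sum>c<d. XM j r c * v c)"
  using assms
proof (induction j arbitrary: v r)
  case (Suc j)
  have tp: "tr (Suc j) (Suc (Suc j)) permutes {1..n}" using Suc.prems by (intro tr_n) auto
  let ?t = "mact d (tm j)"
  have "X (Suc (Suc j)) v = ?t (X (Suc j) (?t v)) + ?t v"
    using s_X_s[of "Suc j" v] Suc.prems by simp
  then have "X (Suc (Suc j)) v r = ?t (X (Suc j) (?t v)) r + ?t v r" by simp
  also have "?t (X (Suc j) (?t v)) r = (\<Sum>i<d. tm j $$ (r, i) * (\<Sum>k<d. XM j i k * (\<Sum>c<d. tm j $$ (k, c) * v c)))"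
  proof -
    have "X (Suc j) (?t v) i = (\<Sum>k<d. XM j i k * (\<Sum>c<d. tm j $$ (k, c) * v c))" if "i < d" for i
    proof -
      have "X (Suc j) (?t v) i = (\<Sum>k<d. XM j i k * ?t v k)" using Suc.prems that by (intro Suc.IH) auto
      also have "\<dots> = (\<Sum>k<d. XM j i k * (\<Sum>c<d. tm j $$ (k, c) * v c))" by (intro sum.cong) (auto simp: mact_def)
      finally show ?thesis .
    qed
    then show ?thesis using Suc.prems(3) by (simp add: mact_def)
  qed
  also have "\<dots> = (\<Sum>c<d. (\<Sum>i<d. tm j $$ (r, i) * (\<Sum>k<d. XM j i k * tm j $$ (k, c))) * v c)"
  proof -
    have A: "(\<Sum>k<d. XM j i k * (\<Sum>c<d. tm j $$ (k, c) * v c)) = (\<Sum>c<d. (\<Sum>k<d. XM j i k * tm j $$ (k, c)) * v c)" for i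
      unfolding sum_distrib_left by (rule sum_mult_swap)
    have "(\<Sum>i<d. tm j $$ (r, i) * (\<Sum>k<d. XM j i k * (\<Sum>c<d. tm j $$ (k, c) * v c)))
       = (\<Sum>i<d. \<Sum>c<d. tm j $$ (r, i) * ((\<Sum>k<d. XM j i k * tm j $$ (k, c)) * v c))"
      by (intro sum.cong refl) (unfold A, rule sum_distrib_left)
    also have "\<dots> = (\<Sum>c<d. (\<Sum>i<d. tm j $$ (r, i) * (\<Sum>k<d. XM j i k * tm j $$ (k, c))) * v c)"
      by (rule sum_mult_swap)
    finally show ?thesis .
  qed
  also have "?t v r = (\<Sum>c<d. tm j $$ (r, c) * v c)" using Suc.prems by (simp add: mact_def)
  finally show ?case by (simp only: XM.simps sum.distrib distrib_right)
qed simp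

text \<open>The cell \<open>zero\<close> is never assigned and keeps its initial value; comparisons
  with 0 refer to it.\<close>

definition inp :: "state \<Rightarrow> bool" where
  "inp s \<longleftrightarrow> nats s ''n'' 0 = n \<and> nats s ''d'' 0 = d \<and> reals s ''zero'' 0 = 0 \<and>
     (\<forall>l<n - 1. \<forall>r<d. \<forall>c<d. reals s ''rho'' ((l * d + r) * d + c) = tm l $$ (r, c))"

lemma inpD: "inp s \<Longrightarrow> nats s ''n'' 0 = n" "inp s \<Longrightarrow> nats s ''d'' 0 = d" "inp s \<Longrightarrow> reals s ''zero'' 0 = 0"
  "inp s \<Longrightarrow> l < n - 1 \<Longrightarrow> r < d \<Longrightarrow> c < d \<Longrightarrow> reals s ''rho'' ((l * d + r) * d + c) = tm l $$ (r, c)"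
  by (auto simp: inp_def)

lemma inp_eqx: "inp s \<Longrightarrow> eqx NX RX s t \<Longrightarrow> ''n'' \<notin> NX \<Longrightarrow> ''d'' \<notin> NX \<Longrightarrow> ''zero'' \<notin> RX \<Longrightarrow> ''rho'' \<notin> RX \<Longrightarrow> inp t"
  by (auto simp: inp_def eqx_def)

definition hasX :: "nat \<Rightarrow> state \<Rightarrow> bool" where
  "hasX l s \<longleftrightarrow> (\<forall>j\<le>l. \<forall>r<d. \<forall>c<d. reals s ''X'' ((j * d + r) * d + c) = XM j r c)"

lemma wp_jm_step:
  assumes s: "inp s" "nats s ''l'' 0 = l" "l < n - 1" "hasX l s"
  shows "wp jm_step (d * d * (1 + 2 * d) + d * d * (1 + 2 * d + 1))
    (\<lambda>t. eqx {''k'', ''i''} {''acc'', ''tmp'', ''X'', ''Y''} s t \<and> hasX (Suc l) t) s"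
  unfolding jm_step_def
proof (rule wp_Seq, rule wp_post[OF wp_Fill[where N = "d * d" and b = 0 and NX = "{''i''}" and RX = "{''acc'', ''tmp''}" and
    F = "\<lambda>k. \<Sum>m<d. XM l (k div d) m * tm l $$ (m, k mod d)"]], goal_cases)
  case (1 t)
  then show ?case using s by (simp add: eqxN[OF 1] inpD)
next
  case (4 k t)
  note e4 = eqxN[OF 4(3)] eqxR[OF 4(3)]
  show ?case
  proof (rule wp_Dot)
    fix u assume u: "eqx {''i''} {''acc'', ''tmp''} t u"
    note eu = eqxN[OF u] eqxR[OF u]
    show "nval dN u = d" using s by (simp add: eu e4 inpD)
    fix m assume m: "m < d" "nats u ''i'' 0 = m"
    show "get_real u (''X'', idx3 (Nv ''l'') rowN (Nv ''i'')) = XM l (k div d) m \<and>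
       get_real u (''rho'', idx3 (Nv ''l'') (Nv ''i'') colN) = tm l $$ (m, k mod d)"
      using s m 4(1,2) div_idx[OF 4(1)] mod_idx[OF 4(1)]
      by (simp add: get_real_def eu e4 inpD minus_div_mult_eq_mod hasX_def)
  qed
next
  case (5 t)
  then have t: "eqx {''k'', ''i''} {''Y'', ''acc'', ''tmp''} s t" by simp
  note et = eqxN[OF t] eqxR[OF t]
  have Y: "reals t ''Y'' (i * d + c) = (\<Sum>m<d. XM l i m * tm l $$ (m, c))" if "i < d" "c < d" for i c
    using 5 idx_lt[OF that] that by simp
  show ?case
  proof (rule wp_post[OF wp_Fill[where N = "d * d" and b = "Suc l * (d * d)" and NX = "{''i''}" and RX = "{''acc'', ''tmp''}" and
      F = "\<lambda>k. XM (Suc l) (k div d) (k mod d)"]], goal_cases)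
    case (1 u)
    then show ?case using s by (simp add: eqxN[OF 1] et inpD)
  next
    case (4 k u)
    note eu = eqxN[OF 4(3)] eqxR[OF 4(3)]
    show ?case
    proof (rule wp_Seq, rule wp_post[OF wp_Dot[where N = d and A = "\<lambda>m. tm l $$ (k div d, m)" and B = "\<lambda>i. \<Sum>m<d. XM l i m * tm l $$ (m, k mod d)"]])
      fix w assume w: "eqx {''i''} {''acc'', ''tmp''} u w"
      note ew = eqxN[OF w] eqxR[OF w]
      show "nval dN w = d" using s by (simp add: ew eu et inpD)
      fix m assume m: "m < d" "nats w ''i'' 0 = m"
      show "get_real w (''rho'', idx3 (Nv ''l'') rowN (Nv ''i'')) = tm l $$ (k div d, m) \<and>
         get_real w (''Y'', idx2 (Nv ''i'') colN) = (\<Sum>ma<d. XM l m ma * tm l $$ (ma, k mod d))"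
        using s m 4(1,2) div_idx[OF 4(1)] mod_idx[OF 4(1)] Y[of m "k mod d"]
        by (simp add: get_real_def ew eu et inpD minus_div_mult_eq_mod)
    next
      fix w assume w: "eqx {''i''} {''acc'', ''tmp''} u w \<and>
          reals w ''acc'' 0 = (\<Sum>m<d. tm l $$ (k div d, m) * (\<Sum>ma<d. XM l m ma * tm l $$ (ma, k mod d)))"
      note ew = eqxN[OF conjunct1[OF w]] eqxR[OF conjunct1[OF w]]
      have ix: "l * (d * d) + k = (l * d + k div d) * d + k mod d"
      proof -
        have "(l * d + k div d) * d + k mod d = l * (d * d) + (k div d * d + k mod d)" by (simp add: algebra_simps)
        then show ?thesis by simp
      qed
      have "reals s ''rho'' (l * (d * d) + k) = tm l $$ (k div d, k mod d)"
        unfolding ix using inpD(4)[OF s(1,3) div_idx[OF 4(1)] mod_idx[OF 4(1)]] .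
      then show "wp (Arith Add acc acc (''rho'', NPlus (NTimes (Nv ''l'') ddN) (Nv ''k''))) 1
          (\<lambda>ua. eqx {''i''} {''acc'', ''tmp''} u ua \<and> reals ua ''acc'' 0 = XM (Suc l) (k div d) (k mod d)) w"
        using s w 4(2) by (intro wp_Arith) (simp_all add: get_real_def ew eu et inpD)
    qed
  next
    case (5 u)
    then have u: "eqx {''k'', ''i''} {''X'', ''acc'', ''tmp''} t u" by simp
    have "reals u ''X'' ((j * d + r) * d + c) = XM j r c" if j: "j \<le> Suc l" and rc: "r < d" "c < d" for j r c
    proof (cases "j = Suc l")
      case True
      have "(j * d + r) * d + c = Suc l * (d * d) + (r * d + c)" using True by (simp add: algebra_simps)
      then show ?thesis using 5 idx_lt[OF rc] rc True by simp
    next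
      case False
      then have "j \<le> l" using j by simp
      have "(j * d + r) * d + c = j * (d * d) + (r * d + c)" by (simp add: algebra_simps)
      also have "\<dots> < j * (d * d) + d * d" using idx_lt[OF rc] by simp
      also have "\<dots> \<le> Suc l * (d * d)" using mult_le_mono1[of "Suc j" "Suc l" "d * d"] \<open>j \<le> l\<close> by simp
      finally have lt: "(j * d + r) * d + c < Suc l * (d * d)" .
      have "reals u ''X'' ((j * d + r) * d + c) = reals t ''X'' ((j * d + r) * d + c)" using 5 lt by simp
      then show ?thesis using s(4) \<open>j \<le> l\<close> rc by (simp add: et hasX_def)
    qed
    then show ?case using eqx_trans[OF t u] by (simp add: hasX_def)
  qed auto
qed auto

lemma wp_jm_prog:
  assumes s: "inp s" "\<And>m. reals s ''X'' m = 0"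
  shows "wp jm_prog ((n - 1) * (d * d * (1 + 2 * d) + d * d * (1 + 2 * d + 1)))
    (\<lambda>t. eqx {''l'', ''k'', ''i''} {''acc'', ''tmp'', ''X'', ''Y''} s t \<and> hasX (n - 1) t) s"
proof -
  define I where "I l t \<longleftrightarrow> eqx {''l'', ''k'', ''i''} {''acc'', ''tmp'', ''X'', ''Y''} s t \<and> hasX l t" for l t
  have "wp jm_prog ((n - 1) * (d * d * (1 + 2 * d) + d * d * (1 + 2 * d + 1))) (\<lambda>t. I (n - 1) t \<and> nats t ''l'' 0 = n - 1) s"
    unfolding jm_prog_def
  proof (rule wp_For)
    show "I 0 (set_nat s (''l'', Lit 0) 0)" using s by (simp add: I_def hasX_def)
    show "nval (NMinus nN (Lit 1)) t = n - 1" if "I m t" for m t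
      using s by (simp add: eqxN[OF conjunct1[OF that[unfolded I_def]]] inpD)
    fix l t assume l: "l < n - 1" "I l t" "nats t ''l'' 0 = l"
    then have t: "eqx {''l'', ''k'', ''i''} {''acc'', ''tmp'', ''X'', ''Y''} s t" "hasX l t" by (auto simp: I_def)
    have it: "inp t" by (rule inp_eqx[OF s(1) t(1)]) auto
    show "wp jm_step (d * d * (1 + 2 * d) + d * d * (1 + 2 * d + 1)) (\<lambda>t. nats t ''l'' 0 = l \<and> I (Suc l) (set_nat t (''l'', Lit 0) (Suc l))) t"
    proof (rule wp_post[OF wp_jm_step[OF it l(3,1) t(2)]])
      fix u assume u: "eqx {''k'', ''i''} {''acc'', ''tmp'', ''X'', ''Y''} t u \<and> hasX (Suc l) u"
      then have "nats u ''l'' 0 = l" using l(3) by (simp add: eqxN[OF conjunct1[OF u]])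
      moreover have "eqx {''l'', ''k'', ''i''} {''acc'', ''tmp'', ''X'', ''Y''} s u"
        by (rule eqx_trans[OF t(1) conjunct1[OF u]]) auto
      ultimately show "nats u ''l'' 0 = l \<and> I (Suc l) (set_nat u (''l'', Lit 0) (Suc l))"
        using u by (simp add: I_def hasX_def)
    qed
  qed
  then show ?thesis by (rule wp_post) (simp add: I_def)
qed

end

definition vec_of :: "nat \<Rightarrow> (nat \<Rightarrow> real) \<Rightarrow> nat \<Rightarrow> real" where
  "vec_of d a = (\<lambda>i. if i < d then a i else 0)"

lemma vec_of_in [simp]: "vec_of d a \<in> fvecs d"
  by (auto simp: vec_of_def fvecs_def)

lemma vec_of_eqI: "w \<in> fvecs d \<Longrightarrow> (\<And>i. i < d \<Longrightarrow> a i = w i) \<Longrightarrow> vec_of d a = w"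
  by (auto simp: vec_of_def fvecs_def fun_eq_iff)

context jm_program
begin

lemma wp_eig_step:
  assumes s: "inp s" "hasX (n - 1) s" "nats s ''j'' 0 = j" "j < n" "nats s ''c'' 0 = c" "nats s ''m'' 0 = m"
    and v: "vec_of d (reals s ''v'') = v"
    and w: "w = X (Suc j) v - of_int (int c - int n) *\<^sub>R v"
  shows "wp eig_step (12 * d ^ 2)
    (\<lambda>t. eqx {''k'', ''i'', ''f'', ''wt''} {''acc'', ''tmp'', ''sc'', ''t2'', ''w'', ''v''} s t \<and>
      vec_of d (reals t ''v'') = (if w = 0 then v else w) \<and>
      nats t ''wt'' = (if w = 0 then (nats s ''wt'')(m * n + j := c) else nats s ''wt'')) s"
proof (rule wp_le)
  define s1 where "s1 = set_real (set_real (set_real s sc (real c)) t2 (real n)) sc (real c - real n)"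
  have s1: "eqx {''k'', ''i'', ''f'', ''wt''} {''acc'', ''tmp'', ''sc'', ''t2'', ''w'', ''v''} s s1" "nats s1 = nats s"
    "reals s1 ''sc'' 0 = real c - real n" "reals s1 ''v'' = reals s ''v''" "reals s1 ''X'' = reals s ''X''" "reals s1 ''zero'' = reals s ''zero''"
    by (simp_all add: s1_def)
  have vV: "v \<in> fvecs d" using v by auto
  have vi: "reals s ''v'' i = v i" if "i < d" for i using v that by (auto simp: vec_of_def)
  have wV: "w \<in> fvecs d"
    unfolding w using vV X_closed[of "Suc j"] s(4) by (intro real_vector.subspace_diff real_vector.subspace_scale subspace_fvecs) auto
  have wi: "(\<Sum>i<d. XM j k i * v i) - (real c - real n) * v k = w k" if "k < d" for k
    unfolding w using XM_X[OF s(4) vV that] by simp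
  have Xs: "reals s ''X'' ((j * d + r) * d + i) = XM j r i" if "r < d" "i < d" for r i
    using s(2,4) that by (simp add: hasX_def)
  note inps = inpD(1-3)[OF s(1)]
  show "wp eig_step (1 + (1 + (1 + (d * (1 + 2 * d + (1 + 1)) + (1 + 2 * d + (1 + d * 0))))))
    (\<lambda>t. eqx {''k'', ''i'', ''f'', ''wt''} {''acc'', ''tmp'', ''sc'', ''t2'', ''w'', ''v''} s t \<and>
      vec_of d (reals t ''v'') = (if w = 0 then v else w) \<and>
      nats t ''wt'' = (if w = 0 then (nats s ''wt'')(m * n + j := c) else nats s ''wt'')) s"
    unfolding eig_step_def
  proof (intro wp_Seq wp_OfNat wp_Arith, simp, goal_cases)
    case 1
    have e: "set_real (set_real (set_real s sc (real (nval (Nv ''c'') s))) t2 (real (nval nN (set_real s sc (real (nval (Nv ''c'') s)))))) sc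
        (op_val Sub (get_real (set_real (set_real s sc (real (nval (Nv ''c'') s))) t2 (real (nval nN (set_real s sc (real (nval (Nv ''c'') s)))))) sc)
          (get_real (set_real (set_real s sc (real (nval (Nv ''c'') s))) t2 (real (nval nN (set_real s sc (real (nval (Nv ''c'') s)))))) t2)) = s1"
      using s(5) inps by (simp add: s1_def get_real_def)
    show ?case unfolding e
    proof (rule wp_post[OF wp_Fill[where N = d and b = 0 and NX = "{''i''}" and RX = "{''acc'', ''tmp'', ''t2''}" and F = w]], goal_cases)
      case (1 t)
      then show ?case using inps by (simp add: eqxN[OF 1] s1)
    next
      case (4 k t)
      note e4 = eqxN[OF 4(3)] eqxR[OF 4(3)]
      show ?case
      proof (rule wp_Seq, rule wp_post[OF wp_Dot[where N = d and A = "XM j k" and B = v]])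
        fix u assume u: "eqx {''i''} {''acc'', ''tmp''} t u"
        note eu = eqxN[OF u] eqxR[OF u]
        show "nval dN u = d" using inps by (simp add: eu e4 s1)
        fix i assume i: "i < d" "nats u ''i'' 0 = i"
        show "get_real u (''X'', idx3 (Nv ''j'') (Nv ''k'') (Nv ''i'')) = XM j k i \<and> get_real u (''v'', Nv ''i'') = v i"
          using inps s(3) i 4(1,2) Xs vi by (simp add: get_real_def eu e4 s1)
      next
        fix u assume u: "eqx {''i''} {''acc'', ''tmp''} t u \<and> reals u ''acc'' 0 = (\<Sum>m<d. XM j k m * v m)"
        note eu = eqxN[OF conjunct1[OF u]] eqxR[OF conjunct1[OF u]]
        have um: "eqx {''i''} {''acc'', ''tmp'', ''t2''} t u" by (rule eqx_mono[OF conjunct1[OF u]]) auto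
        show "wp (Seq (Arith Mul t2 sc (''v'', Nv ''k'')) (Arith Sub acc acc t2)) (1 + 1)
          (\<lambda>ua. eqx {''i''} {''acc'', ''tmp'', ''t2''} t ua \<and> reals ua ''acc'' 0 = w k) u"
          using 4(1,2) u um wi[OF 4(1)] vi[OF 4(1)]
          by (intro wp_Seq wp_Arith) (simp_all add: get_real_def eu e4 s1)
      qed
    next
      case (5 t)
      then have t: "eqx {''k'', ''i''} {''w'', ''acc'', ''tmp'', ''t2''} s1 t" by simp
      note et = eqxN[OF t] eqxR[OF t]
      have tw: "reals t ''w'' i = w i" if "i < d" for i using 5 that by simp
      show ?case
      proof (intro wp_Seq, rule wp_post[OF wp_Dot[where N = d and A = w and B = w]], goal_cases)
        case (1 u)
        then show ?case using inps by (simp add: eqxN[OF 1] et s1)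
      next
        case (2 u i)
        then show ?case using tw by (simp add: get_real_def eqxR[OF 2(2)])
      next
        case (3 u)
        note eu = eqxN[OF conjunct1[OF 3]] eqxR[OF conjunct1[OF 3]]
        have acc: "reals u ''acc'' 0 = vip d w w" using 3 by (simp add: vip_def)
        \<comment> \<open>By definiteness, the comparison with 0 decides whether w vanishes.\<close>
        have w0: "0 < vip d w w \<longleftrightarrow> w \<noteq> 0" using vip_pos[OF wV] by (auto simp: vip_def)
        have su: "eqx {''k'', ''i'', ''f'', ''wt''} {''acc'', ''tmp'', ''sc'', ''t2'', ''w'', ''v''} s u"
          by (rule eqx_trans[OF s1(1) eqx_trans[OF t conjunct1[OF 3], of "{''k'', ''i''}" "{''w'', ''acc'', ''tmp'', ''t2''}"]]) auto
        define u' where "u' = set_nat u fl (if w \<noteq> 0 then 1 else 0)"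
        have cmp: "set_nat u fl (if get_real u zr < get_real u acc then 1 else 0) = u'"
          using inps by (simp add: get_real_def acc w0 u'_def eu et s1)
        show ?case
        proof (rule wp_Seq, rule wp_Compare, unfold cmp, rule wp_If)
          assume "bval pos u'"
          then have ne: "w \<noteq> 0" by (auto simp: u'_def split: if_splits)
          show "wp (Fill ''k'' dN ''v'' (Lit 0) (Copy acc (''w'', Nv ''k''))) (d * 0)
            (\<lambda>t. eqx {''k'', ''i'', ''f'', ''wt''} {''acc'', ''tmp'', ''sc'', ''t2'', ''w'', ''v''} s t \<and>
              vec_of d (reals t ''v'') = (if w = 0 then v else w) \<and>
              nats t ''wt'' = (if w = 0 then (nats s ''wt'')(m * n + j := c) else nats s ''wt'')) u'"
          proof (rule wp_post[OF wp_Fill[where N = d and b = 0 and NX = "{}" and RX = "{''acc''}" and F = w]], goal_cases)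
            case (1 x)
            then show ?case using inps by (simp add: eqxN[OF 1] u'_def eu et s1)
          next
            case (4 k x)
            then show ?case using tw by (intro wp_Copy) (simp add: get_real_def eqxR[OF 4(3)] u'_def eu)
          next
            case (5 x)
            then have x: "eqx {''k''} {''v'', ''acc''} u' x" by simp
            have "eqx {''k'', ''i'', ''f'', ''wt''} {''acc'', ''tmp'', ''sc'', ''t2'', ''w'', ''v''} s u'" using su by (simp add: u'_def)
            then have "eqx {''k'', ''i'', ''f'', ''wt''} {''acc'', ''tmp'', ''sc'', ''t2'', ''w'', ''v''} s x"
              by (rule eqx_trans[OF _ x]) auto
            moreover have "vec_of d (reals x ''v'') = w" using 5 by (intro vec_of_eqI[OF wV]) simp
            moreover have "nats x ''wt'' = nats s ''wt''" by (simp add: eqxN[OF x] u'_def eu et s1)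
            ultimately show ?case using ne by simp
          qed auto
        next
          assume "\<not> bval pos u'"
          then have ze: "w = 0" by (auto simp: u'_def split: if_splits)
          have "reals u' ''v'' = reals s ''v''" "nats u' ''wt'' = nats s ''wt''" by (simp_all add: u'_def eu et s1)
          moreover have "nats u' ''m'' 0 = m" "nats u' ''n'' 0 = n" "nats u' ''j'' 0 = j" "nats u' ''c'' 0 = c"
            using s inps by (simp_all add: u'_def eu et s1)
          ultimately have "wp (NAssign (''wt'', NPlus (NTimes (Nv ''m'') nN) (Nv ''j'')) (Nv ''c'')) 0
            (\<lambda>t. eqx {''k'', ''i'', ''f'', ''wt''} {''acc'', ''tmp'', ''sc'', ''t2'', ''w'', ''v''} s t \<and>
              vec_of d (reals t ''v'') = (if w = 0 then v else w) \<and>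
              nats t ''wt'' = (if w = 0 then (nats s ''wt'')(m * n + j := c) else nats s ''wt'')) u'"
            using su v ze by (intro wp_NAssign) (simp add: u'_def)
          then show "wp (NAssign (''wt'', NPlus (NTimes (Nv ''m'') nN) (Nv ''j'')) (Nv ''c'')) (d * 0)
            (\<lambda>t. eqx {''k'', ''i'', ''f'', ''wt''} {''acc'', ''tmp'', ''sc'', ''t2'', ''w'', ''v''} s t \<and>
              vec_of d (reals t ''v'') = (if w = 0 then v else w) \<and>
              nats t ''wt'' = (if w = 0 then (nats s ''wt'')(m * n + j := c) else nats s ''wt'')) u'" by simp
        qed
      qed
    qed auto
  qed
  \<comment> \<open>The exact cost is 2 d^2 + 5 d + 5; since d is at least 1, the lower terms are
    absorbed into 12 d^2.\<close>
  obtain e where "d = Suc e" using d1 by (cases d) auto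
  then show "1 + (1 + (1 + (d * (1 + 2 * d + (1 + 1)) + (1 + 2 * d + (1 + d * 0))))) \<le> 12 * d ^ 2"
    by (simp add: power2_eq_square algebra_simps)
qed

text \<open>
  Once an eigenvalue has been recorded, the vector stays an eigenvector for it; as long as none has
  been recorded, the vector is the image of the initial one under the factors tried so far.
\<close>

definition eig_state :: "nat \<Rightarrow> (nat \<Rightarrow> real) set \<Rightarrow> nat \<Rightarrow> (nat \<Rightarrow> real) \<Rightarrow> nat \<Rightarrow> (nat \<Rightarrow> nat) \<Rightarrow> (nat \<Rightarrow> real) \<Rightarrow> bool" where
  "eig_state m qset j u c wt v \<longleftrightarrow> v \<in> fvecs d \<and> v \<noteq> 0 \<and> (\<forall>q\<in>qset. vip d v q = 0) \<and>
     (\<forall>i<j. X (Suc i) v = of_int (int (wt (m * n + i)) - int n) *\<^sub>R v) \<and>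
     ((\<exists>c0<c. wt (m * n + j) = c0 \<and> X (Suc j) v = of_int (int c0 - int n) *\<^sub>R v) \<or>
      v = pact (\<Prod>c'<c. lin_factor (int c' - int n)) (X (Suc j)) u)"

text \<open>Applying X_{j+1} minus a scalar keeps orthogonality to earlier weight vectors because
  the operator is symmetric, and earlier eigenvalues because the operators commute.\<close>

lemma eig_state_step:
  assumes st: "eig_state m qset j u c wt v" and j: "j < n" and u: "u \<in> fvecs d"
    and w: "w = X (Suc j) v - of_int (int c - int n) *\<^sub>R v"
    and qs: "\<And>q. q \<in> qset \<Longrightarrow> q \<in> fvecs d \<and> (\<exists>a. X (Suc j) q = a *\<^sub>R q)"
  shows "eig_state m qset j u (Suc c) (if w = 0 then wt(m * n + j := c) else wt) (if w = 0 then v else w)"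
proof (cases "w = 0")
  case True
  then have "X (Suc j) v = of_int (int c - int n) *\<^sub>R v" using w by simp
  then show ?thesis using st True unfolding eig_state_def by auto
next
  case False
  have lX: "linear (X (Suc j))" using X_lin j by simp
  have v: "v \<in> fvecs d" "\<And>q. q \<in> qset \<Longrightarrow> vip d v q = 0" "\<And>i. i < j \<Longrightarrow> X (Suc i) v = of_int (int (wt (m * n + i)) - int n) *\<^sub>R v"
    using st by (auto simp: eig_state_def)
  have "w \<in> fvecs d"
    unfolding w using v(1) X_closed[of "Suc j"] j by (intro real_vector.subspace_diff real_vector.subspace_scale subspace_fvecs) auto
  moreover have "vip d w q = 0" if q: "q \<in> qset" for q
  proof -
    obtain a where a: "X (Suc j) q = a *\<^sub>R q" "q \<in> fvecs d" using qs[OF q] by auto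
    have "vip d (X (Suc j) v) q = vip d v (X (Suc j) q)" using symm_X[of "Suc j"] j v(1) a(2) by (auto simp: symm_def)
    then show ?thesis unfolding w using a v(2)[OF q] by (simp add: ip_simps)
  qed
  moreover have "X (Suc i) w = of_int (int (wt (m * n + i)) - int n) *\<^sub>R w" if i: "i < j" for i
  proof -
    have li: "linear (X (Suc i))" using X_lin i j by simp
    have "X (Suc i) (X (Suc j) v) = X (Suc j) (X (Suc i) v)" using X_commute i j v(1) by simp
    then show ?thesis unfolding w linear_diff[OF li] linear_scale[OF li] v(3)[OF i] linear_scale[OF lX]
      by (simp add: scaleR_diff_right mult.commute)
  qed
  moreover have "(\<exists>c0<Suc c. wt (m * n + j) = c0 \<and> X (Suc j) w = of_int (int c0 - int n) *\<^sub>R w) \<or>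
      w = pact (\<Prod>c'<Suc c. lin_factor (int c' - int n)) (X (Suc j)) u"
  proof (cases "\<exists>c0<c. wt (m * n + j) = c0 \<and> X (Suc j) v = of_int (int c0 - int n) *\<^sub>R v")
    case True
    then obtain c0 where c0: "c0 < c" "wt (m * n + j) = c0" "X (Suc j) v = of_int (int c0 - int n) *\<^sub>R v" by auto
    \<comment> \<open>After a success at c0, later factors only rescale the eigenvector by c0 -
      c.\<close>
    have "w = (of_int (int c0 - int n) - of_int (int c - int n)) *\<^sub>R v" unfolding w c0(3) by (simp add: scaleR_left_diff_distrib)
    then have "X (Suc j) w = of_int (int c0 - int n) *\<^sub>R w" by (simp only: linear_scale[OF lX] c0(3) scaleR_scaleR mult.commute)
    then show ?thesis using c0 by auto
  next
    case False
    then have "v = pact (\<Prod>c'<c. lin_factor (int c' - int n)) (X (Suc j)) u" using st by (auto simp: eig_state_def)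
    then have "w = pact (lin_factor (int c - int n)) (X (Suc j)) (pact (\<Prod>c'<c. lin_factor (int c' - int n)) (X (Suc j)) u)"
      unfolding w pact_lin_factor by simp
    then show ?thesis by (simp only: pact_mult[OF lX, symmetric] prod.lessThan_Suc mult.commute) simp
  qed
  ultimately show ?thesis using False unfolding eig_state_def by simp
qed

text \<open>Over all 2 n + 1 candidates the product of the factors is \<open>content_poly n\<close>,
  which annihilates; as v is nonzero, the alternative without a recorded eigenvalue is
  impossible.\<close>

lemma eig_state_final:
  assumes st: "eig_state m qset j u (2 * n + 1) wt v" and j: "j < n" and u: "u \<in> fvecs d"
  shows "X (Suc j) v = of_int (int (wt (m * n + j)) - int n) *\<^sub>R v"
proof -
  have "(\<Prod>c'<2 * n + 1. lin_factor (int c' - int n)) = content_poly n"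
    unfolding content_poly_def
    by (rule prod.reindex_bij_witness[where i = "\<lambda>c. nat (c + int n)" and j = "\<lambda>c'. int c' - int n"]) auto
  then have "pact (\<Prod>c'<2 * n + 1. lin_factor (int c' - int n)) (X (Suc j)) u = 0"
    using X_minpoly_n[of "Suc j" u] j u by simp
  then show ?thesis using st by (auto simp: eig_state_def)
qed

end

lemma row_lt: "k < m \<Longrightarrow> i < d \<Longrightarrow> k * d + i < m * (d::nat)"
proof -
  assume "k < m" "i < d"
  then have "k * d + i < Suc k * d" "Suc k * d \<le> m * d" using mult_le_mono1[of "Suc k" m d] by simp_all
  then show ?thesis by linarith
qed

context jm_program
begin

text \<open>Weights are stored with n entries per vector and shifted by n; j - 1 turns the positions
  1, ..., n into array offsets.\<close>

definition basis :: "nat \<Rightarrow> state \<Rightarrow> bool" where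
  "basis m s \<longleftrightarrow> orthonormal (vip d) (map (row_of d (reals s ''q'')) [0..<m]) \<and>
     (\<forall>k<m. weight (\<lambda>j. int (nats s ''wt'' (k * n + (j - 1))) - int n) (row_of d (reals s ''q'') k))"

text \<open>
  \<open>P\<close> is the projection onto the complement of the vectors found so far.  Its trace is \<open>d - m > 0\<close>, so
  some diagonal entry is positive and the corresponding row is a nonzero start vector.
\<close>

definition proj :: "nat \<Rightarrow> state \<Rightarrow> bool" where
  "proj m s \<longleftrightarrow> (\<forall>r<d. \<forall>c<d. reals s ''P'' (r * d + c) =
     (if r = c then 1 else 0) - (\<Sum>k<m. row_of d (reals s ''q'') k r * row_of d (reals s ''q'') k c))"

lemma wp_find:
  assumes s: "inp s" and ex: "\<exists>a<d. 0 < reals s ''P'' (a * d + a)"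
  shows "wp find_prog (d * (1 + 0)) (\<lambda>t. eqx {''f'', ''p'', ''a''} {} s t \<and> nats t ''p'' 0 < d \<and>
     0 < reals s ''P'' (nats t ''p'' 0 * d + nats t ''p'' 0)) s"
proof -
  let ?g = "\<lambda>a. 0 < reals s ''P'' (a * d + a)"
  define I where "I m t \<longleftrightarrow> eqx {''f'', ''p'', ''a''} {} s t \<and> ((\<exists>a<m. ?g a) \<longrightarrow> nats t ''p'' 0 < d \<and> ?g (nats t ''p'' 0))" for m t
  have "wp find_prog (d * (1 + 0)) (\<lambda>t. I d t \<and> nats t ''a'' 0 = d) s"
    unfolding find_prog_def
  proof (rule wp_For)
    show "I 0 (set_nat s (''a'', Lit 0) 0)" by (simp add: I_def)
    show "nval dN t = d" if "I m t" for m t using s by (simp add: eqxN[OF conjunct1[OF that[unfolded I_def]]] inpD)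
    fix m t assume m: "m < d" "I m t" "nats t ''a'' 0 = m"
    have t: "eqx {''f'', ''p'', ''a''} {} s t" using m(2) by (simp add: I_def)
    note et = eqxN[OF t] eqxR[OF t]
    define u where "u = set_nat t fl (if ?g m then 1 else 0)"
    have cmp: "set_nat t fl (if get_real t zr < get_real t (''P'', idx2 (Nv ''a'') (Nv ''a'')) then 1 else 0) = u"
      using s m(3) by (simp add: get_real_def u_def et inpD)
    show "wp (Seq (Compare fl zr (''P'', idx2 (Nv ''a'') (Nv ''a''))) (If pos (NAssign (''p'', Lit 0) (Nv ''a'')) Skip)) (1 + 0)
       (\<lambda>t. nats t ''a'' 0 = m \<and> I (Suc m) (set_nat t (''a'', Lit 0) (Suc m))) t"
    proof (rule wp_Seq, rule wp_Compare, unfold cmp, rule wp_If)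
      assume "bval pos u"
      then have "?g m" by (auto simp: u_def split: if_splits)
      then show "wp (NAssign (''p'', Lit 0) (Nv ''a'')) 0 (\<lambda>t. nats t ''a'' 0 = m \<and> I (Suc m) (set_nat t (''a'', Lit 0) (Suc m))) u"
        using m t by (intro wp_NAssign) (simp add: I_def u_def)
    next
      assume "\<not> bval pos u"
      then have "\<not> ?g m" by (auto simp: u_def split: if_splits)
      then show "wp Skip 0 (\<lambda>t. nats t ''a'' 0 = m \<and> I (Suc m) (set_nat t (''a'', Lit 0) (Suc m))) u"
        using m t by (intro wp_Skip) (auto simp: I_def u_def less_Suc_eq)
    qed
  qed
  then show ?thesis by (rule wp_post) (use ex in \<open>auto simp: I_def\<close>)
qed

text \<open>\<open>qset\<close> stands for the basis vectors found before. Entries of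
  \<open>wt\<close> below m n are their weights and have to survive.\<close>

lemma wp_eigs:
  assumes s: "inp s" "hasX (n - 1) s" "nats s ''m'' 0 = m"
    and u: "u = vec_of d (reals s ''v'')" "u \<noteq> 0" "\<And>q. q \<in> qset \<Longrightarrow> vip d u q = 0"
    and qs: "\<And>q. q \<in> qset \<Longrightarrow> q \<in> fvecs d \<and> (\<forall>j<n. \<exists>a. X (Suc j) q = a *\<^sub>R q)"
  shows "wp (For ''j'' nN (For ''c'' (NPlus (NPlus nN nN) (Lit 1)) eig_step)) (n * ((2 * n + 1) * (12 * d ^ 2)))
    (\<lambda>t. eqx {''k'', ''i'', ''f'', ''wt'', ''j'', ''c''} {''acc'', ''tmp'', ''sc'', ''t2'', ''w'', ''v''} s t \<and>
      (\<forall>x<m * n. nats t ''wt'' x = nats s ''wt'' x) \<and>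
      vec_of d (reals t ''v'') \<noteq> 0 \<and> (\<forall>q\<in>qset. vip d (vec_of d (reals t ''v'')) q = 0) \<and>
      weight (\<lambda>j. int (nats t ''wt'' (m * n + (j - 1))) - int n) (vec_of d (reals t ''v''))) s"
proof -
  let ?fr = "\<lambda>t. eqx {''k'', ''i'', ''f'', ''wt'', ''j'', ''c''} {''acc'', ''tmp'', ''sc'', ''t2'', ''w'', ''v''} s t \<and>
      (\<forall>x<m * n. nats t ''wt'' x = nats s ''wt'' x)"
  define J where "J j t \<longleftrightarrow> ?fr t \<and> vec_of d (reals t ''v'') \<noteq> 0 \<and> (\<forall>q\<in>qset. vip d (vec_of d (reals t ''v'')) q = 0) \<and>
      (\<forall>i<j. X (Suc i) (vec_of d (reals t ''v'')) = of_int (int (nats t ''wt'' (m * n + i)) - int n) *\<^sub>R vec_of d (reals t ''v''))" for j t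
  have "wp (For ''j'' nN (For ''c'' (NPlus (NPlus nN nN) (Lit 1)) eig_step)) (n * ((2 * n + 1) * (12 * d ^ 2))) (\<lambda>t. J n t \<and> nats t ''j'' 0 = n) s"
  proof (rule wp_For)
    show "J 0 (set_nat s (''j'', Lit 0) 0)" using u by (simp add: J_def)
    show "nval nN t = n" if "J j t" for j t using that s by (simp add: J_def inpD eqxN[of "{''k'', ''i'', ''f'', ''wt'', ''j'', ''c''}" "{''acc'', ''tmp'', ''sc'', ''t2'', ''w'', ''v''}" s t])
    fix j t assume j: "j < n" "J j t" "nats t ''j'' 0 = j"
    \<comment> \<open>For each j the factors are counted from the vector present when the loop over
      c begins.\<close>
    define v0 where "v0 = vec_of d (reals t ''v'')"
    define I where "I c x \<longleftrightarrow> ?fr x \<and> nats x ''j'' 0 = j \<and> eig_state m qset j v0 c (nats x ''wt'') (vec_of d (reals x ''v''))" for c x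
    show "wp (For ''c'' (NPlus (NPlus nN nN) (Lit 1)) eig_step) ((2 * n + 1) * (12 * d ^ 2))
        (\<lambda>t. nats t ''j'' 0 = j \<and> J (Suc j) (set_nat t (''j'', Lit 0) (Suc j))) t"
    proof (rule wp_post[OF wp_For[where I = I]])
      show "I 0 (set_nat t (''c'', Lit 0) 0)"
        using j by (simp add: I_def J_def eig_state_def v0_def)
      show "nval (NPlus (NPlus nN nN) (Lit 1)) x = 2 * n + 1" if "I c x" for c x
        using that s by (simp add: I_def inpD eqxN[of "{''k'', ''i'', ''f'', ''wt'', ''j'', ''c''}" "{''acc'', ''tmp'', ''sc'', ''t2'', ''w'', ''v''}" s x])
      fix c x assume c: "c < 2 * n + 1" "I c x" "nats x ''c'' 0 = c"
      have x: "eqx {''k'', ''i'', ''f'', ''wt'', ''j'', ''c''} {''acc'', ''tmp'', ''sc'', ''t2'', ''w'', ''v''} s x"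
        using c(2) by (simp add: I_def)
      note ex = eqxN[OF x] eqxR[OF x]
      have ix: "inp x" by (rule inp_eqx[OF s(1) x]) auto
      have hx: "hasX (n - 1) x" using s(2) by (simp add: hasX_def ex)
      have xm: "nats x ''m'' 0 = m" "nats x ''j'' 0 = j" using s(3) c(2) by (simp_all add: ex I_def)
      define v where "v = vec_of d (reals x ''v'')"
      define w where "w = X (Suc j) v - of_int (int c - int n) *\<^sub>R v"
      have st: "eig_state m qset j v0 c (nats x ''wt'') v" using c(2) by (simp add: I_def v_def)
      have st': "eig_state m qset j v0 (Suc c) (if w = 0 then (nats x ''wt'')(m * n + j := c) else nats x ''wt'') (if w = 0 then v else w)"
        using qs j(1) by (intro eig_state_step[OF st j(1) _ w_def]) (auto simp: v0_def)
      show "wp eig_step (12 * d ^ 2) (\<lambda>t. nats t ''c'' 0 = c \<and> I (Suc c) (set_nat t (''c'', Lit 0) (Suc c))) x"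
      proof (rule wp_post[OF wp_eig_step[OF ix hx xm(2) j(1) c(3) xm(1) v_def[symmetric] w_def]], goal_cases)
        case (1 y)
        then have y: "eqx {''k'', ''i'', ''f'', ''wt''} {''acc'', ''tmp'', ''sc'', ''t2'', ''w'', ''v''} x y"
          and yv: "vec_of d (reals y ''v'') = (if w = 0 then v else w)"
          and yw: "nats y ''wt'' = (if w = 0 then (nats x ''wt'')(m * n + j := c) else nats x ''wt'')" by auto
        have sy: "eqx {''k'', ''i'', ''f'', ''wt'', ''j'', ''c''} {''acc'', ''tmp'', ''sc'', ''t2'', ''w'', ''v''} s y"
          by (rule eqx_trans[OF x y]) auto
        have yj: "nats y ''j'' 0 = j" "nats y ''c'' 0 = c" using xm(2) c(3) by (simp_all add: eqxN[OF y])
        have fr: "\<forall>z<m * n. nats y ''wt'' z = nats s ''wt'' z" using c(2) unfolding yw I_def by auto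
        show ?case using sy yj fr st' unfolding I_def by (simp add: yv yw)
      qed
    next
      fix x assume x: "I (2 * n + 1) x \<and> nats x ''c'' 0 = 2 * n + 1"
      then have st: "eig_state m qset j v0 (2 * n + 1) (nats x ''wt'') (vec_of d (reals x ''v''))" by (simp add: I_def)
      have "X (Suc j) (vec_of d (reals x ''v'')) = of_int (int (nats x ''wt'' (m * n + j)) - int n) *\<^sub>R vec_of d (reals x ''v'')"
        by (rule eig_state_final[OF st j(1)]) (simp add: v0_def)
      then show "nats x ''j'' 0 = j \<and> J (Suc j) (set_nat x (''j'', Lit 0) (Suc j))"
        using x st unfolding I_def J_def eig_state_def by (auto simp: less_Suc_eq)
    qed
  qed
  then show ?thesis
  proof (rule wp_post)
    fix t assume t: "J n t \<and> nats t ''j'' 0 = n"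
    have "X j (vec_of d (reals t ''v'')) = of_int (int (nats t ''wt'' (m * n + (j - 1))) - int n) *\<^sub>R vec_of d (reals t ''v'')" if "j \<in> {1..n}" for j
    proof -
      have "j - 1 < n" "Suc (j - 1) = j" using that by auto
      then show ?thesis using t unfolding J_def by metis
    qed
    then show "eqx {''k'', ''i'', ''f'', ''wt'', ''j'', ''c''} {''acc'', ''tmp'', ''sc'', ''t2'', ''w'', ''v''} s t \<and>
      (\<forall>x<m * n. nats t ''wt'' x = nats s ''wt'' x) \<and>
      vec_of d (reals t ''v'') \<noteq> 0 \<and> (\<forall>q\<in>qset. vip d (vec_of d (reals t ''v'')) q = 0) \<and>
      weight (\<lambda>j. int (nats t ''wt'' (m * n + (j - 1))) - int n) (vec_of d (reals t ''v''))"
      using t unfolding J_def weight_def by simp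
  qed
qed

lemma wp_norm:
  assumes s: "inp s" "nats s ''m'' 0 = m" and v: "v = vec_of d (reals s ''v'')" "v \<noteq> 0"
  shows "wp norm_prog (1 + 2 * d + (1 + d * 1))
    (\<lambda>t. eqx {''k'', ''i''} {''acc'', ''tmp'', ''sq'', ''q''} s t \<and>
      (\<forall>k<m. row_of d (reals t ''q'') k = row_of d (reals s ''q'') k) \<and>
      row_of d (reals t ''q'') m = (1 / sqrt (vip d v v)) *\<^sub>R v) s"
  unfolding norm_prog_def
proof (rule wp_Seq, rule wp_post[OF wp_Dot[where N = d and A = v and B = v]], goal_cases)
  case (1 t)
  then show ?case using s by (simp add: eqxN[OF 1] inpD)
next
  case (2 t i)
  then show ?case using v by (simp add: get_real_def eqxR[OF 2(2)] vec_of_def)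
next
  case (3 t)
  note et = eqxN[OF conjunct1[OF 3]] eqxR[OF conjunct1[OF 3]]
  have vV: "v \<in> fvecs d" using v by simp
  \<comment> \<open>Positivity makes both the square root and the division by it defined.\<close>
  have pos: "vip d v v > 0" using vip_pos[OF vV v(2)] .
  have acc: "reals t ''acc'' 0 = vip d v v" using 3 by (simp add: vip_def)
  define u where "u = set_real t sq (sqrt (vip d v v))"
  have su: "eqx {''k'', ''i''} {''acc'', ''tmp'', ''sq'', ''q''} s u"
    using eqx_mono[OF conjunct1[OF 3], of "{''k'', ''i''}" "{''acc'', ''tmp'', ''sq'', ''q''}"] by (simp add: u_def)
  have uq: "reals u ''q'' = reals s ''q''" "reals u ''v'' = reals s ''v''" by (simp_all add: u_def et)
  show ?case
  proof (rule wp_Seq, rule wp_Sqrt, goal_cases)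
    case 2
    have "set_real t sq (sqrt (get_real t acc)) = u" by (simp add: u_def get_real_def acc)
    show ?case unfolding \<open>set_real t sq (sqrt (get_real t acc)) = u\<close>
    proof (rule wp_post[OF wp_Fill[where N = d and b = "m * d" and NX = "{}" and RX = "{''acc''}" and F = "\<lambda>i. v i / sqrt (vip d v v)"]], goal_cases)
      case (1 x)
      then show ?case using s by (simp add: eqxN[OF 1] eqxN[OF su] inpD)
    next
      case (4 k x)
      have "v k = reals s ''v'' k" using 4(1) by (simp add: v(1) vec_of_def)
      then have "reals x ''v'' k = v k" by (simp add: eqxR[OF 4(3)] uq)
      moreover have "reals x ''sq'' 0 = sqrt (vip d v v)" by (simp add: eqxR[OF 4(3)] u_def)
      ultimately show ?case using pos 4(2) by (intro wp_Arith) (simp_all add: get_real_def)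
    next
      case (5 x)
      have sx: "eqx {''k'', ''i''} {''acc'', ''tmp'', ''sq'', ''q''} s x"
        by (rule eqx_trans[OF su conjunct1[OF 5]]) auto
      have "row_of d (reals x ''q'') k = row_of d (reals s ''q'') k" if "k < m" for k
      proof
        fix i
        show "row_of d (reals x ''q'') k i = row_of d (reals s ''q'') k i"
          using conjunct2[OF 5, rule_format, of "k * d + i"] row_lt[OF that, of i d] uq by (cases "i < d") (simp_all add: row_of_def)
      qed
      moreover have "row_of d (reals x ''q'') m = (1 / sqrt (vip d v v)) *\<^sub>R v"
        using 5 vV by (auto simp: row_of_def fun_eq_iff fvecs_def)
      ultimately show ?case using sx by simp
    qed auto
  qed (use acc pos in \<open>simp add: get_real_def\<close>)
qed

lemma wp_upd:
  assumes s: "inp s" "nats s ''m'' 0 = m" "proj m s"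
  shows "wp upd_prog (d * d * (1 + 1)) (\<lambda>t. eqx {''k''} {''acc'', ''t2'', ''P''} s t \<and> proj (Suc m) t) s"
  unfolding upd_prog_def
proof (rule wp_post[OF wp_Fill[where N = "d * d" and b = 0 and NX = "{}" and RX = "{''acc'', ''t2''}" and
      F = "\<lambda>k. reals s ''P'' k - row_of d (reals s ''q'') m (k div d) * row_of d (reals s ''q'') m (k mod d)"]], goal_cases)
  case (1 t)
  then show ?case using s by (simp add: eqxN[OF 1] inpD)
next
  case (4 k t)
  note e4 = eqxN[OF 4(3)] eqxR[OF 4(3)]
  have "reals t ''P'' k = reals s ''P'' k" using 4(4)[of k] by simp
  then show ?case using s 4(1,2) div_idx[OF 4(1)] mod_idx[OF 4(1)]
    by (intro wp_Seq wp_Arith) (simp_all add: get_real_def e4 inpD minus_div_mult_eq_mod row_of_def)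
next
  case (5 t)
  then have t: "eqx {''k''} {''P'', ''acc'', ''t2''} s t" by simp
  have "reals t ''P'' (r * d + c) = (if r = c then 1 else 0) - (\<Sum>k<Suc m. row_of d (reals t ''q'') k r * row_of d (reals t ''q'') k c)"
    if rc: "r < d" "c < d" for r c
  proof -
    have "reals t ''P'' (r * d + c) = reals s ''P'' (r * d + c) - row_of d (reals s ''q'') m r * row_of d (reals s ''q'') m c"
      using 5 idx_lt[OF rc] rc by simp
    then show ?thesis using s(3) rc by (simp add: proj_def eqxR[OF t])
  qed
  then show ?case using 5 eqx_mono[OF t] by (simp add: proj_def)
qed auto

text \<open>Row a of the projection is the residue of the unit vector e_a, so a start vector taken
  from it is orthogonal to all vectors found before.\<close>

lemma proj_row:
  assumes p: "proj m s" and on: "orthonormal (vip d) (map (row_of d (reals s ''q'')) [0..<m])" and a: "a < d"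
  shows "vec_of d (\<lambda>c. reals s ''P'' (a * d + c)) = gs_proj (vip d) (map (row_of d (reals s ''q'')) [0..<m]) (\<lambda>j. if j = a then 1 else 0)"
proof (rule vec_of_eqI)
  let ?E = "\<lambda>j. if j = a then 1 else 0 :: real"
  have eV: "?E \<in> fvecs d" using a by (auto simp: fvecs_def)
  have eu: "vip d ?E u = u a" for u using a by (simp add: vip_def if_distrib[of "\<lambda>x. x * _"] cong: if_cong)
  show "gs_proj (vip d) (map (row_of d (reals s ''q'')) [0..<m]) ?E \<in> fvecs d"
    by (rule gs_proj_in[OF eV]) auto
  show "reals s ''P'' (a * d + i) = gs_proj (vip d) (map (row_of d (reals s ''q'')) [0..<m]) ?E i" if "i < d" for i
    using p a that by (auto simp: proj_def gs_proj_def sum_fun_apply eu)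
qed

lemma proj_pos:
  assumes p: "proj m s" and on: "orthonormal (vip d) (map (row_of d (reals s ''q'')) [0..<m])" and m: "m < d"
  shows "\<exists>a<d. 0 < reals s ''P'' (a * d + a)"
proof (rule ccontr)
  assume "\<not> ?thesis"
  then have "reals s ''P'' (a * d + a) \<le> 0" if "a < d" for a using that by (meson not_le)
  then have "(\<Sum>a<d. reals s ''P'' (a * d + a)) \<le> 0" by (intro sum_nonpos) simp
  moreover have "(\<Sum>a<d. reals s ''P'' (a * d + a)) = real d - real m"
  proof -
    let ?r = "\<lambda>k. row_of d (reals s ''q'') k"
    have "(\<Sum>a<d. reals s ''P'' (a * d + a)) = (\<Sum>a<d. 1 - (\<Sum>k<m. ?r k a * ?r k a))"
      using p by (intro sum.cong) (auto simp: proj_def)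
    also have "\<dots> = real d - (\<Sum>k<m. vip d (?r k) (?r k))"
      unfolding vip_def by (simp add: sum_subtractf) (rule sum.swap)
    also have "(\<Sum>k<m. vip d (?r k) (?r k)) = (\<Sum>k<m. 1)"
      using on by (intro sum.cong) (auto simp: orthonormal_def)
    finally show ?thesis by simp
  qed
  ultimately show False using m by simp
qed

lemma wp_vec_step:
  assumes s: "inp s" "hasX (n - 1) s" "nats s ''m'' 0 = m" "m < d" "basis m s" "proj m s"
  shows "wp vec_step (60 * (n ^ 2 * d ^ 2))
    (\<lambda>t. eqx {''k'', ''i'', ''f'', ''wt'', ''j'', ''c'', ''a'', ''p''} {''acc'', ''tmp'', ''sc'', ''t2'', ''w'', ''v'', ''sq'', ''q'', ''P''} s t \<and>
      basis (Suc m) t \<and> proj (Suc m) t) s"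
proof (rule wp_le)
  let ?N = "{''k'', ''i'', ''f'', ''wt'', ''j'', ''c'', ''a'', ''p''}"
  let ?R = "{''acc'', ''tmp'', ''sc'', ''t2'', ''w'', ''v'', ''sq'', ''q'', ''P''}"
  let ?r = "row_of d (reals s ''q'')"
  let ?qs = "map ?r [0..<m]"
  have on: "orthonormal (vip d) ?qs" and wt: "\<And>k. k < m \<Longrightarrow> weight (\<lambda>j. int (nats s ''wt'' (k * n + (j - 1))) - int n) (?r k)"
    using s(5) by (auto simp: basis_def)
  show "wp vec_step (d * (1 + 0) + (d * 0 + (n * ((2 * n + 1) * (12 * d ^ 2)) + (1 + 2 * d + (1 + d * 1) + d * d * (1 + 1)))))
    (\<lambda>t. eqx ?N ?R s t \<and> basis (Suc m) t \<and> proj (Suc m) t) s"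
    unfolding vec_step_def
  proof (rule wp_Seq, rule wp_post[OF wp_find[OF s(1) proj_pos[OF s(6) on s(4)]]], rule wp_Seq, goal_cases)
    case (1 t)
    then have t: "eqx {''f'', ''p'', ''a''} {} s t" and p: "nats t ''p'' 0 < d" "0 < reals s ''P'' (nats t ''p'' 0 * d + nats t ''p'' 0)" by auto
    note et = eqxN[OF t] eqxR[OF t]
    define a where "a = nats t ''p'' 0"
    define v0 where "v0 = gs_proj (vip d) ?qs (\<lambda>j. if j = a then 1 else 0)"
    have v0: "vec_of d (\<lambda>c. reals s ''P'' (a * d + c)) = v0" unfolding v0_def using p by (intro proj_row[OF s(6) on]) (simp add: a_def)
    have v0i: "reals s ''P'' (a * d + i) = v0 i" if "i < d" for i using that by (simp add: v0[symmetric] vec_of_def)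
    have "v0 a > 0" using p v0i[of a] by (simp add: a_def)
    then have v0ne: "v0 \<noteq> 0" by auto
    show ?case
    proof (rule wp_post[OF wp_Fill[where N = d and b = 0 and NX = "{}" and RX = "{''acc''}" and F = v0]], goal_cases)
      case (1 x)
      then show ?case using s(1) by (simp add: eqxN[OF 1] et inpD)
    next
      case (4 k x)
      then show ?case using s(1) v0i[OF 4(1)] by (intro wp_Copy) (simp add: get_real_def eqxN[OF 4(3)] eqxR[OF 4(3)] et inpD a_def)
    next
      case (5 x)
      then have x: "eqx {''k''} {''v'', ''acc''} t x" by simp
      have sx: "eqx ?N ?R s x" by (rule eqx_trans[OF t x]) auto
      note ex = eqxN[OF x] eqxR[OF x]
      have vx: "v0 = vec_of d (reals x ''v'')"
      proof (rule vec_of_eqI[symmetric])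
        show "v0 \<in> fvecs d" unfolding v0[symmetric] by simp
        show "reals x ''v'' i = v0 i" if "i < d" for i using conjunct2[OF 5, rule_format, of i] that by simp
      qed
      have ix: "inp x" by (rule inp_eqx[OF s(1) sx]) auto
      have hx: "hasX (n - 1) x" using s(2) by (simp add: hasX_def ex et)
      have mx: "nats x ''m'' 0 = m" using s(3) by (simp add: ex et)
      have qset: "q \<in> fvecs d \<and> (\<forall>j<n. \<exists>a. X (Suc j) q = a *\<^sub>R q)" if qin: "q \<in> set ?qs" for q
      proof -
        obtain k where k: "k < m" "q = ?r k" using qin by auto
        have "\<exists>a. X (Suc j) q = a *\<^sub>R q" if "j < n" for j
          using weightD(2)[OF wt[OF k(1)], of "Suc j"] k(2) that by auto
        then show ?thesis using k(2) by simp
      qed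
      have perp: "vip d v0 q = 0" if qin: "q \<in> set ?qs" for q
      proof -
        obtain i where i: "i < length ?qs" "q = ?qs ! i" using qin unfolding in_set_conv_nth by blast
        show ?thesis unfolding v0_def i(2) by (rule gs_proj_orth[OF on i(1)])
      qed
      show ?case
      proof (rule wp_Seq, rule wp_post[OF wp_eigs[where qset = "set ?qs", OF ix hx mx vx v0ne]], goal_cases)
        case (1 q)
        then show ?case by (rule perp)
      next
        case (2 q)
        then show ?case by (rule qset)
      next
        case (3 y)
        then have y: "eqx {''k'', ''i'', ''f'', ''wt'', ''j'', ''c''} {''acc'', ''tmp'', ''sc'', ''t2'', ''w'', ''v''} x y" by simp
        have sy: "eqx ?N ?R s y" by (rule eqx_trans[OF sx y]) auto
        note ey = eqxN[OF y] eqxR[OF y]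
        define v where "v = vec_of d (reals y ''v'')"
        have v: "v \<noteq> 0" "\<And>q. q \<in> set ?qs \<Longrightarrow> vip d v q = 0"
          and wv: "weight (\<lambda>j. int (nats y ''wt'' (m * n + (j - 1))) - int n) v"
          and wty: "\<And>z. z < m * n \<Longrightarrow> nats y ''wt'' z = nats s ''wt'' z"
          using 3 by (auto simp: v_def ex et)
        have vV: "v \<in> fvecs d" by (simp add: v_def)
        have iy: "inp y" by (rule inp_eqx[OF s(1) sy]) auto
        have my: "nats y ''m'' 0 = m" using mx by (simp add: ey)
        show ?case
        proof (rule wp_Seq, rule wp_post[OF wp_norm[OF iy my v_def v(1)]], goal_cases)
          case (1 z)
          then have z: "eqx {''k'', ''i''} {''acc'', ''tmp'', ''sq'', ''q''} y z" by simp
          have sz: "eqx ?N ?R s z" by (rule eqx_trans[OF sy z]) auto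
          note ez = eqxN[OF z] eqxR[OF z]
          have qy: "reals y ''q'' = reals s ''q''" "reals y ''P'' = reals s ''P''" by (simp_all add: ey ex et)
          have rz: "row_of d (reals z ''q'') k = ?r k" if "k < m" for k using 1 that by (simp add: qy)
          have rm: "row_of d (reals z ''q'') m = (1 / sqrt (vip d v v)) *\<^sub>R v" using 1 by simp
          have iz: "inp z" by (rule inp_eqx[OF s(1) sz]) auto
          have mz: "nats z ''m'' 0 = m" using my by (simp add: ez)
          have pz: "proj m z" using s(6) rz unfolding proj_def by (simp add: ez qy)
          let ?b = "(1 / sqrt (vip d v v)) *\<^sub>R v"
          have vpos: "vip d v v > 0" using vip_pos vV v(1) by blast
          have map_z: "map (row_of d (reals z ''q'')) [0..<Suc m] = ?qs @ [?b]" using rz rm by simp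
          have "orthonormal (vip d) (?qs @ [?b])"
          proof (rule orthonormal_snoc[OF on])
            show "vip d ?b ?b = 1" using vpos by (simp add: ip_simps)
            show "vip d ?b (?qs ! k) = 0" if "k < length ?qs" for k using v(2)[OF nth_mem[OF that]] by (simp add: ip_simps)
          qed
          moreover have "weight (\<lambda>j. int (nats z ''wt'' (k * n + (j - 1))) - int n) (row_of d (reals z ''q'') k)" if k: "k < Suc m" for k
          proof (cases "k = m")
            case True
            have "weight (\<lambda>j. int (nats y ''wt'' (m * n + (j - 1))) - int n) ?b"
              using wv unfolding weight_def
              by (auto simp: linear_scale[OF X_lin] real_vector.subspace_scale[OF subspace_fvecs] mult.commute)
            then show ?thesis using True rm by (simp add: ez)
          next
            case False
            then have km: "k < m" using k by simp
            have "nats z ''wt'' (k * n + (j - 1)) = nats s ''wt'' (k * n + (j - 1))" if "1 \<le> j" "j \<le> n" for j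
              using wty row_lt[OF km, of "j - 1" n] that by (simp add: ez)
            then have "weight (\<lambda>j. int (nats z ''wt'' (k * n + (j - 1))) - int n) (?r k)
                \<longleftrightarrow> weight (\<lambda>j. int (nats s ''wt'' (k * n + (j - 1))) - int n) (?r k)"
              by (intro weight_cong) simp
            then show ?thesis using wt[OF km] rz[OF km] by simp
          qed
          ultimately have bz: "basis (Suc m) z" unfolding basis_def map_z by blast
          show ?case
          proof (rule wp_post[OF wp_upd[OF iz mz pz]])
            fix z' assume z': "eqx {''k''} {''acc'', ''t2'', ''P''} z z' \<and> proj (Suc m) z'"
            have "eqx ?N ?R s z'" by (rule eqx_trans[OF sz conjunct1[OF z']]) auto
            moreover have "basis (Suc m) z'" using bz unfolding basis_def by (simp add: eqxN[OF conjunct1[OF z']] eqxR[OF conjunct1[OF z']])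
            ultimately show "eqx ?N ?R s z' \<and> basis (Suc m) z' \<and> proj (Suc m) z'" using z' by blast
          qed
        qed
      qed
    qed auto
  qed
  \<comment> \<open>The eigenvector search dominates: 12 n (2 n + 1) d^2 is at most 36 n^2 d^2, and
    the remaining terms are of order d^2.\<close>
  obtain e where e: "d = Suc e" using d1 by (cases d) auto
  obtain f where f: "n = Suc f" using n1 by (cases n) auto
  show "d * (1 + 0) + (d * 0 + (n * ((2 * n + 1) * (12 * d ^ 2)) + (1 + 2 * d + (1 + d * 1) + d * d * (1 + 1)))) \<le> 60 * (n ^ 2 * d ^ 2)"
    unfolding e f by (simp add: power2_eq_square algebra_simps)
qed

end

context jm_program
begin

lemma wp_basis_prog:
  assumes s: "inp s" "hasX (n - 1) s"
  shows "wp basis_prog (d * d * 1 + d * (60 * (n ^ 2 * d ^ 2)))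
    (\<lambda>t. eqx {''k'', ''i'', ''f'', ''wt'', ''j'', ''c'', ''a'', ''p'', ''m''} {''acc'', ''tmp'', ''sc'', ''t2'', ''w'', ''v'', ''sq'', ''q'', ''P''} s t \<and>
      basis d t) s"
  unfolding basis_prog_def
proof (rule wp_Seq, rule wp_post[OF wp_Fill[where N = "d * d" and b = 0 and NX = "{}" and RX = "{''acc''}" and
      F = "\<lambda>k. if k div d = k mod d then 1 else 0"]], goal_cases)
  case (1 t)
  then show ?case using s by (simp add: eqxN[OF 1] inpD)
next
  case (4 k t)
  have k: "nats t ''k'' 0 = k" "nats t ''d'' 0 = d" using s 4(2) by (simp_all add: eqxN[OF 4(3)] inpD)
  show ?case
    by (rule wp_If; rule wp_OfNat) (use k in \<open>auto simp: minus_div_mult_eq_mod\<close>)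
next
  case (5 t)
  let ?N = "{''k'', ''i'', ''f'', ''wt'', ''j'', ''c'', ''a'', ''p'', ''m''}"
  let ?R = "{''acc'', ''tmp'', ''sc'', ''t2'', ''w'', ''v'', ''sq'', ''q'', ''P''}"
  have t: "eqx ?N ?R s t" by (rule eqx_mono[OF conjunct1[OF 5]]) auto
  have p0: "proj 0 t" unfolding proj_def
  proof (intro allI impI)
    fix r c assume rc: "r < d" "c < d"
    show "reals t ''P'' (r * d + c) = (if r = c then 1 else 0) - (\<Sum>k<0. row_of d (reals t ''q'') k r * row_of d (reals t ''q'') k c)"
      using conjunct2[OF 5, rule_format, of "r * d + c"] idx_lt[OF rc] div_mod_idx[OF rc(2), of r] by simp
  qed
  define I where "I m u \<longleftrightarrow> eqx ?N ?R s u \<and> basis m u \<and> proj m u" for m u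
  show ?case
  proof (rule wp_post[OF wp_For[where I = I]])
    show "I 0 (set_nat t (''m'', Lit 0) 0)" using t p0 by (simp add: I_def basis_def proj_def orthonormal_def)
    show "nval dN u = d" if "I m u" for m u using s by (simp add: eqxN[OF conjunct1[OF that[unfolded I_def]]] inpD)
    fix m u assume m: "m < d" "I m u" "nats u ''m'' 0 = m"
    have u: "eqx ?N ?R s u" "basis m u" "proj m u" using m(2) by (auto simp: I_def)
    have iu: "inp u" by (rule inp_eqx[OF s(1) u(1)]) auto
    have hu: "hasX (n - 1) u" using s(2) by (simp add: hasX_def eqxR[OF u(1)])
    show "wp vec_step (60 * (n ^ 2 * d ^ 2)) (\<lambda>t. nats t ''m'' 0 = m \<and> I (Suc m) (set_nat t (''m'', Lit 0) (Suc m))) u"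
    proof (rule wp_post[OF wp_vec_step[OF iu hu m(3,1) u(2,3)]], goal_cases)
      case (1 x)
      have "eqx ?N ?R s x" by (rule eqx_trans[OF u(1) conjunct1[OF 1]]) auto
      moreover have "nats x ''m'' 0 = m" using m(3) by (simp add: eqxN[OF conjunct1[OF 1]])
      ultimately show ?case using 1 by (simp add: I_def basis_def proj_def)
    qed
  qed (auto simp: I_def)
qed auto

end

section \<open>Reading off the partitions\<close>

definition pad :: "nat list \<Rightarrow> nat \<Rightarrow> nat" where
  "pad mu a = (if a < length mu then mu ! a else 0)"

definition word :: "nat \<Rightarrow> (nat \<Rightarrow> nat) \<Rightarrow> nat \<Rightarrow> int list" where
  "word n wt k = map (\<lambda>j. int (wt (k * n + j)) - int n) [0..<n]"

lemma length_word [simp]: "length (word n wt k) = n"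
  by (simp add: word_def)

lemma composition_length: "composition mu \<Longrightarrow> length mu \<le> sum_list mu"
  by (induction mu) (auto simp: composition_def)

text \<open>Parts are positive, so padding with zeros is unambiguous; this justifies the entrywise
  comparison in \<open>lookup_prog\<close>.\<close>

lemma pad_inj:
  assumes "composition mu" "composition nu" "length mu \<le> n" "length nu \<le> n" "\<And>a. a < n \<Longrightarrow> pad mu a = pad nu a"
  shows "mu = nu"
proof -
  have pos: "mu ! a > 0" if "composition mu" "a < length mu" for mu a using that by (auto simp: composition_def)
  have "\<not> length mu < length nu" using assms(5)[of "length mu"] assms(4) pos[OF assms(2), of "length mu"] by (auto simp: pad_def)
  moreover have "\<not> length nu < length mu" using assms(5)[of "length nu"] assms(3) pos[OF assms(1), of "length nu"] by (auto simp: pad_def)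
  ultimately have l: "length mu = length nu" by simp
  show ?thesis using assms(5,3) l by (intro nth_equalityI) (auto simp: pad_def, metis order_less_le_trans)
qed

text \<open>
  The cells of \<open>wt\<close> hold the eigenvalues shifted by \<open>n\<close>, as natural numbers cannot be negative.
  Entry \<open>k\<close> of \<open>clsf\<close> becomes \<open>p + 1\<close> if the weight of the \<open>k\<close>-th vector is the content word of the
  \<open>p\<close>-th partition in the list, and 0 if it is no content word.
\<close>

definition parse_body :: com where
  "parse_body = If (Less (Lit 0) (Nv ''ok''))
     (If (And (Less (Lit 0) (Nv ''len''))
           (Neq (Cell ''wt'' (NPlus (NTimes (Nv ''m'') nN) (Nv ''j''))) (NPlus (Cell ''wt'' (NPlus (NTimes (Nv ''m'') nN) (NMinus (Nv ''j'') (Lit 1)))) (Lit 1))))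
        (NAssign (''cur'', NMinus (Nv ''len'') (Lit 1)) (NPlus (Cell ''cur'' (NMinus (Nv ''len'') (Lit 1))) (Lit 1)))
        (If (Neq (NPlus (Cell ''wt'' (NPlus (NTimes (Nv ''m'') nN) (Nv ''j''))) (Nv ''len'')) nN)
           (Seq (NAssign (''cur'', Nv ''len'') (Lit 1)) (NAssign (''len'', Lit 0) (NPlus (Nv ''len'') (Lit 1))))
           (NAssign (''ok'', Lit 0) (Lit 0))))
     Skip"

definition parse_prog :: com where
  "parse_prog = Seq (NAssign (''ok'', Lit 0) (Lit 1)) (Seq (NAssign (''len'', Lit 0) (Lit 0))
     (Seq (For ''a'' nN (NAssign (''cur'', Nv ''a'') (Lit 0))) (For ''j'' nN parse_body)))"

text \<open>The value r, one past the last index, stands for a failed search; it is also the index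
  at which \<open>add_prog\<close> appends.\<close>

definition lookup_prog :: com where
  "lookup_prog = Seq (NAssign (''p'', Lit 0) (Nv ''r''))
     (For ''z'' (Nv ''r'') (Seq (NAssign (''e'', Lit 0) (Lit 1))
        (Seq (For ''a'' nN (If (Neq (Cell ''lam'' (NPlus (NTimes (Nv ''z'') nN) (Nv ''a''))) (Cell ''cur'' (Nv ''a''))) Skip (NAssign (''e'', Lit 0) (Lit 0))))
             (If (Less (Lit 0) (Nv ''e'')) (NAssign (''p'', Lit 0) (Nv ''z'')) Skip))))"

definition add_prog :: com where
  "add_prog = If (Less (Nv ''p'') (Nv ''r'')) Skip
     (Seq (For ''a'' nN (NAssign (''lam'', NPlus (NTimes (Nv ''r'') nN) (Nv ''a'')) (Cell ''cur'' (Nv ''a''))))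
     (Seq (NAssign (''mult'', Nv ''r'') (Lit 0)) (NAssign (''r'', Lit 0) (NPlus (Nv ''r'') (Lit 1)))))"

definition class_step :: com where
  "class_step = Seq parse_prog (If (Less (Lit 0) (Nv ''ok''))
     (Seq lookup_prog (Seq add_prog
        (Seq (NAssign (''mult'', Nv ''p'') (NPlus (Cell ''mult'' (Nv ''p'')) (Lit 1)))
             (NAssign (''clsf'', Nv ''m'') (NPlus (Nv ''p'') (Lit 1))))))
     (NAssign (''clsf'', Nv ''m'') (Lit 0)))"

definition class_prog :: com where
  "class_prog = For ''m'' dN class_step"

definition parsed :: "nat \<Rightarrow> int list \<Rightarrow> state \<Rightarrow> bool" where
  "parsed n xs t \<longleftrightarrow>
     (nats t ''ok'' 0 = 1 \<and> (\<exists>mu. composition mu \<and> xs = cont mu \<and> nats t ''len'' 0 = length mu \<and> (\<forall>a<n. nats t ''cur'' a = pad mu a))) \<or>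
     (nats t ''ok'' 0 = 0 \<and> \<not> (\<exists>mu. composition mu \<and> xs = cont mu))"

lemma cont_extend_row:
  assumes "composition mu" "mu \<noteq> []"
  shows "composition (butlast mu @ [Suc (last mu)])" "cont (butlast mu @ [Suc (last mu)]) = cont mu @ [last (cont mu) + 1]"
proof -
  obtain la m where mu: "mu = la @ [m]" using assms by (cases mu rule: rev_cases) auto
  then obtain m' where m: "m = Suc m'" using assms by (cases m) (auto simp: composition_def)
  show "composition (butlast mu @ [Suc (last mu)])" using assms mu by (auto simp: composition_def)
  show "cont (butlast mu @ [Suc (last mu)]) = cont mu @ [last (cont mu) + 1]"
    using mu m cont_snoc_Suc[of la m'] cont_snoc_Suc[of la m] by simp
qed

lemma wp_parse_body:
  assumes t: "nats t ''n'' 0 = n" "nats t ''m'' 0 = k" "nats t ''j'' 0 = j" "j < n"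
    and p: "parsed n (take j (word n (nats t ''wt'') k)) t"
  shows "wp parse_body 0 (\<lambda>u. eqx {''ok'', ''len'', ''cur''} {} t u \<and> parsed n (take (Suc j) (word n (nats t ''wt'') k)) u) t"
proof -
  let ?W = "word n (nats t ''wt'') k"
  have tk: "take (Suc j) ?W = take j ?W @ [?W ! j]" using t by (simp add: take_Suc_conv_app_nth)
  have Wj: "?W ! i = int (nats t ''wt'' (k * n + i)) - int n" if "i < n" for i using that by (simp add: word_def)
  show ?thesis
  proof (cases "nats t ''ok'' 0 = 1")
    case False
    then have no: "\<not> (\<exists>mu. composition mu \<and> take j ?W = cont mu)" "nats t ''ok'' 0 = 0" using p by (auto simp: parsed_def)
    \<comment> \<open>Rejection is permanent: by \<open>cont_prefix\<close>, prefixes of content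
      words are content words.\<close>
    have "\<not> (\<exists>mu. composition mu \<and> take (Suc j) ?W = cont mu)"
    proof
      assume "\<exists>mu. composition mu \<and> take (Suc j) ?W = cont mu"
      then obtain mu where "composition mu" "cont mu = take j ?W @ [?W ! j]" using tk by auto
      then obtain nu where "composition nu" "take j ?W = cont nu" by (rule cont_prefix)
      then show False using no by blast
    qed
    then have pu: "parsed n (take (Suc j) ?W) t" using no by (simp add: parsed_def)
    show ?thesis unfolding parse_body_def
      by (rule wp_If) (use no pu in \<open>auto intro: wp_Skip\<close>)
  next
    case True
    then obtain mu where mu: "composition mu" "take j ?W = cont mu" "nats t ''len'' 0 = length mu" "\<And>a. a < n \<Longrightarrow> nats t ''cur'' a = pad mu a"
      using p by (auto simp: parsed_def)
    have sj: "sum_list mu = j" using mu(2) t(4) by (metis length_cont length_take length_word min.absorb2 less_imp_le min.commute)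
    have lm: "length mu \<le> j" using composition_length[OF mu(1)] sj by simp
    let ?w = "nats t ''wt'' (k * n + j)"
    have lastj: "mu \<noteq> [] \<Longrightarrow> last (cont mu) = int (nats t ''wt'' (k * n + (j - 1))) - int n \<and> 1 \<le> j"
    proof -
      assume "mu \<noteq> []"
      then have j1: "1 \<le> j" using lm by (cases mu) auto
      have "last (take j ?W) = ?W ! (j - 1)" using j1 t(4) by (subst last_conv_nth) (auto simp flip: length_0_conv)
      then show ?thesis using mu(2) Wj[of "j - 1"] j1 t(4) by simp
    qed
    let ?c1 = "mu \<noteq> [] \<and> ?w = nats t ''wt'' (k * n + (j - 1)) + 1" and ?c2 = "?w + length mu = n"
    show ?thesis unfolding parse_body_def
    proof (rule wp_If, rule wp_If, goal_cases)
      case 1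
      then have c1: ?c1 using t mu(3) by auto
      let ?nu = "butlast mu @ [Suc (last mu)]"
      have "?W ! j = last (cont mu) + 1" using c1 lastj Wj[OF t(4)] by simp
      then have e: "composition ?nu" "take (Suc j) ?W = cont ?nu" using cont_extend_row[OF mu(1)] c1 tk mu(2) by auto
      let ?u = "set_nat t (''cur'', NMinus (Nv ''len'') (Lit 1)) (nval (NPlus (Cell ''cur'' (NMinus (Nv ''len'') (Lit 1))) (Lit 1)) t)"
      have "nats ?u ''cur'' a = pad ?nu a" if "a < n" for a
        using that mu(3) mu(4)[OF that] c1 by (auto simp: pad_def nth_append nth_butlast last_conv_nth)
      moreover have "nats ?u ''len'' 0 = length ?nu" "nats ?u ''ok'' 0 = 1" using mu(3) c1 True by auto
      ultimately have "parsed n (take (Suc j) ?W) ?u" unfolding parsed_def using e by blast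
      then show ?case by (intro wp_NAssign) simp
    next
      case 2
      then have nc1: "\<not> ?c1" using t mu(3) by auto
      show ?case
      proof (rule wp_If, goal_cases)
        case 1
        then have c2: ?c2 using t mu(3) by auto
        have "?W ! j = - int (length mu)" using c2 Wj[OF t(4)] by simp
        then have e: "composition (mu @ [1])" "take (Suc j) ?W = cont (mu @ [1])"
          using mu tk by (auto simp: composition_def cont_snoc)
        let ?u = "set_nat (set_nat t (''cur'', Nv ''len'') 1) (''len'', Lit 0) (Suc (length mu))"
        have "nats ?u ''cur'' a = pad (mu @ [1]) a" if "a < n" for a
          using that mu(3) mu(4)[OF that] by (auto simp: pad_def nth_append)
        moreover have "nats ?u ''len'' 0 = length (mu @ [1])" "nats ?u ''ok'' 0 = 1" using True by auto
        ultimately have "parsed n (take (Suc j) ?W) ?u" unfolding parsed_def using e by blast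
        then have "wp (Seq (NAssign (''cur'', Nv ''len'') (Lit 1)) (NAssign (''len'', Lit 0) (NPlus (Nv ''len'') (Lit 1)))) (0 + 0)
          (\<lambda>u. eqx {''ok'', ''len'', ''cur''} {} t u \<and> parsed n (take (Suc j) ?W) u) t"
          using mu(3) by (intro wp_Seq wp_NAssign) simp
        then show ?case by simp
      next
        case 2
        then have nc2: "\<not> ?c2" using t mu(3) by auto
        have "\<not> (\<exists>nu. composition nu \<and> take (Suc j) ?W = cont nu)"
        proof
          assume "\<exists>nu. composition nu \<and> take (Suc j) ?W = cont nu"
          then obtain nu where nu: "composition nu" "cont nu = cont mu @ [?W ! j]" using tk mu(2) by auto
          \<comment> \<open>By \<open>cont_inj\<close> the rows parsed so far are the only
            candidate, so two failed tests exclude every continuation.\<close>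
          obtain xi where xi: "composition xi" "cont mu = cont xi" "(xi \<noteq> [] \<and> ?W ! j = last (cont mu) + 1) \<or> ?W ! j = - int (length xi)"
            using cont_prefix[OF nu] by metis
          have "xi = mu" using cont_inj xi mu(1) by metis
          then show False using xi(3) lastj nc1 nc2 Wj[OF t(4)] by auto
        qed
        then show ?case by (intro wp_NAssign) (simp add: parsed_def)
      qed
    next
      case 3
      then show ?case using True by simp
    qed
  qed
qed

lemma wp_parse_prog:
  assumes s: "nats s ''n'' 0 = n" "nats s ''m'' 0 = k"
  shows "wp parse_prog 0 (\<lambda>u. eqx {''ok'', ''len'', ''cur'', ''a'', ''j''} {} s u \<and> parsed n (word n (nats s ''wt'') k) u) s"
proof -
  define s1 where "s1 = set_nat (set_nat s (''ok'', Lit 0) 1) (''len'', Lit 0) 0"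
  let ?N = "{''ok'', ''len'', ''cur'', ''a'', ''j''}"
  have s1: "eqx ?N {} s s1" "nats s1 ''ok'' 0 = 1" "nats s1 ''len'' 0 = 0" by (simp_all add: s1_def)
  define A where "A a t \<longleftrightarrow> eqx ?N {} s t \<and> nats t ''ok'' 0 = 1 \<and> nats t ''len'' 0 = 0 \<and> (\<forall>b<a. nats t ''cur'' b = 0)" for a t
  define B where "B j t \<longleftrightarrow> eqx ?N {} s t \<and> parsed n (take j (word n (nats s ''wt'') k)) t" for j t
  have "wp (For ''a'' nN (NAssign (''cur'', Nv ''a'') (Lit 0))) (n * 0) (\<lambda>t. A n t \<and> nats t ''a'' 0 = n) s1"
  proof (rule wp_For)
    show "A 0 (set_nat s1 (''a'', Lit 0) 0)" using s1 by (simp add: A_def)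
    show "nval nN t = n" if "A a t" for a t using s by (simp add: eqxN[OF conjunct1[OF that[unfolded A_def]]])
    show "wp (NAssign (''cur'', Nv ''a'') (Lit 0)) 0 (\<lambda>t. nats t ''a'' 0 = a \<and> A (Suc a) (set_nat t (''a'', Lit 0) (Suc a))) t"
      if "a < n" "A a t" "nats t ''a'' 0 = a" for a t
      using that by (intro wp_NAssign) (simp add: A_def less_Suc_eq)
  qed
  moreover have "wp (For ''j'' nN parse_body) (n * 0) (\<lambda>t. B n t \<and> nats t ''j'' 0 = n) t" if t: "A n t" for t
  proof (rule wp_For)
    have "composition [] \<and> [] = cont []" by (simp add: composition_def)
    then show "B 0 (set_nat t (''j'', Lit 0) 0)" using t unfolding A_def B_def parsed_def
      by (auto simp: pad_def intro!: exI[of _ "[]"])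
    show "nval nN t = n" if "B a t" for a t using s by (simp add: eqxN[OF conjunct1[OF that[unfolded B_def]]])
    fix j u assume j: "j < n" "B j u" "nats u ''j'' 0 = j"
    have u: "eqx ?N {} s u" using j(2) by (simp add: B_def)
    have wu: "nats u ''wt'' = nats s ''wt''" by (simp add: eqxN[OF u])
    show "wp parse_body 0 (\<lambda>t. nats t ''j'' 0 = j \<and> B (Suc j) (set_nat t (''j'', Lit 0) (Suc j))) u"
    proof (rule wp_post[OF wp_parse_body[where n = n and k = k and j = j]], goal_cases)
      case (6 x)
      have "eqx ?N {} s x" by (rule eqx_trans[OF u conjunct1[OF 6]]) auto
      moreover have "nats x ''j'' 0 = j" using j(3) by (simp add: eqxN[OF conjunct1[OF 6]])
      ultimately show ?case using 6 by (simp add: B_def wu parsed_def)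
    qed (use s j u wu in \<open>simp_all add: eqxN[OF u] B_def\<close>)
  qed
  ultimately have "wp parse_prog (0 + (0 + (n * 0 + n * 0))) (\<lambda>t. B n t \<and> nats t ''j'' 0 = n) s"
    unfolding parse_prog_def
    by (intro wp_Seq wp_NAssign) (auto simp: s1_def elim!: wp_post)
  then have "wp parse_prog 0 (\<lambda>t. B n t \<and> nats t ''j'' 0 = n) s" by simp
  then show ?thesis by (rule wp_post) (simp add: B_def)
qed

definition listed :: "nat \<Rightarrow> nat list list \<Rightarrow> state \<Rightarrow> bool" where
  "listed n lams t \<longleftrightarrow> nats t ''r'' 0 = length lams \<and> (\<forall>q<length lams. \<forall>a<n. nats t ''lam'' (q * n + a) = pad (lams ! q) a)"

lemma wp_lookup_prog:
  assumes s: "nats s ''n'' 0 = n" "listed n lams s" and lams: "\<And>nu. nu \<in> set lams \<Longrightarrow> composition nu \<and> length nu \<le> n"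
    and mu: "composition mu" "length mu \<le> n" "\<And>a. a < n \<Longrightarrow> nats s ''cur'' a = pad mu a"
  shows "wp lookup_prog 0 (\<lambda>u. eqx {''p'', ''z'', ''e'', ''a''} {} s u \<and>
    (nats u ''p'' 0 = length lams \<and> mu \<notin> set lams \<or> nats u ''p'' 0 < length lams \<and> lams ! nats u ''p'' 0 = mu)) s"
proof -
  let ?N = "{''p'', ''z'', ''e'', ''a''}"
  define I where "I z t \<longleftrightarrow> eqx ?N {} s t \<and>
    (nats t ''p'' 0 = length lams \<and> mu \<notin> set (take z lams) \<or> nats t ''p'' 0 < length lams \<and> lams ! nats t ''p'' 0 = mu)" for z t
  have r: "nats s ''r'' 0 = length lams" using s by (simp add: listed_def)
  have "wp lookup_prog (0 + length lams * (0 + (n * 0 + 0))) (\<lambda>t. I (length lams) t \<and> nats t ''z'' 0 = length lams) s"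
    unfolding lookup_prog_def
  proof (intro wp_Seq wp_NAssign, rule wp_For, goal_cases)
    case 1
    show ?case using r by (simp add: I_def)
  next
    case (2 z t)
    then have t: "eqx ?N {} s t" by (simp add: I_def)
    show ?case using r by (simp add: eqxN[OF t])
  next
    case (3 z t)
    then have t: "eqx ?N {} s t" by (simp add: I_def)
    let ?same = "\<lambda>a. \<forall>b<a. pad (lams ! z) b = pad mu b"
    have lz: "lams ! z \<in> set lams" using 3(1) by simp
    have same: "?same n \<longleftrightarrow> lams ! z = mu" using pad_inj[of "lams ! z" mu n] lams[OF lz] mu(1,2) by auto
    define t1 where "t1 = set_nat t (''e'', Lit 0) 1"
    have t1: "eqx {''e''} {} t t1" by (simp add: t1_def)
    define E where "E a u \<longleftrightarrow> eqx {''e'', ''a''} {} t u \<and> nats u ''e'' 0 = (if ?same a then 1 else 0)" for a u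
    let ?body = "If (Neq (Cell ''lam'' (NPlus (NTimes (Nv ''z'') nN) (Nv ''a''))) (Cell ''cur'' (Nv ''a''))) Skip (NAssign (''e'', Lit 0) (Lit 0))"
    have inner: "wp (For ''a'' nN ?body) (n * 0) (\<lambda>u. E n u \<and> nats u ''a'' 0 = n) t1"
    proof (rule wp_For)
      show "E 0 (set_nat t1 (''a'', Lit 0) 0)" by (simp add: E_def t1_def)
      show "nval nN u = n" if "E a u" for a u
      proof -
        have u: "eqx {''e'', ''a''} {} t u" using that by (simp add: E_def)
        show ?thesis using s by (simp add: eqxN[OF u] eqxN[OF t])
      qed
      fix a u assume a: "a < n" "E a u" "nats u ''a'' 0 = a"
      have u: "eqx {''e'', ''a''} {} t u" using a(2) by (simp add: E_def)
      have b: "bval (Neq (Cell ''lam'' (NPlus (NTimes (Nv ''z'') nN) (Nv ''a''))) (Cell ''cur'' (Nv ''a''))) u \<longleftrightarrow> pad (lams ! z) a = pad mu a"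
      proof -
        have "nats s ''lam'' (z * n + a) = pad (lams ! z) a" using s(2) 3(1) a(1) by (simp add: listed_def)
        then show ?thesis using s(1) 3(3) a mu(3) by (auto simp: eqxN[OF u] eqxN[OF t])
      qed
      have sa: "?same (Suc a) \<longleftrightarrow> ?same a \<and> pad (lams ! z) a = pad mu a" by (auto simp: less_Suc_eq)
      show "wp ?body 0 (\<lambda>t. nats t ''a'' 0 = a \<and> E (Suc a) (set_nat t (''a'', Lit 0) (Suc a))) u"
        using a by (intro wp_If wp_Skip wp_NAssign; unfold b) (simp_all add: E_def sa)
    qed
    show ?case
    proof (intro wp_Seq wp_NAssign, unfold nval.simps t1_def[symmetric], rule wp_post[OF inner], goal_cases)
      case (1 u)
      then have u: "eqx {''e'', ''a''} {} t u" by (simp add: E_def)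
      have su: "eqx ?N {} s u" by (rule eqx_trans[OF t u]) auto
      have uz: "nats u ''z'' 0 = z" "nats u ''p'' 0 = nats t ''p'' 0" using 3(3) by (simp_all add: eqxN[OF u])
      have e: "nats u ''e'' 0 = (if lams ! z = mu then 1 else 0)" using 1 by (simp only: E_def same)
      have tk: "take (Suc z) lams = take z lams @ [lams ! z]" using 3(1) by (simp add: take_Suc_conv_app_nth)
      have It: "nats t ''p'' 0 = length lams \<and> mu \<notin> set (take z lams) \<or> nats t ''p'' 0 < length lams \<and> lams ! nats t ''p'' 0 = mu"
        using 3(2) by (simp add: I_def)
      show ?case
      proof (rule wp_If)
        assume "bval (Less (Lit 0) (Nv ''e'')) u"
        then have "lams ! z = mu" using e by (simp split: if_splits)
        then show "wp (NAssign (''p'', Lit 0) (Nv ''z'')) 0 (\<lambda>t. nats t ''z'' 0 = z \<and> I (Suc z) (set_nat t (''z'', Lit 0) (Suc z))) u"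
          using su uz 3(1) by (intro wp_NAssign) (simp add: I_def)
      next
        assume "\<not> bval (Less (Lit 0) (Nv ''e'')) u"
        then have "lams ! z \<noteq> mu" using e by auto
        then show "wp Skip 0 (\<lambda>t. nats t ''z'' 0 = z \<and> I (Suc z) (set_nat t (''z'', Lit 0) (Suc z))) u"
          using su uz It tk by (intro wp_Skip) (auto simp: I_def)
      qed
    qed
  qed
  then show ?thesis by (rule wp_conseq) (auto simp: I_def)
qed

lemma wp_add_prog:
  assumes s: "nats s ''n'' 0 = n" "listed n lams s" and mu: "\<And>a. a < n \<Longrightarrow> nats s ''cur'' a = pad mu a"
    and p: "nats s ''p'' 0 = length lams \<and> mu \<notin> set lams \<or> nats s ''p'' 0 < length lams \<and> lams ! nats s ''p'' 0 = mu"
    and lams': "lams' = (if mu \<in> set lams then lams else lams @ [mu])"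
  shows "wp add_prog 0 (\<lambda>u. eqx {''lam'', ''mult'', ''r'', ''a''} {} s u \<and> listed n lams' u \<and>
    nats s ''p'' 0 < length lams' \<and> lams' ! nats s ''p'' 0 = mu \<and>
    (\<forall>q<length lams. nats u ''mult'' q = nats s ''mult'' q) \<and> (mu \<notin> set lams \<longrightarrow> nats u ''mult'' (length lams) = 0)) s"
  unfolding add_prog_def
proof (rule wp_If, goal_cases)
  case 1
  then have "nats s ''p'' 0 < length lams" using s by (simp add: listed_def)
  then have "lams ! nats s ''p'' 0 = mu" "mu \<in> set lams" using p by (auto simp: in_set_conv_nth)
  then show ?case using s lams' \<open>nats s ''p'' 0 < length lams\<close> by (intro wp_Skip) simp
next
  case 2
  let ?r = "length lams"
  have r: "nats s ''r'' 0 = ?r" using s by (simp add: listed_def)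
  have pr: "nats s ''p'' 0 = ?r" "mu \<notin> set lams" using p 2 r by auto
  have l': "lams' = lams @ [mu]" using lams' pr by simp
  define A where "A a t \<longleftrightarrow> eqx {''lam'', ''a''} {} s t \<and>
    (\<forall>x. nats t ''lam'' x = (if ?r * n \<le> x \<and> x < ?r * n + a then pad mu (x - ?r * n) else nats s ''lam'' x))" for a t
  have "wp (For ''a'' nN (NAssign (''lam'', NPlus (NTimes (Nv ''r'') nN) (Nv ''a'')) (Cell ''cur'' (Nv ''a'')))) (n * 0) (\<lambda>t. A n t \<and> nats t ''a'' 0 = n) s"
  proof (rule wp_For)
    show "A 0 (set_nat s (''a'', Lit 0) 0)" by (simp add: A_def)
    show "nval nN u = n" if "A a u" for a u
    proof -
      have u: "eqx {''lam'', ''a''} {} s u" using that by (simp add: A_def)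
      show ?thesis using s by (simp add: eqxN[OF u])
    qed
    fix a u assume a: "a < n" "A a u" "nats u ''a'' 0 = a"
    have u: "eqx {''lam'', ''a''} {} s u" using a(2) by (simp add: A_def)
    have v: "nats u ''r'' 0 = ?r" "nats u ''n'' 0 = n" "nats u ''cur'' a = pad mu a"
      using r s(1) mu[OF a(1)] by (simp_all add: eqxN[OF u])
    show "wp (NAssign (''lam'', NPlus (NTimes (Nv ''r'') nN) (Nv ''a'')) (Cell ''cur'' (Nv ''a''))) 0
       (\<lambda>t. nats t ''a'' 0 = a \<and> A (Suc a) (set_nat t (''a'', Lit 0) (Suc a))) u"
    proof (rule wp_NAssign)
      show "nats (set_nat u (''lam'', NPlus (NTimes (Nv ''r'') nN) (Nv ''a'')) (nval (Cell ''cur'' (Nv ''a'')) u)) ''a'' 0 = a \<and>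
        A (Suc a) (set_nat (set_nat u (''lam'', NPlus (NTimes (Nv ''r'') nN) (Nv ''a'')) (nval (Cell ''cur'' (Nv ''a'')) u)) (''a'', Lit 0) (Suc a))"
        using a v by (auto simp: A_def)
    qed
  qed
  then have "wp (Seq (For ''a'' nN (NAssign (''lam'', NPlus (NTimes (Nv ''r'') nN) (Nv ''a'')) (Cell ''cur'' (Nv ''a''))))
     (Seq (NAssign (''mult'', Nv ''r'') (Lit 0)) (NAssign (''r'', Lit 0) (NPlus (Nv ''r'') (Lit 1))))) (n * 0 + (0 + 0))
    (\<lambda>u. eqx {''lam'', ''mult'', ''r'', ''a''} {} s u \<and> listed n lams' u \<and>
    nats s ''p'' 0 < length lams' \<and> lams' ! nats s ''p'' 0 = mu \<and>
    (\<forall>q<length lams. nats u ''mult'' q = nats s ''mult'' q) \<and> (mu \<notin> set lams \<longrightarrow> nats u ''mult'' (length lams) = 0)) s"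
  proof (intro wp_Seq, elim wp_post, intro wp_Seq wp_NAssign, goal_cases)
    case (1 t)
    then have t: "eqx {''lam'', ''a''} {} s t" by (simp add: A_def)
    have v: "nats t ''r'' 0 = ?r" "nats t ''mult'' = nats s ''mult''" using r by (simp_all add: eqxN[OF t])
    have st: "eqx {''lam'', ''mult'', ''r'', ''a''} {} s t" by (rule eqx_mono[OF t]) auto
    have lam: "nats t ''lam'' (q * n + a) = pad (lams' ! q) a" if q: "q < Suc ?r" "a < n" for q a
    proof (cases "q = ?r")
      case True
      then show ?thesis using 1 q l' by (simp add: A_def)
    next
      case False
      then have "q < ?r" using q by simp
      then show ?thesis using 1 q l' row_lt[of q ?r a n] s(2) by (simp add: A_def listed_def nth_append)
    qed
    show ?case using st v l' pr lam by (simp add: listed_def)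
  qed
  then show ?case by simp
qed

text \<open>The upper bound on \<open>clsf\<close> guarantees that a partition appended later finds
  no earlier vector already pointing to its index.\<close>

definition classified :: "nat \<Rightarrow> (nat \<Rightarrow> int list) \<Rightarrow> nat \<Rightarrow> nat list list \<Rightarrow> state \<Rightarrow> bool" where
  "classified n W k lams t \<longleftrightarrow> distinct lams \<and> set lams = {mu. composition mu \<and> (\<exists>j<k. W j = cont mu)} \<and> listed n lams t \<and>
     (\<forall>q<length lams. nats t ''mult'' q = length (filter (\<lambda>j. W j = cont (lams ! q)) [0..<k])) \<and>
     (\<forall>j<k. nats t ''clsf'' j \<le> length lams \<and> (\<forall>q<length lams. nats t ''clsf'' j = Suc q \<longleftrightarrow> W j = cont (lams ! q)))"

lemma classified_add:
  assumes s: "classified n W k lams s" and mu: "composition mu" "W k = cont mu"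
    and lams': "lams' = (if mu \<in> set lams then lams else lams @ [mu])"
    and u: "listed n lams' u" "p < length lams'" "lams' ! p = mu"
      "\<forall>q<length lams. nats u ''mult'' q = nats s ''mult'' q" "mu \<notin> set lams \<longrightarrow> nats u ''mult'' (length lams) = 0"
      "nats u ''clsf'' = nats s ''clsf''"
    and z: "nats z ''r'' = nats u ''r''" "nats z ''lam'' = nats u ''lam''" "nats z ''mult'' = (nats u ''mult'')(p := Suc (nats u ''mult'' p))"
      "nats z ''clsf'' = (nats u ''clsf'')(k := Suc p)"
  shows "classified n W (Suc k) lams' z"
proof -
  have comp: "composition nu" if "nu \<in> set lams'" for nu using s that lams' mu(1) by (auto simp: classified_def split: if_splits)
  have dist: "distinct lams'" using s lams' by (auto simp: classified_def)
  have "set lams' = {mu. composition mu \<and> (\<exists>j<Suc k. W j = cont mu)}"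
  proof -
    have S: "set lams = {mu. composition mu \<and> (\<exists>j<k. W j = cont mu)}" using s by (simp add: classified_def)
    have "{nu. composition nu \<and> (\<exists>j<Suc k. W j = cont nu)} = insert mu (set lams)"
      unfolding S using mu cont_inj by (auto simp: less_Suc_eq)
    then show ?thesis using lams' by auto
  qed
  moreover have "listed n lams' z" using u(1) z by (simp add: listed_def)
  moreover
  have old: "nats u ''mult'' q = length (filter (\<lambda>j. W j = cont (lams' ! q)) [0..<k]) \<and>
      (\<forall>j<k. nats u ''clsf'' j = Suc q \<longleftrightarrow> W j = cont (lams' ! q))" if q: "q < length lams'" for q
  proof (cases "q < length lams")
    case True
    then have "lams' ! q = lams ! q" using lams' by (auto simp: nth_append)
    then show ?thesis using s True u(4,6) by (simp add: classified_def)
  next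
    case False
    \<comment> \<open>A new partition: no earlier vector has this word, so its counter rightly
      starts at 0.\<close>
    then have m1: "mu \<notin> set lams" "q = length lams" using q lams' by (auto split: if_splits)
    then have m: "mu \<notin> set lams" "q = length lams" "lams' ! q = mu" using lams' by simp_all
    then have W: "W j \<noteq> cont mu" if "j < k" for j using s mu(1) that by (auto simp: classified_def)
    have c: "nats s ''clsf'' j \<le> length lams" if "j < k" for j using s that by (auto simp: classified_def)
    have e: "filter (\<lambda>j. W j = cont mu) [0..<k] = []" using W by (simp add: filter_empty_conv)
    have "nats s ''clsf'' j \<noteq> Suc (length lams)" if "j < k" for j using c[OF that] by simp
    then show ?thesis using m u(5,6) W e by simp
  qed
  have kq: "W k = cont (lams' ! q) \<longleftrightarrow> q = p" if "q < length lams'" for q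
  proof -
    have "W k = cont (lams' ! q) \<longleftrightarrow> lams' ! q = lams' ! p" using cont_inj[OF mu(1) comp[OF nth_mem[OF that]]] mu(2) u(3) by auto
    then show ?thesis using dist that u(2) by (simp add: nth_eq_iff_index_eq)
  qed
  have "\<forall>q<length lams'. nats z ''mult'' q = length (filter (\<lambda>j. W j = cont (lams' ! q)) [0..<Suc k])"
    using old kq z by auto
  moreover have "nats z ''clsf'' j \<le> length lams' \<and> (\<forall>q<length lams'. nats z ''clsf'' j = Suc q \<longleftrightarrow> W j = cont (lams' ! q))"
    if j: "j < Suc k" for j
  proof (cases "j = k")
    case True
    then show ?thesis using kq z u(2) by auto
  next
    case False
    then have "nats s ''clsf'' j \<le> length lams'" using s j lams' by (auto simp: classified_def le_SucI)
    then show ?thesis using False old z u(6) j by auto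
  qed
  ultimately show ?thesis using dist by (simp add: classified_def)
qed

lemma wp_class_step:
  assumes s: "nats s ''n'' 0 = n" "nats s ''m'' 0 = k" and W: "W = word n (nats s ''wt'')" and c: "classified n W k lams s"
  shows "wp class_step 0 (\<lambda>u. eqx {''ok'', ''len'', ''cur'', ''a'', ''j'', ''p'', ''z'', ''e'', ''lam'', ''mult'', ''r'', ''clsf''} {} s u \<and>
    (\<exists>lams. classified n W (Suc k) lams u)) s"
proof -
  let ?N = "{''ok'', ''len'', ''cur'', ''a'', ''j'', ''p'', ''z'', ''e'', ''lam'', ''mult'', ''r'', ''clsf''}"
  have "wp class_step (0 + (0 + (0 + (0 + 0)))) (\<lambda>u. eqx ?N {} s u \<and> (\<exists>lams. classified n W (Suc k) lams u)) s"
    unfolding class_step_def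
  proof (rule wp_Seq, rule wp_post[OF wp_parse_prog[OF s]], goal_cases)
    case (1 t)
    then have t: "eqx {''ok'', ''len'', ''cur'', ''a'', ''j''} {} s t" and pt: "parsed n (W k) t" using W by auto
    have st: "eqx ?N {} s t" by (rule eqx_mono[OF t]) auto
    have et: "nats t x = nats s x" if "x \<in> {''n'', ''m'', ''r'', ''lam'', ''mult'', ''clsf''}" for x
      using that by (intro eqxN[OF t]) auto
    show ?case
    proof (rule wp_If, goal_cases)
      case 1
      then obtain mu where mu: "composition mu" "W k = cont mu" "\<And>a. a < n \<Longrightarrow> nats t ''cur'' a = pad mu a"
        using pt by (auto simp: parsed_def)
      have len: "length nu \<le> n" if "composition nu" "W j = cont nu" for nu j
        using composition_length[OF that(1)] that(2) length_cont[of nu] W length_word[of n "nats s ''wt''" j] by simp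
      have lt: "listed n lams t" using c et by (simp add: classified_def listed_def)
      have cl: "composition nu \<and> length nu \<le> n" if "nu \<in> set lams" for nu using c that len by (auto simp: classified_def)
      define lams' where "lams' = (if mu \<in> set lams then lams else lams @ [mu])"
      have nt: "nats t ''n'' 0 = n" using s et by simp
      show ?case
      proof (rule wp_Seq, rule wp_post[OF wp_lookup_prog[OF nt lt cl mu(1) len[OF mu(1,2)] mu(3)]], goal_cases)
        case (3 u)
        then have u: "eqx {''p'', ''z'', ''e'', ''a''} {} t u" by simp
        have su: "eqx ?N {} s u" by (rule eqx_trans[OF st u]) auto
        have eu: "nats u x = nats s x" if "x \<in> {''n'', ''m'', ''r'', ''lam'', ''mult'', ''clsf''}" for x
          using eqxN[OF u, of x] et[OF that] that by auto
        have lu: "listed n lams u" using c eu by (simp add: classified_def listed_def)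
        have nu: "nats u ''n'' 0 = n" using s eu by simp
        have cu: "nats u ''cur'' a = pad mu a" if "a < n" for a using mu(3)[OF that] by (simp add: eqxN[OF u])
        show ?case
        proof (rule wp_Seq, rule wp_post[OF wp_add_prog[OF nu lu cu conjunct2[OF 3] lams'_def]], goal_cases)
          case (2 v)
          then have v: "eqx {''lam'', ''mult'', ''r'', ''a''} {} u v" by simp
          have sv: "eqx ?N {} s v" by (rule eqx_trans[OF su v]) auto
          have ev: "nats v ''p'' = nats u ''p''" "nats v ''m'' 0 = k" "nats v ''clsf'' = nats s ''clsf''"
            using s eu[of "''clsf''"] eu[of "''m''"] by (simp_all add: eqxN[OF v])
          show ?case
          proof (intro wp_Seq wp_NAssign conjI exI[of _ lams'])
            let ?z = "set_nat (set_nat v (''mult'', Nv ''p'') (nval (NPlus (Cell ''mult'' (Nv ''p'')) (Lit 1)) v)) (''clsf'', Nv ''m'')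
              (nval (NPlus (Nv ''p'') (Lit 1)) (set_nat v (''mult'', Nv ''p'') (nval (NPlus (Cell ''mult'' (Nv ''p'')) (Lit 1)) v)))"
            show "eqx ?N {} s ?z" using sv by simp
            show "classified n W (Suc k) lams' ?z"
            proof (rule classified_add[OF c mu(1,2) lams'_def, where u = v and p = "nats u ''p'' 0"])
              show "\<forall>q<length lams. nats v ''mult'' q = nats s ''mult'' q" using 2 eu by simp
            qed (use 2 ev in auto)
          qed
        qed (use cu in auto)
      qed (use cl mu in auto)
    next
      case 2
      then have no: "\<not> (\<exists>mu. composition mu \<and> W k = cont mu)" using pt by (auto simp: parsed_def)
      let ?z = "set_nat t (''clsf'', Nv ''m'') (nval (Lit 0) t)"
      have ez: "nats ?z ''r'' = nats s ''r''" "nats ?z ''lam'' = nats s ''lam''" "nats ?z ''mult'' = nats s ''mult''"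
        "nats ?z ''clsf'' = (nats s ''clsf'')(k := 0)" using et s by auto
      have "classified n W (Suc k) lams ?z"
      proof -
        have S: "{mu. composition mu \<and> (\<exists>j<Suc k. W j = cont mu)} = {mu. composition mu \<and> (\<exists>j<k. W j = cont mu)}"
          using no by (auto simp: less_Suc_eq)
        have nq: "W k \<noteq> cont (lams ! q)" if "q < length lams" for q
          using no c nth_mem[OF that] by (auto simp: classified_def)
        show ?thesis using c nq unfolding classified_def listed_def S ez by (auto simp: less_Suc_eq)
      qed
      then have "eqx ?N {} s ?z \<and> (\<exists>lams. classified n W (Suc k) lams ?z)" using st by auto
      then have "wp (NAssign (''clsf'', Nv ''m'') (Lit 0)) 0 (\<lambda>u. eqx ?N {} s u \<and> (\<exists>lams. classified n W (Suc k) lams u)) t"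
        by (rule wp_NAssign)
      then show ?case by simp
    qed
  qed
  then show ?thesis by simp
qed

lemma wp_class_prog:
  assumes s: "nats s ''n'' 0 = n" "nats s ''d'' 0 = d" "nats s ''r'' 0 = 0" and W: "W = word n (nats s ''wt'')"
  shows "wp class_prog 0 (\<lambda>u. eqx {''ok'', ''len'', ''cur'', ''a'', ''j'', ''p'', ''z'', ''e'', ''lam'', ''mult'', ''r'', ''clsf'', ''m''} {} s u \<and>
    (\<exists>lams. classified n W d lams u)) s"
proof -
  let ?N = "{''ok'', ''len'', ''cur'', ''a'', ''j'', ''p'', ''z'', ''e'', ''lam'', ''mult'', ''r'', ''clsf'', ''m''}"
  define I where "I k t \<longleftrightarrow> eqx ?N {} s t \<and> (\<exists>lams. classified n W k lams t)" for k t
  have "wp class_prog (d * 0) (\<lambda>t. I d t \<and> nats t ''m'' 0 = d) s"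
    unfolding class_prog_def
  proof (rule wp_For)
    have "classified n W 0 [] (set_nat s (''m'', Lit 0) 0)" using s by (simp add: classified_def listed_def)
    then show "I 0 (set_nat s (''m'', Lit 0) 0)" unfolding I_def by auto
    fix k t assume "I k t"
    then have t: "eqx ?N {} s t" by (simp add: I_def)
    show "nval dN t = d" using s by (simp add: eqxN[OF t])
  next
    fix k t assume k: "k < d" "I k t" "nats t ''m'' 0 = k"
    have t: "eqx ?N {} s t" using k by (simp add: I_def)
    obtain lams where c: "classified n W k lams t" using k by (auto simp: I_def)
    have nt: "nats t ''n'' 0 = n" "W = word n (nats t ''wt'')" using s W by (simp_all add: eqxN[OF t])
    show "wp class_step 0 (\<lambda>t. nats t ''m'' 0 = k \<and> I (Suc k) (set_nat t (''m'', Lit 0) (Suc k))) t"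
    proof (rule wp_post[OF wp_class_step[OF nt(1) k(3) nt(2) c]])
      fix u assume u: "eqx {''ok'', ''len'', ''cur'', ''a'', ''j'', ''p'', ''z'', ''e'', ''lam'', ''mult'', ''r'', ''clsf''} {} t u \<and>
        (\<exists>lams. classified n W (Suc k) lams u)"
      then obtain lams' where c': "classified n W (Suc k) lams' u" by blast
      have "eqx ?N {} s u" by (rule eqx_trans[OF t conjunct1[OF u]]) auto
      moreover have "nats u ''m'' 0 = k" using k(3) by (simp add: eqxN[OF conjunct1[OF u]])
      moreover have "classified n W (Suc k) lams' (set_nat u (''m'', Lit 0) (Suc k))" using c' by (simp add: classified_def listed_def)
      ultimately show "nats u ''m'' 0 = k \<and> I (Suc k) (set_nat u (''m'', Lit 0) (Suc k))" unfolding I_def by auto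
    qed
  qed
  then show ?thesis by (rule wp_conseq) (auto simp: I_def)
qed

section \<open>Phase two: the adapted basis\<close>

abbreviation "cntN \<equiv> Nv ''cnt''"
abbreviation "stN \<equiv> Nv ''st''"

text \<open>Inner products are taken with the original vector \<open>u\<close>, not with the
  partially reduced \<open>w\<close>, in accordance with \<open>gs_proj\<close>. Only members of the
  current block, from position \<open>st\<close> on, take part; the modules of different blocks are
  orthogonal by \<open>cross\<close>.\<close>

definition gs_prog :: com where
  "gs_prog = Seq (Fill ''k'' dN ''w'' (Lit 0) (Copy acc (''u'', Nv ''k'')))
    (Seq (For ''z'' (NMinus cntN stN)
       (Seq (Dot dN (''u'', Nv ''i'') (''bb'', idx2 (NPlus stN (Nv ''z'')) (Nv ''i'')))
       (Seq (Copy sc acc)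
            (Fill ''k'' dN ''w'' (Lit 0) (Seq (Arith Mul t2 sc (''bb'', idx2 (NPlus stN (Nv ''z'')) (Nv ''k''))) (Arith Sub acc (''w'', Nv ''k'') t2))))))
    (Seq (Dot dN (''w'', Nv ''i'') (''w'', Nv ''i'')) (Seq (Compare fl zr acc)
    (If pos (Seq (Sqrt sq acc) (Seq (Fill ''k'' dN ''bb'' (NTimes cntN dN) (Arith Quot acc (''w'', Nv ''k'') sq))
              (NAssign (''cnt'', Lit 0) (NPlus cntN (Lit 1))))) Skip))))"

definition row_prog :: com where
  "row_prog = For ''l'' (NMinus nN (Lit 1)) (Seq
     (Fill ''k'' dN ''u'' (Lit 0) (Dot dN (''rho'', idx3 (Nv ''l'') (Nv ''k'') (Nv ''i'')) (''bb'', idx2 (NPlus stN (Nv ''m'')) (Nv ''i'')))) gs_prog)"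

text \<open>The part of \<open>bb\<close> from \<open>st\<close> on is the worklist of
  \<open>gs\<close>: rounds beyond its current end are skipped without cost.\<close>

definition block_prog :: com where
  "block_prog = For ''m'' dN (If (Less (NPlus stN (Nv ''m'')) cntN) row_prog Skip)"

definition blocks_prog :: com where
  "blocks_prog = For ''b'' (Nv ''B'') (Seq (NAssign (''st'', Lit 0) cntN)
     (Seq (Fill ''k'' dN ''bb'' (NTimes cntN dN) (Copy acc (''q'', idx2 (Cell ''ord'' (Nv ''b'')) (Nv ''k''))))
     (Seq (NAssign (''cnt'', Lit 0) (NPlus cntN (Lit 1))) block_prog)))"

text \<open>Scanning all vectors once per partition groups the start vectors by class, so that equal
  blocks become neighbours; the scan is pure bookkeeping on naturals.\<close>

definition ord_prog :: com where
  "ord_prog = Seq (NAssign (''B'', Lit 0) (Lit 0)) (For ''p'' (Nv ''r'') (For ''k'' dN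
     (If (Neq (Cell ''clsf'' (Nv ''k'')) (NPlus (Nv ''p'') (Lit 1)))
        (Seq (NAssign (''ord'', Nv ''B'') (Nv ''k'')) (NAssign (''B'', Lit 0) (NPlus (Nv ''B'') (Lit 1)))) Skip)))"

definition listing :: "nat list \<Rightarrow> state \<Rightarrow> bool" where
  "listing xs t \<longleftrightarrow> nats t ''B'' 0 = length xs \<and> (\<forall>i<length xs. nats t ''ord'' i = xs ! i)"

lemma wp_ord_prog:
  assumes s: "nats s ''d'' 0 = d" "nats s ''r'' 0 = r"
  shows "wp ord_prog 0 (\<lambda>t. eqx {''B'', ''ord'', ''p'', ''k''} {} s t \<and>
    listing (concat (map (\<lambda>p. filter (\<lambda>k. nats s ''clsf'' k = Suc p) [0..<d]) [0..<r])) t) s"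
proof -
  let ?N = "{''B'', ''ord'', ''p'', ''k''}"
  let ?f = "\<lambda>p k. filter (\<lambda>k. nats s ''clsf'' k = Suc p) [0..<k]"
  define I where "I p t \<longleftrightarrow> eqx ?N {} s t \<and> listing (concat (map (\<lambda>p. ?f p d) [0..<p])) t" for p t
  define J where "J p k t \<longleftrightarrow> eqx ?N {} s t \<and> nats t ''p'' 0 = p \<and> listing (concat (map (\<lambda>p. ?f p d) [0..<p]) @ ?f p k) t" for p k t
  let ?body = "If (Neq (Cell ''clsf'' (Nv ''k'')) (NPlus (Nv ''p'') (Lit 1)))
        (Seq (NAssign (''ord'', Nv ''B'') (Nv ''k'')) (NAssign (''B'', Lit 0) (NPlus (Nv ''B'') (Lit 1)))) Skip"
  have "wp ord_prog (0 + r * (d * (0 + 0))) (\<lambda>t. I r t \<and> nats t ''p'' 0 = r) s"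
    unfolding ord_prog_def
  proof (intro wp_Seq wp_NAssign, rule wp_For, goal_cases)
    case 1
    show ?case by (simp add: I_def listing_def)
  next
    case (2 p t)
    then have t: "eqx ?N {} s t" by (simp add: I_def)
    show ?case using s by (simp add: eqxN[OF t])
  next
    case (3 p t)
    have "wp (For ''k'' dN ?body) (d * (0 + 0)) (\<lambda>t. J p d t \<and> nats t ''k'' 0 = d) t"
    proof (rule wp_For)
      show "J p 0 (set_nat t (''k'', Lit 0) 0)" using 3 by (simp add: J_def I_def listing_def)
      show "nval dN u = d" if "J p k u" for k u
      proof -
        have u: "eqx ?N {} s u" using that by (simp add: J_def)
        show ?thesis using s by (simp add: eqxN[OF u])
      qed
      fix k u assume k: "k < d" "J p k u" "nats u ''k'' 0 = k"
      have u: "eqx ?N {} s u" using k by (simp add: J_def)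
      have cu: "nats u ''clsf'' = nats s ''clsf''" by (simp add: eqxN[OF u])
      have pu: "nats u ''p'' 0 = p" and lu: "listing (concat (map (\<lambda>p. ?f p d) [0..<p]) @ ?f p k) u" using k(2) by (simp_all add: J_def)
      show "wp ?body (0 + 0) (\<lambda>t. nats t ''k'' 0 = k \<and> J p (Suc k) (set_nat t (''k'', Lit 0) (Suc k))) u"
      proof (rule wp_If)
        assume "bval (Neq (Cell ''clsf'' (Nv ''k'')) (NPlus (Nv ''p'') (Lit 1))) u"
        then have f: "?f p (Suc k) = ?f p k @ [k]" using cu pu k(3) by simp
        let ?xs = "concat (map (\<lambda>p. ?f p d) [0..<p]) @ ?f p k"
        have snoc: "listing (xs @ [k]) (set_nat (set_nat u (''ord'', Nv ''B'') k) (''B'', Lit 0) (Suc (length xs)))" if "listing xs u" for xs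
          using that by (auto simp: listing_def nth_append less_Suc_eq)
        have cong: "listing xs (set_nat v (''k'', Lit 0) w) = listing xs v" for xs v w by (simp add: listing_def)
        have B: "nats u ''B'' 0 = length ?xs" using lu unfolding listing_def by (rule conjunct1)
        show "wp (Seq (NAssign (''ord'', Nv ''B'') (Nv ''k'')) (NAssign (''B'', Lit 0) (NPlus (Nv ''B'') (Lit 1)))) (0 + 0)
          (\<lambda>t. nats t ''k'' 0 = k \<and> J p (Suc k) (set_nat t (''k'', Lit 0) (Suc k))) u"
          using snoc[OF lu] u pu k(3) unfolding J_def f append_assoc[symmetric] cong
          by (intro wp_Seq wp_NAssign) (simp add: B)
      next
        assume "\<not> bval (Neq (Cell ''clsf'' (Nv ''k'')) (NPlus (Nv ''p'') (Lit 1))) u"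
        then have f: "?f p (Suc k) = ?f p k" using cu pu k(3) by auto
        show "wp Skip (0 + 0) (\<lambda>t. nats t ''k'' 0 = k \<and> J p (Suc k) (set_nat t (''k'', Lit 0) (Suc k))) u"
          using k(3) u pu lu unfolding J_def f by (intro wp_le[OF wp_Skip]) (simp_all add: listing_def)
      qed
    qed
    then show ?case by (rule wp_post) (simp add: J_def I_def listing_def)
  qed
  then show ?thesis by (rule wp_conseq) (auto simp: I_def)
qed

section \<open>Correctness of the block construction\<close>

context jm_program
begin

definition held :: "(nat \<Rightarrow> real) list \<Rightarrow> state \<Rightarrow> bool" where
  "held L t \<longleftrightarrow> nats t ''cnt'' 0 = length L \<and> (\<forall>j<length L. row_of d (reals t ''bb'') j = L ! j)"

lemma held_nth: "held (pre @ bs) t \<Longrightarrow> j < length bs \<Longrightarrow> i < d \<Longrightarrow> reals t ''bb'' ((length pre + j) * d + i) = (bs ! j) i"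
proof -
  assume a: "held (pre @ bs) t" "j < length bs" "i < d"
  then have "row_of d (reals t ''bb'') (length pre + j) = bs ! j" by (simp add: held_def nth_append)
  then have "row_of d (reals t ''bb'') (length pre + j) i = (bs ! j) i" by simp
  then show ?thesis using a(3) by (simp add: row_of_def)
qed

lemma held_snoc:
  assumes h: "held L s" and b: "b \<in> fvecs d" "\<And>i. i < d \<Longrightarrow> F i = b i"
    and t: "\<forall>m. reals t ''bb'' m = (if length L * d \<le> m \<and> m < length L * d + d then F (m - length L * d) else reals s ''bb'' m)"
    and c: "nats t ''cnt'' 0 = Suc (length L)"
  shows "held (L @ [b]) t"
proof -
  have "row_of d (reals t ''bb'') j = (L @ [b]) ! j" if j: "j < Suc (length L)" for j
  proof (cases "j = length L")
    case True
    then show ?thesis using t b by (auto simp: row_of_def fun_eq_iff fvecs_def)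
  next
    case False
    then have jl: "j < length L" using j by simp
    have "row_of d (reals t ''bb'') j = row_of d (reals s ''bb'') j"
      using t row_lt[OF jl] by (fastforce simp: row_of_def fun_eq_iff)
    then show ?thesis using h jl by (simp add: held_def nth_append)
  qed
  then show ?thesis using c by (simp add: held_def)
qed

lemma wp_gs_prog:
  assumes s: "inp s" "held (pre @ bs) s" "nats s ''st'' 0 = length pre" and u: "u = vec_of d (reals s ''u'')"
    and bs: "length bs \<le> d" "set bs \<subseteq> fvecs d"
  shows "wp gs_prog (12 * d ^ 2) (\<lambda>t. eqx {''k'', ''i'', ''z'', ''f'', ''cnt''} {''acc'', ''tmp'', ''sc'', ''t2'', ''w'', ''sq'', ''bb''} s t \<and>
    held (pre @ gs_ext (vip d) bs u) t) s"
proof -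
  let ?N = "{''k'', ''i'', ''z'', ''f'', ''cnt''}" and ?R = "{''acc'', ''tmp'', ''sc'', ''t2'', ''w'', ''sq'', ''bb''}"
  let ?N1 = "{''k'', ''i'', ''z''}" and ?R1 = "{''acc'', ''tmp'', ''sc'', ''t2'', ''w''}"
  let ?Q = "\<lambda>t. eqx ?N ?R s t \<and> held (pre @ gs_ext (vip d) bs u) t"
  \<comment> \<open>The residue after z subtractions; it passes from \<open>u\<close> to the value
    of \<open>gs_proj\<close>.\<close>
  define pw where "pw z = u - (\<Sum>j<z. vip d u (bs ! j) *\<^sub>R bs ! j)" for z
  have pwS: "pw (Suc z) i = pw z i - vip d u (bs ! z) * (bs ! z) i" for z i by (simp add: pw_def)
  have pw: "pw (length bs) = gs_proj (vip d) bs u" by (simp add: pw_def gs_proj_def)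
  have pw0: "pw 0 = u" by (simp add: pw_def)
  have uV: "u \<in> fvecs d" by (simp add: u)
  have cnt: "nats s ''cnt'' 0 = length pre + length bs" using s(2) by (simp add: held_def)
  define I where "I z t \<longleftrightarrow> eqx ?N1 ?R1 s t \<and> (\<forall>i<d. reals t ''w'' i = pw z i)" for z t
  have "wp gs_prog (d * 0 + (length bs * (1 + 2 * d + (0 + d * (1 + 1))) + (1 + 2 * d + (1 + (1 + (d * 1 + 0)))))) ?Q s"
    unfolding gs_prog_def
  proof (rule wp_Seq, rule wp_post[OF wp_Fill[where N = d and b = 0 and NX = "{}" and RX = "{''acc''}" and F = u]], goal_cases)
    case (1 t)
    then show ?case using s by (simp add: eqxN[OF 1] inpD)
  next
    case (4 k t)
    then show ?case using u by (intro wp_Copy) (simp add: get_real_def eqxR[OF 4(3)] vec_of_def)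
  next
    case (5 t)
    have t: "eqx ?N1 ?R1 s t" by (rule eqx_mono[OF conjunct1[OF 5]]) auto
    have I0: "I 0 (set_nat t (''z'', Lit 0) 0)" using t 5 by (simp add: I_def pw0)
    show ?case
    proof (rule wp_Seq, rule wp_post[OF wp_For[where I = I and N = "length bs", OF I0]], goal_cases)
      case (1 z x)
      then have x: "eqx ?N1 ?R1 s x" by (simp add: I_def)
      show ?case using cnt s(3) by (simp add: eqxN[OF x])
    next
      case (2 z x)
      then have x: "eqx ?N1 ?R1 s x" and w: "\<And>i. i < d \<Longrightarrow> reals x ''w'' i = pw z i" by (simp_all add: I_def)
      note ex = eqxN[OF x] eqxR[OF x]
      have bz: "reals s ''bb'' ((length pre + z) * d + i) = (bs ! z) i" if "i < d" for i using held_nth[OF s(2) 2(1) that] .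
      show ?case
      proof (rule wp_Seq, rule wp_post[OF wp_Dot[where N = d and A = u and B = "bs ! z"]], goal_cases)
        case (1 y)
        then show ?case using s by (simp add: eqxN[OF 1] ex inpD)
      next
        case (2 y i)
        then show ?case using u bz[OF 2(1)] s \<open>nats x ''z'' 0 = z\<close>
          by (simp add: get_real_def eqxN[OF 2(2)] eqxR[OF 2(2)] ex vec_of_def inpD)
      next
        case (3 y)
        define y' where "y' = set_real y sc (vip d u (bs ! z))"
        have xy: "eqx {''i''} {''acc'', ''tmp'', ''sc''} x y'"
          using eqx_mono[OF conjunct1[OF 3], of "{''i''}" "{''acc'', ''tmp'', ''sc''}"] by (simp add: y'_def)
        have g: "get_real y acc = vip d u (bs ! z)" using 3 by (simp add: get_real_def vip_def)
        have y'sc: "reals y' ''sc'' 0 = vip d u (bs ! z)" by (simp add: y'_def)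
        have z: "nats x ''z'' 0 = z" by fact
        note ey = eqxN[OF xy] eqxR[OF xy]
        show ?case
        proof (rule wp_Seq, rule wp_Copy, unfold g y'_def[symmetric],
            rule wp_post[OF wp_Fill[where N = d and b = 0 and NX = "{}" and RX = "{''acc'', ''t2''}" and F = "pw (Suc z)"]], goal_cases)
          case (1 v)
          then show ?case using s by (simp add: eqxN[OF 1] ey ex inpD)
        next
          case (4 k v)
          note ev = eqxN[OF 4(3)] eqxR[OF 4(3)]
          have "reals v ''w'' k = pw z k" using 4(4)[of k] 4(1) w by (simp add: ey)
          then show ?case using s z 4(2) bz[OF 4(1)] y'sc
            by (intro wp_Seq wp_Arith) (simp_all add: get_real_def ev ey ex inpD pwS)
        next
          case (5 v)
          then have yv: "eqx {''k''} {''w'', ''acc'', ''t2''} y' v" by simp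
          have "eqx ?N1 ?R1 x v" by (rule eqx_trans[OF xy yv]) auto
          then have "eqx ?N1 ?R1 s v" using eqx_trans[OF x] by blast
          moreover have "nats v ''z'' 0 = z" using z by (simp add: eqxN[OF yv] ey)
          ultimately show ?case using 5 by (simp add: I_def)
        qed auto
      qed
    next
      case (3 x)
      then have x: "eqx ?N1 ?R1 s x" by (simp add: I_def)
      let ?w = "gs_proj (vip d) bs u"
      have w: "reals x ''w'' i = ?w i" if "i < d" for i using 3 that by (simp add: I_def pw)
      have wV: "?w \<in> fvecs d" by (rule gs_proj_in[OF uV bs(2)])
      show ?case
      proof (rule wp_Seq, rule wp_post[OF wp_Dot[where N = d and A = ?w and B = ?w]], goal_cases)
        case (1 y)
        then show ?case using s by (simp add: eqxN[OF 1] eqxN[OF x] inpD)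
      next
        case (2 y i)
        then show ?case using w by (simp add: get_real_def eqxR[OF 2(2)])
      next
        case (3 y)
        define y' where "y' = set_nat y fl (if 0 < vip d ?w ?w then 1 else 0)"
        have y: "eqx {''i''} {''acc'', ''tmp''} x y" and a: "reals y ''acc'' 0 = vip d ?w ?w" using 3 by (simp_all add: vip_def)
        have sy: "eqx ?N ?R s y'" unfolding y'_def using eqx_trans[OF x y, of ?N ?R] by simp
        have ry: "reals y' ''w'' = reals x ''w''" "reals y' ''bb'' = reals s ''bb''" "nats y' ''cnt'' 0 = length pre + length bs" "reals y' ''acc'' 0 = vip d ?w ?w"
          "nats y' ''d'' 0 = d"
          using a cnt s(1) by (simp_all add: y'_def eqxN[OF y] eqxR[OF y] eqxN[OF x] eqxR[OF x] inpD)
        have hy: "held (pre @ bs) y'" using s(2) ry cnt by (simp add: held_def)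
        have cmp: "set_nat y fl (if get_real y zr < get_real y acc then 1 else 0) = y'"
          using a s(1) by (simp add: y'_def get_real_def eqxR[OF y] eqxR[OF x] inpD)
        show ?case
        proof (rule wp_Seq, rule wp_Compare, unfold cmp, rule wp_If)
          assume "bval pos y'"
          then have p: "0 < vip d ?w ?w" by (simp add: y'_def split: if_splits)
          have e: "gs_ext (vip d) bs u = bs @ [(1 / sqrt (vip d ?w ?w)) *\<^sub>R ?w]" using p by (simp add: gs_ext_def Let_def)
          define y2 where "y2 = set_real y' sq (sqrt (vip d ?w ?w))"
          have g2: "set_real y' sq (sqrt (get_real y' acc)) = y2" by (simp add: y2_def get_real_def ry)
          show "wp (Seq (Sqrt sq acc) (Seq (Fill ''k'' dN ''bb'' (NTimes cntN dN) (Arith Quot acc (''w'', Nv ''k'') sq))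
              (NAssign (''cnt'', Lit 0) (NPlus cntN (Lit 1))))) (1 + (d * 1 + 0)) ?Q y'"
          proof (rule wp_Seq, rule wp_Sqrt)
            show "0 \<le> get_real y' acc" using p ry by (simp add: get_real_def)
            show "wp (Seq (Fill ''k'' dN ''bb'' (NTimes cntN dN) (Arith Quot acc (''w'', Nv ''k'') sq))
              (NAssign (''cnt'', Lit 0) (NPlus cntN (Lit 1)))) (d * 1 + 0) ?Q (set_real y' sq (sqrt (get_real y' acc)))"
              unfolding g2
            proof (rule wp_Seq, rule wp_post[OF wp_Fill[where N = d and b = "(length pre + length bs) * d" and NX = "{}" and RX = "{''acc''}" and F = "\<lambda>i. ?w i / sqrt (vip d ?w ?w)"]], goal_cases)
              case (1 v)
              then show ?case using ry by (simp add: eqxN[OF 1] y2_def)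
            next
              case (4 k v)
              then show ?case using p w[OF 4(1)] by (intro wp_Arith) (simp_all add: get_real_def eqxR[OF 4(3)] y2_def ry)
            next
              case (5 v)
              then have v: "eqx {''k''} {''bb'', ''acc''} y2 v" by simp
              have y2: "eqx ?N ?R s y2" using sy by (simp add: y2_def)
              have sv: "eqx ?N ?R s v" by (rule eqx_trans[OF y2 v]) auto
              have cv: "nats v ''cnt'' 0 = length (pre @ bs)" using ry by (simp add: eqxN[OF v] y2_def)
              have "held ((pre @ bs) @ [(1 / sqrt (vip d ?w ?w)) *\<^sub>R ?w]) (set_nat v (''cnt'', Lit 0) (Suc (length (pre @ bs))))"
                by (rule held_snoc[OF hy, where F = "\<lambda>i. ?w i / sqrt (vip d ?w ?w)"])
                  (use 5 wV in \<open>simp_all add: y2_def real_vector.subspace_scale[OF subspace_fvecs]\<close>)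
              then show ?case unfolding e using sv cv by (intro wp_NAssign) simp
            qed auto
          qed
        next
          assume "\<not> bval pos y'"
          then have "\<not> 0 < vip d ?w ?w" by (simp add: y'_def split: if_splits)
          then have e: "gs_ext (vip d) bs u = bs" by (simp add: gs_ext_def Let_def)
          show "wp Skip (1 + (d * 1 + 0)) ?Q y'" unfolding e using sy hy by (intro wp_le[OF wp_Skip]) auto
        qed
      qed
    qed
  qed auto
  \<comment> \<open>A block has at most d members, each costing 4 d + 1 operations; normalization
    adds terms linear in d.\<close>
  moreover have "d * 0 + (length bs * (1 + 2 * d + (0 + d * (1 + 1))) + (1 + 2 * d + (1 + (1 + (d * 1 + 0))))) \<le> 12 * d ^ 2"
  proof -
    obtain e where e: "d = Suc e" using d1 by (cases d) auto
    have "length bs * (1 + 2 * d + (0 + d * (1 + 1))) \<le> d * (1 + 2 * d + (0 + d * (1 + 1)))" using bs(1) by (rule mult_le_mono1)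
    moreover have "d * 0 + (d * (1 + 2 * d + (0 + d * (1 + 1))) + (1 + 2 * d + (1 + (1 + (d * 1 + 0))))) \<le> 12 * d ^ 2"
      unfolding e by (simp add: power2_eq_square algebra_simps)
    ultimately show ?thesis by linarith
  qed
  ultimately show ?thesis by (rule wp_le)
qed

lemma wp_row_prog:
  assumes s: "inp s" "held (pre @ bs) s" "nats s ''st'' 0 = length pre" "nats s ''m'' 0 = m" "m < length bs"
    and bs: "orthonormal (vip d) bs" "set bs \<subseteq> fvecs d"
  shows "wp row_prog (n * (15 * d ^ 2)) (\<lambda>t. eqx {''k'', ''i'', ''z'', ''f'', ''cnt'', ''l''} {''acc'', ''tmp'', ''sc'', ''t2'', ''w'', ''sq'', ''bb'', ''u''} s t \<and>
    held (pre @ gs_row (vip d) tau (bs ! m) (n - 1) bs) t) s"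
proof -
  let ?N = "{''k'', ''i'', ''z'', ''f'', ''cnt'', ''l''}" and ?R = "{''acc'', ''tmp'', ''sc'', ''t2'', ''w'', ''sq'', ''bb'', ''u''}"
  let ?b = "bs ! m"
  let ?r = "\<lambda>l. gs_row (vip d) tau ?b l bs"
  have row: "orthonormal (vip d) (?r l)" "set (?r l) \<subseteq> fvecs d" if "l \<le> n - 1" for l
    using gs_row_props[OF bs(1) inv_sub_V bs(2) _ that, of ?b] bs(2) s(5) nth_mem by blast+
  have len: "length (?r l) \<le> d" if "l \<le> n - 1" for l using orthonormal_bessel(1)[OF row[OF that]] .
  define I where "I l t \<longleftrightarrow> eqx ?N ?R s t \<and> held (pre @ ?r l) t" for l t
  have "wp row_prog ((n - 1) * (d * (1 + 2 * d) + 12 * d ^ 2)) (\<lambda>t. I (n - 1) t \<and> nats t ''l'' 0 = n - 1) s"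
    unfolding row_prog_def
  proof (rule wp_For)
    show "I 0 (set_nat s (''l'', Lit 0) 0)" using s(2) by (simp add: I_def held_def)
    show "nval (NMinus nN (Lit 1)) t = n - 1" if "I l t" for l t
    proof -
      have t: "eqx ?N ?R s t" using that by (simp add: I_def)
      show ?thesis using s(1) by (simp add: eqxN[OF t] inpD)
    qed
    fix l t assume l: "l < n - 1" "I l t" "nats t ''l'' 0 = l"
    have t: "eqx ?N ?R s t" and h: "held (pre @ ?r l) t" using l(2) by (simp_all add: I_def)
    have it: "inp t" by (rule inp_eqx[OF s(1) t]) auto
    obtain zs where zs: "?r l = bs @ zs" using gs_row_prefix by blast
    have m: "m < length (?r l)" "?r l ! m = ?b" using s(5) zs by (simp_all add: nth_append)
    have bb: "reals t ''bb'' ((length pre + m) * d + i) = ?b i" if "i < d" for i using held_nth[OF h m(1) that] m(2) by simp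
    have nt: "nats t ''st'' 0 = length pre" "nats t ''m'' 0 = m" using s by (simp_all add: eqxN[OF t])
    show "wp (Seq (Fill ''k'' dN ''u'' (Lit 0) (Dot dN (''rho'', idx3 (Nv ''l'') (Nv ''k'') (Nv ''i'')) (''bb'', idx2 (NPlus stN (Nv ''m'')) (Nv ''i'')))) gs_prog)
       (d * (1 + 2 * d) + 12 * d ^ 2) (\<lambda>t. nats t ''l'' 0 = l \<and> I (Suc l) (set_nat t (''l'', Lit 0) (Suc l))) t"
    proof (rule wp_Seq, rule wp_post[OF wp_Fill[where N = d and b = 0 and NX = "{''i''}" and RX = "{''acc'', ''tmp''}" and F = "tau l ?b"]], goal_cases)
      case (1 x)
      then show ?case using it by (simp add: eqxN[OF 1] inpD)
    next
      case (4 k x)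
      note ex = eqxN[OF 4(3)] eqxR[OF 4(3)]
      show ?case
      proof (rule wp_post[OF wp_Dot[where N = d and A = "\<lambda>i. tm l $$ (k, i)" and B = ?b]], goal_cases)
        case (1 y)
        then show ?case using it by (simp add: eqxN[OF 1] ex inpD)
      next
        case (2 y i)
        note ey = eqxN[OF 2(2)] eqxR[OF 2(2)]
        show ?case using it l 4(1,2) 2(1,3) nt bb[OF 2(1)] by (simp add: get_real_def ey ex inpD)
      next
        case (3 y)
        then show ?case using 4(1) eqx_mono by (simp add: mact_def)
      qed
    next
      case (5 x)
      then have x: "eqx {''k'', ''i''} {''u'', ''acc'', ''tmp''} t x" by simp
      have sx: "eqx ?N ?R s x" by (rule eqx_trans[OF t x]) auto
      have ix: "inp x" by (rule inp_eqx[OF s(1) sx]) auto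
      have hx: "held (pre @ ?r l) x" using h by (simp add: held_def eqxN[OF x] eqxR[OF x])
      have tb: "tau l ?b = vec_of d (reals x ''u'')" using 5 by (intro vec_of_eqI[symmetric]) auto
      have sx': "nats x ''st'' 0 = length pre" using nt by (simp add: eqxN[OF x])
      have ll: "l \<le> n - 1" using l by simp
      show ?case
      proof (rule wp_post[OF wp_gs_prog[OF ix hx sx' tb len[OF ll] row(2)[OF ll]]], goal_cases)
        case (1 y)
        have "eqx ?N ?R s y" by (rule eqx_trans[OF sx conjunct1[OF 1]]) auto
        moreover have "nats y ''l'' 0 = l" using l(3) by (simp add: eqxN[OF conjunct1[OF 1]] eqxN[OF x])
        ultimately show ?case using 1 by (simp add: I_def held_def)
      qed
    qed auto
  qed
  moreover have "(n - 1) * (d * (1 + 2 * d) + 12 * d ^ 2) \<le> n * (15 * d ^ 2)"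
  proof (rule mult_le_mono)
    obtain e where e: "d = Suc e" using d1 by (cases d) auto
    show "d * (1 + 2 * d) + 12 * d ^ 2 \<le> 15 * d ^ 2" unfolding e by (simp add: power2_eq_square algebra_simps)
  qed simp
  ultimately show ?thesis by (rule wp_conseq) (simp add: I_def)
qed

lemma wp_block_prog:
  assumes s: "inp s" "held (pre @ [v]) s" "nats s ''st'' 0 = length pre" and v: "v \<in> fvecs d" "vip d v v = 1"
  shows "wp block_prog (d * (n * (15 * d ^ 2))) (\<lambda>t. eqx {''k'', ''i'', ''z'', ''f'', ''cnt'', ''l'', ''m''} {''acc'', ''tmp'', ''sc'', ''t2'', ''w'', ''sq'', ''bb'', ''u''} s t \<and>
    held (pre @ G v) t) s"
proof -
  let ?N = "{''k'', ''i'', ''z'', ''f'', ''cnt'', ''l'', ''m''}" and ?R = "{''acc'', ''tmp'', ''sc'', ''t2'', ''w'', ''sq'', ''bb'', ''u''}"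
  let ?g = "gs (vip d) tau (n - 1) v"
  define I where "I m t \<longleftrightarrow> eqx ?N ?R s t \<and> held (pre @ ?g m) t" for m t
  have "wp block_prog (d * (n * (15 * d ^ 2))) (\<lambda>t. I d t \<and> nats t ''m'' 0 = d) s"
    unfolding block_prog_def
  proof (rule wp_For)
    show "I 0 (set_nat s (''m'', Lit 0) 0)" using s(2) by (simp add: I_def held_def)
    show "nval dN t = d" if "I m t" for m t
    proof -
      have t: "eqx ?N ?R s t" using that by (simp add: I_def)
      show ?thesis using s(1) by (simp add: eqxN[OF t] inpD)
    qed
    fix m t assume m: "m < d" "I m t" "nats t ''m'' 0 = m"
    have t: "eqx ?N ?R s t" and h: "held (pre @ ?g m) t" using m(2) by (simp_all add: I_def)
    have it: "inp t" by (rule inp_eqx[OF s(1) t]) auto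
    have st: "nats t ''st'' 0 = length pre" using s by (simp add: eqxN[OF t])
    have ct: "nats t ''cnt'' 0 = length pre + length (?g m)" using h by (simp add: held_def)
    have g: "orthonormal (vip d) (?g m)" "set (?g m) \<subseteq> fvecs d"
      using gs_props[OF v, of m] cyc_inv_sub[OF v(1)] by (auto simp: inv_sub_def)
    show "wp (If (Less (NPlus stN (Nv ''m'')) cntN) row_prog Skip) (n * (15 * d ^ 2))
       (\<lambda>t. nats t ''m'' 0 = m \<and> I (Suc m) (set_nat t (''m'', Lit 0) (Suc m))) t"
    proof (rule wp_If)
      assume "bval (Less (NPlus stN (Nv ''m'')) cntN) t"
      then have ml: "m < length (?g m)" using st ct m(3) by simp
      then have gS: "?g (Suc m) = gs_row (vip d) tau (?g m ! m) (n - 1) (?g m)" by (simp add: Let_def)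
      show "wp row_prog (n * (15 * d ^ 2)) (\<lambda>t. nats t ''m'' 0 = m \<and> I (Suc m) (set_nat t (''m'', Lit 0) (Suc m))) t"
      proof (rule wp_post[OF wp_row_prog[OF it h st m(3) ml g]], goal_cases)
        case (1 x)
        have "eqx ?N ?R s x" by (rule eqx_trans[OF t conjunct1[OF 1]]) auto
        moreover have "nats x ''m'' 0 = m" using m(3) by (simp add: eqxN[OF conjunct1[OF 1]])
        moreover have "held (pre @ ?g (Suc m)) (set_nat x (''m'', Lit 0) (Suc m))" unfolding gS using 1 by (simp add: held_def)
        ultimately show ?case by (simp add: I_def del: gs.simps)
      qed
    next
      assume "\<not> bval (Less (NPlus stN (Nv ''m'')) cntN) t"
      then have "\<not> m < length (?g m)" using st ct m(3) by simp
      then have gS: "?g (Suc m) = ?g m" by (simp add: Let_def)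
      show "wp Skip (n * (15 * d ^ 2)) (\<lambda>t. nats t ''m'' 0 = m \<and> I (Suc m) (set_nat t (''m'', Lit 0) (Suc m))) t"
        unfolding I_def gS using t h m(3) by (intro wp_le[OF wp_Skip]) (simp_all add: held_def)
    qed
  qed
  then show ?thesis by (rule wp_post) (simp add: I_def G_def)
qed

lemma wp_blocks_prog:
  assumes s: "inp s" "held [] s" "listing os s" "length os \<le> d"
    and os: "\<And>k. k \<in> set os \<Longrightarrow> vip d (row_of d (reals s ''q'') k) (row_of d (reals s ''q'') k) = 1"
  shows "wp blocks_prog (15 * n * d ^ 4) (\<lambda>t. eqx {''k'', ''i'', ''z'', ''f'', ''cnt'', ''l'', ''m'', ''st'', ''b''} {''acc'', ''tmp'', ''sc'', ''t2'', ''w'', ''sq'', ''bb'', ''u''} s t \<and>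
    held (concat (map (\<lambda>k. G (row_of d (reals s ''q'') k)) os)) t) s"
proof -
  let ?N = "{''k'', ''i'', ''z'', ''f'', ''cnt'', ''l'', ''m'', ''st'', ''b''}" and ?R = "{''acc'', ''tmp'', ''sc'', ''t2'', ''w'', ''sq'', ''bb'', ''u''}"
  let ?q = "row_of d (reals s ''q'')"
  let ?L = "\<lambda>b. concat (map (\<lambda>k. G (?q k)) (take b os))"
  define I where "I b t \<longleftrightarrow> eqx ?N ?R s t \<and> held (?L b) t" for b t
  have "wp blocks_prog (length os * (0 + (d * 0 + (0 + d * (n * (15 * d ^ 2)))))) (\<lambda>t. I (length os) t \<and> nats t ''b'' 0 = length os) s"
    unfolding blocks_prog_def
  proof (rule wp_For)
    show "I 0 (set_nat s (''b'', Lit 0) 0)" using s(2) by (simp add: I_def held_def)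
    show "nval (Nv ''B'') t = length os" if "I b t" for b t
    proof -
      have t: "eqx ?N ?R s t" using that by (simp add: I_def)
      show ?thesis using s(3) by (simp add: eqxN[OF t] listing_def)
    qed
    fix b t assume b: "b < length os" "I b t" "nats t ''b'' 0 = b"
    have t: "eqx ?N ?R s t" and h: "held (?L b) t" using b(2) by (simp_all add: I_def)
    let ?v = "?q (os ! b)"
    have LS: "?L (Suc b) = ?L b @ G ?v" using b(1) by (simp add: take_Suc_conv_app_nth)
    have ct: "nats t ''cnt'' 0 = length (?L b)" using h by (simp add: held_def)
    define t1 where "t1 = set_nat t (''st'', Lit 0) (length (?L b))"
    have st1: "eqx ?N ?R s t1" using t by (simp add: t1_def)
    have h1: "held (?L b) t1" using h by (simp add: held_def t1_def)
    have v: "?v \<in> fvecs d" "vip d ?v ?v = 1" using os b(1) by simp_all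
    have o: "nats s ''ord'' b = os ! b" using s(3) b(1) by (simp add: listing_def)
    have b1: "nats t1 ''b'' 0 = b" using b(3) by (simp add: t1_def)
    show "wp (Seq (NAssign (''st'', Lit 0) cntN)
     (Seq (Fill ''k'' dN ''bb'' (NTimes cntN dN) (Copy acc (''q'', idx2 (Cell ''ord'' (Nv ''b'')) (Nv ''k''))))
     (Seq (NAssign (''cnt'', Lit 0) (NPlus cntN (Lit 1))) block_prog))) (0 + (d * 0 + (0 + d * (n * (15 * d ^ 2)))))
      (\<lambda>t. nats t ''b'' 0 = b \<and> I (Suc b) (set_nat t (''b'', Lit 0) (Suc b))) t"
    proof (rule wp_Seq, rule wp_NAssign, unfold nval.simps ct t1_def[symmetric],
       rule wp_Seq, rule wp_post[OF wp_Fill[where N = d and b = "length (?L b) * d" and NX = "{}" and RX = "{''acc''}" and F = ?v]], goal_cases)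
      case (1 x)
      have "nats t1 ''cnt'' 0 = length (?L b)" using ct by (simp add: t1_def)
      then show ?case using s(1) by (simp add: eqxN[OF 1] eqxN[OF st1] inpD)
    next
      case (4 k x)
      then show ?case using s(1) b1 o
        by (intro wp_Copy) (simp add: get_real_def eqxN[OF 4(3)] eqxR[OF 4(3)] eqxN[OF st1] eqxR[OF st1] inpD row_of_def)
    next
      case (5 x)
      then have x: "eqx {''k''} {''bb'', ''acc''} t1 x" by simp
      have sx: "eqx ?N ?R s x" by (rule eqx_trans[OF st1 x]) auto
      have cx: "nats x ''cnt'' 0 = length (?L b)" using ct by (simp add: eqxN[OF x] t1_def)
      define x1 where "x1 = set_nat x (''cnt'', Lit 0) (Suc (length (?L b)))"
      have sx1: "eqx ?N ?R s x1" using sx by (simp add: x1_def)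
      have hx: "held (?L b @ [?v]) x1"
        by (rule held_snoc[OF h1, where F = ?v]) (use 5 in \<open>simp_all add: x1_def\<close>)
      have stx: "nats x1 ''st'' 0 = length (?L b)" by (simp add: x1_def eqxN[OF x] t1_def)
      have bx: "nats x1 ''b'' 0 = b" using b1 by (simp add: x1_def eqxN[OF x])
      have ix: "inp x1" by (rule inp_eqx[OF s(1) sx1]) auto
      have e: "set_nat x (''cnt'', Lit 0) (length (?L b) + 1) = x1" by (simp add: x1_def)
      show ?case
      proof (rule wp_Seq, rule wp_NAssign, unfold nval.simps cx e, rule wp_post[OF wp_block_prog[OF ix hx stx v]], goal_cases)
        case (1 y)
        have "eqx ?N ?R s y" by (rule eqx_trans[OF sx1 conjunct1[OF 1]]) auto
        moreover have "nats y ''b'' 0 = b" using bx by (simp add: eqxN[OF conjunct1[OF 1]])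
        ultimately show ?case using 1 unfolding I_def LS by (simp add: held_def)
      qed
    qed auto
  qed
  \<comment> \<open>At most d blocks, each charged d rounds of n generators at 15 d^2.\<close>
  moreover have "length os * (0 + (d * 0 + (0 + d * (n * (15 * d ^ 2))))) \<le> 15 * n * d ^ 4"
  proof -
    have "length os * (d * (n * (15 * d ^ 2))) \<le> d * (d * (n * (15 * d ^ 2)))" using s(4) by (rule mult_le_mono1)
    also have "\<dots> = 15 * n * d ^ 4" by (simp add: power4_eq_xxxx power2_eq_square algebra_simps)
    finally show ?thesis by simp
  qed
  ultimately show ?thesis by (rule wp_conseq) (simp add: I_def)
qed

end

section \<open>The algorithm\<close>

text \<open>The basis vectors are stored as rows of \<open>q\<close> and have to become columns,
  hence the exchanged indices in the final copy; the second program ends in the same way.\<close>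

definition phase1 :: com where
  "phase1 = Seq jm_prog (Seq basis_prog (Seq class_prog
     (Fill ''k'' ddN ''Qt'' (Lit 0) (Copy acc (''q'', idx2 colN rowN)))))"

definition phase2 :: com where
  "phase2 = Seq ord_prog (Seq (NAssign (''cnt'', Lit 0) (Lit 0)) (Seq blocks_prog
     (Fill ''k'' ddN ''Q'' (Lit 0) (Copy acc (''bb'', idx2 colN rowN)))))"

context jm_program
begin

text \<open>Links the operator \<open>X j\<close> with the linear extension of \<rho> to the group
  algebra, in which the diagonalization is stated.\<close>

lemma mact_jucys_murphy:
  assumes j: "j \<in> {1..n}"
  shows "mact d (rep_extend n d \<rho> (jucys_murphy j)) v = X j v"
proof
  fix r
  have tp: "tr i j \<in> carrier (sym_group n)" if "i \<in> {1..<j}" for i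
    using that j tr_n[of i j] by (auto simp: sym_group_def)
  have fin: "finite (carrier (sym_group n))" by (simp add: sym_group_def finite_permutations)
  have e: "(\<Sum>g\<in>carrier (sym_group n). jucys_murphy j g * \<rho> g $$ (r, c)) = (\<Sum>i=1..<j. \<rho> (tr i j) $$ (r, c))" for c
  proof -
    have "(\<Sum>g\<in>carrier (sym_group n). jucys_murphy j g * \<rho> g $$ (r, c)) =
      (\<Sum>g\<in>carrier (sym_group n). \<Sum>i=1..<j. if g = tr i j then \<rho> g $$ (r, c) else 0)"
      by (simp add: jucys_murphy_def ga_single_def sum_distrib_right if_distrib[of "\<lambda>x. x * _"] cong: if_cong)
    also have "\<dots> = (\<Sum>i=1..<j. \<Sum>g\<in>carrier (sym_group n). if g = tr i j then \<rho> g $$ (r, c) else 0)" by (rule sum.swap)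
    also have "\<dots> = (\<Sum>i=1..<j. \<rho> (tr i j) $$ (r, c))" using tp fin by (intro sum.cong refl) (simp add: sum.delta')
    finally show ?thesis .
  qed
  show "mact d (rep_extend n d \<rho> (jucys_murphy j)) v r = X j v r"
  proof (cases "r < d")
    case True
    have "mact d (rep_extend n d \<rho> (jucys_murphy j)) v r = (\<Sum>c<d. (\<Sum>i=1..<j. \<rho> (tr i j) $$ (r, c)) * v c)"
      using True by (simp add: mact_def rep_extend_def e)
    also have "\<dots> = (\<Sum>i=1..<j. \<Sum>c<d. \<rho> (tr i j) $$ (r, c) * v c)" unfolding sum_distrib_right by (rule sum.swap)
    also have "\<dots> = X j v r" unfolding X_def sum_fun_apply using True by (simp add: mact_def)
    finally show ?thesis .
  next
    case False
    then show ?thesis by (simp add: X_def sum_fun_apply mact_def)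
  qed
qed

lemma inp_input_state: "inp (input_state n d (\<lambda>l. \<rho> (tr l (l + 1))))"
proof -
  \<comment> \<open>The input array is decoded by division and remainder, while the programs address
    it by nested multiplication; both name the same position.\<close>
  have "((l * d + r) * d + c < (n - 1) * d * d) \<and> ((l * d + r) * d + c) div (d * d) = l \<and>
     ((l * d + r) * d + c) div d mod d = r \<and> ((l * d + r) * d + c) mod d = c"
    if l: "l < n - 1" and r: "r < d" and c: "c < d" for l r c
  proof -
    have "l * d + r < (n - 1) * d" by (rule row_lt[OF l r])
    moreover have "((l * d + r) * d + c) div (d * d) = ((l * d + r) * d + c) div d div d" by (simp add: div_mult2_eq)
    ultimately show ?thesis using row_lt[of "l * d + r" "(n - 1) * d" c d] r c by (simp add: div_mod_idx)
  qed
  then show ?thesis by (simp add: inp_def input_state_def)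
qed

lemma wp_phase1:
  "wp phase1 (80 * n ^ 2 * d ^ 3) (\<lambda>t. inp t \<and> basis d t \<and> (\<exists>lams. classified n (word n (nats t ''wt'')) d lams t) \<and>
     (\<forall>i<d. \<forall>j<d. reals t ''Qt'' (i * d + j) = row_of d (reals t ''q'') j i)) (input_state n d (\<lambda>l. \<rho> (tr l (l + 1))))"
proof -
  let ?s = "input_state n d (\<lambda>l. \<rho> (tr l (l + 1)))"
  let ?Q = "\<lambda>t. inp t \<and> basis d t \<and> (\<exists>lams. classified n (word n (nats t ''wt'')) d lams t) \<and>
     (\<forall>i<d. \<forall>j<d. reals t ''Qt'' (i * d + j) = row_of d (reals t ''q'') j i)"
  have X0: "reals ?s ''X'' m = 0" for m by (simp add: input_state_def)
  have r0: "nats ?s ''r'' 0 = 0" by (simp add: input_state_def)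
  have "wp phase1 ((n - 1) * (d * d * (1 + 2 * d) + d * d * (1 + 2 * d + 1)) +
     ((d * d * 1 + d * (60 * (n ^ 2 * d ^ 2))) + (0 + d * d * 0))) ?Q ?s"
    unfolding phase1_def
  proof (rule wp_Seq, rule wp_post[OF wp_jm_prog[OF inp_input_state X0]], goal_cases)
    case (1 t)
    note t = conjunct1[OF 1]
    have it: "inp t" by (rule inp_eqx[OF inp_input_state t]) auto
    have rt: "nats t ''r'' 0 = 0" using r0 by (simp add: eqxN[OF t])
    show ?case
    proof (rule wp_Seq, rule wp_post[OF wp_basis_prog[OF it conjunct2[OF 1]]], goal_cases)
      case (1 u)
      note u = conjunct1[OF 1]
      have iu: "inp u" by (rule inp_eqx[OF it u]) auto
      have ru: "nats u ''r'' 0 = 0" using rt by (simp add: eqxN[OF u])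
      show ?case
      proof (rule wp_Seq, rule wp_post[OF wp_class_prog[OF inpD(1,2)[OF iu] ru refl]], goal_cases)
        case (1 v)
        note v = conjunct1[OF 1]
        have iv: "inp v" by (rule inp_eqx[OF iu v]) auto
        have bv: "basis d v" using conjunct2[OF \<open>_ \<and> basis d u\<close>] by (simp add: basis_def eqxN[OF v] eqxR[OF v])
        have wv: "nats v ''wt'' = nats u ''wt''" by (simp add: eqxN[OF v])
        obtain lams where cv: "classified n (word n (nats v ''wt'')) d lams v" using conjunct2[OF 1] unfolding wv by blast
        show ?case
        proof (rule wp_post[OF wp_Fill[where N = "d * d" and b = 0 and NX = "{}" and RX = "{''acc''}" and
            F = "\<lambda>k. reals v ''q'' ((k mod d) * d + k div d)"]], goal_cases)
          case (1 x)
          then show ?case using iv by (simp add: eqxN[OF 1] inpD)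
        next
          case (4 k x)
          then show ?case using iv by (intro wp_Copy) (simp add: get_real_def eqxN[OF 4(3)] eqxR[OF 4(3)] inpD minus_div_mult_eq_mod)
        next
          case (5 x)
          note x = conjunct1[OF 5]
          have "inp x" by (rule inp_eqx[OF iv x]) auto
          moreover have "basis d x" using bv by (simp add: basis_def eqxN[OF x] eqxR[OF x])
          moreover have "classified n (word n (nats x ''wt'')) d lams x" using cv by (simp add: classified_def listed_def eqxN[OF x])
          moreover have "reals x ''Qt'' (i * d + j) = row_of d (reals x ''q'') j i" if ij: "i < d" "j < d" for i j
            using conjunct2[OF 5, rule_format, of "i * d + j"] idx_lt[OF ij] ij by (simp add: div_mod_idx row_of_def eqxR[OF x])
          ultimately show ?case by blast
        qed auto
      qed
    qed
  qed
  moreover have "(n - 1) * (d * d * (1 + 2 * d) + d * d * (1 + 2 * d + 1)) +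
     ((d * d * 1 + d * (60 * (n ^ 2 * d ^ 2))) + (0 + d * d * 0)) \<le> 80 * n ^ 2 * d ^ 3"
  proof -
    \<comment> \<open>The summands are (n - 1) (4 d^3 + 3 d^2) for the matrices, d^2 for the initial
      projection and 60 n^2 d^3 for the basis; reading off the partitions and copying are
      free.\<close>
    obtain e where e: "d = Suc e" using d1 by (cases d) auto
    obtain f where f: "n = Suc f" using n1 by (cases n) auto
    show ?thesis unfolding e f by (simp add: power2_eq_square power3_eq_cube algebra_simps)
  qed
  ultimately show ?thesis by (rule wp_le)
qed

end

text \<open>The second program starts in the very state that the first one leaves; the locale
  records what is known about that state, and the sublocale identifies its contents as a
  \<open>weight_basis\<close>.\<close>

locale phase2_input = jm_program n d \<rho> for n d \<rho> +
  fixes s1 :: state and lams :: "nat list list"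
  assumes s1: "inp s1" "basis d s1" "classified n (word n (nats s1 ''wt'')) d lams s1"
begin

sublocale weight_basis n d \<rho> "map (row_of d (reals s1 ''q'')) [0..<d]" "word n (nats s1 ''wt'')" lams
proof
  show "weight (wt_of (word n (nats s1 ''wt'') k)) (map (row_of d (reals s1 ''q'')) [0..<d] ! k)" if "k < d" for k
  proof -
    have "weight (wt_of (word n (nats s1 ''wt'') k)) (row_of d (reals s1 ''q'') k) \<longleftrightarrow>
      weight (\<lambda>j. int (nats s1 ''wt'' (k * n + (j - 1))) - int n) (row_of d (reals s1 ''q'') k)"
      by (rule weight_cong) (simp add: wt_of_def word_def)
    then show ?thesis using s1(2) that by (simp add: basis_def)
  qed
qed (use s1 in \<open>auto simp: basis_def classified_def\<close>)

lemma outputs: "outputs_partitions s1 n lams (irrep_multiplicity n d \<rho>)"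
  using s1(3) multiplicity_cls by (simp add: outputs_partitions_def classified_def listed_def pad_def cls_def)

lemma Qt_diagonalizes:
  assumes Qt: "\<forall>i<d. \<forall>j<d. reals s1 ''Qt'' (i * d + j) = row_of d (reals s1 ''q'') j i"
  shows "output_mat s1 ''Qt'' d \<in> carrier (orthogonal_group d)"
    and "j \<in> {1..n} \<Longrightarrow> diagonal_mat (transpose_mat (output_mat s1 ''Qt'' d) * rep_extend n d \<rho> (jucys_murphy j) * output_mat s1 ''Qt'' d)"
proof -
  let ?qs = "map (row_of d (reals s1 ''q'')) [0..<d]"
  have Q: "output_mat s1 ''Qt'' d = col_mat d ?qs"
    using Qt by (intro eq_matI) (auto simp: output_mat_def col_mat_def)
  show "output_mat s1 ''Qt'' d \<in> carrier (orthogonal_group d)"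
    unfolding Q by (rule col_mat_orthogonal[OF qs_len qs_in qs_on])
  assume j: "j \<in> {1..n}"
  have c: "rep_extend n d \<rho> (jucys_murphy j) \<in> carrier_mat d d" by (simp add: rep_extend_def)
  \<comment> \<open>X_j maps each basis vector to a multiple of itself, so off-diagonal entries are
    multiples of inner products of distinct basis vectors.\<close>
  have "vip d (?qs ! a) (X j (?qs ! b)) = 0" if ab: "a < d" "b < d" "a \<noteq> b" for a b
  proof -
    have "X j (?qs ! b) = of_int (wt_of (word n (nats s1 ''wt'') b) j) *\<^sub>R ?qs ! b"
      using weightD(2)[OF qs_wt[OF ab(2)]] j by simp
    then show ?thesis using qs_orth[OF ab] by (simp only: ip_simps mult_zero_right)
  qed
  then show "diagonal_mat (transpose_mat (output_mat s1 ''Qt'' d) * rep_extend n d \<rho> (jucys_murphy j) * output_mat s1 ''Qt'' d)"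
    unfolding Q conj_col_mat[OF qs_len c] diagonal_mat_def gmat_def mact_jucys_murphy[OF j] by simp
qed

lemma wp_phase2: "wp phase2 (80 * n * d ^ 4) (\<lambda>t. output_mat t ''Q'' d = Qmat) s1"
proof -
  let ?q = "row_of d (reals s1 ''q'')"
  have c: "nats s1 ''r'' 0 = length lams" using s1(3) by (simp add: classified_def listed_def)
  have ord: "concat (map (\<lambda>p. filter (\<lambda>k. nats s1 ''clsf'' k = Suc p) [0..<d]) [0..<length lams]) = ord"
  proof -
    have "filter (\<lambda>k. nats s1 ''clsf'' k = Suc p) [0..<d] = cls p" if "p < length lams" for p
      unfolding cls_def using s1(3) that by (intro filter_cong) (auto simp: classified_def)
    then show ?thesis unfolding ord_def by (metis (no_types, lifting) map_cong atLeastLessThan_iff set_upt)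
  qed
  have od: "set ord \<subseteq> {..<d}" using ord_weight by auto
  have ol: "length ord \<le> d" using card_mono[OF _ od] distinct_card[OF ord_distinct] by simp
  have qv: "vip d (?q k) (?q k) = 1" if "k \<in> set ord" for k using qs_one[of k] od that by auto
  have Qs: "concat (map (\<lambda>k. G (?q k)) ord) = Qs"
  proof -
    have "map (\<lambda>k. G (?q k)) ord = map (\<lambda>k. G (map ?q [0..<d] ! k)) ord" using od by (intro map_cong refl) auto
    then show ?thesis by (simp only: Qs_def)
  qed
  have "wp phase2 (0 + (0 + (15 * n * d ^ 4 + d * d * 0))) (\<lambda>t. output_mat t ''Q'' d = Qmat) s1"
    unfolding phase2_def
  proof (rule wp_Seq, rule wp_post[OF wp_ord_prog[OF inpD(2)[OF s1(1)] c]], unfold ord, goal_cases)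
    case (1 t)
    note t = conjunct1[OF 1]
    define t1 where "t1 = set_nat t (''cnt'', Lit 0) 0"
    have t1: "eqx {''B'', ''ord'', ''p'', ''k'', ''cnt''} {} s1 t1" using eqx_mono[OF t, of "{''B'', ''ord'', ''p'', ''k'', ''cnt''}" "{}"] by (simp add: t1_def)
    have it: "inp t1" by (rule inp_eqx[OF s1(1) t1]) auto
    have h: "held [] t1" by (simp add: held_def t1_def)
    have l: "listing ord t1" using conjunct2[OF 1] by (simp add: listing_def t1_def)
    have q: "reals t1 ''q'' = reals s1 ''q''" by (simp add: eqxR[OF t1])
    show ?case
    proof (rule wp_Seq, rule wp_NAssign, unfold nval.simps t1_def[symmetric], rule wp_Seq,
        rule wp_post[OF wp_blocks_prog[OF it h l ol]], unfold q Qs, goal_cases)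
      case (1 k)
      then show ?case by (rule qv)
    next
      case (2 u)
      note u = conjunct1[OF 2]
      have iu: "inp u" by (rule inp_eqx[OF it u]) auto
      have row: "row_of d (reals u ''bb'') j = Qs ! j" if "j < d" for j using conjunct2[OF 2] that by (simp add: held_def Qs_length)
      show ?case
      proof (rule wp_post[OF wp_Fill[where N = "d * d" and b = 0 and NX = "{}" and RX = "{''acc''}" and
          F = "\<lambda>k. reals u ''bb'' ((k mod d) * d + k div d)"]], goal_cases)
        case (1 x)
        then show ?case using iu by (simp add: eqxN[OF 1] inpD)
      next
        case (4 k x)
        then show ?case using iu by (intro wp_Copy) (simp add: get_real_def eqxN[OF 4(3)] eqxR[OF 4(3)] inpD minus_div_mult_eq_mod)
      next
        case (5 x)
        have "reals x ''Q'' (i * d + j) = (Qs ! j) i" if ij: "i < d" "j < d" for i j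
          using conjunct2[OF 5, rule_format, of "i * d + j"] idx_lt[OF ij] ij row[OF ij(2), symmetric]
          by (simp add: div_mod_idx row_of_def)
        then show ?case by (intro eq_matI) (auto simp: output_mat_def col_mat_def)
      qed auto
    qed
  qed
  then show ?thesis by (rule wp_le) simp
qed

end

theorem corollary5:
  shows "\<exists>(C :: nat) (phase1 :: com) (phase2 :: com).
    \<forall>(n :: nat) (d :: nat) (\<rho> :: (nat \<Rightarrow> nat) \<Rightarrow> real mat).
      n \<ge> 1 \<and> d \<ge> 1 \<and> \<rho> \<in> hom (sym_group n) (orthogonal_group d) \<longrightarrow>
      (\<exists>k1 s1 k2 s2 lams Qt Q.
         exec phase1 (input_state n d (\<lambda>l. \<rho> (Transposition.transpose l (l + 1)))) k1 s1 \<and>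
         k1 \<le> C * n ^ 2 * d ^ 3 \<and>
         distinct lams \<and>
         set lams = {lam \<in> partitions_of n. irrep_multiplicity n d \<rho> lam > 0} \<and>
         outputs_partitions s1 n lams (irrep_multiplicity n d \<rho>) \<and>
         Qt = output_mat s1 ''Qt'' d \<and>
         Qt \<in> carrier (orthogonal_group d) \<and>
         (\<forall>j \<in> {1..n}. diagonal_mat (transpose_mat Qt * rep_extend n d \<rho> (jucys_murphy j) * Qt)) \<and>
         exec phase2 s1 k2 s2 \<and>
         k2 \<le> C * n * d ^ 4 \<and>
         Q = output_mat s2 ''Q'' d \<and>
         Q \<in> carrier (orthogonal_group d) \<and>
         (\<exists>(e :: nat \<Rightarrow> nat) (\<sigma> :: nat \<Rightarrow> (nat \<Rightarrow> nat) \<Rightarrow> real mat).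
            (\<forall>k < length lams.
               \<sigma> k \<in> hom (sym_group n) (orthogonal_group (e k)) \<and>
               irreducible_rep n (e k) (\<sigma> k) \<and>
               indexed_by n (e k) (\<sigma> k) (lams ! k)) \<and>
            (\<forall>k < length lams. \<forall>l < length lams. k \<noteq> l \<longrightarrow>
               \<not> rep_isomorphic n (e k) (\<sigma> k) (e l) (\<sigma> l)) \<and>
            (\<forall>g \<in> carrier (sym_group n).
               transpose_mat Q * \<rho> g * Q =
               diag_block_mat (concat (map (\<lambda>k.
                 replicate (irrep_multiplicity n d \<rho> (lams ! k)) (\<sigma> k g)) [0..<length lams])))))"
proof (rule exI[of _ 80], rule exI[of _ phase1], rule exI[of _ phase2], intro allI impI, goal_cases)
  \<comment> \<open>Both programs are fixed before n, d and \<rho> are given, and 80 serves both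
    bounds.\<close>
  case (1 n d \<rho>)
  interpret orth_mat_rep n d \<rho> using 1 orth_mat_rep_hom by blast
  interpret jm_program n d \<rho> using 1 by unfold_locales auto
  obtain k1 s1 lams where e1: "exec phase1 (input_state n d (\<lambda>l. \<rho> (tr l (l + 1)))) k1 s1" "k1 \<le> 80 * n ^ 2 * d ^ 3"
    and s1: "inp s1" "basis d s1" "classified n (word n (nats s1 ''wt'')) d lams s1"
    and Qt: "\<forall>i<d. \<forall>j<d. reals s1 ''Qt'' (i * d + j) = row_of d (reals s1 ''q'') j i"
    using wp_phase1 unfolding wp_def by blast
  interpret phase2_input n d \<rho> s1 lams using s1 by unfold_locales auto
  obtain k2 s2 where e2: "exec phase2 s1 k2 s2" "k2 \<le> 80 * n * d ^ 4" and Q: "output_mat s2 ''Q'' d = Qmat"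
    using wp_phase2 unfolding wp_def by blast
  note facts = e1 lams_dist lams_eq outputs refl Qt_diagonalizes(1)[OF Qt] ballI[OF Qt_diagonalizes(2)[OF Qt]] e2 Q[symmetric] Qmat_orthogonal
  show ?case
    by (rule exI[of _ k1], rule exI[of _ s1], rule exI[of _ k2], rule exI[of _ s2], rule exI[of _ lams],
        rule exI[of _ "output_mat s1 ''Qt'' d"], rule exI[of _ Qmat])
      (intro conjI; (rule facts block_form; assumption?))
qed

end
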